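(* Let $\mathscr B_1$ and $\mathscr B_2$ be quasi-Banach spaces such that $$\mathcal S_{1/2}(\mathbf R^{d_j})\hookrightarrow\mathscr B_j\hookrightarrow\mathcal S_{1/2}'(\mathbf R^{d_j}),\quad j=1,2,$$ and let $p\in(0,\infty]$. Then the following is true: (1) if $s\ge 1/2$, $\mathscr B_1\hookrightarrow\mathcal S_s'(\mathbf R^{d_1})$, $\mathcal S_s(\mathbf R^{d_2})\hookrightarrow\mathscr B_2$, and $K\in\mathcal S_s(\mathbf R^{d_2+d_1})$, then $T_K\in\mathscr I_p(\mathscr B_1,\mathscr B_2)$; (2) if $s>1/2$, $\mathscr B_1\hookrightarrow\Sigma_s'(\mathbf R^{d_1})$, $\Sigma_s(\mathbf R^{d_2})\hookrightarrow\mathscr B_2$, and $K\in\Sigma_s(\mathbf R^{d_2+d_1})$, then $T_K\in\mathscr I_p(\mathscr B_1,\mathscr B_2)$; (3) if $\mathscr B_1\hookrightarrow\mathscr S'(\mathbf R^{d_1})$, $\mathscr S(\mathbf R^{d_2})\hookrightarrow\mathscr B_2$, and $K\in\mathscr S(\mathbf R^{d_2+d_1})$, then $T_K\in\mathscr I_p(\mathscr B_1,\mathscr B_2)$.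
   Context: $A\hookrightarrow B$ means that the topological space $A$ is continuously embedded in $B$ (as a subset). $\mathscr S$ and $\mathscr S'$ are the Schwartz space and the space of tempered distributions. **Gelfand-Shilov spaces.** For $h,s>0$, $\mathcal S_{s,h}(\mathbf R^d)$ is the Banach space of all $f\in C^\infty(\mathbf R^d)$ such that $$\|f\|_{\mathcal S_{s,h}}=\sup_{\alpha,\beta\in\mathbf N^d,\ x\in\mathbf R^d}\frac{|x^\beta\partial^\alpha f(x)|}{h^{|\alpha|+|\beta|}(\alpha!\,\beta!)^s}<\infty .$$ Set $\mathcal S_s(\mathbf R^d)=\bigcup_{h>0}\mathcal S_{s,h}(\mathbf R^d)$ with the inductive limit topology and $\Sigma_s(\mathbf R^d)=\bigcap_{h>0}\mathcal S_{s,h}(\mathbf R^d)$ with the projective limit (Fréchet) topology. $\mathcal S_s'(\mathbf R^d)$ ($s\ge1/2$) and $\Sigma_s'(\mathbf R^d)$ ($s>1/2$) are the topological duals of $\mathcal S_s(\mathbf R^d)$ and $\Sigma_s(\mathbf R^d)$; topologically they are the projective, respectively inductive, limits over $h>0$ of the duals $\mathcal S_{s,h}'(\mathbf R^d)$. **The operator $T_K$.** $T_K$ is the linear operator with kernel $K$, i.e. $T_Kf(x)=\int K(x,y)f(y)\,dy$ for $f\in\mathcal S_{1/2}(\mathbf R^{d_1})$. When $K\in\mathcal S_s(\mathbf R^{d_2+d_1})$ (resp. $\Sigma_s$, $\mathscr S$), it extends uniquely to a continuous operator from $\mathcal S_s'(\mathbf R^{d_1})$ to $\mathcal S_s(\mathbf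 R^{d_2})$ (resp. from $\Sigma_s'$ to $\Sigma_s$, from $\mathscr S'$ to $\mathscr S$), given by applying $f$ to $K(x,\cdot)$; the restriction of this extension to $\mathscr B_1$, viewed as a map into $\mathscr B_2$, is still denoted $T_K$. **Quasi-Banach spaces.** A quasi-norm on a vector space $\mathscr B$ is a non-negative function $\|\cdot\|_{\mathscr B}$ with $\|f\|_{\mathscr B}=0$ iff $f=0$, $\|\alpha f\|_{\mathscr B}=|\alpha|\,\|f\|_{\mathscr B}$ for $\alpha\in\mathbf C$, and $\|f+g\|_{\mathscr B}\le D(\|f\|_{\mathscr B}+\|g\|_{\mathscr B})$ for some constant $D\ge1$ independent of $f,g$. $\mathscr B$ is a quasi-Banach space if it is complete in the topology defined by $\|\cdot\|_{\mathscr B}$. **Schatten-von Neumann classes.** For quasi-Banach spaces $\mathscr B_1,\mathscr B_2$, a linear map $T:\mathscr B_1\to\mathscr B_2$ and an integer $j\ge1$, the singular value of order $j$ is $$\sigma_j(\mathscr B_1,\mathscr B_2,T)=\inf\|T-T_0\|_{\mathscr B_1\to\mathscr B_2},$$ the infimum being over all linear operators $T_0:\mathscr B_1\to\mathscr B_2$ of rank at most $j-1$. For $p\in(0,\infty]$, $\|T\|_{\mathscr I_p(\mathscr B_1,\mathscr B_2)}=\|(\sigma_j(\mathscr B_1,\mathscr B_2,T))_{j=1}^\infty\|_{\ell^p}$, and $\mathscr I_p(\mathscr B_1,\mathscr B_2)$ is the set of all linear $T:\mathscr B_1\to\mathscr B_2$ for which this is finite. *)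

theory Defs
  imports "HOL-Analysis.Analysis" "HOL-Library.Function_Algebras"
begin

section \<open>Complex vector spaces of functions\<close>

text \<open>All spaces below are complex vector spaces of complex-valued functions on some type
  (functions on \<open>\<real>\<^sup>d\<close>, or functionals on such functions), with the pointwise operations.\<close>

definition cscale :: "complex \<Rightarrow> ('x \<Rightarrow> complex) \<Rightarrow> 'x \<Rightarrow> complex" where
  "cscale c u = (\<lambda>x. c * u x)"

interpretation cfun: vector_space "cscale :: complex \<Rightarrow> ('x \<Rightarrow> complex) \<Rightarrow> 'x \<Rightarrow> complex"
  by unfold_locales (auto simp: cscale_def fun_eq_iff algebra_simps)

definition linear_map_on ::
  "('x \<Rightarrow> complex) set \<Rightarrow> (('x \<Rightarrow> complex) \<Rightarrow> ('y \<Rightarrow> complex)) \<Rightarrow> bool" where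
  "linear_map_on E T \<longleftrightarrow>
     (\<forall>u\<in>E. \<forall>v\<in>E. T (u + v) = T u + T v) \<and> (\<forall>c. \<forall>u\<in>E. T (cscale c u) = cscale c (T u))"

text \<open>Linear functionals on \<open>E\<close> are represented by the total function that vanishes off \<open>E\<close>.\<close>

definition linear_functional_on :: "('x \<Rightarrow> complex) set \<Rightarrow> (('x \<Rightarrow> complex) \<Rightarrow> complex) \<Rightarrow> bool" where
  "linear_functional_on E u \<longleftrightarrow>
     (\<forall>f\<in>E. \<forall>g\<in>E. u (f + g) = u f + u g) \<and> (\<forall>c. \<forall>f\<in>E. u (cscale c f) = c * u f) \<and>
     (\<forall>f. f \<notin> E \<longrightarrow> u f = 0)"

definition restr :: "'a set \<Rightarrow> ('a \<Rightarrow> complex) \<Rightarrow> 'a \<Rightarrow> complex" where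
  "restr E u = (\<lambda>f. if f \<in> E then u f else 0)"


section \<open>Linear topologies\<close>

text \<open>The translation-invariant topology on the subspace \<open>E\<close> in which the sets \<open>V \<inter> E\<close>,
  \<open>V \<in> \<V>\<close>, form a base of neighbourhoods of 0; \<open>\<V>\<close> must be directed downwards.\<close>

definition nbhd_topology :: "'v::plus set \<Rightarrow> 'v set set \<Rightarrow> 'v topology" where
  "nbhd_topology E \<V> =
     topology (\<lambda>U. U \<subseteq> E \<and> (\<forall>f\<in>U. \<exists>V\<in>\<V>. \<forall>g\<in>V. f + g \<in> E \<longrightarrow> f + g \<in> U))"

lemma openin_nbhd_topology:
  assumes "\<And>V W. V \<in> \<V> \<Longrightarrow> W \<in> \<V> \<Longrightarrow> \<exists>Z\<in>\<V>. Z \<subseteq> V \<inter> W"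
  shows "openin (nbhd_topology E \<V>) U \<longleftrightarrow>
     U \<subseteq> E \<and> (\<forall>f\<in>U. \<exists>V\<in>\<V>. \<forall>g\<in>V. f + g \<in> E \<longrightarrow> f + g \<in> U)"
proof -
  have "istopology (\<lambda>U. U \<subseteq> E \<and> (\<forall>f\<in>U. \<exists>V\<in>\<V>. \<forall>g\<in>V. f + g \<in> E \<longrightarrow> f + g \<in> U))"
    (is "istopology ?P")
    unfolding istopology_def
  proof (intro conjI allI impI)
    fix S T assume S: "?P S" and T: "?P T"
    show "S \<inter> T \<subseteq> E" using S by blast
    show "\<forall>f\<in>S \<inter> T. \<exists>V\<in>\<V>. \<forall>g\<in>V. f + g \<in> E \<longrightarrow> f + g \<in> S \<inter> T"
    proof
      fix f assume f: "f \<in> S \<inter> T"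
      obtain V where V: "V \<in> \<V>" "\<forall>g\<in>V. f + g \<in> E \<longrightarrow> f + g \<in> S" using S f by blast
      obtain W where W: "W \<in> \<V>" "\<forall>g\<in>W. f + g \<in> E \<longrightarrow> f + g \<in> T" using T f by blast
      show "\<exists>V\<in>\<V>. \<forall>g\<in>V. f + g \<in> E \<longrightarrow> f + g \<in> S \<inter> T"
        using assms[OF V(1) W(1)] V(2) W(2) by blast
    qed
  next
    fix \<K> assume K: "\<forall>K\<in>\<K>. ?P K"
    show "\<Union>\<K> \<subseteq> E" using K by blast
    show "\<forall>f\<in>\<Union>\<K>. \<exists>V\<in>\<V>. \<forall>g\<in>V. f + g \<in> E \<longrightarrow> f + g \<in> \<Union>\<K>"
      using K by (meson Union_iff)
  qed
  then show ?thesis by (simp add: nbhd_topology_def topology_inverse')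
qed

text \<open>The topology on \<open>E\<close> defined by a family of (quasi-)seminorms \<open>N i\<close>, \<open>i \<in> I\<close>.\<close>

definition seminorm_nbhds :: "'i set \<Rightarrow> ('i \<Rightarrow> 'v \<Rightarrow> ennreal) \<Rightarrow> 'v set set" where
  "seminorm_nbhds I N = {{g. \<forall>i\<in>F. N i g < ennreal \<epsilon>} |F \<epsilon>. finite F \<and> F \<subseteq> I \<and> 0 < \<epsilon>}"

definition seminorm_topology ::
  "'v::plus set \<Rightarrow> 'i set \<Rightarrow> ('i \<Rightarrow> 'v \<Rightarrow> ennreal) \<Rightarrow> 'v topology" where
  "seminorm_topology E I N = nbhd_topology E (seminorm_nbhds I N)"

definition absolutely_convex :: "('x \<Rightarrow> complex) set \<Rightarrow> bool" where
  "absolutely_convex V \<longleftrightarrow>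
     (\<forall>u\<in>V. \<forall>v\<in>V. \<forall>a b. cmod a + cmod b \<le> 1 \<longrightarrow> cscale a u + cscale b v \<in> V)"

text \<open>The (locally convex) inductive limit topology on \<open>E\<close>: the finest locally convex topology
  for which all the linear maps \<open>j i\<close> from the normed spaces \<open>(X i, N i)\<close>, \<open>i \<in> I\<close>, into \<open>E\<close>
  are continuous.\<close>

definition ind_limit_nbhds ::
  "'i set \<Rightarrow> ('i \<Rightarrow> 'w set) \<Rightarrow> ('i \<Rightarrow> 'w \<Rightarrow> ennreal) \<Rightarrow> ('i \<Rightarrow> 'w \<Rightarrow> 'x \<Rightarrow> complex)
    \<Rightarrow> ('x \<Rightarrow> complex) set set" where
  "ind_limit_nbhds I X N j =
     {V. absolutely_convex V \<and> (\<forall>i\<in>I. \<exists>\<epsilon>>0. \<forall>g\<in>X i. N i g < ennreal \<epsilon> \<longrightarrow> j i g \<in> V)}"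

definition ind_limit_topology ::
  "('x \<Rightarrow> complex) set \<Rightarrow> 'i set \<Rightarrow> ('i \<Rightarrow> 'w set) \<Rightarrow> ('i \<Rightarrow> 'w \<Rightarrow> ennreal)
    \<Rightarrow> ('i \<Rightarrow> 'w \<Rightarrow> 'x \<Rightarrow> complex) \<Rightarrow> ('x \<Rightarrow> complex) topology" where
  "ind_limit_topology E I X N j = nbhd_topology E (ind_limit_nbhds I X N j)"

lemma openin_seminorm_topology:
  "openin (seminorm_topology E I N) U \<longleftrightarrow>
     U \<subseteq> E \<and> (\<forall>f\<in>U. \<exists>V\<in>seminorm_nbhds I N. \<forall>g\<in>V. f + g \<in> E \<longrightarrow> f + g \<in> U)"
  unfolding seminorm_topology_def
proof (rule openin_nbhd_topology)
  fix V W assume "V \<in> seminorm_nbhds I N" "W \<in> seminorm_nbhds I N"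
  then obtain F \<epsilon> G \<delta> where
    V: "V = {g. \<forall>i\<in>F. N i g < ennreal \<epsilon>}" "finite F" "F \<subseteq> I" "0 < \<epsilon>" and
    W: "W = {g. \<forall>i\<in>G. N i g < ennreal \<delta>}" "finite G" "G \<subseteq> I" "0 < \<delta>"
    unfolding seminorm_nbhds_def by blast
  let ?Z = "{g. \<forall>i\<in>F \<union> G. N i g < ennreal (min \<epsilon> \<delta>)}"
  have "?Z \<in> seminorm_nbhds I N"
    unfolding seminorm_nbhds_def using V W
    by (intro CollectI exI[of _ "F \<union> G"] exI[of _ "min \<epsilon> \<delta>"]) auto
  moreover have "?Z \<subseteq> V \<inter> W"
  proof -
    have "ennreal (min \<epsilon> \<delta>) \<le> ennreal \<epsilon>" "ennreal (min \<epsilon> \<delta>) \<le> ennreal \<delta>"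
      by (auto intro: ennreal_leI)
    then show ?thesis using V W by (auto intro: less_le_trans)
  qed
  ultimately show "\<exists>Z\<in>seminorm_nbhds I N. Z \<subseteq> V \<inter> W" by blast
qed

lemma topspace_seminorm_topology [simp]: "topspace (seminorm_topology E I N) = E"
proof -
  have "{g. \<forall>i\<in>{}. N i g < ennreal 1} \<in> seminorm_nbhds I N"
    unfolding seminorm_nbhds_def using zero_less_one by blast
  then have "openin (seminorm_topology E I N) E"
    unfolding openin_seminorm_topology by blast
  then show ?thesis
    by (meson openin_seminorm_topology openin_subset openin_topspace subset_antisym)
qed

lemma openin_ind_limit_topology:
  "openin (ind_limit_topology E I X N j) U \<longleftrightarrow>
     U \<subseteq> E \<and> (\<forall>f\<in>U. \<exists>V\<in>ind_limit_nbhds I X N j. \<forall>g\<in>V. f + g \<in> E \<longrightarrow> f + g \<in> U)"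
  unfolding ind_limit_topology_def
proof (rule openin_nbhd_topology)
  fix V W assume V: "V \<in> ind_limit_nbhds I X N j" and W: "W \<in> ind_limit_nbhds I X N j"
  have "absolutely_convex (V \<inter> W)"
    using V W unfolding ind_limit_nbhds_def absolutely_convex_def by blast
  moreover have "\<exists>\<epsilon>>0. \<forall>g\<in>X i. N i g < ennreal \<epsilon> \<longrightarrow> j i g \<in> V \<inter> W" if i: "i \<in> I" for i
  proof -
    obtain \<epsilon> where e: "\<epsilon> > 0" "\<forall>g\<in>X i. N i g < ennreal \<epsilon> \<longrightarrow> j i g \<in> V"
      using V i unfolding ind_limit_nbhds_def by blast
    obtain \<delta> where d: "\<delta> > 0" "\<forall>g\<in>X i. N i g < ennreal \<delta> \<longrightarrow> j i g \<in> W"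
      using W i unfolding ind_limit_nbhds_def by blast
    have "ennreal (min \<epsilon> \<delta>) \<le> ennreal \<epsilon>" "ennreal (min \<epsilon> \<delta>) \<le> ennreal \<delta>"
      by (auto intro: ennreal_leI)
    then have "\<forall>g\<in>X i. N i g < ennreal (min \<epsilon> \<delta>) \<longrightarrow> j i g \<in> V \<inter> W"
      using e(2) d(2) by (meson IntI less_le_trans)
    then show ?thesis using e(1) d(1) by (intro exI[of _ "min \<epsilon> \<delta>"]) simp
  qed
  ultimately show "\<exists>Z\<in>ind_limit_nbhds I X N j. Z \<subseteq> V \<inter> W"
    unfolding ind_limit_nbhds_def by blast
qed

lemma topspace_ind_limit_topology [simp]: "topspace (ind_limit_topology E I X N j) = E"
proof -
  have "UNIV \<in> ind_limit_nbhds I X N j"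
    unfolding ind_limit_nbhds_def absolutely_convex_def using zero_less_one by blast
  then have "openin (ind_limit_topology E I X N j) E"
    unfolding openin_ind_limit_topology by blast
  then show ?thesis
    by (meson openin_ind_limit_topology openin_subset openin_topspace subset_antisym)
qed

definition top_dual :: "('x \<Rightarrow> complex) topology \<Rightarrow> (('x \<Rightarrow> complex) \<Rightarrow> complex) set" where
  "top_dual X = {u. linear_functional_on (topspace X) u \<and> continuous_map X euclidean u}"

text \<open>For \<open>C\<close> the unit ball of a normed space this is the dual norm; for \<open>C\<close> ranging over the
  bounded sets of a locally convex space it gives the seminorms of the strong dual topology.\<close>

definition sup_on :: "'a set \<Rightarrow> ('a \<Rightarrow> complex) \<Rightarrow> ennreal" where
  "sup_on C u = (SUP f\<in>C. ennreal (cmod (u f)))"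


section \<open>Smooth functions on \<open>\<real>\<^sup>d\<close>\<close>

definition partial :: "'n::finite \<Rightarrow> (real^'n \<Rightarrow> complex) \<Rightarrow> real^'n \<Rightarrow> complex" where
  "partial i f = (\<lambda>x. frechet_derivative f (at x) (axis i 1))"

fun Ck :: "nat \<Rightarrow> (real^'n::finite \<Rightarrow> complex) \<Rightarrow> bool" where
  "Ck 0 f \<longleftrightarrow> continuous_on UNIV f"
| "Ck (Suc k) f \<longleftrightarrow> (\<forall>x. f differentiable (at x)) \<and> (\<forall>i. Ck k (partial i f))"

definition smooth :: "(real^'n::finite \<Rightarrow> complex) \<Rightarrow> bool" where
  "smooth f \<longleftrightarrow> (\<forall>k. Ck k f)"

text \<open>An index type \<open>'n\<close> carries no order, so some enumeration of the coordinates is fixed in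
  order to write \<open>\<partial>\<^sup>\<alpha>\<close> as a composition of partial derivatives; for smooth functions the choice
  is irrelevant.\<close>

definition coords :: "'n::finite list" where
  "coords = (SOME l. distinct l \<and> set l = UNIV)"

definition multi_deriv :: "('n::finite \<Rightarrow> nat) \<Rightarrow> (real^'n \<Rightarrow> complex) \<Rightarrow> real^'n \<Rightarrow> complex" where
  "multi_deriv \<alpha> f = foldr (\<lambda>i. partial i ^^ \<alpha> i) coords f"

definition mono_pow :: "real^'n::finite \<Rightarrow> ('n \<Rightarrow> nat) \<Rightarrow> real" where
  "mono_pow x \<beta> = (\<Prod>i\<in>UNIV. (x $ i) ^ \<beta> i)"

definition multi_size :: "('n::finite \<Rightarrow> nat) \<Rightarrow> nat" where
  "multi_size \<alpha> = (\<Sum>i\<in>UNIV. \<alpha> i)"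

definition multi_fact :: "('n::finite \<Rightarrow> nat) \<Rightarrow> real" where
  "multi_fact \<alpha> = (\<Prod>i\<in>UNIV. fact (\<alpha> i))"


section \<open>Test function spaces\<close>

definition GS_norm :: "real \<Rightarrow> real \<Rightarrow> (real^'n::finite \<Rightarrow> complex) \<Rightarrow> ennreal" where
  "GS_norm s h f = (SUP \<alpha>. SUP \<beta>. SUP x.
     ennreal (cmod (of_real (mono_pow x \<beta>) * multi_deriv \<alpha> f x)
              / (h ^ (multi_size \<alpha> + multi_size \<beta>) * (multi_fact \<alpha> * multi_fact \<beta>) powr s)))"

definition GS_step :: "real \<Rightarrow> real \<Rightarrow> (real^'n::finite \<Rightarrow> complex) set" where
  "GS_step s h = {f. smooth f \<and> GS_norm s h f < \<infinity>}"

definition GS_S :: "real \<Rightarrow> (real^'n::finite \<Rightarrow> complex) set" where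
  "GS_S s = (\<Union>h\<in>{0<..}. GS_step s h)"

definition GS_S_top :: "real \<Rightarrow> (real^'n::finite \<Rightarrow> complex) topology" where
  "GS_S_top s = ind_limit_topology (GS_S s) {0<..} (GS_step s) (GS_norm s) (\<lambda>h f. f)"

definition GS_Sigma :: "real \<Rightarrow> (real^'n::finite \<Rightarrow> complex) set" where
  "GS_Sigma s = (\<Inter>h\<in>{0<..}. GS_step s h)"

definition GS_Sigma_top :: "real \<Rightarrow> (real^'n::finite \<Rightarrow> complex) topology" where
  "GS_Sigma_top s = seminorm_topology (GS_Sigma s) {0<..} (GS_norm s)"

definition schwartz_seminorm ::
  "('n \<Rightarrow> nat) \<times> ('n \<Rightarrow> nat) \<Rightarrow> (real^'n::finite \<Rightarrow> complex) \<Rightarrow> ennreal" where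
  "schwartz_seminorm = (\<lambda>(\<alpha>, \<beta>) f.
     SUP x. ennreal (cmod (of_real (mono_pow x \<beta>) * multi_deriv \<alpha> f x)))"

definition schwartz :: "(real^'n::finite \<Rightarrow> complex) set" where
  "schwartz = {f. smooth f \<and> (\<forall>\<alpha> \<beta>. schwartz_seminorm (\<alpha>, \<beta>) f < \<infinity>)}"

definition schwartz_top :: "(real^'n::finite \<Rightarrow> complex) topology" where
  "schwartz_top = seminorm_topology schwartz UNIV schwartz_seminorm"


section \<open>Distribution spaces\<close>

type_synonym 'n functional = "(real^'n \<Rightarrow> complex) \<Rightarrow> complex"

definition GS_step_ball :: "real \<Rightarrow> real \<Rightarrow> (real^'n::finite \<Rightarrow> complex) set" where
  "GS_step_ball s h = {f \<in> GS_step s h. GS_norm s h f \<le> 1}"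

definition GS_step_dual :: "real \<Rightarrow> real \<Rightarrow> 'n::finite functional set" where
  "GS_step_dual s h = {u. linear_functional_on (GS_step s h) u \<and> sup_on (GS_step_ball s h) u < \<infinity>}"

text \<open>The dual of \<open>GS_S_top s\<close>, topologized as the projective limit of the duals of the steps: the
  dual norm of the restriction of \<open>u\<close> to \<open>GS_step s h\<close> is \<open>sup_on (GS_step_ball s h) u\<close>.\<close>

definition GS_S_dual_top :: "real \<Rightarrow> 'n::finite functional topology" where
  "GS_S_dual_top s =
     seminorm_topology (top_dual (GS_S_top s)) {0<..} (\<lambda>h. sup_on (GS_step_ball s h))"

text \<open>The dual of \<open>GS_Sigma_top s\<close>, topologized as the inductive limit of the duals of the steps,
  which are mapped into it by restricting functionals to \<open>GS_Sigma s\<close>.\<close>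

definition GS_Sigma_dual_top :: "real \<Rightarrow> 'n::finite functional topology" where
  "GS_Sigma_dual_top s =
     ind_limit_topology (top_dual (GS_Sigma_top s)) {0<..} (GS_step_dual s)
       (\<lambda>h. sup_on (GS_step_ball s h)) (\<lambda>h. restr (GS_Sigma s))"

definition schwartz_bounded :: "(real^'n::finite \<Rightarrow> complex) set \<Rightarrow> bool" where
  "schwartz_bounded C \<longleftrightarrow>
     C \<subseteq> schwartz \<and> (\<forall>\<alpha> \<beta>. (SUP f\<in>C. schwartz_seminorm (\<alpha>, \<beta>) f) < \<infinity>)"

text \<open>Tempered distributions with the strong dual topology.\<close>

definition schwartz_dual_top :: "'n::finite functional topology" where
  "schwartz_dual_top = seminorm_topology (top_dual schwartz_top) {C. schwartz_bounded C} sup_on"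


section \<open>Continuous embeddings\<close>

text \<open>All spaces are regarded as subsets of the dual of \<open>GS_S_top (1/2)\<close>: a function \<open>f\<close> is the
  functional \<open>\<phi> \<mapsto> \<integral> f \<phi>\<close> on \<open>GS_S (1/2)\<close>, and a functional on one of the larger test function
  spaces (all of which contain \<open>GS_S (1/2)\<close> densely) is its restriction to \<open>GS_S (1/2)\<close>.\<close>

definition of_function :: "(real^'n::finite \<Rightarrow> complex) \<Rightarrow> 'n functional" where
  "of_function f = restr (GS_S (1/2)) (\<lambda>\<phi>. LINT y|lborel. f y * \<phi> y)"

definition of_functional :: "'n::finite functional \<Rightarrow> 'n functional" where
  "of_functional u = restr (GS_S (1/2)) u"

text \<open>Continuous inclusion of \<open>X\<close> in \<open>Y\<close>, whose points are identified with points of a common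
  ambient space by the maps \<open>a\<close> and \<open>b\<close>.\<close>

definition embeds :: "('a \<Rightarrow> 'c) \<Rightarrow> 'a topology \<Rightarrow> ('b \<Rightarrow> 'c) \<Rightarrow> 'b topology \<Rightarrow> bool" where
  "embeds a X b Y \<longleftrightarrow> (\<exists>e. continuous_map X Y e \<and> (\<forall>x\<in>topspace X. b (e x) = a x))"


section \<open>Quasi-Banach spaces and Schatten-von Neumann classes\<close>

definition quasi_norm_on :: "('x \<Rightarrow> complex) set \<Rightarrow> (('x \<Rightarrow> complex) \<Rightarrow> real) \<Rightarrow> bool" where
  "quasi_norm_on B q \<longleftrightarrow>
     (\<forall>u\<in>B. 0 \<le> q u) \<and> (\<forall>u\<in>B. q u = 0 \<longleftrightarrow> u = 0) \<and>
     (\<forall>c. \<forall>u\<in>B. q (cscale c u) = cmod c * q u) \<and>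
     (\<exists>D\<ge>1. \<forall>u\<in>B. \<forall>v\<in>B. q (u + v) \<le> D * (q u + q v))"

definition quasi_banach :: "('x \<Rightarrow> complex) set \<Rightarrow> (('x \<Rightarrow> complex) \<Rightarrow> real) \<Rightarrow> bool" where
  "quasi_banach B q \<longleftrightarrow>
     cfun.subspace B \<and> quasi_norm_on B q \<and>
     (\<forall>X::nat \<Rightarrow> 'x \<Rightarrow> complex.
        (\<forall>n. X n \<in> B) \<and> (\<forall>\<epsilon>>0. \<exists>M. \<forall>m\<ge>M. \<forall>n\<ge>M. q (X m - X n) < \<epsilon>) \<longrightarrow>
        (\<exists>l\<in>B. (\<lambda>n. q (X n - l)) \<longlonglongrightarrow> 0))"

definition quasi_norm_top ::
  "('x \<Rightarrow> complex) set \<Rightarrow> (('x \<Rightarrow> complex) \<Rightarrow> real) \<Rightarrow> ('x \<Rightarrow> complex) topology" where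
  "quasi_norm_top B q = seminorm_topology B {()} (\<lambda>_ u. ennreal (q u))"

definition op_norm ::
  "('x \<Rightarrow> complex) set \<Rightarrow> (('x \<Rightarrow> complex) \<Rightarrow> real) \<Rightarrow> (('y \<Rightarrow> complex) \<Rightarrow> real)
    \<Rightarrow> (('x \<Rightarrow> complex) \<Rightarrow> ('y \<Rightarrow> complex)) \<Rightarrow> ennreal" where
  "op_norm B1 q1 q2 T = (SUP u\<in>{u\<in>B1. q1 u \<le> 1}. ennreal (q2 (T u)))"

text \<open>Rank at most \<open>k\<close>, phrased without \<open>cfun.dim\<close>, which is 0 on infinite-dimensional spaces.\<close>

definition rank_le ::
  "nat \<Rightarrow> ('x \<Rightarrow> complex) set \<Rightarrow> (('x \<Rightarrow> complex) \<Rightarrow> ('y \<Rightarrow> complex)) \<Rightarrow> bool" where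
  "rank_le k B1 T \<longleftrightarrow> (\<exists>S. finite S \<and> card S \<le> k \<and> T ` B1 \<subseteq> cfun.span S)"

definition singular_value ::
  "nat \<Rightarrow> ('x \<Rightarrow> complex) set \<Rightarrow> (('x \<Rightarrow> complex) \<Rightarrow> real)
    \<Rightarrow> ('y \<Rightarrow> complex) set \<Rightarrow> (('y \<Rightarrow> complex) \<Rightarrow> real)
    \<Rightarrow> (('x \<Rightarrow> complex) \<Rightarrow> ('y \<Rightarrow> complex)) \<Rightarrow> ennreal" where
  "singular_value j B1 q1 B2 q2 T =
     (INF T0\<in>{T0. linear_map_on B1 T0 \<and> T0 ` B1 \<subseteq> B2 \<and> rank_le (j - 1) B1 T0}.
        op_norm B1 q1 q2 (\<lambda>u. T u - T0 u))"

text \<open>The power \<open>x\<^sup>r\<close> for \<open>r > 0\<close>.\<close>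

definition epow :: "ennreal \<Rightarrow> real \<Rightarrow> ennreal" where
  "epow x r = (if x = \<infinity> then \<infinity> else ennreal (enn2real x powr r))"

definition lp_norm :: "ennreal \<Rightarrow> (nat \<Rightarrow> ennreal) \<Rightarrow> ennreal" where
  "lp_norm p a =
     (if p = \<infinity> then (SUP k. a k)
      else epow (\<Sum>k. epow (a k) (enn2real p)) (1 / enn2real p))"

definition schatten_norm ::
  "ennreal \<Rightarrow> ('x \<Rightarrow> complex) set \<Rightarrow> (('x \<Rightarrow> complex) \<Rightarrow> real)
    \<Rightarrow> ('y \<Rightarrow> complex) set \<Rightarrow> (('y \<Rightarrow> complex) \<Rightarrow> real)
    \<Rightarrow> (('x \<Rightarrow> complex) \<Rightarrow> ('y \<Rightarrow> complex)) \<Rightarrow> ennreal" where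
  "schatten_norm p B1 q1 B2 q2 T = lp_norm p (\<lambda>k. singular_value (Suc k) B1 q1 B2 q2 T)"

definition schatten_class ::
  "ennreal \<Rightarrow> ('x \<Rightarrow> complex) set \<Rightarrow> (('x \<Rightarrow> complex) \<Rightarrow> real)
    \<Rightarrow> ('y \<Rightarrow> complex) set \<Rightarrow> (('y \<Rightarrow> complex) \<Rightarrow> real)
    \<Rightarrow> (('x \<Rightarrow> complex) \<Rightarrow> ('y \<Rightarrow> complex)) set" where
  "schatten_class p B1 q1 B2 q2 =
     {T. linear_map_on B1 T \<and> T ` B1 \<subseteq> B2 \<and> schatten_norm p B1 q1 B2 q2 T < \<infinity>}"


section \<open>Operators with kernels\<close>

definition join :: "real^'m::finite \<Rightarrow> real^'n::finite \<Rightarrow> real^('m + 'n)" where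
  "join x y = (\<chi> k. case k of Inl i \<Rightarrow> x $ i | Inr j \<Rightarrow> y $ j)"

text \<open>\<open>D\<close> is the distribution space (\<open>GS_S_dual_top s\<close>, \<open>GS_Sigma_dual_top s\<close> or
  \<open>schwartz_dual_top\<close>) to which the operator with kernel \<open>K\<close> is extended: \<open>u\<close>, given as a
  functional on \<open>GS_S (1/2)\<close>, is first identified with the element of \<open>D\<close> restricting to it, and
  that element is then applied to \<open>K(x, \<cdot>)\<close>. For \<open>u = of_function f\<close>,
  \<open>f \<in> GS_S (1/2)\<close>, the result is the function \<open>x \<mapsto> \<integral> K(x, y) f(y) dy\<close>.\<close>

definition kernel_op ::
  "'n functional topology \<Rightarrow> (real^('m::finite + 'n::finite) \<Rightarrow> complex)
    \<Rightarrow> 'n functional \<Rightarrow> 'm functional" where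
  "kernel_op D K u =
     of_function (\<lambda>x. (inv_into (topspace D) of_functional u) (\<lambda>y. K (join x y)))"

end

theory Submission
  imports Defs "HOL-Probability.Sinc_Integral"
begin

text \<open>Let \<open>a\<close>, \<open>a\<^sup>*\<close> denote the ladder operators \<open>x\<^sub>i + \<partial>\<^sub>i\<close>, \<open>x\<^sub>i - \<partial>\<^sub>i\<close>. The three test function spaces all consist
  of the smooth \<open>f\<close> for which every product of \<open>k\<close> ladder operators applied to \<open>f\<close> is bounded by \<open>\<omega> k\<close> for some weight \<open>\<omega>\<close>
  in a class closed under the obvious operations. The projection \<open>P\<^sub>n\<close> onto the first \<open>n\<close> Hermite functions commutes
  with \<open>a\<close>, \<open>a\<^sup>*\<close> up to shifting \<open>n\<close> by one, and a function orthogonal to the first \<open>n\<close> Hermite functions satisfies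
  \<open>\<parallel>a f\<parallel>\<^sup>2 \<ge> 2n \<parallel>f\<parallel>\<^sup>2\<close>; hence \<open>f - P\<^sub>n f\<close> satisfies ladder bounds of the same class, smaller by any prescribed power of
  \<open>n\<close>. Splitting the weight of \<open>K\<close> between its two variables shows that \<open>T\<^sub>K\<close> maps the unit ball of \<open>\<B>\<^sub>1\<close> into the
  functions with one fixed weight. Projecting the range in all \<open>d\<^sub>2\<close> coordinates gives operators of rank at most \<open>n ^ d\<^sub>2\<close>
  that approximate \<open>T\<^sub>K\<close> to any power of \<open>1/n\<close>, so the singular values decay faster than every power.\<close>

section \<open>Hermite expansions in one variable\<close>

text \<open>Multiplication by x_i and differentiation do not respect the Hermite grading separately;
  their sum and difference shift it by one, which is why every bound is phrased through words in
  ladder operators. The spectral gap is an L2 statement and gives the rate n^(-1/2); turning it into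
  a sup bound by a one-variable Sobolev inequality leaves n^(-1/4), and idempotence of the
  projection repairs the loss by repetition. All integration for these estimates takes place on a
  line with the other coordinates frozen. Each approximation error is estimated as one function,
  never as the sum of a series, so the constants of the quasi-triangle inequality do not accumulate.
  The topologies enter through two facts only: the functions sharing one weight form a bounded set
  of the test space (\<open>absorbing\<close>), and the polar of that set contains a neighbourhood
  of 0 in the dual (\<open>polar_nbhds\<close>). Splitting a weight is the delicate point for
  Beurling classes, where one new weight has to beat every geometric rate at once.\<close>

definition rapid :: "(real \<Rightarrow> real) \<Rightarrow> bool" where
  "rapid u \<longleftrightarrow> (\<forall>b::nat. \<exists>C. \<forall>x. \<bar>x\<bar> ^ b * \<bar>u x\<bar> \<le> C)"

text \<open>The derivative is an existential witness, so that sum and product rules follow by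
  induction on \<open>k\<close> with explicit derivatives; \<open>schwartz1_deriv\<close> identifies
  it with \<open>deriv\<close>. Real values suffice because complex functions are handled through
  their real parts.\<close>

fun schwartz1_upto :: "nat \<Rightarrow> (real \<Rightarrow> real) \<Rightarrow> bool" where
  "schwartz1_upto 0 u \<longleftrightarrow> rapid u \<and> continuous_on UNIV u"
| "schwartz1_upto (Suc k) u \<longleftrightarrow> rapid u \<and>
     (\<exists>u'. (\<forall>x. (u has_real_derivative u' x) (at x)) \<and> schwartz1_upto k u')"

definition schwartz1 :: "(real \<Rightarrow> real) \<Rightarrow> bool" where
  "schwartz1 u \<longleftrightarrow> (\<forall>k. schwartz1_upto k u)"

lemma rapid_add:
  assumes "rapid u" "rapid v"
  shows "rapid (\<lambda>x. u x + v x)"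
  unfolding rapid_def
proof
  fix b :: nat
  obtain C D where C: "\<And>x. \<bar>x\<bar> ^ b * \<bar>u x\<bar> \<le> C" and D: "\<And>x. \<bar>x\<bar> ^ b * \<bar>v x\<bar> \<le> D"
    using assms unfolding rapid_def by meson
  have "\<bar>x\<bar> ^ b * \<bar>u x + v x\<bar> \<le> C + D" for x
  proof -
    have "\<bar>x\<bar> ^ b * \<bar>u x + v x\<bar> \<le> \<bar>x\<bar> ^ b * (\<bar>u x\<bar> + \<bar>v x\<bar>)"
      by (intro mult_left_mono) auto
    also have "\<dots> \<le> C + D" using C[of x] D[of x] by (simp add: algebra_simps)
    finally show ?thesis .
  qed
  then show "\<exists>C. \<forall>x. \<bar>x\<bar> ^ b * \<bar>u x + v x\<bar> \<le> C" by blast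
qed

lemma rapid_mult_bounded:
  assumes "rapid u" "\<And>x. \<bar>v x\<bar> \<le> B"
  shows "rapid (\<lambda>x. u x * v x)"
  unfolding rapid_def
proof
  fix b :: nat
  obtain C where C: "\<And>x. \<bar>x\<bar> ^ b * \<bar>u x\<bar> \<le> C"
    using assms unfolding rapid_def by meson
  have "\<bar>x\<bar> ^ b * \<bar>u x * v x\<bar> \<le> C * B" for x
    using mult_mono[OF C assms(2), of x x] order_trans[OF _ C[of x], of 0]
    by (simp add: abs_mult mult.assoc)
  then show "\<exists>C. \<forall>x. \<bar>x\<bar> ^ b * \<bar>u x * v x\<bar> \<le> C" by blast
qed

lemma rapid_mult_id:
  assumes "rapid u"
  shows "rapid (\<lambda>x. x * u x)"
  unfolding rapid_def
proof
  fix b :: nat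
  obtain C where "\<And>x. \<bar>x\<bar> ^ Suc b * \<bar>u x\<bar> \<le> C"
    using assms unfolding rapid_def by meson
  then have "\<bar>x\<bar> ^ b * \<bar>x * u x\<bar> \<le> C" for x
    by (simp add: abs_mult mult_ac)
  then show "\<exists>C. \<forall>x. \<bar>x\<bar> ^ b * \<bar>x * u x\<bar> \<le> C" by blast
qed

lemma rapid_bounded:
  assumes "rapid u"
  obtains B where "\<And>x. \<bar>u x\<bar> \<le> B"
proof -
  obtain C where "\<And>x. \<bar>x\<bar> ^ 0 * \<bar>u x\<bar> \<le> C"
    using assms unfolding rapid_def by meson
  then have "\<And>x. \<bar>u x\<bar> \<le> C" by simp
  then show ?thesis using that by blast
qed

lemma schwartz1_upto_rapid: "schwartz1_upto k u \<Longrightarrow> rapid u"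
  by (cases k) auto

lemma schwartz1_upto_cont: "schwartz1_upto k u \<Longrightarrow> continuous_on UNIV u"
  by (cases k) (auto intro: DERIV_continuous_on)

lemma schwartz1_upto_SucD: "schwartz1_upto (Suc k) u \<Longrightarrow> schwartz1_upto k u"
proof (induction k arbitrary: u)
  case 0
  then show ?case using schwartz1_upto_cont[OF 0] by auto
qed force

lemma schwartz1_upto_add:
  "schwartz1_upto k u \<Longrightarrow> schwartz1_upto k v \<Longrightarrow> schwartz1_upto k (\<lambda>x. u x + v x)"
proof (induction k arbitrary: u v)
  case (Suc k)
  obtain u' v' where "\<forall>x. (u has_real_derivative u' x) (at x)" "schwartz1_upto k u'"
    "\<forall>x. (v has_real_derivative v' x) (at x)" "schwartz1_upto k v'"
    using Suc.prems by auto
  then show ?case using Suc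
    by (auto intro!: rapid_add exI[of _ "\<lambda>x. u' x + v' x"] derivative_eq_intros)
qed (auto intro!: rapid_add continuous_intros)

lemma schwartz1_upto_mult:
  "schwartz1_upto k u \<Longrightarrow> schwartz1_upto k v \<Longrightarrow> schwartz1_upto k (\<lambda>x. u x * v x)"
proof (induction k arbitrary: u v)
  case 0
  obtain B where "\<And>x. \<bar>v x\<bar> \<le> B" using 0 rapid_bounded[of v] by auto
  then show ?case using 0 by (auto intro!: continuous_intros intro: rapid_mult_bounded)
next
  case (Suc k)
  obtain u' v' where d: "\<forall>x. (u has_real_derivative u' x) (at x)" "schwartz1_upto k u'"
    "\<forall>x. (v has_real_derivative v' x) (at x)" "schwartz1_upto k v'"
    using Suc.prems by auto
  have "schwartz1_upto k (\<lambda>x. u' x * v x + u x * v' x)"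
    using d Suc.prems[THEN schwartz1_upto_SucD] by (intro schwartz1_upto_add Suc.IH)
  moreover have "\<forall>x. ((\<lambda>x. u x * v x) has_real_derivative u' x * v x + u x * v' x) (at x)"
    using d by (auto intro!: derivative_eq_intros)
  moreover obtain B where "\<And>x. \<bar>v x\<bar> \<le> B"
    using Suc.prems(2)[THEN schwartz1_upto_rapid] rapid_bounded[of v] by auto
  then have "rapid (\<lambda>x. u x * v x)"
    using Suc.prems(1)[THEN schwartz1_upto_rapid] by (intro rapid_mult_bounded)
  ultimately show ?case by auto
qed

lemma schwartz1_upto_cmult: "schwartz1_upto k u \<Longrightarrow> schwartz1_upto k (\<lambda>x. c * u x)"
proof (induction k arbitrary: u)
  case 0
  then show ?case using rapid_mult_bounded[of u "\<lambda>_. c" "\<bar>c\<bar>"]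
    by (auto intro!: continuous_intros simp: mult.commute)
next
  case (Suc k)
  obtain u' where d: "\<forall>x. (u has_real_derivative u' x) (at x)" "schwartz1_upto k u'"
    using Suc.prems by auto
  have "rapid (\<lambda>x. c * u x)"
    using Suc.prems rapid_mult_bounded[of u "\<lambda>_. c" "\<bar>c\<bar>"] by (simp add: mult.commute)
  then show ?case using d Suc.IH[OF d(2)]
    by (auto intro!: exI[of _ "\<lambda>x. c * u' x"] derivative_eq_intros)
qed

lemma schwartz1_upto_mult_id: "schwartz1_upto k u \<Longrightarrow> schwartz1_upto k (\<lambda>x. x * u x)"
proof (induction k arbitrary: u)
  case 0
  then show ?case by (auto intro!: continuous_intros rapid_mult_id)
next
  case (Suc k)
  obtain u' where d: "\<forall>x. (u has_real_derivative u' x) (at x)" "schwartz1_upto k u'"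
    using Suc.prems by auto
  have "schwartz1_upto k (\<lambda>x. u x + x * u' x)"
    using d Suc.prems[THEN schwartz1_upto_SucD] by (intro schwartz1_upto_add Suc.IH)
  moreover have "\<forall>x. ((\<lambda>x. x * u x) has_real_derivative u x + x * u' x) (at x)"
    using d by (auto intro!: derivative_eq_intros)
  ultimately show ?case using Suc.prems rapid_mult_id by auto
qed

lemma schwartz1_add: "schwartz1 u \<Longrightarrow> schwartz1 v \<Longrightarrow> schwartz1 (\<lambda>x. u x + v x)"
  and schwartz1_mult: "schwartz1 u \<Longrightarrow> schwartz1 v \<Longrightarrow> schwartz1 (\<lambda>x. u x * v x)"
  and schwartz1_cmult: "schwartz1 u \<Longrightarrow> schwartz1 (\<lambda>x. c * u x)"
  and schwartz1_mult_id: "schwartz1 u \<Longrightarrow> schwartz1 (\<lambda>x. x * u x)"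
  and schwartz1_rapid: "schwartz1 u \<Longrightarrow> rapid u"
  and schwartz1_cont: "schwartz1 u \<Longrightarrow> continuous_on UNIV u"
  unfolding schwartz1_def
  by (auto intro: schwartz1_upto_add schwartz1_upto_mult schwartz1_upto_cmult
      schwartz1_upto_mult_id schwartz1_upto_rapid schwartz1_upto_cont)

lemma schwartz1_diff: "schwartz1 u \<Longrightarrow> schwartz1 v \<Longrightarrow> schwartz1 (\<lambda>x. u x - v x)"
  using schwartz1_add[OF _ schwartz1_cmult[of v "-1"], of u] by simp

lemma schwartz1_zero: "schwartz1 (\<lambda>_. 0)"
proof -
  have "schwartz1_upto k (\<lambda>_. 0)" for k
    by (induction k) (auto simp: rapid_def intro!: exI[of _ "\<lambda>_. 0"])
  then show ?thesis by (simp add: schwartz1_def)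
qed

lemma schwartz1_sum: "(\<And>i. i \<in> I \<Longrightarrow> schwartz1 (f i)) \<Longrightarrow> schwartz1 (\<lambda>x. \<Sum>i\<in>I. f i x)"
  by (induction I rule: infinite_finite_induct) (auto intro: schwartz1_zero schwartz1_add)

text \<open>By uniqueness of derivatives the witnesses belonging to different orders
  \<open>k\<close> are all \<open>deriv u\<close>, so one function serves every order.\<close>

lemma schwartz1_deriv:
  assumes "schwartz1 u"
  shows schwartz1_DERIV: "(u has_real_derivative deriv u x) (at x)"
    and schwartz1_deriv_closed: "schwartz1 (deriv u)"
proof -
  have *: "\<exists>u'. (\<forall>x. (u has_real_derivative u' x) (at x)) \<and> schwartz1_upto k u'" for k
    using assms[unfolded schwartz1_def, rule_format, of "Suc k"] by simp
  have e: "u' = deriv u" if "\<forall>x. (u has_real_derivative u' x) (at x)" for u'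
    using that by (intro ext) (rule DERIV_imp_deriv[symmetric], blast)
  have **: "(\<forall>x. (u has_real_derivative deriv u x) (at x)) \<and> schwartz1_upto k (deriv u)" for k
  proof -
    obtain u' where u': "\<forall>x. (u has_real_derivative u' x) (at x)" "schwartz1_upto k u'"
      using *[of k] by blast
    show ?thesis using u' unfolding e[OF u'(1)] by blast
  qed
  show "(u has_real_derivative deriv u x) (at x)" using **[of 0] by blast
  show "schwartz1 (deriv u)" unfolding schwartz1_def using ** by blast
qed

section \<open>Integrals of rapidly decreasing functions of one variable\<close>

lemma integrable_inverse_one_plus_square: "integrable lborel (\<lambda>x::real. inverse (1 + x\<^sup>2))"
  using integrable_inverse_1_plus_square by (simp add: set_integrable_def)

lemma integrable_quadratic_decay:
  fixes f :: "real \<Rightarrow> 'b::{banach,second_countable_topology}"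
  assumes "continuous_on UNIV f" "\<And>x. (1 + x\<^sup>2) * norm (f x) \<le> C"
  shows "integrable lborel f"
proof (rule Bochner_Integration.integrable_bound)
  show "integrable lborel (\<lambda>x::real. C * inverse (1 + x\<^sup>2))"
    using integrable_inverse_one_plus_square by simp
  show "f \<in> borel_measurable lborel"
    using assms(1) by (simp add: borel_measurable_continuous_onI)
  show "AE x in lborel. norm (f x) \<le> norm (C * inverse (1 + x\<^sup>2))"
  proof (rule AE_I2)
    fix x :: real
    have p: "0 < 1 + x\<^sup>2" by (simp add: add_pos_nonneg)
    then have "norm (f x) \<le> C * inverse (1 + x\<^sup>2)"
      using assms(2)[of x] by (simp add: divide_inverse[symmetric] pos_le_divide_eq mult.commute)
    then show "norm (f x) \<le> norm (C * inverse (1 + x\<^sup>2))"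
      by (simp only: real_norm_def)
  qed
qed

lemma schwartz1_quadratic_decay:
  assumes "schwartz1 u"
  shows "\<exists>C. \<forall>x. (1 + x\<^sup>2) * \<bar>u x\<bar> \<le> C"
proof -
  obtain B where B: "\<And>x. \<bar>u x\<bar> \<le> B"
    using rapid_bounded[OF schwartz1_rapid[OF assms]] by blast
  obtain C where C: "\<And>x. \<bar>x\<bar> ^ 2 * \<bar>u x\<bar> \<le> C"
    using schwartz1_rapid[OF assms] unfolding rapid_def by meson
  have "(1 + x\<^sup>2) * \<bar>u x\<bar> \<le> B + C" for x
    using B[of x] C[of x] by (simp add: algebra_simps)
  then show ?thesis by blast
qed

lemma schwartz1_integrable: "schwartz1 u \<Longrightarrow> integrable lborel u"
  using schwartz1_quadratic_decay[of u] integrable_quadratic_decay[of u] schwartz1_cont[of u] by auto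

lemma tendsto_zero_quadratic_decay:
  fixes u :: "real \<Rightarrow> 'b::real_normed_vector"
  assumes "\<And>x. (1 + x\<^sup>2) * norm (u x) \<le> C"
  shows "(u \<longlongrightarrow> 0) at_top" "(u \<longlongrightarrow> 0) at_bot"
proof -
  have b: "norm (u x) \<le> C / (1 + x\<^sup>2)" for x
    using assms[of x] by (simp add: pos_le_divide_eq mult.commute add_pos_nonneg)
  have "((\<lambda>x::real. C / (1 + x\<^sup>2)) \<longlongrightarrow> 0) at_top"
    by (intro tendsto_divide_0[OF tendsto_const] filterlim_at_top_imp_at_infinity
        filterlim_tendsto_add_at_top[OF tendsto_const] filterlim_pow_at_top filterlim_ident) auto
  then show "(u \<longlongrightarrow> 0) at_top" by (rule Lim_null_comparison[rotated]) (use b in auto)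
  have "((\<lambda>x::real. C / (1 + x\<^sup>2)) \<longlongrightarrow> 0) at_bot"
    by (intro tendsto_divide_0[OF tendsto_const] filterlim_at_top_imp_at_infinity
        filterlim_tendsto_add_at_top[OF tendsto_const] filterlim_pow_at_bot_even filterlim_ident) auto
  then show "(u \<longlongrightarrow> 0) at_bot" by (rule Lim_null_comparison[rotated]) (use b in auto)
qed

text \<open>The fundamental theorem of calculus on the whole line: quadratic decay of
  \<open>u\<close> kills both boundary terms, that of \<open>u'\<close> gives integrability. The
  adjointness \<open>ip_raise\<close> rests on it.\<close>

lemma integral_derivative_zero:
  fixes u u' :: "real \<Rightarrow> 'b::euclidean_space"
  assumes "\<And>x. (u has_vector_derivative u' x) (at x)" "continuous_on UNIV u'"
    "\<And>x. (1 + x\<^sup>2) * norm (u x) \<le> C" "\<And>x. (1 + x\<^sup>2) * norm (u' x) \<le> D"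
  shows "(LINT x|lborel. u' x) = 0"
proof -
  have "(LBINT x=-\<infinity>..\<infinity>. u' x) = 0 - 0"
  proof (rule interval_integral_FTC_integrable[where F=u])
    show "set_integrable lborel (einterval (- \<infinity>) \<infinity>) u'"
      using integrable_quadratic_decay[OF assms(2,4)] by (simp add: set_integrable_def)
  qed (use assms tendsto_zero_quadratic_decay[OF assms(3)] in
      \<open>auto simp: ereal_tendsto_simps continuous_on_eq_continuous_at\<close>)
  then show ?thesis by (simp add: interval_lebesgue_integral_def set_lebesgue_integral_def)
qed

lemma schwartz1_integral_deriv:
  assumes "schwartz1 u"
  shows "(LINT x|lborel. deriv u x) = 0"
proof -
  obtain C where "\<And>x. (1 + x\<^sup>2) * \<bar>u x\<bar> \<le> C"
    using schwartz1_quadratic_decay[OF assms] by blast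
  moreover obtain D where "\<And>x. (1 + x\<^sup>2) * \<bar>deriv u x\<bar> \<le> D"
    using schwartz1_quadratic_decay[OF schwartz1_deriv_closed[OF assms]] by blast
  ultimately show ?thesis
    using schwartz1_DERIV[OF assms] schwartz1_cont[OF schwartz1_deriv_closed[OF assms]]
    by (intro integral_derivative_zero[of u]) (auto simp: has_real_derivative_iff_has_vector_derivative)
qed

section \<open>Creation and annihilation operators and Hermite functions on the line\<close>

definition ip :: "(real \<Rightarrow> real) \<Rightarrow> (real \<Rightarrow> real) \<Rightarrow> real" where
  "ip u v = (LINT x|lborel. u x * v x)"

text \<open>\<open>raise\<close> and \<open>lower\<close> are the creation and annihilation
  operators of the harmonic oscillator without the factor 1/sqrt 2; hence the commutator 2 in
  \<open>lower_raise\<close>.\<close>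

definition raise :: "(real \<Rightarrow> real) \<Rightarrow> real \<Rightarrow> real" where
  "raise u x = x * u x - deriv u x"

definition lower :: "(real \<Rightarrow> real) \<Rightarrow> real \<Rightarrow> real" where
  "lower u x = x * u x + deriv u x"

lemma schwartz1_raise: "schwartz1 u \<Longrightarrow> schwartz1 (raise u)"
  unfolding raise_def[abs_def] by (intro schwartz1_diff schwartz1_mult_id schwartz1_deriv_closed)

lemma schwartz1_lower: "schwartz1 u \<Longrightarrow> schwartz1 (lower u)"
  unfolding lower_def[abs_def] by (intro schwartz1_add schwartz1_mult_id schwartz1_deriv_closed)

lemma ip_commute: "ip u v = ip v u"
  by (simp add: ip_def mult.commute)

lemma ip_add_left:
  "schwartz1 u \<Longrightarrow> schwartz1 v \<Longrightarrow> schwartz1 w \<Longrightarrow> ip (\<lambda>x. u x + v x) w = ip u w + ip v w"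
  by (simp add: ip_def distrib_right schwartz1_integrable schwartz1_mult)

lemma ip_diff_left:
  "schwartz1 u \<Longrightarrow> schwartz1 v \<Longrightarrow> schwartz1 w \<Longrightarrow> ip (\<lambda>x. u x - v x) w = ip u w - ip v w"
  by (simp add: ip_def left_diff_distrib schwartz1_integrable schwartz1_mult)

lemma ip_cmult_left: "ip (\<lambda>x. c * u x) v = c * ip u v"
  by (simp add: ip_def mult.assoc)

lemma ip_zero_left [simp]: "ip (\<lambda>x. 0) v = 0"
  by (simp add: ip_def)

lemma ip_sum_left:
  assumes "schwartz1 w" "\<And>i. i \<in> I \<Longrightarrow> schwartz1 (f i)"
  shows "ip (\<lambda>x. \<Sum>i\<in>I. f i x) w = (\<Sum>i\<in>I. ip (f i) w)"
  using assms(2) by (induction I rule: infinite_finite_induct)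
    (auto simp: assms ip_add_left schwartz1_sum)

lemma ip_self_nonneg: "0 \<le> ip u u"
  by (simp add: ip_def)

text \<open>Integration by parts: the derivative of u v integrates to 0, so -d/dx and d/dx are
  adjoint, while multiplication by x is symmetric.\<close>

lemma ip_raise:
  assumes "schwartz1 u" "schwartz1 v"
  shows "ip (raise u) v = ip u (lower v)"
proof -
  note d = assms[THEN schwartz1_DERIV] and s = assms assms[THEN schwartz1_deriv_closed]
    assms[THEN schwartz1_mult_id]
  have "deriv (\<lambda>x. u x * v x) = (\<lambda>x. u x * deriv v x + deriv u x * v x)"
    using DERIV_mult'[OF d] by (auto intro!: DERIV_imp_deriv)
  then have "(LINT x|lborel. u x * deriv v x + deriv u x * v x) = 0"
    using schwartz1_integral_deriv[OF schwartz1_mult[OF assms]] by simp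
  then have "ip u (deriv v) + ip (deriv u) v = 0"
    by (simp add: ip_def s schwartz1_integrable schwartz1_mult)
  moreover have "ip (raise u) v = ip (\<lambda>x. x * u x) v - ip (deriv u) v"
    unfolding raise_def[abs_def] by (simp add: ip_diff_left s)
  moreover have "ip u (lower v) = ip (\<lambda>x. x * v x) u + ip (deriv v) u"
    unfolding lower_def[abs_def] by (subst ip_commute) (simp add: ip_add_left s)
  moreover have "ip (\<lambda>x. x * u x) v = ip (\<lambda>x. x * v x) u"
    by (simp add: ip_def mult_ac)
  ultimately show ?thesis by (simp add: ip_commute)
qed

lemma deriv_mult_id:
  assumes "schwartz1 u"
  shows "deriv (\<lambda>x. x * u x) x = u x + x * deriv u x"
proof (rule DERIV_imp_deriv)
  show "((\<lambda>x. x * u x) has_real_derivative u x + x * deriv u x) (at x)"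
    using DERIV_mult'[OF DERIV_ident schwartz1_DERIV[OF assms], of x] by (simp add: mult.commute add.commute)
qed

lemma lower_raise:
  assumes "schwartz1 u"
  shows "lower (raise u) x = raise (lower u) x + 2 * u x"
proof -
  note s = assms schwartz1_deriv_closed[OF assms] schwartz1_mult_id[OF assms]
  have 1: "deriv (raise u) x = u x + x * deriv u x - deriv (deriv u) x"
    unfolding raise_def[abs_def]
    using DERIV_diff[OF s(3)[THEN schwartz1_DERIV] s(2)[THEN schwartz1_DERIV], of x]
    by (auto intro!: DERIV_imp_deriv simp: deriv_mult_id assms)
  have 2: "deriv (lower u) x = u x + x * deriv u x + deriv (deriv u) x"
    unfolding lower_def[abs_def]
    using DERIV_add[OF s(3)[THEN schwartz1_DERIV] s(2)[THEN schwartz1_DERIV], of x]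
    by (auto intro!: DERIV_imp_deriv simp: deriv_mult_id assms)
  show ?thesis
    unfolding lower_def[of "raise u"] raise_def[of "lower u"] 1 2
    by (simp add: raise_def lower_def algebra_simps)
qed

text \<open>Unnormalised: \<open>hermite k\<close> is the physicists' Hermite polynomial H_k times
  exp (-x^2/2). Generating it by \<open>raise\<close> lets the algebra of ladder operators replace
  polynomial identities.\<close>

fun hermite :: "nat \<Rightarrow> real \<Rightarrow> real" where
  "hermite 0 = (\<lambda>x. exp (- (x\<^sup>2 / 2)))"
| "hermite (Suc k) = raise (hermite k)"

text \<open>A single term of the exponential series gives (x^2/2)^b / b! \<le> exp (x^2/2), and
  |x|^b \<le> 1 + x^(2b).\<close>

lemma rapid_gauss: "rapid (\<lambda>x. exp (- (x\<^sup>2 / 2)))"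
  unfolding rapid_def
proof
  fix b :: nat
  have "\<bar>x\<bar> ^ b * \<bar>exp (- (x\<^sup>2 / 2))\<bar> \<le> 1 + 2 ^ b * fact b" for x :: real
  proof -
    define E where "E = exp (x\<^sup>2 / 2)"
    have "(\<lambda>n. (x\<^sup>2 / 2) ^ n /\<^sub>R fact n) sums E" unfolding E_def by (rule exp_converges)
    then have "(\<Sum>n\<in>{b}. (x\<^sup>2 / 2) ^ n /\<^sub>R fact n) \<le> E"
      using sum_le_suminf[of "\<lambda>n. (x\<^sup>2 / 2) ^ n /\<^sub>R fact n" "{b}"] by (simp add: sums_iff)
    then have 1: "(x\<^sup>2) ^ b \<le> 2 ^ b * fact b * E"
      by (simp add: power_divide divide_simps mult_ac)
    have 2: "\<bar>x\<bar> ^ b \<le> 1 + (x\<^sup>2) ^ b"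
    proof (cases "\<bar>x\<bar> \<le> 1")
      case True
      then have "\<bar>x\<bar> ^ b \<le> 1" by (simp add: power_le_one)
      then show ?thesis by (simp add: add_increasing2)
    next
      case False
      then have "\<bar>x\<bar> ^ b \<le> \<bar>x\<bar> ^ (2 * b)" by (intro power_increasing) auto
      then show ?thesis by (simp add: power_mult)
    qed
    have "1 \<le> E" by (simp add: E_def)
    then have "\<bar>x\<bar> ^ b \<le> (1 + 2 ^ b * fact b) * E"
      using 1 2 by (simp add: distrib_right)
    moreover have "exp (- (x\<^sup>2 / 2)) = inverse E" "E > 0" by (simp_all add: E_def exp_minus)
    ultimately show ?thesis by (simp add: divide_inverse[symmetric] pos_divide_le_eq)
  qed
  then show "\<exists>C. \<forall>x::real. \<bar>x\<bar> ^ b * \<bar>exp (- (x\<^sup>2 / 2))\<bar> \<le> C" by blast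
qed

lemma DERIV_gauss: "((\<lambda>x. exp (- (x\<^sup>2 / 2))) has_real_derivative -1 * (x * exp (- (x\<^sup>2 / 2)))) (at x)"
  by (auto intro!: derivative_eq_intros)

lemma schwartz1_hermite: "schwartz1 (hermite k)"
proof (induction k)
  case 0
  have "schwartz1_upto k (\<lambda>x. exp (- (x\<^sup>2 / 2)))" for k
  proof (induction k)
    case 0
    then show ?case using rapid_gauss by (auto intro!: continuous_intros)
  next
    case (Suc k)
    then show ?case using rapid_gauss DERIV_gauss
      by (auto intro!: exI[of _ "\<lambda>x. -1 * (x * exp (- (x\<^sup>2 / 2)))"] schwartz1_upto_cmult
          schwartz1_upto_mult_id simp del: mult_minus1)
  qed
  then show ?case by (simp add: schwartz1_def)
qed (simp add: schwartz1_raise)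

lemma lower_hermite_0: "lower (hermite 0) = (\<lambda>x. 0)"
  using DERIV_imp_deriv[OF DERIV_gauss] by (simp add: lower_def[abs_def])

text \<open>The commutation relation moves \<open>lower\<close> past one \<open>raise\<close> at the
  cost of a term with factor 2; the k + 1 passages add up, and at the end \<open>lower\<close>
  annihilates the Gaussian.\<close>

lemma lower_hermite_Suc: "lower (hermite (Suc k)) = (\<lambda>x. 2 * real (Suc k) * hermite k x)"
proof (induction k)
  case 0
  show ?case
  proof
    fix x
    have "deriv (\<lambda>x. 0 :: real) x = 0" by simp
    then show "lower (hermite (Suc 0)) x = 2 * real (Suc 0) * hermite 0 x"
      using lower_raise[OF schwartz1_hermite, of 0 x] unfolding lower_hermite_0
      by (simp add: raise_def)
  qed
next
  case (Suc k)
  have d: "deriv (\<lambda>x. 2 * real (Suc k) * hermite k x) x = 2 * real (Suc k) * deriv (hermite k) x" for x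
    using DERIV_cmult[OF schwartz1_DERIV[OF schwartz1_hermite]] by (rule DERIV_imp_deriv)
  show ?case
  proof
    fix x
    have "lower (hermite (Suc (Suc k))) x
      = raise (lower (hermite (Suc k))) x + 2 * hermite (Suc k) x"
      using lower_raise[OF schwartz1_hermite, of "Suc k" x] by simp
    also have "raise (lower (hermite (Suc k))) x = 2 * real (Suc k) * hermite (Suc k) x"
      unfolding Suc.IH raise_def d by (simp add: raise_def algebra_simps)
    finally show "lower (hermite (Suc (Suc k))) x = 2 * real (Suc (Suc k)) * hermite (Suc k) x"
      by (simp add: algebra_simps)
  qed
qed

lemma ip_hermite_Suc: "schwartz1 u \<Longrightarrow> ip u (hermite (Suc k)) = ip (lower u) (hermite k)"
  using ip_raise[OF schwartz1_hermite, of u k] by (simp add: ip_commute)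

lemma ip_lower_hermite_Suc:
  "schwartz1 u \<Longrightarrow> ip (raise u) (hermite (Suc k)) = 2 * real (Suc k) * ip u (hermite k)"
  by (simp only: ip_raise schwartz1_hermite lower_hermite_Suc) (simp add: ip_commute[of u] ip_cmult_left)

lemma ip_raise_hermite_0: "schwartz1 u \<Longrightarrow> ip (raise u) (hermite 0) = 0"
  by (simp only: ip_raise schwartz1_hermite lower_hermite_0) (simp add: ip_commute[of u])

text \<open>Moving a \<open>raise\<close> across the inner product lowers both indices. The smaller
  one reaches 0, and the Gaussian is orthogonal to the range of \<open>raise\<close> because
  \<open>lower\<close> annihilates it.\<close>

lemma hermite_orthogonal: "j < k \<Longrightarrow> ip (hermite k) (hermite j) = 0"
proof (induction j arbitrary: k)
  case 0
  then obtain l where "k = Suc l" by (cases k) auto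
  then show ?case using ip_raise_hermite_0[OF schwartz1_hermite, of l] by simp
next
  case (Suc j)
  then obtain l where "k = Suc l" "j < l" by (cases k) auto
  then show ?case
    using ip_lower_hermite_Suc[OF schwartz1_hermite, of l j] Suc.IH by simp
qed

text \<open>The value is 2^k k! sqrt pi. Its recursion \<open>hermite_sqnorm_Suc\<close> supplies
  the factors by which projections intertwine with ladder operators.\<close>

definition hermite_sqnorm :: "nat \<Rightarrow> real" where
  "hermite_sqnorm k = ip (hermite k) (hermite k)"

lemma ip_hermite: "ip (hermite j) (hermite k) = (if j = k then hermite_sqnorm k else 0)"
  using hermite_orthogonal[of j k] hermite_orthogonal[of k j]
  by (auto simp: hermite_sqnorm_def ip_commute dest: nat_neq_iff[THEN iffD1])

lemma hermite_sqnorm_Suc: "hermite_sqnorm (Suc k) = 2 * real (Suc k) * hermite_sqnorm k"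
  using ip_lower_hermite_Suc[OF schwartz1_hermite, of k k] by (simp add: hermite_sqnorm_def)

lemma hermite_sqnorm_pos: "0 < hermite_sqnorm k"
proof (induction k)
  case 0
  have i: "integrable lborel (\<lambda>x. hermite 0 x * hermite 0 x)"
    by (intro schwartz1_integrable schwartz1_mult schwartz1_hermite)
  have "hermite_sqnorm 0 \<noteq> 0"
  proof
    assume "hermite_sqnorm 0 = 0"
    then have "AE x in lborel. hermite 0 x * hermite 0 x = 0"
      unfolding hermite_sqnorm_def ip_def
      by (subst (asm) integral_nonneg_eq_0_iff_AE[OF i]) auto
    then have "AE x in (lborel :: real measure). False" by simp
    then show False by (simp add: AE_iff_null null_sets_def)
  qed
  moreover have "hermite_sqnorm 0 \<ge> 0" unfolding hermite_sqnorm_def by (rule ip_self_nonneg)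
  ultimately show ?case by simp
qed (simp add: hermite_sqnorm_Suc)

section \<open>Inverting the creation operator within rapidly decreasing functions\<close>

lemma gauss_tail_bound:
  assumes F: "\<And>y. (F has_real_derivative w y) (at y)" and lim: "(F \<longlongrightarrow> 0) at_top"
    and w: "\<And>y. y \<ge> x \<Longrightarrow> \<bar>w y\<bar> \<le> B * (y * exp (- (y\<^sup>2 / 2)))"
  shows "\<bar>F x\<bar> \<le> B * exp (- (x\<^sup>2 / 2))"
proof -
  \<comment> \<open>The majorant B exp (-y^2/2) has derivative -B y exp (-y^2/2), so adding it to F
    or to -F gives a function that is nonincreasing on [x, \<infinity>) with limit 0, hence
    nonnegative at x.\<close>
  have *: "0 \<le> c * F x + B * exp (- (x\<^sup>2 / 2))" if c: "c = 1 \<or> c = -1" for c :: real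
  proof (rule tendsto_upperbound)
    let ?H = "\<lambda>y. c * F y + B * exp (- (y\<^sup>2 / 2))"
    have g: "((\<lambda>y::real. exp (- (y\<^sup>2 / 2))) \<longlongrightarrow> 0) at_top"
      using schwartz1_quadratic_decay[OF schwartz1_hermite[of 0]]
        tendsto_zero_quadratic_decay(1)[of "hermite 0"] by auto
    have "(?H \<longlongrightarrow> c * 0 + B * 0) at_top" by (intro tendsto_intros lim g)
    then show "(?H \<longlongrightarrow> 0) at_top" by simp
    show "\<forall>\<^sub>F y in at_top. ?H y \<le> ?H x"
      using eventually_ge_at_top[of x]
    proof eventually_elim
      case (elim y)
      show ?case
      proof (rule DERIV_nonpos_imp_nonincreasing[OF elim])
        fix z assume z: "x \<le> z" "z \<le> y"
        have "(?H has_real_derivative c * w z + B * (-1 * (z * exp (- (z\<^sup>2 / 2))))) (at z)"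
          by (intro DERIV_add DERIV_cmult F DERIV_gauss)
        moreover have "c * w z + B * (-1 * (z * exp (- (z\<^sup>2 / 2)))) \<le> 0"
          using w[OF z(1)] c by auto
        ultimately show "\<exists>d. (?H has_real_derivative d) (at z) \<and> d \<le> 0" by blast
      qed
    qed
  qed simp
  show ?thesis using *[of 1] *[of "-1"] by auto
qed

text \<open>Dividing by the Gaussian costs no decay, because the tail of the antiderivative is
  itself of Gaussian size. For y \<ge> x \<ge> 1 the bound C / x^b on |v y| may be multiplied by y,
  which produces the exact derivative used in \<open>gauss_tail_bound\<close>.\<close>

lemma rapid_antiderivative:
  assumes "rapid v" and F: "\<And>y. (F has_real_derivative exp (- (y\<^sup>2 / 2)) * v y) (at y)"
    and lim: "(F \<longlongrightarrow> 0) at_top"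
  shows "\<exists>C. \<forall>x\<ge>1. x ^ b * \<bar>exp (x\<^sup>2 / 2) * F x\<bar> \<le> C"
proof -
  obtain C where C: "\<And>x. \<bar>x\<bar> ^ b * \<bar>v x\<bar> \<le> C"
    using assms(1) unfolding rapid_def by meson
  have C0: "0 \<le> C" using C[of 0] by (meson abs_ge_zero mult_nonneg_nonneg order_trans zero_le_power)
  have "x ^ b * \<bar>exp (x\<^sup>2 / 2) * F x\<bar> \<le> C" if x: "x \<ge> 1" for x
  proof -
    have "\<bar>exp (- (y\<^sup>2 / 2)) * v y\<bar> \<le> C / x ^ b * (y * exp (- (y\<^sup>2 / 2)))" if y: "y \<ge> x" for y
    proof -
      have "x ^ b * \<bar>v y\<bar> \<le> \<bar>y\<bar> ^ b * \<bar>v y\<bar>"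
        using x y by (intro mult_right_mono power_mono) auto
      then have "x ^ b * \<bar>v y\<bar> \<le> C" using C[of y] by linarith
      then have "\<bar>v y\<bar> \<le> C / x ^ b" using x by (simp add: pos_le_divide_eq mult.commute)
      also have "\<dots> \<le> C / x ^ b * y"
        using mult_left_mono[of 1 y "C / x ^ b"] x y C0 by auto
      finally have "exp (- (y\<^sup>2 / 2)) * \<bar>v y\<bar> \<le> exp (- (y\<^sup>2 / 2)) * (C / x ^ b * y)"
        by (intro mult_left_mono) auto
      then show ?thesis by (simp add: abs_mult mult_ac)
    qed
    from gauss_tail_bound[OF F lim this]
    have "\<bar>F x\<bar> \<le> C / x ^ b * exp (- (x\<^sup>2 / 2))" by simp
    then have "exp (x\<^sup>2 / 2) * \<bar>F x\<bar> \<le> exp (x\<^sup>2 / 2) * (C / x ^ b * exp (- (x\<^sup>2 / 2)))"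
      by (intro mult_left_mono) auto
    also have "\<dots> = C / x ^ b" by (simp add: exp_minus)
    finally show ?thesis using x by (simp add: abs_mult pos_le_divide_eq mult.commute)
  qed
  then show ?thesis by blast
qed

text \<open>\<open>F\<close> is the integral of \<open>w\<close> from -\<infinity>, so its limit at
  the upper end is the total integral, which is 0. Its derivative is read off from an arbitrary
  antiderivative \<open>G\<close>, since \<open>F\<close> and \<open>G\<close> differ by a
  constant.\<close>

lemma antiderivative_tendsto_zero:
  fixes w :: "real \<Rightarrow> real"
  assumes "integrable lborel w" "continuous_on UNIV w" "(LINT x|lborel. w x) = 0"
  obtains F where "\<And>y. (F has_real_derivative w y) (at y)" "(F \<longlongrightarrow> 0) at_top" "(F \<longlongrightarrow> 0) at_bot"
proof -
  define F where "F t = (LINT x|lborel. indicator {..t} x *\<^sub>R w x)" for t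
  obtain G where G: "\<And>y. (G has_vector_derivative w y) (at y)"
    using einterval_antiderivative[of "-\<infinity>" "\<infinity>" w] assms(2)
    by (auto simp: continuous_on_eq_continuous_at)
  have i: "integrable lborel (\<lambda>x. indicator A x *\<^sub>R w x)" if "A \<in> sets lborel" for A
    using integrable_mult_indicator[OF that assms(1)] by simp
  have FG: "F t - F s = G t - G s" if "s \<le> t" for s t
  proof -
    have "F t - F s = (LINT x|lborel. indicator {..t} x *\<^sub>R w x - indicator {..s} x *\<^sub>R w x)"
      unfolding F_def by (rule Bochner_Integration.integral_diff[symmetric]) (rule i, simp)+
    also have "\<dots> = (LINT x|lborel. indicator {s..t} x *\<^sub>R w x)"
    proof (rule integral_cong_AE)
      show "AE x in lborel. indicator {..t} x *\<^sub>R w x - indicator {..s} x *\<^sub>R w x = indicator {s..t} x *\<^sub>R w x"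
        using AE_lborel_singleton[of s] by eventually_elim (use that in \<open>auto split: split_indicator\<close>)
      show "(\<lambda>x. indicator {s..t} x *\<^sub>R w x) \<in> borel_measurable lborel"
        using i[of "{s..t}"] borel_measurable_integrable by auto
      show "(\<lambda>x. indicator {..t} x *\<^sub>R w x - indicator {..s} x *\<^sub>R w x) \<in> borel_measurable lborel"
        using i[of "{..s}"] i[of "{..t}"] borel_measurable_integrable by auto
    qed
    also have "\<dots> = G t - G s"
      using G assms(2) that by (intro integral_FTC_atLeastAtMost)
        (auto intro: continuous_on_subset has_vector_derivative_at_within)
    finally show ?thesis .
  qed
  define c where "c = F 0 - G 0"
  have "F t = G t + c" for t
    unfolding c_def using FG[of 0 t] FG[of t 0] by linarith
  then have Feq: "F = (\<lambda>t. G t + c)" by blast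
  show thesis
  proof
    show "(F has_real_derivative w y) (at y)" for y
      using G[of y] unfolding Feq has_real_derivative_iff_has_vector_derivative
      by (auto intro!: derivative_eq_intros)
    show "(F \<longlongrightarrow> 0) at_top"
      using tendsto_integral_at_top[OF _ assms(1)] assms(3) by (simp add: F_def[abs_def])
    have "((\<lambda>s. LINT x|lborel. indicator {..-s} x *\<^sub>R w x) \<longlongrightarrow> (LINT x|(lborel :: real measure). 0)) at_top"
    proof (rule integral_dominated_convergence_at_top)
      show "integrable lborel (\<lambda>x. \<bar>w x\<bar>)" using assms(1) by simp
      show "AE x in lborel. ((\<lambda>s. indicator {..- s} x *\<^sub>R w x) \<longlongrightarrow> 0) at_top"
      proof (rule AE_I2)
        fix x :: real
        have "eventually (\<lambda>s. indicator {..- s} x *\<^sub>R w x = 0) at_top"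
          using eventually_gt_at_top[of "-x"] by eventually_elim (auto split: split_indicator)
        then show "((\<lambda>s. indicator {..- s} x *\<^sub>R w x) \<longlongrightarrow> 0) at_top" by (rule tendsto_eventually)
      qed
      show "(\<lambda>x. indicator {..- s} x *\<^sub>R w x) \<in> borel_measurable lborel" for s
        using i[of "{..-s}"] borel_measurable_integrable by auto
    qed (auto split: split_indicator)
    then show "(F \<longlongrightarrow> 0) at_bot"
      by (simp add: filterlim_at_bot_mirror F_def[abs_def])
  qed
qed

lemma rapidI:
  assumes "continuous_on UNIV g" "\<And>b. \<exists>C. \<forall>x\<ge>1. x ^ b * \<bar>g x\<bar> \<le> C"
    "\<And>b. \<exists>C. \<forall>x\<ge>1. x ^ b * \<bar>g (- x)\<bar> \<le> C"
  shows "rapid g"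
  unfolding rapid_def
proof
  fix b
  obtain C D where C: "\<forall>x\<ge>1. x ^ b * \<bar>g x\<bar> \<le> C" and D: "\<forall>x\<ge>1. x ^ b * \<bar>g (- x)\<bar> \<le> D"
    using assms(2,3) by meson
  have "compact ((\<lambda>x. \<bar>x\<bar> ^ b * \<bar>g x\<bar>) ` {-1..1})"
    using assms(1) by (intro compact_continuous_image continuous_intros) (auto intro: continuous_on_subset)
  then have "bdd_above ((\<lambda>x. \<bar>x\<bar> ^ b * \<bar>g x\<bar>) ` {-1..1})"
    by (intro bounded_imp_bdd_above compact_imp_bounded)
  then obtain E where E: "\<forall>x\<in>{-1..1}. \<bar>x\<bar> ^ b * \<bar>g x\<bar> \<le> E"
    by (auto simp: bdd_above_def)
  have "\<bar>x\<bar> ^ b * \<bar>g x\<bar> \<le> max E (max C D)" for x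
  proof -
    consider "x \<ge> 1" | "- x \<ge> 1" | "x \<in> {-1..1}" by (cases "x \<ge> 1"; cases "-x \<ge> 1") auto
    then show ?thesis
    proof cases
      case 1
      then show ?thesis using C by (auto simp: max.coboundedI2 max.coboundedI1)
    next
      case 2
      then show ?thesis using D[rule_format, of "-x"] by (auto simp: max.coboundedI2)
    next
      case 3
      then show ?thesis using E by (auto simp: max.coboundedI1)
    qed
  qed
  then show "\<exists>C. \<forall>x. \<bar>x\<bar> ^ b * \<bar>g x\<bar> \<le> C" by blast
qed

lemma rapid_reflect: "rapid v \<Longrightarrow> rapid (\<lambda>x. v (- x))"
  unfolding rapid_def by (metis abs_minus_cancel)

text \<open>The equation x g - g' = v has the integrating factor exp (-x^2/2), which gives g = -exp
  (x^2/2) F with F' = exp (-x^2/2) v. Orthogonality to the Gaussian makes F vanish at both ends, so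
  that the growing factor is compensated on both half-lines. Smoothness follows by bootstrapping g'
  = x g - v.\<close>

lemma raise_surj:
  assumes v: "schwartz1 v" and "ip v (hermite 0) = 0"
  obtains g where "schwartz1 g" "raise g = v"
proof -
  let ?e = "\<lambda>y::real. exp (- (y\<^sup>2 / 2))"
  have s: "schwartz1 (\<lambda>y. ?e y * v y)"
    using schwartz1_mult[OF schwartz1_hermite[of 0] v] by simp
  obtain F where F: "\<And>y. (F has_real_derivative ?e y * v y) (at y)"
    and lim: "(F \<longlongrightarrow> 0) at_top" "(F \<longlongrightarrow> 0) at_bot"
    using antiderivative_tendsto_zero[OF schwartz1_integrable[OF s] schwartz1_cont[OF s]] assms(2)
    by (auto simp: ip_def mult.commute)
  define g where "g x = - (exp (x\<^sup>2 / 2) * F x)" for x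
  have dg: "(g has_real_derivative x * g x - v x) (at x)" for x
    unfolding g_def[abs_def]
    by (rule derivative_eq_intros F refl | simp)+ (simp add: algebra_simps exp_minus)
  have "rapid g"
  proof (rule rapidI)
    show "continuous_on UNIV g" by (rule DERIV_continuous_on[OF has_field_derivative_at_within[OF dg]])
    show "\<exists>C. \<forall>x\<ge>1. x ^ b * \<bar>g x\<bar> \<le> C" for b
      using rapid_antiderivative[OF schwartz1_rapid[OF v] F lim(1)] by (simp add: g_def)
    \<comment> \<open>The negative half-line is reduced to the positive one by reflection: -F(-x) is
      the antiderivative that belongs to v(-x), and the limit of F at -\<infinity> takes over the
      role of the limit at \<infinity>.\<close>
    have F': "((\<lambda>x. - F (- x)) has_real_derivative ?e y * v (- y)) (at y)" for y
      using DERIV_minus[OF DERIV_chain2[OF F[of "-y"] DERIV_minus[OF DERIV_ident]]] by simp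
    have lim': "((\<lambda>x. - F (- x)) \<longlongrightarrow> 0) at_top"
      using lim(2) by (auto simp: filterlim_at_bot_mirror intro!: tendsto_eq_intros)
    show "\<exists>C. \<forall>x\<ge>1. x ^ b * \<bar>g (- x)\<bar> \<le> C" for b
      using rapid_antiderivative[OF rapid_reflect[OF schwartz1_rapid[OF v]] F' lim']
      by (simp add: g_def)
  qed
  have "schwartz1_upto k g" for k
  proof (induction k)
    case 0
    show ?case using \<open>rapid g\<close> DERIV_continuous_on[OF has_field_derivative_at_within[OF dg]] by simp
  next
    case (Suc k)
    have "schwartz1_upto k (\<lambda>x. x * g x + -1 * v x)"
      using Suc v by (intro schwartz1_upto_add schwartz1_upto_mult_id schwartz1_upto_cmult)
        (auto simp: schwartz1_def)
    then show ?case using \<open>rapid g\<close> dg by (auto intro!: exI[of _ "\<lambda>x. x * g x - v x"])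
  qed
  then have "schwartz1 g" by (simp add: schwartz1_def)
  moreover have "raise g = v"
    using DERIV_imp_deriv[OF dg] by (auto simp: raise_def)
  ultimately show thesis using that by blast
qed

lemma ip_cong_fun: "(\<And>x. f x = g x) \<Longrightarrow> ip f h = ip g h"
  by (simp add: ip_def)

lemma ip_raise_raise:
  assumes "schwartz1 g"
  shows "ip (raise g) (raise g) = ip (lower g) (lower g) + 2 * ip g g"
proof -
  have "ip (raise g) (raise g) = ip (lower (raise g)) g"
    using ip_raise[OF assms schwartz1_raise[OF assms]] by (simp add: ip_commute)
  also have "\<dots> = ip (\<lambda>x. raise (lower g) x + 2 * g x) g"
    by (rule ip_cong_fun) (rule lower_raise[OF assms])
  also have "\<dots> = ip (raise (lower g)) g + 2 * ip g g"
    using assms by (simp add: ip_add_left ip_cmult_left schwartz1_raise schwartz1_lower schwartz1_cmult)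
  also have "ip (raise (lower g)) g = ip (lower g) (lower g)"
    using assms by (simp add: ip_raise schwartz1_lower)
  finally show ?thesis .
qed

text \<open>The spectral gap is obtained without completeness of the Hermite functions: a function
  orthogonal to the Gaussian is \<open>raise g\<close>, and \<open>g\<close> is orthogonal to one Hermite function less.\<close>

lemma hermite_spectral_gap:
  assumes "schwartz1 v" "\<And>k. k < n \<Longrightarrow> ip v (hermite k) = 0"
  shows "2 * real n * ip v v \<le> ip (lower v) (lower v)"
  using assms
proof (induction n arbitrary: v)
  case 0
  then show ?case by (simp add: ip_self_nonneg)
next
  case (Suc n)
  obtain g where g: "schwartz1 g" "raise g = v"
    using raise_surj[OF Suc.prems(1)] Suc.prems(2)[of 0] by auto
  have "ip g (hermite k) = 0" if "k < n" for k
    using Suc.prems(2)[of "Suc k"] ip_lower_hermite_Suc[OF g(1), of k] that g(2) by simp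
  then have IH: "2 * real n * ip g g \<le> ip (lower g) (lower g)" using Suc.IH g(1) by blast
  define l where "l = 2 * real (Suc n)"
  have vv: "l * ip g g \<le> ip v v"
    using IH ip_raise_raise[OF g(1)] by (simp add: g(2) l_def algebra_simps)
  have lg: "ip (lower v) g = ip v v"
    using ip_raise[OF g(1) Suc.prems(1)] by (simp add: g(2) ip_commute)
  \<comment> \<open>\<open>?d\<close> vanishes in the extremal case where v is the Hermite function
    of index \<open>Suc n\<close>. Expanding its square with <lower v, g> = <v, v> and l <g, g>
    \<le> <v, v> leaves exactly l <v, v> \<le> <lower v, lower v>.\<close>
  let ?d = "\<lambda>x. lower v x - l * g x"
  note s = schwartz1_lower[OF Suc.prems(1)] schwartz1_cmult[OF g(1), of l]
  have d: "schwartz1 ?d" using s by (intro schwartz1_diff)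
  have "0 \<le> ip ?d ?d" by (rule ip_self_nonneg)
  also have "ip ?d ?d = ip ?d (lower v) - l * ip ?d g"
    by (subst ip_diff_left[OF s d]) (simp add: ip_cmult_left ip_commute)
  also have "\<dots> = ip (lower v) (lower v) - 2 * l * ip v v + l * (l * ip g g)"
  proof -
    have 1: "ip ?d (lower v) = ip (lower v) (lower v) - l * ip v v"
      using ip_diff_left[OF s schwartz1_lower[OF Suc.prems(1)]] lg ip_commute[of g "lower v"]
      by (simp add: ip_cmult_left)
    have 2: "ip ?d g = ip v v - l * ip g g"
      using ip_diff_left[OF s g(1)] lg by (simp add: ip_cmult_left)
    show ?thesis unfolding 1 2 by (simp add: algebra_simps)
  qed
  also have "\<dots> \<le> ip (lower v) (lower v) - 2 * l * ip v v + l * ip v v"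
    using vv by (intro add_left_mono mult_left_mono) (auto simp: l_def)
  finally have "l * ip v v \<le> ip (lower v) (lower v)" by (simp add: algebra_simps)
  then show ?case by (simp only: l_def)
qed

section \<open>Hermite projections on the line and the size of their residuals\<close>

definition hermite_coeff :: "(real \<Rightarrow> real) \<Rightarrow> nat \<Rightarrow> real" where
  "hermite_coeff u k = ip u (hermite k) / hermite_sqnorm k"

definition hermite_proj :: "nat \<Rightarrow> (real \<Rightarrow> real) \<Rightarrow> real \<Rightarrow> real" where
  "hermite_proj n u x = (\<Sum>k<n. hermite_coeff u k * hermite k x)"

lemma schwartz1_hermite_proj: "schwartz1 (hermite_proj n u)"
  unfolding hermite_proj_def[abs_def] by (intro schwartz1_sum schwartz1_cmult schwartz1_hermite)

lemma ip_hermite_proj: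
  assumes "k < n"
  shows "ip (hermite_proj n u) (hermite k) = ip u (hermite k)"
proof -
  have "ip (hermite_proj n u) (hermite k)
    = (\<Sum>j<n. hermite_coeff u j * ip (hermite j) (hermite k))"
    unfolding hermite_proj_def[abs_def]
    by (simp add: ip_sum_left schwartz1_cmult schwartz1_hermite ip_cmult_left)
  also have "\<dots> = (\<Sum>j<n. if j = k then ip u (hermite k) else 0)"
    by (rule sum.cong) (use hermite_sqnorm_pos[of k] in \<open>auto simp: ip_hermite hermite_coeff_def\<close>)
  also have "\<dots> = ip u (hermite k)" using assms by simp
  finally show ?thesis .
qed

lemma deriv_sum_schwartz1:
  assumes "\<And>i. i \<in> I \<Longrightarrow> schwartz1 (f i)"
  shows "deriv (\<lambda>x. \<Sum>i\<in>I. f i x) x = (\<Sum>i\<in>I. deriv (f i) x)"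
  using assms by (intro DERIV_imp_deriv DERIV_sum schwartz1_DERIV)

lemma lower_sum:
  assumes "\<And>i. i \<in> I \<Longrightarrow> schwartz1 (f i)"
  shows "lower (\<lambda>x. \<Sum>i\<in>I. f i x) = (\<lambda>x. \<Sum>i\<in>I. lower (f i) x)"
  by (simp add: lower_def fun_eq_iff deriv_sum_schwartz1 assms sum.distrib sum_distrib_left)

lemma lower_cmult: "schwartz1 u \<Longrightarrow> lower (\<lambda>x. c * u x) = (\<lambda>x. c * lower u x)"
  using DERIV_imp_deriv[OF DERIV_cmult[OF schwartz1_DERIV]]
  by (simp add: lower_def fun_eq_iff algebra_simps)

lemma lower_diff: "schwartz1 u \<Longrightarrow> schwartz1 v \<Longrightarrow> lower (\<lambda>x. u x - v x) = (\<lambda>x. lower u x - lower v x)"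
  using DERIV_imp_deriv[OF DERIV_diff[OF schwartz1_DERIV schwartz1_DERIV]]
  by (simp add: lower_def fun_eq_iff algebra_simps)

text \<open>The term k = 0 is annihilated and the others move down one index; the factor 2 (k + 1)
  of \<open>lower_hermite_Suc\<close> cancels against that of
  \<open>hermite_sqnorm_Suc\<close>.\<close>

lemma lower_hermite_proj_Suc:
  assumes "schwartz1 u"
  shows "lower (hermite_proj (Suc n) u) = hermite_proj n (lower u)"
proof
  fix x
  have "lower (hermite_proj (Suc n) u) x
      = (\<Sum>k<Suc n. hermite_coeff u k * lower (hermite k) x)"
    unfolding hermite_proj_def[abs_def]
    by (simp add: lower_sum lower_cmult schwartz1_cmult schwartz1_hermite del: sum.lessThan_Suc)
  also have "\<dots> = (\<Sum>k<n. hermite_coeff u (Suc k) * lower (hermite (Suc k)) x)"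
    by (subst sum.lessThan_Suc_shift) (simp add: lower_hermite_0 del: hermite.simps)
  also have "\<dots> = hermite_proj n (lower u) x"
    unfolding hermite_proj_def
  proof (rule sum.cong)
    fix k
    have "hermite_sqnorm k \<noteq> 0" using hermite_sqnorm_pos[of k] by simp
    then show "hermite_coeff u (Suc k) * lower (hermite (Suc k)) x
        = hermite_coeff (lower u) k * hermite k x"
      unfolding hermite_coeff_def lower_hermite_Suc hermite_sqnorm_Suc ip_hermite_Suc[OF assms]
      by (simp del: of_nat_Suc)
  qed simp
  finally show "lower (hermite_proj (Suc n) u) x = hermite_proj n (lower u) x" .
qed

text \<open>Pythagoras: the projection is orthogonal to the residual.\<close>

lemma ip_residual_le:
  assumes u: "schwartz1 u"
  shows "ip (\<lambda>x. u x - hermite_proj n u x) (\<lambda>x. u x - hermite_proj n u x) \<le> ip u u"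
proof -
  let ?p = "hermite_proj n u" and ?d = "\<lambda>x. u x - hermite_proj n u x"
  note p = schwartz1_hermite_proj[of n u]
  have d: "schwartz1 ?d" by (intro schwartz1_diff u p)
  have "ip ?p ?d = (\<Sum>k<n. hermite_coeff u k * ip (hermite k) ?d)"
    by (subst hermite_proj_def[abs_def])
      (simp add: ip_sum_left schwartz1_cmult schwartz1_hermite ip_cmult_left d)
  also have "\<dots> = 0"
    by (intro sum.neutral)
      (auto simp: ip_commute[of "hermite _"] ip_diff_left u p schwartz1_hermite ip_hermite_proj)
  finally have 0: "ip ?p ?d = 0" .
  have "ip u u = ip (\<lambda>x. ?d x + ?p x) (\<lambda>x. ?d x + ?p x)" by simp
  also have "\<dots> = ip (\<lambda>x. ?d x + ?p x) ?d + ip (\<lambda>x. ?d x + ?p x) ?p"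
    by (subst ip_commute, subst ip_add_left) (auto intro: d p u simp: ip_commute)
  also have "\<dots> = ip ?d ?d + ip ?p ?p"
    using 0 by (simp only: ip_add_left d p) (simp add: ip_commute[of ?d ?p])
  finally show ?thesis using ip_self_nonneg[of ?p] by simp
qed

text \<open>The one-dimensional Sobolev inequality with a free parameter: integrate (v^2)' = 2 v v'
  from -\<infinity> to t and use 2 |v v'| \<le> e v^2 + v'^2 / e. The parameter is later tuned to
  n.\<close>

lemma sup_le_ip:
  assumes v: "schwartz1 v" and e: "e > 0"
  shows "(v t)\<^sup>2 \<le> e * ip v v + ip (deriv v) (deriv v) / e"
proof -
  let ?w = "\<lambda>x. v x * deriv v x + deriv v x * v x"
  note dv = schwartz1_deriv_closed[OF v]
  note vv = schwartz1_mult[OF v v] and dd = schwartz1_mult[OF dv dv]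
  have w: "schwartz1 ?w" by (intro schwartz1_add schwartz1_mult v dv)
  have D: "((\<lambda>x. v x * v x) has_real_derivative ?w x) (at x)" for x
    by (rule DERIV_mult'[OF schwartz1_DERIV[OF v] schwartz1_DERIV[OF v]])
  have lim: "((\<lambda>x. v x * v x) \<longlongrightarrow> 0) at_bot"
    using schwartz1_quadratic_decay[OF vv] tendsto_zero_quadratic_decay(2)[of "\<lambda>x. v x * v x"] by auto
  let ?I = "e * ip v v + ip (deriv v) (deriv v) / e"
  have I: "?I = (LINT x|lborel. e * (v x * v x) + deriv v x * deriv v x / e)"
    by (simp add: ip_def schwartz1_integrable vv dd)
  have pw: "\<bar>?w x\<bar> \<le> e * (v x * v x) + deriv v x * deriv v x / e" for x
  proof -
    have "(e * v x - deriv v x)\<^sup>2 / e = e * (v x * v x) + deriv v x * deriv v x / e - ?w x"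
      "(e * v x + deriv v x)\<^sup>2 / e = e * (v x * v x) + deriv v x * deriv v x / e + ?w x"
      using e by (simp_all add: power2_eq_square field_simps)
    moreover have "0 \<le> (e * v x - deriv v x)\<^sup>2 / e" "0 \<le> (e * v x + deriv v x)\<^sup>2 / e"
      using e by simp_all
    ultimately show ?thesis by linarith
  qed
  have "v t * v t - v s * v s \<le> ?I" if "s \<le> t" for s
  proof -
    have "v t * v t - v s * v s = (LINT x|lborel. indicator {s..t} x *\<^sub>R ?w x)"
      using D schwartz1_cont[OF w] that
      by (intro integral_FTC_atLeastAtMost[symmetric, where F="\<lambda>x. v x * v x"])
        (auto simp: has_real_derivative_iff_has_vector_derivative
          intro: continuous_on_subset has_vector_derivative_at_within)
    also have "\<dots> \<le> ?I"
      unfolding I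
    proof (rule integral_mono)
      show "integrable lborel (\<lambda>x. indicator {s..t} x *\<^sub>R ?w x)"
        by (intro integrable_mult_indicator schwartz1_integrable w) auto
      show "integrable lborel (\<lambda>x. e * (v x * v x) + deriv v x * deriv v x / e)"
        by (simp add: schwartz1_integrable vv dd)
      fix x
      have "0 \<le> e * (v x * v x) + deriv v x * deriv v x / e" using e by simp
      then show "indicator {s..t} x *\<^sub>R ?w x \<le> e * (v x * v x) + deriv v x * deriv v x / e"
        using pw[of x] by (auto split: split_indicator)
    qed
    finally show ?thesis .
  qed
  then have "\<forall>\<^sub>F s in at_bot. v t * v t - v s * v s \<le> ?I"
    unfolding eventually_at_bot_linorder by blast
  moreover have "((\<lambda>s. v t * v t - v s * v s) \<longlongrightarrow> v t * v t - 0) at_bot"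
    by (intro tendsto_diff tendsto_const lim)
  ultimately have "v t * v t - 0 \<le> ?I" by (intro tendsto_upperbound) auto
  then show ?thesis by (simp add: power2_eq_square)
qed

text \<open>The average of (x v + v')^2 and (x v - v')^2 is x^2 v^2 + v'^2, and by
  \<open>ip_raise_raise\<close> the integrals of the two squares differ by 2 <v, v>.\<close>

lemma deriv_sq_le:
  assumes v: "schwartz1 v"
  shows "ip (deriv v) (deriv v) \<le> ip (lower v) (lower v) + ip v v"
proof -
  note s = schwartz1_raise[OF v] schwartz1_lower[OF v] schwartz1_deriv_closed[OF v]
  have "ip (deriv v) (deriv v) \<le> (ip (lower v) (lower v) + ip (raise v) (raise v)) / 2"
  proof -
    have "ip (deriv v) (deriv v) \<le>
        (LINT x|lborel. (lower v x * lower v x + raise v x * raise v x) / 2)"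
      unfolding ip_def
    proof (rule integral_mono)
      fix x
      have "(lower v x * lower v x + raise v x * raise v x) / 2 - deriv v x * deriv v x
        = (x * v x)\<^sup>2"
        by (simp add: lower_def raise_def power2_eq_square field_simps)
      then show "deriv v x * deriv v x \<le> (lower v x * lower v x + raise v x * raise v x) / 2"
        by (metis diff_ge_0_iff_ge zero_le_power2)
    next
      show "integrable lborel (\<lambda>x. deriv v x * deriv v x)"
        by (intro schwartz1_integrable schwartz1_mult s)
      have "schwartz1 (\<lambda>x. lower v x * lower v x + raise v x * raise v x)"
        by (intro schwartz1_add schwartz1_mult s)
      then show "integrable lborel (\<lambda>x. (lower v x * lower v x + raise v x * raise v x) / 2)"
        using schwartz1_integrable by simp
    qed
    then show ?thesis by (simp add: ip_def schwartz1_integrable schwartz1_mult s)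
  qed
  then show ?thesis using ip_raise_raise[OF v] by simp
qed

text \<open>For the residual v, \<open>lower v\<close> is a residual of \<open>lower u\<close>, so X
  is at most the squared norm of \<open>lower u\<close>, which is at most B^2 pi < 4 B^2 unless B =
  0. The gap gives <v, v> \<le> X / (2 n), whereas v' is only of size X; interpolating between the
  two by \<open>sup_le_ip\<close> makes v^2 of order n^(-1/2), whence the exponent 1/4.\<close>

lemma hermite_proj_residual_bound:
  assumes u: "schwartz1 u" and n: "n \<ge> 1" and B: "\<And>x. (1 + x\<^sup>2) * \<bar>lower u x\<bar> \<le> B"
  shows "\<bar>u t - hermite_proj n u t\<bar> \<le> 3 * B / real n powr (1/4)"
proof -
  define v where "v = (\<lambda>x. u x - hermite_proj n u x)"
  define X where "X = ip (lower v) (lower v)"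
  have v: "schwartz1 v" unfolding v_def by (intro schwartz1_diff u schwartz1_hermite_proj)
  have B0: "0 \<le> B" using B[of 0] by simp
  have "2 * real n * ip v v \<le> X"
    unfolding X_def using v
  proof (rule hermite_spectral_gap)
    show "ip v (hermite k) = 0" if "k < n" for k
      unfolding v_def using that
      by (simp add: ip_diff_left u schwartz1_hermite_proj schwartz1_hermite ip_hermite_proj)
  qed
  obtain m where m: "n = Suc m" using n by (cases n) auto
  have "lower v = (\<lambda>x. lower u x - hermite_proj m (lower u) x)"
    unfolding v_def m by (simp add: lower_diff u schwartz1_hermite_proj lower_hermite_proj_Suc)
  then have "X \<le> ip (lower u) (lower u)"
    unfolding X_def using ip_residual_le[OF schwartz1_lower[OF u], of m] by simp
  also have "\<dots> \<le> (LINT x|lborel. B\<^sup>2 * inverse (1 + x\<^sup>2))"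
    unfolding ip_def
  proof (rule integral_mono)
    show "integrable lborel (\<lambda>x. lower u x * lower u x)"
      by (intro schwartz1_integrable schwartz1_mult schwartz1_lower u)
    show "integrable lborel (\<lambda>x. B\<^sup>2 * inverse (1 + x\<^sup>2))"
      using integrable_inverse_one_plus_square by simp
    fix x :: real
    define d where "d = 1 + x\<^sup>2"
    have d: "d \<ge> 1" by (simp add: d_def)
    have "\<bar>lower u x\<bar> \<le> B / d" using B[of x] d by (simp add: d_def[symmetric] pos_le_divide_eq mult.commute)
    then have "(\<bar>lower u x\<bar>)\<^sup>2 \<le> (B / d)\<^sup>2" by (intro power_mono) auto
    also have "\<dots> \<le> B\<^sup>2 / d"
    proof -
      have "d * 1 \<le> d * d" using d by (intro mult_left_mono) auto
      then show ?thesis using d by (simp add: power_divide frac_le power2_eq_square)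
    qed
    finally show "lower u x * lower u x \<le> B\<^sup>2 * inverse (1 + x\<^sup>2)"
      by (simp add: d_def power2_eq_square divide_inverse)
  qed
  also have "\<dots> = B\<^sup>2 * pi"
    using LBINT_inverse_1_plus_square by (simp add: interval_lebesgue_integral_def set_lebesgue_integral_def)
  also have "\<dots> \<le> B\<^sup>2 * 4" using pi_less_4 by (intro mult_left_mono) auto
  finally have X: "X \<le> 4 * B\<^sup>2" by simp
  have X0: "0 \<le> X" unfolding X_def by (rule ip_self_nonneg)
  \<comment> \<open>With e = sqrt n both terms of \<open>sup_le_ip\<close> are of order X / e. They
    add up to 2 X / e \<le> 8 B^2 / e, which is rounded up to a perfect square with 9.\<close>
  define e where "e = sqrt (real n)"
  have e: "e \<ge> 1" "e * e = real n" using n by (auto simp: e_def)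
  have vv: "ip v v \<le> X / (2 * (e * e))"
    using \<open>2 * real n * ip v v \<le> X\<close> n e(2) by (simp add: field_simps)
  have "X / (2 * (e * e)) \<le> X / 2"
    using X0 e mult_mono[of 1 e 1 e] by (intro divide_left_mono) auto
  with vv have "ip v v \<le> X / 2" by linarith
  then have dv: "ip (deriv v) (deriv v) \<le> 3 / 2 * X" using deriv_sq_le[OF v] by (simp add: X_def)
  have "(v t)\<^sup>2 \<le> e * ip v v + ip (deriv v) (deriv v) / e" using e by (intro sup_le_ip v) auto
  also have "\<dots> \<le> e * (X / (2 * (e * e))) + (3 / 2 * X) / e"
    using vv dv e by (intro add_mono mult_left_mono divide_right_mono) auto
  also have "\<dots> = 2 * X / e" using e(1) by (simp add: field_simps)
  also have "\<dots> \<le> 9 * B\<^sup>2 / e" using X e zero_le_power2[of B] by (intro divide_right_mono) linarith+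
  also have "\<dots> = (3 * B / real n powr (1/4))\<^sup>2"
  proof -
    have "(real n powr (1/4))\<^sup>2 = e"
      using n by (simp add: e_def powr_half_sqrt[symmetric] power2_eq_square powr_add[symmetric])
    then show ?thesis by (simp add: power_divide power_mult_distrib)
  qed
  finally show ?thesis using B0 by (intro power2_le_imp_le[of "\<bar>_\<bar>"]) (auto simp: v_def)
qed

section \<open>Calculus of smooth functions\<close>

lemma Ck_cont: "Ck k f \<Longrightarrow> continuous_on UNIV f"
  by (cases k) (auto simp: differentiable_imp_continuous_within continuous_on_eq_continuous_within)

lemma Ck_SucD: "Ck (Suc k) f \<Longrightarrow> Ck k f"
proof (induction k arbitrary: f)
  case 0
  then show ?case using Ck_cont[OF 0] by simp
qed force

lemma smooth_differentiable: "smooth f \<Longrightarrow> f differentiable (at x)"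
  unfolding smooth_def by (metis Ck.simps(2))

lemma smooth_partial: "smooth f \<Longrightarrow> smooth (partial i f)"
  unfolding smooth_def by (metis Ck.simps(2))

lemma smooth_cont: "smooth f \<Longrightarrow> continuous_on UNIV f"
  unfolding smooth_def using Ck_cont by blast

lemma partial_eq: "(f has_derivative D) (at x) \<Longrightarrow> partial i f x = D (axis i 1)"
  unfolding partial_def by (metis frechet_derivative_at)

lemma partial_add:
  assumes "f differentiable (at x)" "g differentiable (at x)"
  shows "partial i (\<lambda>x. f x + g x) x = partial i f x + partial i g x"
  using has_derivative_add[OF assms[unfolded frechet_derivative_works]]
  by (auto dest!: partial_eq simp: partial_def)

lemma partial_mult:
  assumes "f differentiable (at x)" "g differentiable (at x)"
  shows "partial i (\<lambda>x. f x * g x) x = f x * partial i g x + partial i f x * g x"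
  using has_derivative_mult[OF assms[unfolded frechet_derivative_works]]
  by (auto dest!: partial_eq simp: partial_def)

lemma partial_const: "partial i (\<lambda>x. c) = (\<lambda>x. 0)"
  by (auto intro!: partial_eq[where D="\<lambda>_. 0"])

lemma partial_coord: "partial i (\<lambda>x::real^'n. complex_of_real (x $ j)) = (\<lambda>x. if i = j then 1 else 0)"
proof
  fix x :: "real^'n"
  have "((\<lambda>x. complex_of_real (x $ j)) has_derivative (\<lambda>x. complex_of_real (x $ j))) (at x)"
    by (intro has_derivative_of_real bounded_linear_imp_has_derivative bounded_linear_vec_nth)
  then show "partial i (\<lambda>x::real^'n. complex_of_real (x $ j)) x = (if i = j then 1 else 0)"
    by (auto dest!: partial_eq[of _ _ _ i] simp: axis_def)
qed

lemma differentiable_coord: "(\<lambda>x. complex_of_real (x $ j)) differentiable (at x)"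
  by (rule differentiableI, rule has_derivative_of_real, rule bounded_linear_imp_has_derivative,
      rule bounded_linear_vec_nth)

lemma Ck_const: "Ck k (\<lambda>x. c)"
  by (induction k arbitrary: c) (auto simp: partial_const)

lemma Ck_coord: "Ck k (\<lambda>x. complex_of_real (x $ j))"
proof (cases k)
  case 0
  then show ?thesis by (auto intro!: continuous_intros)
next
  case (Suc l)
  then show ?thesis by (simp add: differentiable_coord partial_coord Ck_const)
qed

lemma Ck_add: "Ck k f \<Longrightarrow> Ck k g \<Longrightarrow> Ck k (\<lambda>x. f x + g x)"
proof (induction k arbitrary: f g)
  case (Suc k)
  have "partial i (\<lambda>x. f x + g x) = (\<lambda>x. partial i f x + partial i g x)" for i
    using Suc.prems by (auto intro!: partial_add)
  then show ?case using Suc by auto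
qed (auto intro: continuous_intros)

lemma Ck_mult: "Ck k f \<Longrightarrow> Ck k g \<Longrightarrow> Ck k (\<lambda>x. f x * g x)"
proof (induction k arbitrary: f g)
  case (Suc k)
  have "partial i (\<lambda>x. f x * g x) = (\<lambda>x. f x * partial i g x + partial i f x * g x)" for i
    using Suc.prems by (auto intro!: partial_mult)
  moreover have "Ck k (\<lambda>x. f x * partial i g x + partial i f x * g x)" for i
    using Suc.prems Suc.prems[THEN Ck_SucD] by (intro Ck_add Suc.IH) auto
  ultimately show ?case using Suc.prems by auto
qed (auto intro: continuous_intros)

lemma smooth_const: "smooth (\<lambda>x. c)"
  and smooth_coord: "smooth (\<lambda>x. complex_of_real (x $ j))"
  and smooth_add: "smooth f \<Longrightarrow> smooth g \<Longrightarrow> smooth (\<lambda>x. f x + g x)"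
  and smooth_mult: "smooth f \<Longrightarrow> smooth g \<Longrightarrow> smooth (\<lambda>x. f x * g x)"
  unfolding smooth_def using Ck_const Ck_coord Ck_add Ck_mult by blast+

lemma smooth_cmult: "smooth f \<Longrightarrow> smooth (\<lambda>x. c * f x)"
  by (intro smooth_mult smooth_const)

lemma smooth_diff: "smooth f \<Longrightarrow> smooth g \<Longrightarrow> smooth (\<lambda>x. f x - g x)"
  using smooth_add[OF _ smooth_cmult[of g "-1"], of f] by simp

lemma smooth_sum: "(\<And>i. i \<in> I \<Longrightarrow> smooth (f i)) \<Longrightarrow> smooth (\<lambda>x. \<Sum>i\<in>I. f i x)"
  by (induction I rule: infinite_finite_induct) (auto intro: smooth_const smooth_add)

lemma smooth_partial_add:
  "smooth f \<Longrightarrow> smooth g \<Longrightarrow> partial i (\<lambda>x. f x + g x) = (\<lambda>x. partial i f x + partial i g x)"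
  by (auto intro!: partial_add smooth_differentiable)

lemma smooth_partial_mult:
  "smooth f \<Longrightarrow> smooth g \<Longrightarrow> partial i (\<lambda>x. f x * g x) = (\<lambda>x. f x * partial i g x + partial i f x * g x)"
  by (auto intro!: partial_mult smooth_differentiable)

lemma smooth_partial_cmult: "smooth f \<Longrightarrow> partial i (\<lambda>x. c * f x) = (\<lambda>x. c * partial i f x)"
  by (simp add: smooth_partial_mult smooth_const partial_const)

section \<open>Symmetry of mixed derivatives and second-order Taylor estimates\<close>

lemma scaleR_complex: "r *\<^sub>R z = complex_of_real r * z"
  by (rule scaleR_conv_of_real)

lemma smooth_has_derivative:
  assumes "smooth f"
  shows "(f has_derivative (\<lambda>v. \<Sum>j\<in>UNIV. of_real (v $ j) * partial j f x)) (at x)"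
proof -
  let ?D = "frechet_derivative f (at x)"
  have D: "(f has_derivative ?D) (at x)"
    using smooth_differentiable[OF assms] frechet_derivative_works by blast
  then have lin: "linear ?D" by (rule has_derivative_linear)
  have "?D v = (\<Sum>j\<in>UNIV. of_real (v $ j) * partial j f x)" for v
  proof -
    have "?D v = ?D (\<Sum>j\<in>UNIV. (v $ j) *\<^sub>R axis j 1)"
      using basis_expansion[of v] by (simp add: scalar_mult_eq_scaleR)
    also have "\<dots> = (\<Sum>j\<in>UNIV. of_real (v $ j) * partial j f x)"
      by (simp add: linear_sum[OF lin] linear_scale[OF lin] partial_def scaleR_complex)
    finally show ?thesis .
  qed
  then have "?D = (\<lambda>v. \<Sum>j\<in>UNIV. of_real (v $ j) * partial j f x)" by blast
  with D show ?thesis by simp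
qed

lemma smooth_line_derivative:
  assumes "smooth f"
  shows "((\<lambda>t. f (x + t *\<^sub>R v)) has_vector_derivative
    (\<Sum>j\<in>UNIV. of_real (v $ j) * partial j f (x + t *\<^sub>R v))) (at t)"
proof -
  have "((\<lambda>t. x + t *\<^sub>R v) has_derivative (\<lambda>h. h *\<^sub>R v)) (at t)"
    by (auto intro!: derivative_eq_intros)
  from has_derivative_compose[OF this smooth_has_derivative[OF assms]]
  show ?thesis
    unfolding has_vector_derivative_def
    by (simp add: o_def sum_distrib_left scaleR_complex mult.assoc)
qed

lemma smooth_axis_derivative:
  fixes f :: "real^'n::finite \<Rightarrow> complex"
  assumes "smooth f"
  shows "((\<lambda>t. f (x + t *\<^sub>R axis i 1)) has_vector_derivative partial i f (x + t *\<^sub>R axis i 1)) (at t)"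
proof -
  have "(\<Sum>j\<in>UNIV. of_real ((axis i 1 :: real^'n) $ j) * partial j f (x + t *\<^sub>R axis i 1))
    = (\<Sum>j\<in>UNIV. if j = i then partial i f (x + t *\<^sub>R axis i 1) else 0)"
    by (rule sum.cong) (auto simp: axis_def)
  then show ?thesis
    using smooth_line_derivative[OF assms, of x "axis i 1" t] by simp
qed

lemma smooth_Re_axis_derivative:
  assumes "smooth f"
  shows "((\<lambda>t. Re (f (x + t *\<^sub>R axis i 1))) has_real_derivative Re (partial i f (x + t *\<^sub>R axis i 1))) (at t)"
  unfolding has_real_derivative_iff_has_vector_derivative
  by (rule bounded_linear.has_vector_derivative[OF bounded_linear_Re smooth_axis_derivative[OF assms]])

text \<open>The mean value theorem is used twice: for the difference in direction j as a function of
  the step in direction i, then for the resulting difference of \<open>partial i f\<close>. Real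
  parts are taken because the theorem fails for complex values.\<close>

lemma Re_second_difference:
  assumes f: "smooth f" and t: "t > 0"
  shows "\<exists>\<xi> \<eta>. 0 < \<xi> \<and> \<xi> < t \<and> 0 < \<eta> \<and> \<eta> < t \<and>
    Re (f (x + t *\<^sub>R axis i 1 + t *\<^sub>R axis j 1) - f (x + t *\<^sub>R axis j 1) - f (x + t *\<^sub>R axis i 1) + f x)
     = t * (t * Re (partial j (partial i f) (x + \<xi> *\<^sub>R axis i 1 + \<eta> *\<^sub>R axis j 1)))"
proof -
  note Re_d = smooth_Re_axis_derivative
  define g where "g s = Re (f (x + t *\<^sub>R axis j 1 + s *\<^sub>R axis i 1)) - Re (f (x + s *\<^sub>R axis i 1))" for s
  define g' where "g' s = Re (partial i f (x + t *\<^sub>R axis j 1 + s *\<^sub>R axis i 1)) - Re (partial i f (x + s *\<^sub>R axis i 1))" for s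
  have "(g has_real_derivative g' s) (at s)" for s
    unfolding g_def[abs_def] g'_def by (intro DERIV_diff Re_d f)
  then obtain \<xi> where xi: "0 < \<xi>" "\<xi> < t" "g t - g 0 = (t - 0) * g' \<xi>"
    using MVT2[OF t, of g g'] by blast
  let ?y = "x + \<xi> *\<^sub>R axis i 1"
  have "((\<lambda>s. Re (partial i f (?y + s *\<^sub>R axis j 1))) has_real_derivative
      Re (partial j (partial i f) (?y + s *\<^sub>R axis j 1))) (at s)" for s
    by (intro Re_d smooth_partial f)
  then obtain \<eta> where eta: "0 < \<eta>" "\<eta> < t"
    "Re (partial i f (?y + t *\<^sub>R axis j 1)) - Re (partial i f (?y + 0 *\<^sub>R axis j 1))
      = (t - 0) * Re (partial j (partial i f) (?y + \<eta> *\<^sub>R axis j 1))"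
    using MVT2[OF t, of "\<lambda>s. Re (partial i f (?y + s *\<^sub>R axis j 1))"
        "\<lambda>s. Re (partial j (partial i f) (?y + s *\<^sub>R axis j 1))"] by blast
  have "g' \<xi> = t * Re (partial j (partial i f) (?y + \<eta> *\<^sub>R axis j 1))"
    using eta(3) by (simp add: g'_def add.assoc add.commute[of "t *\<^sub>R _"])
  then have "g t - g 0 = t * (t * Re (partial j (partial i f) (?y + \<eta> *\<^sub>R axis j 1)))"
    using xi(3) by simp
  moreover have "g t - g 0 = Re (f (x + t *\<^sub>R axis i 1 + t *\<^sub>R axis j 1) - f (x + t *\<^sub>R axis j 1)
      - f (x + t *\<^sub>R axis i 1) + f x)"
    by (simp add: g_def add.assoc add.commute[of "t *\<^sub>R axis j 1"])
  ultimately show ?thesis using xi eta by metis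
qed

text \<open>The second difference is symmetric in i and j, so the two mixed derivatives have equal
  real parts at a pair of points within any prescribed distance of x. Continuity carries this to
  x.\<close>

lemma Re_partial_commute:
  assumes f: "smooth f"
  shows "Re (partial i (partial j f) x) = Re (partial j (partial i f) x)"
proof (rule ccontr)
  assume "\<not> ?thesis"
  then have e: "0 < \<bar>Re (partial i (partial j f) x) - Re (partial j (partial i f) x)\<bar> / 2" (is "0 < ?e")
    by simp
  have "continuous (at x) (partial k (partial l f))" for k l
    using smooth_cont[OF smooth_partial[OF smooth_partial[OF f]]]
    by (simp add: continuous_on_eq_continuous_within)
  then have "\<exists>d>0. \<forall>y. dist y x < d \<longrightarrow> dist (partial k (partial l f) y) (partial k (partial l f) x) < ?e" for k l
    using e unfolding continuous_at_eps_delta by blast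
  then obtain d1 d2 where d: "d1 > 0" "d2 > 0"
    and d1: "\<And>y. dist y x < d1 \<Longrightarrow> dist (partial i (partial j f) y) (partial i (partial j f) x) < ?e"
    and d2: "\<And>y. dist y x < d2 \<Longrightarrow> dist (partial j (partial i f) y) (partial j (partial i f) x) < ?e"
    by meson
  define t where "t = min d1 d2 / 2"
  have t: "t > 0" using d by (simp add: t_def)
  have near: "dist (x + a *\<^sub>R axis k 1 + b *\<^sub>R axis l 1) x < min d1 d2"
    if "0 < a" "a < t" "0 < b" "b < t" for a b k l
  proof -
    have "dist (x + a *\<^sub>R axis k 1 + b *\<^sub>R axis l 1) x = norm (a *\<^sub>R axis k 1 + b *\<^sub>R axis l (1::real))"
      by (simp add: dist_norm add.assoc)
    also have "\<dots> \<le> norm (a *\<^sub>R axis k (1::real)) + norm (b *\<^sub>R axis l (1::real))" by (rule norm_triangle_ineq)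
    also have "\<dots> = a + b" using that by (simp add: norm_axis_1)
    also have "\<dots> < min d1 d2" using that by (simp add: t_def)
    finally show ?thesis .
  qed
  obtain a b where ab: "0 < a" "a < t" "0 < b" "b < t"
    "Re (f (x + t *\<^sub>R axis i 1 + t *\<^sub>R axis j 1) - f (x + t *\<^sub>R axis j 1) - f (x + t *\<^sub>R axis i 1) + f x)
     = t * (t * Re (partial j (partial i f) (x + a *\<^sub>R axis i 1 + b *\<^sub>R axis j 1)))"
    using Re_second_difference[OF f t, of x i j] by blast
  obtain a' b' where ab': "0 < a'" "a' < t" "0 < b'" "b' < t"
    "Re (f (x + t *\<^sub>R axis j 1 + t *\<^sub>R axis i 1) - f (x + t *\<^sub>R axis i 1) - f (x + t *\<^sub>R axis j 1) + f x)
     = t * (t * Re (partial i (partial j f) (x + a' *\<^sub>R axis j 1 + b' *\<^sub>R axis i 1)))"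
    using Re_second_difference[OF f t, of x j i] by blast
  have "Re (f (x + t *\<^sub>R axis i 1 + t *\<^sub>R axis j 1) - f (x + t *\<^sub>R axis j 1) - f (x + t *\<^sub>R axis i 1) + f x)
      = Re (f (x + t *\<^sub>R axis j 1 + t *\<^sub>R axis i 1) - f (x + t *\<^sub>R axis i 1) - f (x + t *\<^sub>R axis j 1) + f x)"
    by (simp add: add.assoc add.commute[of "t *\<^sub>R axis i 1"])
  then have "t * (t * Re (partial j (partial i f) (x + a *\<^sub>R axis i 1 + b *\<^sub>R axis j 1)))
     = t * (t * Re (partial i (partial j f) (x + a' *\<^sub>R axis j 1 + b' *\<^sub>R axis i 1)))"
    unfolding ab(5)[symmetric] ab'(5)[symmetric] .
  then have eq: "Re (partial j (partial i f) (x + a *\<^sub>R axis i 1 + b *\<^sub>R axis j 1))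
     = Re (partial i (partial j f) (x + a' *\<^sub>R axis j 1 + b' *\<^sub>R axis i 1))"
    using t by simp
  have "\<bar>Re (partial j (partial i f) (x + a *\<^sub>R axis i 1 + b *\<^sub>R axis j 1)) - Re (partial j (partial i f) x)\<bar> < ?e"
    using d2[of "x + a *\<^sub>R axis i 1 + b *\<^sub>R axis j 1"] near[OF ab(1-4), of i j]
      abs_Re_le_cmod[of "partial j (partial i f) (x + a *\<^sub>R axis i 1 + b *\<^sub>R axis j 1) - partial j (partial i f) x"]
    by (simp add: dist_norm)
  moreover have "\<bar>Re (partial i (partial j f) (x + a' *\<^sub>R axis j 1 + b' *\<^sub>R axis i 1)) - Re (partial i (partial j f) x)\<bar> < ?e"
    using d1[of "x + a' *\<^sub>R axis j 1 + b' *\<^sub>R axis i 1"] near[OF ab'(1-4), of j i]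
      abs_Re_le_cmod[of "partial i (partial j f) (x + a' *\<^sub>R axis j 1 + b' *\<^sub>R axis i 1) - partial i (partial j f) x"]
    by (simp add: dist_norm)
  moreover have "False" if "\<bar>u - p\<bar> < \<bar>q - p\<bar> / 2" "\<bar>u - q\<bar> < \<bar>q - p\<bar> / 2" for u p q :: real
    using that by (auto simp: abs_if split: if_splits)
  ultimately show False using eq by metis
qed

lemma partial_commute:
  assumes f: "smooth f"
  shows "partial i (partial j f) = partial j (partial i f)"
proof
  fix x
  have "Re (partial i (partial j (\<lambda>x. \<i> * f x)) x) = Re (partial j (partial i (\<lambda>x. \<i> * f x)) x)"
    by (intro Re_partial_commute smooth_cmult f)
  then have "Im (partial i (partial j f) x) = Im (partial j (partial i f) x)"
    by (simp add: smooth_partial_cmult smooth_partial f)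
  then show "partial i (partial j f) x = partial j (partial i f) x"
    using Re_partial_commute[OF f] by (simp add: complex_eq_iff)
qed

lemma first_order_bound:
  assumes g: "smooth g" and B: "\<And>i y. cmod (partial i g y) \<le> B"
  shows "cmod (g (x + v) - g x) \<le> B * (\<Sum>j\<in>UNIV. \<bar>v $ j\<bar>)"
proof -
  let ?h' = "\<lambda>t. \<Sum>j\<in>UNIV. of_real (v $ j) * partial j g (x + t *\<^sub>R v)"
  have d: "((\<lambda>t. g (x + t *\<^sub>R v)) has_vector_derivative ?h' t) (at t)" for t
    by (rule smooth_line_derivative[OF g])
  have "\<exists>t\<in>{0<..<1::real}. norm (g (x + 1 *\<^sub>R v) - g (x + 0 *\<^sub>R v)) \<le> norm ((1 - 0) *\<^sub>R ?h' t)"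
  proof (rule mvt_general)
    show "continuous_on {0..1} (\<lambda>t. g (x + t *\<^sub>R v))"
      using d by (meson continuous_at_imp_continuous_on has_vector_derivative_continuous)
  qed (use d in \<open>auto simp: has_vector_derivative_def\<close>)
  then obtain t where "cmod (g (x + v) - g x) \<le> cmod (?h' t)" by auto
  also have "\<dots> \<le> (\<Sum>j\<in>UNIV. \<bar>v $ j\<bar> * B)"
    by (intro sum_norm_le) (auto simp: norm_mult intro!: mult_left_mono B)
  finally show ?thesis by (simp add: sum_distrib_left mult.commute)
qed

text \<open>The mean value inequality for f(x + t v) minus t times its linear part: the derivative
  in t is a combination of differences of first partials, to which \<open>first_order_bound\<close>
  applies.\<close>

lemma second_order_bound:
  assumes f: "smooth f" and B: "\<And>i j y. cmod (partial i (partial j f) y) \<le> B"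
  shows "cmod (f (x + v) - f x - (\<Sum>j\<in>UNIV. of_real (v $ j) * partial j f x)) \<le> B * (\<Sum>j\<in>UNIV. \<bar>v $ j\<bar>)\<^sup>2"
proof -
  let ?S = "\<Sum>j\<in>UNIV. \<bar>v $ j\<bar>"
  let ?c = "\<Sum>j\<in>UNIV. of_real (v $ j) * partial j f x"
  let ?h' = "\<lambda>t. (\<Sum>j\<in>UNIV. of_real (v $ j) * partial j f (x + t *\<^sub>R v)) - ?c"
  have B0: "0 \<le> B" using B[of undefined undefined undefined] norm_ge_zero order_trans by blast
  have S0: "0 \<le> ?S" by (simp add: sum_nonneg)
  have d: "((\<lambda>t. f (x + t *\<^sub>R v) - t *\<^sub>R ?c) has_vector_derivative ?h' t) (at t)" for t
    using has_vector_derivative_diff[OF smooth_line_derivative[OF f]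
        has_vector_derivative_scaleR[OF DERIV_ident has_vector_derivative_const[of ?c]]]
    by simp
  have "\<exists>t\<in>{0<..<1::real}. norm ((f (x + 1 *\<^sub>R v) - 1 *\<^sub>R ?c) - (f (x + 0 *\<^sub>R v) - 0 *\<^sub>R ?c)) \<le> norm ((1 - 0) *\<^sub>R ?h' t)"
  proof (rule mvt_general)
    show "continuous_on {0..1} (\<lambda>t. f (x + t *\<^sub>R v) - t *\<^sub>R ?c)"
      using d by (meson continuous_at_imp_continuous_on has_vector_derivative_continuous)
  qed (use d in \<open>auto simp: has_vector_derivative_def\<close>)
  then obtain t where t: "0 < t" "t < 1" and "cmod (f (x + v) - ?c - f x) \<le> cmod (?h' t)" by auto
  then have "cmod (f (x + v) - f x - ?c) \<le> cmod (?h' t)" by (simp add: algebra_simps)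
  also have "?h' t = (\<Sum>j\<in>UNIV. of_real (v $ j) * (partial j f (x + t *\<^sub>R v) - partial j f x))"
    by (simp add: sum_subtractf right_diff_distrib)
  also have "cmod \<dots> \<le> (\<Sum>j\<in>UNIV. \<bar>v $ j\<bar> * (B * ?S))"
  proof (intro sum_norm_le)
    fix j
    have "cmod (partial j f (x + t *\<^sub>R v) - partial j f x) \<le> B * (\<Sum>k\<in>UNIV. \<bar>(t *\<^sub>R v) $ k\<bar>)"
      by (intro first_order_bound smooth_partial f B)
    also have "(\<Sum>k\<in>UNIV. \<bar>(t *\<^sub>R v) $ k\<bar>) = t * ?S"
      using t by (simp add: abs_mult sum_distrib_left)
    also have "B * (t * ?S) \<le> B * ?S"
      using t S0 B0 by (intro mult_left_mono) (auto intro: mult_left_le_one_le)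
    finally show "cmod (of_real (v $ j) * (partial j f (x + t *\<^sub>R v) - partial j f x)) \<le> \<bar>v $ j\<bar> * (B * ?S)"
      by (simp add: norm_mult mult_left_mono)
  qed
  also have "\<dots> = B * ?S\<^sup>2" by (simp add: sum_distrib_right[symmetric] power2_eq_square)
  finally show ?thesis .
qed

lemma sum_abs_nth_le: "(\<Sum>j\<in>UNIV. \<bar>v $ j\<bar>) \<le> real CARD('n) * norm (v :: real^'n)"
  using sum_bounded_above[of UNIV "\<lambda>j. \<bar>v $ j\<bar>" "norm v"] component_le_norm_cart[of v] by simp

text \<open>A quadratic remainder determines the derivative. This is how derivatives are taken under
  the Hermite integral (\<open>hcoeff_derivative\<close>) and under a functional
  (\<open>wfunctional_slice_derivative\<close>), where an estimate of the Taylor remainder is what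
  carries over.\<close>

lemma has_derivative_second_order:
  fixes g :: "real^'n \<Rightarrow> complex"
  assumes "\<And>v. cmod (g (x + v) - g x - (\<Sum>j\<in>UNIV. of_real (v $ j) * c j)) \<le> B * (\<Sum>j\<in>UNIV. \<bar>v $ j\<bar>)\<^sup>2"
  shows "(g has_derivative (\<lambda>v. \<Sum>j\<in>UNIV. of_real (v $ j) * c j)) (at x)"
  unfolding has_derivative_at_alt
proof (intro conjI allI impI)
  show "bounded_linear (\<lambda>v. \<Sum>j\<in>UNIV. complex_of_real (v $ j) * c j)"
    by (intro bounded_linear_sum bounded_linear_mult_left[THEN bounded_linear_compose]
        bounded_linear_of_real[THEN bounded_linear_compose] bounded_linear_vec_nth)
  fix e :: real assume e: "0 < e"
  define A where "A = (\<bar>B\<bar> + 1) * (real CARD('n))\<^sup>2"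
  have A: "A > 0" by (simp add: A_def)
  show "\<exists>d>0. \<forall>y. norm (y - x) < d \<longrightarrow>
      cmod (g y - g x - (\<Sum>j\<in>UNIV. of_real ((y - x) $ j) * c j)) \<le> e * norm (y - x)"
  proof (intro exI conjI allI impI)
    show "e / A > 0" using e A by simp
    fix y assume y: "norm (y - x) < e / A"
    let ?v = "y - x"
    have "cmod (g y - g x - (\<Sum>j\<in>UNIV. of_real (?v $ j) * c j)) \<le> B * (\<Sum>j\<in>UNIV. \<bar>?v $ j\<bar>)\<^sup>2"
      using assms[of ?v] by simp
    also have "\<dots> \<le> (\<bar>B\<bar> + 1) * (real CARD('n) * norm ?v)\<^sup>2"
      by (intro mult_mono power_mono sum_abs_nth_le) (auto simp: sum_nonneg)
    also have "\<dots> = (A * norm ?v) * norm ?v" by (simp add: A_def power2_eq_square)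
    also have "\<dots> \<le> e * norm ?v"
      using y A by (intro mult_right_mono) (auto simp: field_simps)
    finally show "cmod (g y - g x - (\<Sum>j\<in>UNIV. of_real (?v $ j) * c j)) \<le> e * norm ?v" .
  qed
qed

lemma second_order_partial:
  fixes g :: "real^'n \<Rightarrow> complex"
  assumes "\<And>v. cmod (g (x + v) - g x - (\<Sum>j\<in>UNIV. of_real (v $ j) * c j)) \<le> B * (\<Sum>j\<in>UNIV. \<bar>v $ j\<bar>)\<^sup>2"
  shows "partial i g x = c i" "g differentiable (at x)"
proof -
  note d = has_derivative_second_order[OF assms]
  show "g differentiable (at x)" using d by (rule differentiableI)
  have "(\<Sum>j\<in>UNIV. complex_of_real ((axis i 1 :: real^'n) $ j) * c j) = (\<Sum>j\<in>UNIV. if j = i then c i else 0)"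
    by (rule sum.cong) (auto simp: axis_def)
  then show "partial i g x = c i" using partial_eq[OF d, of i] by simp
qed

section \<open>Ladder operators\<close>

definition ladder :: "'n \<times> bool \<Rightarrow> (real^'n::finite \<Rightarrow> complex) \<Rightarrow> real^'n \<Rightarrow> complex" where
  "ladder l f = (\<lambda>x. of_real (x $ fst l) * f x + (if snd l then 1 else -1) * partial (fst l) f x)"

definition word :: "('n \<times> bool) list \<Rightarrow> (real^'n::finite \<Rightarrow> complex) \<Rightarrow> real^'n \<Rightarrow> complex" where
  "word w f = foldr ladder w f"

text \<open>Quantifying over all words makes the condition stable under each ladder operator with a
  mere shift of the index and no commutators to track.\<close>

definition ladder_bdd :: "(real^'n::finite \<Rightarrow> complex) \<Rightarrow> (nat \<Rightarrow> real) \<Rightarrow> bool" where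
  "ladder_bdd f \<omega> \<longleftrightarrow> (\<forall>w x. cmod (word w f x) \<le> \<omega> (length w))"

definition xmult :: "'n \<Rightarrow> (real^'n::finite \<Rightarrow> complex) \<Rightarrow> real^'n \<Rightarrow> complex" where
  "xmult i f = (\<lambda>x. of_real (x $ i) * f x)"

lemma word_Nil [simp]: "word [] f = f"
  and word_Cons: "word (l # w) f = ladder l (word w f)"
  and word_append: "word (v @ w) f = word v (word w f)"
  by (simp_all add: word_def)

lemma ladder_True: "ladder (i, True) f x = xmult i f x + partial i f x"
  and ladder_False: "ladder (i, False) f x = xmult i f x - partial i f x"
  by (simp_all add: ladder_def xmult_def)

lemma smooth_xmult: "smooth f \<Longrightarrow> smooth (xmult i f)"
  unfolding xmult_def by (intro smooth_mult smooth_coord)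

lemma smooth_ladder: "smooth f \<Longrightarrow> smooth (ladder l f)"
  unfolding ladder_def by (intro smooth_add smooth_cmult smooth_mult smooth_coord smooth_partial)

lemma smooth_word: "smooth f \<Longrightarrow> smooth (word w f)"
  by (induction w) (auto simp: word_Cons intro: smooth_ladder)

lemma ladder_add: "smooth f \<Longrightarrow> smooth g \<Longrightarrow> ladder l (\<lambda>x. f x + g x) = (\<lambda>x. ladder l f x + ladder l g x)"
  by (simp add: ladder_def smooth_partial_add fun_eq_iff algebra_simps)

lemma ladder_cmult: "smooth f \<Longrightarrow> ladder l (\<lambda>x. c * f x) = (\<lambda>x. c * ladder l f x)"
  by (simp add: ladder_def smooth_partial_cmult fun_eq_iff algebra_simps)

lemma word_add: "smooth f \<Longrightarrow> smooth g \<Longrightarrow> word w (\<lambda>x. f x + g x) = (\<lambda>x. word w f x + word w g x)"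
  by (induction w) (simp_all add: word_Cons ladder_add smooth_word)

lemma word_cmult: "smooth f \<Longrightarrow> word w (\<lambda>x. c * f x) = (\<lambda>x. c * word w f x)"
  by (induction w) (simp_all add: word_Cons ladder_cmult smooth_word)

lemma word_diff: "smooth f \<Longrightarrow> smooth g \<Longrightarrow> word w (\<lambda>x. f x - g x) = (\<lambda>x. word w f x - word w g x)"
  using word_add[of f "\<lambda>x. -1 * g x" w] word_cmult[of g w "-1"] smooth_cmult[of g "-1"] by simp

lemma word_zero: "word w (\<lambda>x. 0) = (\<lambda>x. 0)"
  using word_cmult[OF smooth_const, of w 0 0] by simp

lemma word_sum:
  assumes "\<And>i. i \<in> I \<Longrightarrow> smooth (f i)"
  shows "word w (\<lambda>x. \<Sum>i\<in>I. f i x) = (\<lambda>x. \<Sum>i\<in>I. word w (f i) x)"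
  using assms
  by (induction I rule: infinite_finite_induct) (simp_all add: word_zero word_add smooth_sum)

lemma ladder_bddD: "ladder_bdd f \<omega> \<Longrightarrow> cmod (word w f x) \<le> \<omega> (length w)"
  by (simp add: ladder_bdd_def)

lemma ladder_bdd_0: "ladder_bdd f \<omega> \<Longrightarrow> cmod (f x) \<le> \<omega> 0"
  using ladder_bddD[of f \<omega> "[]"] by simp

lemma ladder_bdd_nonneg: "ladder_bdd f \<omega> \<Longrightarrow> 0 \<le> \<omega> k"
  using ladder_bddD[of f \<omega> "replicate k undefined" undefined] norm_ge_zero order_trans
  by (metis length_replicate)

lemma ladder_bdd_mono: "ladder_bdd f \<omega> \<Longrightarrow> (\<And>k. \<omega> k \<le> \<omega>' k) \<Longrightarrow> ladder_bdd f \<omega>'"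
  unfolding ladder_bdd_def by (meson order_trans)

lemma ladder_bdd_word: "ladder_bdd f \<omega> \<Longrightarrow> ladder_bdd (word w f) (\<lambda>k. \<omega> (k + length w))"
  unfolding ladder_bdd_def by (metis word_append length_append)

lemma ladder_bdd_ladder: "ladder_bdd f \<omega> \<Longrightarrow> ladder_bdd (ladder l f) (\<lambda>k. \<omega> (Suc k))"
  using ladder_bdd_word[of f \<omega> "[l]"] by (simp add: word_Cons)

lemma ladder_bdd_add:
  assumes "smooth f" "smooth g" "ladder_bdd f \<omega>" "ladder_bdd g \<omega>'"
  shows "ladder_bdd (\<lambda>x. f x + g x) (\<lambda>k. \<omega> k + \<omega>' k)"
  unfolding ladder_bdd_def
proof (intro allI)
  fix w x
  show "cmod (word w (\<lambda>x. f x + g x) x) \<le> \<omega> (length w) + \<omega>' (length w)"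
    using assms norm_triangle_mono[OF ladder_bddD[OF assms(3)] ladder_bddD[OF assms(4)]]
    by (simp add: word_add)
qed

lemma ladder_bdd_cmult:
  assumes "smooth f" "ladder_bdd f \<omega>"
  shows "ladder_bdd (\<lambda>x. c * f x) (\<lambda>k. cmod c * \<omega> k)"
  unfolding ladder_bdd_def
  using assms by (auto simp: word_cmult norm_mult intro!: mult_left_mono ladder_bddD)

lemma ladder_bdd_diff:
  assumes "smooth f" "smooth g" "ladder_bdd f \<omega>" "ladder_bdd g \<omega>'"
  shows "ladder_bdd (\<lambda>x. f x - g x) (\<lambda>k. \<omega> k + \<omega>' k)"
  using ladder_bdd_add[OF assms(1) smooth_cmult[of g "-1"] assms(3) ladder_bdd_cmult[of g \<omega>' "-1"]] assms
  by simp

lemma partial_ladder: "partial i f = (\<lambda>x. (1/2) * ladder (i, True) f x + (-1/2) * ladder (i, False) f x)"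
  and xmult_ladder: "xmult i f = (\<lambda>x. (1/2) * ladder (i, True) f x + (1/2) * ladder (i, False) f x)"
  by (simp_all add: ladder_True ladder_False fun_eq_iff field_simps)

text \<open>The two coefficients in \<open>partial_ladder\<close> have moduli adding up to 1, so a
  derivative costs one index and no constant; the same holds for multiplication by a
  coordinate.\<close>

lemma ladder_bdd_partial:
  assumes "smooth f" "ladder_bdd f \<omega>"
  shows "ladder_bdd (partial i f) (\<lambda>k. \<omega> (Suc k))"
proof -
  have "ladder_bdd (partial i f) (\<lambda>k. cmod (1/2) * \<omega> (Suc k) + cmod (-1/2) * \<omega> (Suc k))"
    unfolding partial_ladder
    by (intro ladder_bdd_add ladder_bdd_cmult ladder_bdd_ladder smooth_cmult smooth_ladder assms)
  then show ?thesis by (simp add: norm_divide)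
qed

lemma ladder_bdd_xmult:
  assumes "smooth f" "ladder_bdd f \<omega>"
  shows "ladder_bdd (xmult i f) (\<lambda>k. \<omega> (Suc k))"
proof -
  have "ladder_bdd (xmult i f) (\<lambda>k. cmod (1/2) * \<omega> (Suc k) + cmod (1/2) * \<omega> (Suc k))"
    unfolding xmult_ladder
    by (intro ladder_bdd_add ladder_bdd_cmult ladder_bdd_ladder smooth_cmult smooth_ladder assms)
  then show ?thesis by (simp add: norm_divide)
qed

lemma ladder_bdd_partials:
  assumes "smooth f" "ladder_bdd f \<omega>"
  shows "smooth ((partial i ^^ k) f) \<and> ladder_bdd ((partial i ^^ k) f) (\<lambda>l. \<omega> (l + k))"
proof (induction k)
  case (Suc k)
  then show ?case
    using ladder_bdd_partial[of "(partial i ^^ k) f" "\<lambda>l. \<omega> (l + k)"] by (auto intro: smooth_partial)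
qed (use assms in auto)

lemma ladder_bdd_xmults:
  assumes "smooth f" "ladder_bdd f \<omega>"
  shows "smooth ((xmult i ^^ k) f) \<and> ladder_bdd ((xmult i ^^ k) f) (\<lambda>l. \<omega> (l + k))"
proof (induction k)
  case (Suc k)
  then show ?case
    using ladder_bdd_xmult[of "(xmult i ^^ k) f" "\<lambda>l. \<omega> (l + k)"] by (auto intro: smooth_xmult)
qed (use assms in auto)

lemma xmult_power: "(xmult i ^^ k) f x = of_real (x $ i) ^ k * f x"
  by (induction k) (auto simp: xmult_def)

lemma coords: "distinct (coords :: 'n::finite list)" "set (coords :: 'n list) = UNIV"
proof -
  have "\<exists>l :: 'n list. distinct l \<and> set l = UNIV"
    using finite_distinct_list[OF finite_class.finite_UNIV] by blast
  then have "distinct (coords :: 'n list) \<and> set (coords :: 'n list) = UNIV"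
    unfolding coords_def by (rule someI_ex)
  then show "distinct (coords :: 'n list)" "set (coords :: 'n list) = UNIV" by auto
qed

section \<open>Normal ordering: words in ladder operators against monomials times
  derivatives\<close>

lemma ladder_bdd_multi_deriv_aux:
  assumes "smooth f" "ladder_bdd f \<omega>"
  shows "smooth (foldr (\<lambda>i. partial i ^^ \<alpha> i) L f) \<and>
    ladder_bdd (foldr (\<lambda>i. partial i ^^ \<alpha> i) L f) (\<lambda>l. \<omega> (l + (\<Sum>i\<leftarrow>L. \<alpha> i)))"
proof (induction L)
  case (Cons i L)
  then show ?case
    using ladder_bdd_partials[of "foldr (\<lambda>i. partial i ^^ \<alpha> i) L f"
        "\<lambda>l. \<omega> (l + (\<Sum>i\<leftarrow>L. \<alpha> i))" "\<alpha> i" i]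
    by (simp add: add_ac)
qed (use assms in auto)

lemma ladder_bdd_mono_pow_aux:
  assumes "smooth f" "ladder_bdd f \<omega>"
  shows "smooth (foldr (\<lambda>i. xmult i ^^ \<beta> i) L f) \<and>
    ladder_bdd (foldr (\<lambda>i. xmult i ^^ \<beta> i) L f) (\<lambda>l. \<omega> (l + (\<Sum>i\<leftarrow>L. \<beta> i)))"
proof (induction L)
  case (Cons i L)
  then show ?case
    using ladder_bdd_xmults[of "foldr (\<lambda>i. xmult i ^^ \<beta> i) L f"
        "\<lambda>l. \<omega> (l + (\<Sum>i\<leftarrow>L. \<beta> i))" "\<beta> i" i]
    by (simp add: add_ac)
qed (use assms in auto)

lemma foldr_xmult: "foldr (\<lambda>i. xmult i ^^ \<beta> i) L f x = of_real (\<Prod>i\<leftarrow>L. (x $ i) ^ \<beta> i) * f x"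
  by (induction L) (auto simp: xmult_power)

lemma mono_pow_coords: "(\<Prod>i\<leftarrow>coords. (x $ i) ^ \<beta> i) = mono_pow x \<beta>"
  unfolding mono_pow_def using coords by (metis prod.distinct_set_conv_list)

lemma multi_size_coords: "(\<Sum>i\<leftarrow>coords. \<beta> i) = multi_size \<beta>"
  unfolding multi_size_def using coords by (metis sum.distinct_set_conv_list)

text \<open>No commutators arise in this direction: coordinates and derivatives are signed averages
  of ladder operators, so x^\<beta> \<partial>^\<alpha> is a signed average of words of length
  |\<alpha>| + |\<beta>|.\<close>

lemma ladder_bdd_normal_ordered:
  assumes "smooth f" "ladder_bdd f \<omega>"
  shows "cmod (of_real (mono_pow x \<beta>) * multi_deriv \<alpha> f x) \<le> \<omega> (multi_size \<alpha> + multi_size \<beta>)"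
proof -
  note 1 = ladder_bdd_multi_deriv_aux[OF assms, of \<alpha> coords]
  have "ladder_bdd (foldr (\<lambda>i. xmult i ^^ \<beta> i) coords (multi_deriv \<alpha> f))
      (\<lambda>l. \<omega> (l + multi_size \<beta> + multi_size \<alpha>))"
    using ladder_bdd_mono_pow_aux[OF 1[THEN conjunct1] 1[THEN conjunct2], of \<beta> coords]
    by (simp add: multi_deriv_def multi_size_coords)
  from ladder_bdd_0[OF this, of x] show ?thesis
    by (simp add: foldr_xmult mono_pow_coords add.commute)
qed

lemma partial_xmult:
  assumes "smooth f"
  shows "partial j (xmult i f) = (\<lambda>x. xmult i (partial j f) x + (if i = j then f x else 0))"
  unfolding xmult_def
  by (subst smooth_partial_mult[OF smooth_coord assms]) (auto simp: partial_coord)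

lemma smooth_partials: "smooth f \<Longrightarrow> smooth ((partial i ^^ k) f)"
  by (induction k) (auto intro: smooth_partial)

lemma partials_commute: "smooth f \<Longrightarrow> partial j ((partial i ^^ k) f) = (partial i ^^ k) (partial j f)"
  by (induction k) (auto simp: partial_commute[of _ j i] smooth_partials)

lemma partials_add: "smooth f \<Longrightarrow> smooth g \<Longrightarrow>
  (partial i ^^ k) (\<lambda>x. f x + g x) = (\<lambda>x. (partial i ^^ k) f x + (partial i ^^ k) g x)"
  by (induction k) (auto simp: smooth_partial_add smooth_partials)

lemma partials_cmult: "smooth f \<Longrightarrow> (partial i ^^ k) (\<lambda>x. c * f x) = (\<lambda>x. c * (partial i ^^ k) f x)"
  by (induction k) (auto simp: smooth_partial_cmult smooth_partials)

lemma partials_xmult: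
  assumes "smooth f"
  shows "(partial j ^^ k) (xmult i f) =
    (\<lambda>x. xmult i ((partial j ^^ k) f) x + (if i = j then of_nat k * (partial j ^^ (k - 1)) f x else 0))"
proof (induction k)
  case (Suc k)
  show ?case
  proof (cases "i = j")
    case True
    have "(partial j ^^ Suc k) (xmult i f) = partial j (\<lambda>x. xmult i ((partial j ^^ k) f) x + of_nat k * (partial j ^^ (k - 1)) f x)"
      using Suc True by simp
    also have "\<dots> = (\<lambda>x. xmult i (partial j ((partial j ^^ k) f)) x + (partial j ^^ k) f x + of_nat k * partial j ((partial j ^^ (k - 1)) f) x)"
      using True assms
      by (simp add: smooth_partial_add smooth_partial_cmult smooth_xmult smooth_partials smooth_cmult partial_xmult)
    also have "\<dots> = (\<lambda>x. xmult i ((partial j ^^ Suc k) f) x + of_nat (Suc k) * (partial j ^^ k) f x)"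
      by (cases k) (auto simp: algebra_simps)
    finally show ?thesis using True by simp
  next
    case False
    then show ?thesis using Suc assms by (simp add: partial_xmult smooth_partials)
  qed
qed (simp add: fun_eq_iff)

lemma smooth_pd: "smooth f \<Longrightarrow> smooth (foldr (\<lambda>i. partial i ^^ \<alpha> i) L f)"
  by (induction L) (auto intro: smooth_partials)

lemma pd_add: "smooth f \<Longrightarrow> smooth g \<Longrightarrow> foldr (\<lambda>i. partial i ^^ \<alpha> i) L (\<lambda>x. f x + g x)
    = (\<lambda>x. foldr (\<lambda>i. partial i ^^ \<alpha> i) L f x + foldr (\<lambda>i. partial i ^^ \<alpha> i) L g x)"
  by (induction L) (auto simp: partials_add smooth_pd)

lemma pd_cmult: "smooth f \<Longrightarrow> foldr (\<lambda>i. partial i ^^ \<alpha> i) L (\<lambda>x. c * f x)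
    = (\<lambda>x. c * foldr (\<lambda>i. partial i ^^ \<alpha> i) L f x)"
  by (induction L) (auto simp: partials_cmult smooth_pd)

lemma pd_cong: "(\<And>i. i \<in> set L \<Longrightarrow> \<alpha> i = \<alpha>' i) \<Longrightarrow>
    foldr (\<lambda>i. partial i ^^ \<alpha> i) L f = foldr (\<lambda>i. partial i ^^ \<alpha>' i) L f"
  by (induction L) auto

lemma pd_partial:
  assumes "smooth f" "distinct L" "i \<in> set L"
  shows "foldr (\<lambda>i. partial i ^^ \<alpha> i) L (partial i f) = foldr (\<lambda>j. partial j ^^ ((\<alpha>(i := Suc (\<alpha> i))) j)) L f"
  using assms(2,3)
proof (induction L)
  case (Cons j L)
  show ?case
  proof (cases "j = i")
    case True
    have c: "foldr (\<lambda>i. partial i ^^ \<alpha> i) M (partial i f) = partial i (foldr (\<lambda>i. partial i ^^ \<alpha> i) M f)" for M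
      by (induction M) (auto simp: partials_commute smooth_pd assms(1))
    have "foldr (\<lambda>i. partial i ^^ \<alpha> i) L f = foldr (\<lambda>j. partial j ^^ ((\<alpha>(i := Suc (\<alpha> i))) j)) L f"
      using Cons.prems True by (intro pd_cong) auto
    then show ?thesis using True by (simp add: c funpow_swap1)
  next
    case False
    then show ?thesis using Cons by auto
  qed
qed simp

lemma multi_deriv_partial: "smooth f \<Longrightarrow> multi_deriv \<alpha> (partial i f) = multi_deriv (\<alpha>(i := Suc (\<alpha> i))) f"
  unfolding multi_deriv_def using coords by (intro pd_partial) auto

lemma pd_xmult:
  assumes "smooth f" "distinct L"
  shows "foldr (\<lambda>i. partial i ^^ \<alpha> i) L (xmult i f) = (\<lambda>x. xmult i (foldr (\<lambda>i. partial i ^^ \<alpha> i) L f) x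
     + (if i \<in> set L then of_nat (\<alpha> i) * foldr (\<lambda>j. partial j ^^ ((\<alpha>(i := \<alpha> i - 1)) j)) L f x else 0))"
  using assms(2)
proof (induction L)
  case (Cons j L)
  let ?P = "\<lambda>\<alpha> L. foldr (\<lambda>j. partial j ^^ \<alpha> j) L"
  note s = smooth_pd[OF assms(1)] smooth_xmult smooth_partials smooth_cmult
  show ?case
  proof (cases "j = i")
    case True
    have "?P (\<alpha>(i := \<alpha> i - 1)) L f = ?P \<alpha> L f" using Cons.prems True by (intro pd_cong) auto
    then show ?thesis using Cons True by (simp add: partials_xmult s)
  next
    case False
    show ?thesis
    proof (cases "i \<in> set L")
      case True
      then show ?thesis using Cons False by (simp add: partials_xmult partials_add partials_cmult s)
    next
      case notin: False
      then show ?thesis using Cons False by (simp add: partials_xmult s)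
    qed
  qed
qed simp

lemma multi_deriv_xmult:
  "smooth f \<Longrightarrow> multi_deriv \<alpha> (xmult i f) =
     (\<lambda>x. xmult i (multi_deriv \<alpha> f) x + of_nat (\<alpha> i) * multi_deriv (\<alpha>(i := \<alpha> i - 1)) f x)"
  unfolding multi_deriv_def by (subst pd_xmult) (simp_all add: coords del: fun_upd_apply)

lemma multi_deriv_add: "smooth f \<Longrightarrow> smooth g \<Longrightarrow> multi_deriv \<alpha> (\<lambda>x. f x + g x) = (\<lambda>x. multi_deriv \<alpha> f x + multi_deriv \<alpha> g x)"
  and multi_deriv_cmult: "smooth f \<Longrightarrow> multi_deriv \<alpha> (\<lambda>x. c * f x) = (\<lambda>x. c * multi_deriv \<alpha> f x)"
  unfolding multi_deriv_def by (auto simp: pd_add pd_cmult)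

lemma multi_size_upd: "multi_size (\<alpha>(i := k)) + \<alpha> i = multi_size \<alpha> + k"
  unfolding multi_size_def by (simp add: sum.remove[of UNIV i])

lemma mono_pow_upd: "mono_pow x (\<beta>(i := Suc (\<beta> i))) = x $ i * mono_pow x \<beta>"
  unfolding mono_pow_def by (simp add: prod.remove[of UNIV i])

lemma multi_deriv_zero: "multi_deriv (\<lambda>_. 0) f = f"
proof -
  have "foldr (\<lambda>i. partial i ^^ 0) L f = f" for L by (induction L) auto
  then show ?thesis by (simp add: multi_deriv_def)
qed

text \<open>Peeling off the outermost letter leaves three terms: one more power of x, one more
  derivative, and the commutator of \<partial>^\<alpha> with x_i, which carries the factor \<alpha>
  i but has total order two less than the others. \<open>growth\<close> pays for that factor, and
  three terms per letter give \<open>3 ^ length w\<close>.\<close>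

lemma normal_ordered_word:
  assumes f: "smooth f" and nonneg: "\<And>k. 0 \<le> \<omega> k"
    and growth: "\<And>k. real (Suc k) * \<omega> k \<le> \<omega> (Suc (Suc k))"
    and bd: "\<And>\<alpha> \<beta> x. cmod (of_real (mono_pow x \<beta>) * multi_deriv \<alpha> f x) \<le> \<omega> (multi_size \<alpha> + multi_size \<beta>)"
  shows "cmod (of_real (mono_pow x \<beta>) * multi_deriv \<alpha> (word w f) x)
    \<le> 3 ^ length w * \<omega> (multi_size \<alpha> + multi_size \<beta> + length w)"
proof (induction w arbitrary: \<alpha> \<beta>)
  case Nil
  then show ?case using bd by simp
next
  case (Cons l w)
  obtain i b where l: "l = (i, b)" by (cases l) auto
  define c :: complex where "c = (if b then 1 else -1)"
  have c: "cmod c = 1" by (simp add: c_def)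
  let ?g = "word w f" and ?N = "multi_size \<alpha> + multi_size \<beta>"
  note g = smooth_word[OF f, of w]
  let ?T = "3 ^ length w * \<omega> (Suc ?N + length w)"
  have "word (l # w) f = (\<lambda>x. xmult i ?g x + c * partial i ?g x)"
    by (simp add: word_Cons ladder_def l xmult_def c_def)
  then have "multi_deriv \<alpha> (word (l # w) f) x = xmult i (multi_deriv \<alpha> ?g) x
      + of_nat (\<alpha> i) * multi_deriv (\<alpha>(i := \<alpha> i - 1)) ?g x + c * multi_deriv (\<alpha>(i := Suc (\<alpha> i))) ?g x"
    using g by (simp add: multi_deriv_add multi_deriv_cmult multi_deriv_xmult multi_deriv_partial
        smooth_xmult smooth_cmult smooth_partial)
  then have "of_real (mono_pow x \<beta>) * multi_deriv \<alpha> (word (l # w) f) x =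
      of_real (mono_pow x (\<beta>(i := Suc (\<beta> i)))) * multi_deriv \<alpha> ?g x
      + of_nat (\<alpha> i) * (of_real (mono_pow x \<beta>) * multi_deriv (\<alpha>(i := \<alpha> i - 1)) ?g x)
      + c * (of_real (mono_pow x \<beta>) * multi_deriv (\<alpha>(i := Suc (\<alpha> i))) ?g x)"
    (is "_ = ?A + ?B + ?C") by (simp add: mono_pow_upd xmult_def algebra_simps)
  moreover have "cmod ?A \<le> ?T"
    using Cons.IH[of "\<beta>(i := Suc (\<beta> i))" \<alpha>] multi_size_upd[of \<beta> i "Suc (\<beta> i)"]
    by (simp del: fun_upd_apply)
  moreover have "cmod ?C \<le> ?T"
    using Cons.IH[of \<beta> "\<alpha>(i := Suc (\<alpha> i))"] multi_size_upd[of \<alpha> i "Suc (\<alpha> i)"] c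
    by (simp add: norm_mult del: fun_upd_apply)
  moreover have "cmod ?B \<le> ?T"
  proof (cases "\<alpha> i")
    case 0
    then show ?thesis using nonneg by simp
  next
    case (Suc a)
    \<comment> \<open>\<open>k\<close> is the total order left in the commutator term; it is two
      below the target index, matching the step in \<open>growth\<close>.\<close>
    define k where "k = multi_size (\<alpha>(i := a)) + multi_size \<beta> + length w"
    have ms: "multi_size \<alpha> = Suc (multi_size (\<alpha>(i := a)))"
      using multi_size_upd[of \<alpha> i a] Suc by simp
    have "\<alpha> i \<le> multi_size \<alpha>" unfolding multi_size_def by (rule member_le_sum) auto
    then have ik: "real (\<alpha> i) \<le> real (Suc k)" using ms by (simp add: k_def)
    have "cmod ?B = real (\<alpha> i) * cmod (of_real (mono_pow x \<beta>) * multi_deriv (\<alpha>(i := a)) ?g x)"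
      by (simp only: Suc norm_mult norm_of_nat diff_Suc_1)
    also have "\<dots> \<le> real (Suc k) * (3 ^ length w * \<omega> k)"
      using Cons.IH[of \<beta> "\<alpha>(i := a)"] ik nonneg by (intro mult_mono) (auto simp: k_def simp del: fun_upd_apply)
    also have "\<dots> = 3 ^ length w * (real (Suc k) * \<omega> k)" by simp
    also have "\<dots> \<le> 3 ^ length w * \<omega> (Suc (Suc k))"
      by (intro mult_left_mono growth) auto
    also have "Suc (Suc k) = Suc ?N + length w" by (simp add: k_def ms)
    finally show ?thesis .
  qed
  ultimately have "cmod (of_real (mono_pow x \<beta>) * multi_deriv \<alpha> (word (l # w) f) x) \<le> ?T + ?T + ?T"
    by (metis norm_triangle_mono)
  then show ?case by simp
qed

lemma normal_ordered_ladder_bdd: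
  assumes f: "smooth f" and nonneg: "\<And>k. 0 \<le> \<omega> k"
    and growth: "\<And>k. real (Suc k) * \<omega> k \<le> \<omega> (Suc (Suc k))"
    and bd: "\<And>\<alpha> \<beta> x. cmod (of_real (mono_pow x \<beta>) * multi_deriv \<alpha> f x) \<le> \<omega> (multi_size \<alpha> + multi_size \<beta>)"
  shows "ladder_bdd f (\<lambda>k. 3 ^ k * \<omega> k)"
  unfolding ladder_bdd_def
proof (intro allI)
  fix w x
  show "cmod (word w f x) \<le> 3 ^ length w * \<omega> (length w)"
    using normal_ordered_word[OF assms, of x "\<lambda>_. 0" "\<lambda>_. 0" w]
    by (simp add: multi_deriv_zero multi_size_def mono_pow_def)
qed

section \<open>Hermite projections in one coordinate\<close>

definition rdec :: "(real^'n::finite \<Rightarrow> complex) \<Rightarrow> bool" where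
  "rdec f \<longleftrightarrow> smooth f \<and> (\<exists>\<omega>. ladder_bdd f \<omega>)"

lemma rdec_smooth: "rdec f \<Longrightarrow> smooth f"
  by (simp add: rdec_def)

lemma rdec_partial: "rdec f \<Longrightarrow> rdec (partial i f)"
  and rdec_xmult: "rdec f \<Longrightarrow> rdec (xmult i f)"
  and rdec_ladder: "rdec f \<Longrightarrow> rdec (ladder l f)"
  and rdec_cmult: "rdec f \<Longrightarrow> rdec (\<lambda>x. c * f x)"
  and rdec_add: "rdec f \<Longrightarrow> rdec g \<Longrightarrow> rdec (\<lambda>x. f x + g x)"
  and rdec_diff: "rdec f \<Longrightarrow> rdec g \<Longrightarrow> rdec (\<lambda>x. f x - g x)"
  unfolding rdec_def
  by (auto intro: smooth_partial smooth_xmult smooth_ladder smooth_cmult smooth_add smooth_diff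
      ladder_bdd_partial ladder_bdd_xmult ladder_bdd_ladder ladder_bdd_cmult ladder_bdd_add ladder_bdd_diff)

lemma rdec_bounded:
  assumes "rdec f"
  shows "\<exists>B. \<forall>x. cmod (f x) \<le> B"
  using assms ladder_bdd_0 unfolding rdec_def by blast

lemma rdec_word: "rdec f \<Longrightarrow> rdec (word w f)"
  by (induction w) (auto simp: word_Cons rdec_ladder)

section \<open>Slices in one coordinate and partial Hermite coefficients\<close>

definition upd :: "real^'n::finite \<Rightarrow> 'n \<Rightarrow> real \<Rightarrow> real^'n" where
  "upd x i t = (\<chi> j. if j = i then t else x $ j)"

lemma upd_nth: "upd x i t $ j = (if j = i then t else x $ j)"
  by (simp add: upd_def)

lemma upd_same: "upd x i (x $ i) = x"
  by (simp add: vec_eq_iff upd_nth)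

lemma upd_add: "upd (x + v) i t = upd x i t + upd v i 0"
  by (simp add: vec_eq_iff upd_nth)

lemma upd_axis: "upd x i t = upd x i 0 + t *\<^sub>R axis i 1"
  by (simp add: vec_eq_iff upd_nth axis_def)

lemma smooth_upd_derivative:
  assumes "smooth f"
  shows "((\<lambda>t. f (upd x i t)) has_vector_derivative partial i f (upd x i t)) (at t)"
  using smooth_axis_derivative[OF assms, of "upd x i 0" i t] by (simp only: upd_axis[symmetric])

lemma continuous_upd: "continuous_on UNIV (\<lambda>t. upd x i t)"
proof -
  have "continuous_on UNIV (\<lambda>t. upd x i 0 + t *\<^sub>R axis i 1)" by (intro continuous_intros)
  then show ?thesis by (simp only: upd_axis[symmetric])
qed

lemma continuous_slice:
  assumes "continuous_on UNIV f"
  shows "continuous_on UNIV (\<lambda>t. f (upd x i t))"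
  using continuous_on_compose2[OF assms continuous_upd] by auto

lemma slice_DERIV_Re:
  assumes "smooth f"
  shows "((\<lambda>t. Re (f (upd x i t))) has_real_derivative Re (partial i f (upd x i t))) (at t)"
  unfolding has_real_derivative_iff_has_vector_derivative
  by (rule bounded_linear.has_vector_derivative[OF bounded_linear_Re smooth_upd_derivative[OF assms]])

text \<open>On the slice, powers of t are iterates of \<open>xmult i\<close> and t-derivatives are
  \<open>partial i\<close>, so boundedness of all these functions is decay of every order.\<close>

lemma schwartz1_slice_Re:
  assumes "rdec f"
  shows "schwartz1 (\<lambda>t. Re (f (upd x i t)))"
proof -
  have rap: "rapid (\<lambda>t. Re (f (upd x i t)))" if f: "rdec f" for f :: "real^'a \<Rightarrow> complex"
    unfolding rapid_def
  proof
    fix b :: nat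
    have "rdec ((xmult i ^^ b) f)" by (induction b) (auto intro: rdec_xmult f)
    then obtain B where B: "\<And>x. cmod ((xmult i ^^ b) f x) \<le> B" using rdec_bounded by blast
    have "\<bar>t\<bar> ^ b * \<bar>Re (f (upd x i t))\<bar> \<le> B" for t
    proof -
      have "\<bar>t\<bar> ^ b * \<bar>Re (f (upd x i t))\<bar> \<le> \<bar>t\<bar> ^ b * cmod (f (upd x i t))"
        by (intro mult_left_mono abs_Re_le_cmod) auto
      also have "\<dots> = cmod ((xmult i ^^ b) f (upd x i t))"
        by (simp add: xmult_power upd_nth norm_mult norm_power)
      finally show ?thesis using B[of "upd x i t"] by linarith
    qed
    then show "\<exists>C. \<forall>t. \<bar>t\<bar> ^ b * \<bar>Re (f (upd x i t))\<bar> \<le> C" by blast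
  qed
  have "schwartz1_upto k (\<lambda>t. Re (f (upd x i t)))" for k
    using assms
  proof (induction k arbitrary: f)
    case 0
    then show ?case using rap[OF 0]
      by (auto intro!: continuous_intros continuous_slice smooth_cont rdec_smooth)
  next
    case (Suc k)
    have "\<forall>t. ((\<lambda>t. Re (f (upd x i t))) has_real_derivative Re (partial i f (upd x i t))) (at t)"
      using slice_DERIV_Re[OF rdec_smooth[OF Suc.prems]] by blast
    moreover have "schwartz1_upto k (\<lambda>t. Re (partial i f (upd x i t)))"
      by (intro Suc.IH rdec_partial Suc.prems)
    ultimately show ?case using rap[OF Suc.prems] by auto
  qed
  then show ?thesis by (simp add: schwartz1_def)
qed

lemma slice_lower_Re:
  assumes "rdec f"
  shows "lower (\<lambda>t. Re (f (upd x i t))) = (\<lambda>t. Re (ladder (i, True) f (upd x i t)))"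
    and "raise (\<lambda>t. Re (f (upd x i t))) = (\<lambda>t. Re (ladder (i, False) f (upd x i t)))"
  using DERIV_imp_deriv[OF slice_DERIV_Re[OF rdec_smooth[OF assms], of x i]]
  by (auto simp: fun_eq_iff lower_def raise_def ladder_True ladder_False xmult_def upd_nth)

text \<open>Kept as a function of the whole vector x, constant in \<open>x $ i\<close>, so that it
  has the type of \<open>f\<close> and ladder operators can be applied to it.\<close>

definition hcoeff :: "'n \<Rightarrow> nat \<Rightarrow> (real^'n::finite \<Rightarrow> complex) \<Rightarrow> real^'n \<Rightarrow> complex" where
  "hcoeff i k f x = (LINT t|lborel. complex_of_real (hermite k t) * f (upd x i t))"

lemma integrable_hermite_mult:
  assumes "continuous_on UNIV f" "\<And>x. cmod (f x) \<le> B"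
  shows "integrable lborel (\<lambda>t. complex_of_real (hermite k t) * f (upd x i t))"
proof -
  obtain C where C: "\<And>t. (1 + t\<^sup>2) * \<bar>hermite k t\<bar> \<le> C"
    using schwartz1_quadratic_decay[OF schwartz1_hermite[of k]] by blast
  have B0: "0 \<le> B" using assms(2)[of undefined] norm_ge_zero order_trans by blast
  show ?thesis
  proof (rule integrable_quadratic_decay)
    show "continuous_on UNIV (\<lambda>t. complex_of_real (hermite k t) * f (upd x i t))"
      by (intro continuous_intros continuous_slice assms(1) schwartz1_cont schwartz1_hermite)
    fix t
    have "(1 + t\<^sup>2) * cmod (complex_of_real (hermite k t) * f (upd x i t))
        = ((1 + t\<^sup>2) * \<bar>hermite k t\<bar>) * cmod (f (upd x i t))"
      by (simp add: norm_mult)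
    also have "\<dots> \<le> C * B"
      using C[of t] order_trans[OF mult_nonneg_nonneg C[of t]] by (intro mult_mono assms(2)) auto
    finally show "(1 + t\<^sup>2) * cmod (complex_of_real (hermite k t) * f (upd x i t)) \<le> C * B" .
  qed
qed

lemma integrable_hermite_mult_rdec:
  "rdec f \<Longrightarrow> integrable lborel (\<lambda>t. complex_of_real (hermite k t) * f (upd x i t))"
  using rdec_bounded[of f] integrable_hermite_mult[OF smooth_cont[OF rdec_smooth]] by blast

lemma hcoeff_add: "rdec f \<Longrightarrow> rdec g \<Longrightarrow> hcoeff i k (\<lambda>x. f x + g x) x = hcoeff i k f x + hcoeff i k g x"
  unfolding hcoeff_def by (simp add: distrib_left integrable_hermite_mult_rdec)

lemma hcoeff_cmult: "hcoeff i k (\<lambda>x. c * f x) x = c * hcoeff i k f x"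
  unfolding hcoeff_def by (simp add: mult.left_commute)

lemma Re_hcoeff: "rdec f \<Longrightarrow> Re (hcoeff i k f x) = ip (\<lambda>t. Re (f (upd x i t))) (hermite k)"
  unfolding hcoeff_def ip_def
  by (subst integral_Re[OF integrable_hermite_mult_rdec, symmetric]) (simp_all add: mult.commute)

text \<open>Identities between linear expressions in \<open>hcoeff\<close> only need to be checked on real parts.\<close>

lemma complex_eqI_rotate:
  assumes "Re z = Re w" "Re (\<i> * z) = Re (\<i> * w)"
  shows "z = w"
  using assms by (simp add: complex_eq_iff)

lemma ladder_cmult_rdec: "rdec f \<Longrightarrow> ladder l (\<lambda>x. c * f x) = (\<lambda>x. c * ladder l f x)"
  by (rule ladder_cmult[OF rdec_smooth])

lemma hcoeff_lower:
  assumes "rdec f"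
  shows "hcoeff i k (ladder (i, True) f) x = hcoeff i (Suc k) f x"
proof -
  have R: "Re (hcoeff i k (ladder (i, True) f) x) = Re (hcoeff i (Suc k) f x)"
    if "rdec f" for f :: "real^'a \<Rightarrow> complex"
    using that schwartz1_slice_Re[OF that]
    by (simp add: Re_hcoeff rdec_ladder slice_lower_Re[symmetric] ip_hermite_Suc del: hermite.simps)
  show ?thesis
    using R[OF assms] R[OF rdec_cmult[OF assms, of \<i>]]
    by (intro complex_eqI_rotate) (simp_all only: ladder_cmult_rdec[OF assms] hcoeff_cmult)
qed

lemma hcoeff_raise_0:
  assumes "rdec f"
  shows "hcoeff i 0 (ladder (i, False) f) x = 0"
proof -
  have R: "Re (hcoeff i 0 (ladder (i, False) f) x) = Re 0"
    if "rdec f" for f :: "real^'a \<Rightarrow> complex"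
    using that schwartz1_slice_Re[OF that]
    by (simp add: Re_hcoeff rdec_ladder slice_lower_Re[symmetric] ip_raise_hermite_0 del: hermite.simps)
  show ?thesis
    using R[OF assms] R[OF rdec_cmult[OF assms, of \<i>]]
    by (intro complex_eqI_rotate) (simp_all only: ladder_cmult_rdec[OF assms] hcoeff_cmult mult_zero_right)
qed

lemma hcoeff_raise_Suc:
  assumes "rdec f"
  shows "hcoeff i (Suc k) (ladder (i, False) f) x = of_real (2 * real (Suc k)) * hcoeff i k f x"
proof -
  have R: "Re (hcoeff i (Suc k) (ladder (i, False) f) x) = Re (of_real (2 * real (Suc k)) * hcoeff i k f x)"
    if "rdec f" for f :: "real^'a \<Rightarrow> complex"
    using that schwartz1_slice_Re[OF that] unfolding Re_complex_of_real Re_complex_of_real times_complex.sel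
    by (simp add: Re_hcoeff rdec_ladder slice_lower_Re[symmetric] ip_lower_hermite_Suc del: hermite.simps of_nat_Suc)
  show ?thesis
    using R[OF assms] R[OF rdec_cmult[OF assms, of \<i>]]
    by (intro complex_eqI_rotate) (simp_all only: ladder_cmult_rdec[OF assms] hcoeff_cmult mult.left_commute[of "complex_of_real _"])
qed

lemma hcoeff_xmult: "j \<noteq> i \<Longrightarrow> hcoeff i k (xmult j f) x = of_real (x $ j) * hcoeff i k f x"
  unfolding hcoeff_def xmult_def by (simp add: upd_nth mult.left_commute)

lemma hcoeff_bound:
  assumes "continuous_on UNIV f" "\<And>x. cmod (f x) \<le> B"
  shows "cmod (hcoeff i k f x) \<le> B * (LINT t|lborel. \<bar>hermite k t\<bar>)"
proof -
  have "cmod (hcoeff i k f x) \<le> (LINT t|lborel. cmod (complex_of_real (hermite k t) * f (upd x i t)))"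
    unfolding hcoeff_def by (rule integral_norm_bound)
  also have "\<dots> \<le> (LINT t|lborel. \<bar>hermite k t\<bar> * B)"
    using integrable_norm[OF integrable_hermite_mult[OF assms, of k x i]]
      schwartz1_integrable[OF schwartz1_hermite[of k]]
    by (intro integral_mono) (auto simp: norm_mult intro!: mult_left_mono assms(2))
  finally show ?thesis by (simp add: mult.commute)
qed

text \<open>The Taylor remainder of \<open>f\<close> is uniformly bounded by a multiple of the
  squared increment. Integration against the absolute value of \<open>hermite k\<close> preserves
  this, and a quadratic remainder determines the derivative.\<close>

lemma hcoeff_derivative:
  assumes f: "rdec f"
  shows "hcoeff i k f differentiable (at x)"
    and "partial j (hcoeff i k f) x = (if j = i then 0 else hcoeff i k (partial j f) x)"
proof -
  obtain \<omega> where w: "ladder_bdd f \<omega>" using f unfolding rdec_def by blast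
  define c where "c j = (if j = i then 0 else hcoeff i k (partial j f) x)" for j
  define B where "B = \<omega> 2"
  have B: "cmod (partial a (partial b f) y) \<le> B" for a b y
    using ladder_bdd_0[OF ladder_bdd_partial[OF smooth_partial ladder_bdd_partial[OF _ w]]] rdec_smooth[OF f]
    by (simp add: B_def numeral_2_eq_2)
  let ?N = "LINT t|lborel. \<bar>hermite k t\<bar>"
  have est: "cmod (hcoeff i k f (x + v) - hcoeff i k f x - (\<Sum>j\<in>UNIV. of_real (v $ j) * c j))
      \<le> (B * ?N) * (\<Sum>j\<in>UNIV. \<bar>v $ j\<bar>)\<^sup>2" for v
  proof -
    \<comment> \<open>The slice integral does not see coordinate i, so the increment is used with
      that entry erased; this is also why \<open>c i\<close> is 0.\<close>
    define u where "u = upd v i 0"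
    define S where "S = (\<Sum>j\<in>UNIV. \<bar>u $ j\<bar>)"
    define r where "r y = f (y + u) - f y - (\<Sum>j\<in>UNIV. of_real (u $ j) * partial j f y)" for y
    have ic: "integrable lborel (\<lambda>t. complex_of_real (hermite k t) * g (upd x i t))" if "rdec g" for g
      using that by (rule integrable_hermite_mult_rdec)
    have cu: "continuous_on UNIV (\<lambda>y. f (y + u))"
      by (rule continuous_on_compose2[OF smooth_cont[OF rdec_smooth[OF f]]])
        (auto intro: continuous_on_add continuous_on_id continuous_on_const)
    have iu: "integrable lborel (\<lambda>t. complex_of_real (hermite k t) * f (upd x i t + u))"
      using integrable_hermite_mult[OF cu, of "\<omega> 0" k x i] ladder_bdd_0[OF w] by simp
    have "hcoeff i k r x = hcoeff i k f (x + v) - hcoeff i k f x - (\<Sum>j\<in>UNIV. of_real (u $ j) * hcoeff i k (partial j f) x)"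
    proof -
      have "hcoeff i k r x = (LINT t|lborel. complex_of_real (hermite k t) * f (upd x i t + u)
          - complex_of_real (hermite k t) * f (upd x i t)
          - (\<Sum>j\<in>UNIV. of_real (u $ j) * (complex_of_real (hermite k t) * partial j f (upd x i t))))"
        unfolding hcoeff_def r_def by (simp add: right_diff_distrib sum_distrib_left mult.left_commute)
      also have "\<dots> = (LINT t|lborel. complex_of_real (hermite k t) * f (upd x i t + u))
          - (LINT t|lborel. complex_of_real (hermite k t) * f (upd x i t))
          - (\<Sum>j\<in>UNIV. of_real (u $ j) * (LINT t|lborel. complex_of_real (hermite k t) * partial j f (upd x i t)))"
        using iu ic[OF f] ic[OF rdec_partial[OF f]] by simp
      finally show ?thesis by (simp add: hcoeff_def upd_add u_def)
    qed
    also have "(\<Sum>j\<in>UNIV. of_real (u $ j) * hcoeff i k (partial j f) x) = (\<Sum>j\<in>UNIV. of_real (v $ j) * c j)"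
      by (rule sum.cong) (auto simp: u_def c_def upd_nth)
    finally have eq: "hcoeff i k r x = hcoeff i k f (x + v) - hcoeff i k f x - (\<Sum>j\<in>UNIV. of_real (v $ j) * c j)" .
    have "cmod (hcoeff i k r x) \<le> (B * S\<^sup>2) * ?N"
    proof (rule hcoeff_bound)
      show "continuous_on UNIV r"
        unfolding r_def[abs_def]
        by (intro continuous_intros cu smooth_cont rdec_smooth rdec_partial f)
      show "cmod (r y) \<le> B * S\<^sup>2" for y
        unfolding r_def S_def by (rule second_order_bound[OF rdec_smooth[OF f] B])
    qed
    also have "\<dots> = (B * ?N) * S\<^sup>2" by simp
    also have "\<dots> \<le> (B * ?N) * (\<Sum>j\<in>UNIV. \<bar>v $ j\<bar>)\<^sup>2"
    proof (intro mult_left_mono power_mono)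
      show "S \<le> (\<Sum>j\<in>UNIV. \<bar>v $ j\<bar>)"
        unfolding S_def by (intro sum_mono) (auto simp: u_def upd_nth)
      show "0 \<le> S" by (simp add: S_def sum_nonneg)
      show "0 \<le> B * ?N" using ladder_bdd_nonneg[OF w] by (auto simp: B_def)
    qed
    finally show ?thesis by (simp only: eq)
  qed
  show "hcoeff i k f differentiable (at x)"
    and "partial j (hcoeff i k f) x = (if j = i then 0 else hcoeff i k (partial j f) x)"
    using second_order_partial[OF est] by (auto simp: c_def)
qed

lemma smooth_hcoeff:
  assumes "rdec f"
  shows "smooth (hcoeff i k f)"
proof -
  have "Ck m (hcoeff i k f)" for m
    using assms
  proof (induction m arbitrary: f)
    case 0
    then show ?case using hcoeff_derivative(1)[OF 0]
      by (simp add: differentiable_imp_continuous_within continuous_on_eq_continuous_within)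
  next
    case (Suc m)
    have "Ck m (partial j (hcoeff i k f))" for j
    proof -
      have "partial j (hcoeff i k f) = (if j = i then (\<lambda>x. 0) else hcoeff i k (partial j f))"
        by (rule ext) (simp add: hcoeff_derivative(2)[OF Suc.prems])
      then show ?thesis using Suc.IH[OF rdec_partial[OF Suc.prems]] Ck_const by auto
    qed
    then show ?case using hcoeff_derivative(1)[OF Suc.prems] by simp
  qed
  then show ?thesis by (simp add: smooth_def)
qed

section \<open>The projection in one coordinate and its commutation with ladder operators\<close>

definition hfun :: "'n \<Rightarrow> nat \<Rightarrow> real^'n::finite \<Rightarrow> complex" where
  "hfun i k x = complex_of_real (hermite k (x $ i))"

lemma hfun_derivative:
  shows "hfun i k differentiable (at x)"
    and "partial j (hfun i k) x = (if j = i then of_real (deriv (hermite k) (x $ i)) else 0)"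
proof -
  have 1: "((\<lambda>x. hermite k (x $ i)) has_derivative (\<lambda>v. deriv (hermite k) (x $ i) * (v $ i))) (at x)"
  proof -
    have "((\<lambda>x. x $ i) has_derivative (\<lambda>v. v $ i)) (at x)"
      by (rule bounded_linear_imp_has_derivative[OF bounded_linear_vec_nth])
    from has_derivative_compose[OF this schwartz1_DERIV[OF schwartz1_hermite[of k],
          unfolded has_field_derivative_def]]
    show ?thesis .
  qed
  have d: "(hfun i k has_derivative (\<lambda>v. complex_of_real (deriv (hermite k) (x $ i) * (v $ i)))) (at x)"
    unfolding hfun_def[abs_def] by (rule has_derivative_of_real[OF 1])
  then show "hfun i k differentiable (at x)" by (rule differentiableI)
  show "partial j (hfun i k) x = (if j = i then of_real (deriv (hermite k) (x $ i)) else 0)"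
    using partial_eq[OF d, of j] by (auto simp: axis_def)
qed

lemma smooth_hfun: "smooth (hfun i k)"
proof -
  have "Ck m (hfun i k)" for m
  proof (induction m arbitrary: k)
    case 0
    show ?case
      by (auto simp: continuous_on_eq_continuous_within
          intro!: differentiable_imp_continuous_within hfun_derivative(1))
  next
    case (Suc m)
    have "Ck m (partial j (hfun i k))" for j
    proof -
      \<comment> \<open>Reading \<open>raise\<close> backwards, the derivative of
        \<open>hermite k\<close> is x times \<open>hermite k\<close> minus
        \<open>hermite (Suc k)\<close>, so the induction stays within the family.\<close>
      have "partial j (hfun i k) = (if j = i then (\<lambda>x. of_real (x $ i) * hfun i k x + (-1) * hfun i (Suc k) x) else (\<lambda>x. 0))"
        by (rule ext) (simp add: hfun_derivative(2), simp add: hfun_def raise_def)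
      moreover have "Ck m (\<lambda>x. of_real (x $ i) * hfun i k x + (-1) * hfun i (Suc k) x)"
        by (intro Ck_add Ck_mult Ck_coord Ck_const Suc.IH)
      ultimately show ?thesis using Ck_const by auto
    qed
    then show ?case by (simp add: hfun_derivative(1))
  qed
  then show ?thesis by (simp add: smooth_def)
qed

definition hproj1 :: "'n \<Rightarrow> nat \<Rightarrow> (real^'n::finite \<Rightarrow> complex) \<Rightarrow> real^'n \<Rightarrow> complex" where
  "hproj1 i k f = (\<lambda>x. of_real (1 / hermite_sqnorm k) * (hfun i k x * hcoeff i k f x))"

definition hproj :: "'n \<Rightarrow> nat \<Rightarrow> (real^'n::finite \<Rightarrow> complex) \<Rightarrow> real^'n \<Rightarrow> complex" where
  "hproj i n f = (\<lambda>x. \<Sum>k<n. hproj1 i k f x)"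

lemma smooth_hproj1: "rdec f \<Longrightarrow> smooth (hproj1 i k f)"
  unfolding hproj1_def by (intro smooth_cmult smooth_mult smooth_hfun smooth_hcoeff)

lemma smooth_hproj: "rdec f \<Longrightarrow> smooth (hproj i n f)"
  unfolding hproj_def by (intro smooth_sum smooth_hproj1)

lemma hproj_0: "hproj i 0 f = (\<lambda>x. 0)"
  by (simp add: hproj_def)

lemma ladder_zero: "ladder l (\<lambda>x. 0) = (\<lambda>x. 0)"
  using word_zero[of "[l]"] by (simp add: word_Cons)

lemma ladder_sum:
  "(\<And>i. i \<in> I \<Longrightarrow> smooth (f i)) \<Longrightarrow> ladder l (\<lambda>x. \<Sum>i\<in>I. f i x) = (\<lambda>x. \<Sum>i\<in>I. ladder l (f i) x)"
  using word_sum[of I f "[l]"] by (simp add: word_Cons)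

text \<open>Since \<open>hcoeff i k f\<close> is constant in coordinate i, a ladder operator in
  direction i falls on the Hermite factor alone; in every other direction it passes under the
  integral to \<open>f\<close>.\<close>

lemma ladder_hproj1:
  assumes "rdec f"
  shows "ladder (j, b) (hproj1 i k f) x = of_real (1 / hermite_sqnorm k) *
    (if j = i then of_real ((if b then lower (hermite k) else hermite (Suc k)) (x $ i)) * hcoeff i k f x
     else hfun i k x * hcoeff i k (ladder (j, b) f) x)"
proof -
  have p: "partial j (\<lambda>x. hfun i k x * hcoeff i k f x) x
    = hfun i k x * partial j (hcoeff i k f) x + partial j (hfun i k) x * hcoeff i k f x"
    by (intro partial_mult smooth_differentiable smooth_hfun smooth_hcoeff assms)
  have "ladder (j, b) (hproj1 i k f) x = of_real (1 / hermite_sqnorm k) *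
      ladder (j, b) (\<lambda>x. hfun i k x * hcoeff i k f x) x"
    unfolding hproj1_def by (subst ladder_cmult) (auto intro!: smooth_mult smooth_hfun smooth_hcoeff assms)
  also have "ladder (j, b) (\<lambda>x. hfun i k x * hcoeff i k f x) x =
    (if j = i then of_real ((if b then lower (hermite k) else hermite (Suc k)) (x $ i)) * hcoeff i k f x
     else hfun i k x * hcoeff i k (ladder (j, b) f) x)"
  proof (cases "j = i")
    case True
    then show ?thesis
      unfolding ladder_def using p
      by (simp add: hfun_derivative hcoeff_derivative[OF assms]) (simp add: hfun_def lower_def raise_def algebra_simps)
  next
    case False
    have "ladder (j, b) f = (\<lambda>x. xmult j f x + (if b then 1 else -1) * partial j f x)"
      by (simp add: ladder_def xmult_def)
    then have "hcoeff i k (ladder (j, b) f) x = of_real (x $ j) * hcoeff i k f x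
        + (if b then 1 else -1) * hcoeff i k (partial j f) x"
      using False by (simp only: hcoeff_add rdec_xmult rdec_cmult rdec_partial assms hcoeff_cmult hcoeff_xmult[OF False])
    then show ?thesis
      unfolding ladder_def using p False
      by (simp add: hfun_derivative hcoeff_derivative[OF assms] algebra_simps)
  qed
  finally show ?thesis .
qed

lemma ladder_hproj_other:
  assumes "rdec f" "j \<noteq> i"
  shows "ladder (j, b) (hproj i n f) = hproj i n (ladder (j, b) f)"
proof -
  have "ladder (j, b) (hproj i n f) = (\<lambda>x. \<Sum>k<n. ladder (j, b) (hproj1 i k f) x)"
    unfolding hproj_def by (intro ladder_sum smooth_hproj1 assms)
  also have "\<dots> = hproj i n (ladder (j, b) f)"
    unfolding hproj_def using assms by (simp add: ladder_hproj1) (simp add: hproj1_def)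
  finally show ?thesis .
qed

lemma ladder_hproj_lower:
  assumes "rdec f"
  shows "ladder (i, True) (hproj i (Suc n) f) = hproj i n (ladder (i, True) f)"
proof
  fix x
  have "ladder (i, True) (hproj i (Suc n) f) x = (\<Sum>k<Suc n. ladder (i, True) (hproj1 i k f) x)"
    unfolding hproj_def by (subst ladder_sum) (auto intro: smooth_hproj1 assms)
  also have "\<dots> = (\<Sum>k<n. ladder (i, True) (hproj1 i (Suc k) f) x)"
    by (subst sum.lessThan_Suc_shift) (simp add: ladder_hproj1 assms lower_hermite_0 del: hermite.simps)
  also have "\<dots> = (\<Sum>k<n. hproj1 i k (ladder (i, True) f) x)"
  proof (rule sum.cong)
    fix k
    have "hermite_sqnorm k \<noteq> 0" using hermite_sqnorm_pos[of k] by simp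
    then show "ladder (i, True) (hproj1 i (Suc k) f) x = hproj1 i k (ladder (i, True) f) x"
      using assms unfolding hproj1_def[of i k "ladder (i, True) f"]
      by (simp add: ladder_hproj1 hcoeff_lower lower_hermite_Suc hermite_sqnorm_Suc hfun_def
          del: hermite.simps of_nat_Suc)
  qed simp
  finally show "ladder (i, True) (hproj i (Suc n) f) x = hproj i n (ladder (i, True) f) x"
    by (simp add: hproj_def)
qed

lemma ladder_hproj_raise:
  assumes "rdec f"
  shows "ladder (i, False) (hproj i n f) = hproj i (Suc n) (ladder (i, False) f)"
proof
  fix x
  have "hproj i (Suc n) (ladder (i, False) f) x = (\<Sum>k<n. hproj1 i (Suc k) (ladder (i, False) f) x)"
    unfolding hproj_def
    by (subst sum.lessThan_Suc_shift) (simp add: hproj1_def hcoeff_raise_0 assms)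
  also have "\<dots> = (\<Sum>k<n. ladder (i, False) (hproj1 i k f) x)"
  proof (rule sum.cong)
    fix k
    have "hermite_sqnorm k \<noteq> 0" using hermite_sqnorm_pos[of k] by simp
    then show "hproj1 i (Suc k) (ladder (i, False) f) x = ladder (i, False) (hproj1 i k f) x"
      using assms unfolding hproj1_def[of i "Suc k"]
      by (simp add: ladder_hproj1 hcoeff_raise_Suc hermite_sqnorm_Suc hfun_def
          del: hermite.simps of_nat_Suc)
  qed simp
  also have "\<dots> = ladder (i, False) (hproj i n f) x"
    unfolding hproj_def by (subst ladder_sum) (auto intro: smooth_hproj1 assms)
  finally show "ladder (i, False) (hproj i n f) x = hproj i (Suc n) (ladder (i, False) f) x" by simp
qed

text \<open>A letter in direction i moves the cutoff by at most one and the other letters leave it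
  alone; a cutoff of 0 stays 0 under lowering. Only the loss has to be recorded, as a smaller cutoff
  weakens the residual estimate.\<close>

lemma word_hproj:
  assumes "rdec f"
  shows "\<exists>m. n \<le> m + length w \<and> word w (hproj i n f) = hproj i m (word w f)"
proof (induction w)
  case (Cons l w)
  then obtain m where m: "n \<le> m + length w" "word w (hproj i n f) = hproj i m (word w f)" by blast
  note w = rdec_word[OF assms, of w]
  obtain j b where l: "l = (j, b)" by (cases l) auto
  consider "j \<noteq> i" | "j = i" "b" "m = 0" | m' where "j = i" "b" "m = Suc m'" | "j = i" "\<not> b"
    by (cases m) auto
  then show ?case
  proof cases
    case 1
    then show ?thesis using m w by (intro exI[of _ m]) (simp add: word_Cons l ladder_hproj_other)
  next
    case 2
    then show ?thesis using m by (intro exI[of _ 0]) (simp add: word_Cons l hproj_0 ladder_zero)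
  next
    case (3 m')
    then show ?thesis using m w by (intro exI[of _ m']) (simp add: word_Cons l ladder_hproj_lower)
  next
    case 4
    then show ?thesis using m w by (intro exI[of _ "Suc m"]) (simp add: word_Cons l ladder_hproj_raise)
  qed
qed (auto intro: exI[of _ n])

lemma Re_hproj:
  assumes "rdec f"
  shows "Re (hproj i n f x) = hermite_proj n (\<lambda>t. Re (f (upd x i t))) (x $ i)"
  unfolding hproj_def hermite_proj_def
  by (simp add: hproj1_def hfun_def hermite_coeff_def Re_hcoeff[OF assms, symmetric] mult.commute)

lemma hproj_cmult: "hproj i n (\<lambda>x. c * f x) = (\<lambda>x. c * hproj i n f x)"
  unfolding hproj_def hproj1_def by (simp add: hcoeff_cmult sum_distrib_left mult_ac)

text \<open>The estimate on the line is applied to the real parts of f and \<i> f, which doubles 3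
  to 6. Its hypothesis on (1 + t^2) |lower u| takes one ladder operator for the term 1 and two
  further multiplications by x_i for t^2, whence \<omega> 1 + \<omega> 3.\<close>

lemma hproj_residual:
  assumes f: "rdec f" and w: "ladder_bdd f \<omega>" and n: "n \<ge> 1"
  shows "cmod (f x - hproj i n f x) \<le> 6 * (\<omega> 1 + \<omega> 3) / real n powr (1/4)"
proof -
  have R: "\<bar>Re (f x - hproj i n f x)\<bar> \<le> 3 * (\<omega> 1 + \<omega> 3) / real n powr (1/4)"
    if f: "rdec f" and w: "ladder_bdd f \<omega>" for f :: "real^'a \<Rightarrow> complex"
  proof -
    let ?u = "\<lambda>t. Re (f (upd x i t))" and ?g = "ladder (i, True) f"
    have "(1 + t\<^sup>2) * \<bar>lower ?u t\<bar> \<le> \<omega> 1 + \<omega> 3" for t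
    proof -
      let ?y = "upd x i t"
      note g = ladder_bdd_ladder[OF w, of "(i, True)"] smooth_ladder[OF rdec_smooth[OF f]]
      have a: "cmod (?g ?y) \<le> \<omega> 1" using ladder_bdd_0[OF g(1)] by simp
      have "cmod (xmult i (xmult i ?g) ?y) \<le> \<omega> 3"
        using ladder_bdd_0[OF ladder_bdd_xmult[OF smooth_xmult ladder_bdd_xmult[OF _ g(1)]]] g(2)
        by (simp add: numeral_3_eq_3)
      then have b: "t\<^sup>2 * cmod (?g ?y) \<le> \<omega> 3"
        by (simp add: xmult_def upd_nth norm_mult power2_eq_square)
      have "(1 + t\<^sup>2) * \<bar>lower ?u t\<bar> \<le> (1 + t\<^sup>2) * cmod (?g ?y)"
        unfolding slice_lower_Re[OF f] by (intro mult_left_mono abs_Re_le_cmod) auto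
      then show ?thesis using a b by (simp add: distrib_right)
    qed
    from hermite_proj_residual_bound[OF schwartz1_slice_Re[OF f] n this, of "x $ i"]
    show ?thesis by (simp add: Re_hproj[OF f] upd_same)
  qed
  have w': "ladder_bdd (\<lambda>x. \<i> * f x) \<omega>"
    using ladder_bdd_cmult[OF rdec_smooth[OF f] w, of \<i>] by simp
  have "cmod (f x - hproj i n f x) \<le> \<bar>Re (f x - hproj i n f x)\<bar> + \<bar>Im (f x - hproj i n f x)\<bar>"
    by (rule cmod_le)
  also have "\<bar>Im (f x - hproj i n f x)\<bar> = \<bar>Re (\<i> * f x - hproj i n (\<lambda>x. \<i> * f x) x)\<bar>"
    unfolding hproj_cmult by simp
  finally show ?thesis using R[OF f w] R[OF rdec_cmult[OF f] w'] by (simp add: add_divide_distrib)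
qed

text \<open>The price of one passage to the residual:
  \<open>\<omega> (k + 1) + \<omega> (k + 3)\<close> is the bound of \<open>hproj_residual\<close>
  after k letters, \<open>\<omega> k\<close> covers the case where the letters have used up the
  cutoff, and \<open>k + 1\<close> compensates for a cutoff lowered by at most k.\<close>

definition res_weight :: "(nat \<Rightarrow> real) \<Rightarrow> nat \<Rightarrow> real" where
  "res_weight \<omega> k = 6 * real (k + 1) * (\<omega> k + \<omega> (k + 1) + \<omega> (k + 3))"

lemma hproj_residual_ladder_bdd:
  assumes f: "rdec f" and w: "ladder_bdd f \<omega>" and n: "n \<ge> 1"
  shows "ladder_bdd (\<lambda>x. f x - hproj i n f x) (\<lambda>k. res_weight \<omega> k / real n powr (1/4))"
  unfolding ladder_bdd_def
proof (intro allI)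
  fix v :: "('a \<times> bool) list" and x :: "real^'a"
  let ?k = "length v"
  obtain m where m: "n \<le> m + ?k" "word v (hproj i n f) = hproj i m (word v f)"
    using word_hproj[OF f] by blast
  have eq: "word v (\<lambda>x. f x - hproj i n f x) x = word v f x - hproj i m (word v f) x"
    using f by (simp add: word_diff rdec_smooth smooth_hproj m(2))
  note nn = ladder_bdd_nonneg[OF w]
  define M where "M = max 1 m"
  \<comment> \<open>For m \<ge> 1 one has m + k \<le> (k + 1) m, so the residual bound at cutoff m
    becomes one at cutoff n up to the factor k + 1. For m = 0 the inequality n \<le> k suffices,
    with M = 1 in place of m.\<close>
  have "n \<le> (?k + 1) * M"
  proof (cases "m = 0")
    case False
    then obtain m' where "m = Suc m'" by (cases m) auto
    then show ?thesis using m(1) by (simp add: M_def algebra_simps)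
  qed (use m(1) in \<open>simp add: M_def\<close>)
  then have "real n \<le> real (?k + 1) * real M" by (metis of_nat_le_iff of_nat_mult)
  then have "real n powr (1/4) \<le> (real (?k + 1) * real M) powr (1/4)" by (intro powr_mono2) auto
  also have "\<dots> = real (?k + 1) powr (1/4) * real M powr (1/4)" by (simp add: powr_mult)
  also have "\<dots> \<le> real (?k + 1) powr 1 * real M powr (1/4)"
    by (intro mult_right_mono powr_mono) auto
  finally have np: "real n powr (1/4) \<le> real (?k + 1) * real M powr (1/4)" by simp
  have "cmod (word v f x - hproj i m (word v f) x) \<le> 6 * (\<omega> ?k + \<omega> (?k + 1) + \<omega> (?k + 3)) / real M powr (1/4)"
  proof (cases "m = 0")
    case True
    then show ?thesis using ladder_bddD[OF w, of v x] nn[of ?k] nn[of "?k + 1"] nn[of "?k + 3"]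
      by (simp add: M_def hproj_0)
  next
    case False
    have "cmod (word v f x - hproj i m (word v f) x) \<le> 6 * (\<omega> (1 + ?k) + \<omega> (3 + ?k)) / real m powr (1/4)"
      using False by (intro hproj_residual rdec_word f ladder_bdd_word w) auto
    also have "\<dots> \<le> 6 * (\<omega> ?k + \<omega> (?k + 1) + \<omega> (?k + 3)) / real m powr (1/4)"
      using nn[of ?k] by (intro divide_right_mono) (auto simp: add.commute)
    finally show ?thesis using False by (simp add: M_def max_def)
  qed
  also have "\<dots> \<le> res_weight \<omega> ?k / real n powr (1/4)"
  proof -
    define A where "A = 6 * (\<omega> ?k + \<omega> (?k + 1) + \<omega> (?k + 3))"
    have A: "A \<ge> 0" using nn by (simp add: A_def)
    have p: "real n powr (1/4) > 0" "real M powr (1/4) > 0" using n by (auto simp: M_def)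
    have "A * real n powr (1/4) \<le> A * (real (?k + 1) * real M powr (1/4))"
      by (intro mult_left_mono np A)
    then have "A / real M powr (1/4) \<le> (real (?k + 1) * A) / real n powr (1/4)"
      using p by (simp add: divide_simps mult_ac)
    moreover have "res_weight \<omega> ?k = real (?k + 1) * A"
      by (simp only: res_weight_def A_def mult_ac)
    ultimately show ?thesis by (simp only: A_def)
  qed
  finally show "cmod (word v (\<lambda>x. f x - hproj i n f x) x) \<le> res_weight \<omega> ?k / real n powr (1/4)"
    by (simp only: eq)
qed

section \<open>Weight classes and Hermite projections\<close>

lemma ladder_bdd_zero: "(\<And>k. 0 \<le> \<omega> k) \<Longrightarrow> ladder_bdd (\<lambda>x. 0) \<omega>"
  by (simp add: ladder_bdd_def word_zero)

lemma rdec_zero: "rdec (\<lambda>x. 0)"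
  using smooth_const ladder_bdd_zero[of "\<lambda>_. 0"] unfolding rdec_def by blast

lemma rdec_sum: "(\<And>i. i \<in> I \<Longrightarrow> rdec (f i)) \<Longrightarrow> rdec (\<lambda>x. \<Sum>i\<in>I. f i x)"
  by (induction I rule: infinite_finite_induct) (auto intro: rdec_zero rdec_add)

text \<open>The coefficients need no separate estimate: the projection is f minus its residual,
  which is already known to be ladder bounded.\<close>

lemma rdec_hproj:
  assumes "rdec f"
  shows "rdec (hproj i n f)"
proof (cases "n = 0")
  case True
  then show ?thesis by (simp add: hproj_0 rdec_zero)
next
  case False
  obtain \<omega> where w: "ladder_bdd f \<omega>" using assms unfolding rdec_def by blast
  have "rdec (\<lambda>x. f x - hproj i n f x)"
    using hproj_residual_ladder_bdd[OF assms w, of n i] False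
      smooth_diff[OF rdec_smooth[OF assms] smooth_hproj[OF assms]]
    unfolding rdec_def by auto
  from rdec_diff[OF assms this] show ?thesis by simp
qed

lemma rdec_hproj1:
  assumes "rdec f"
  shows "rdec (hproj1 i k f)"
  using rdec_diff[OF rdec_hproj[OF assms, of i "Suc k"] rdec_hproj[OF assms, of i k]]
  by (simp add: hproj_def)

lemma hcoeff_sum:
  "(\<And>a. a \<in> I \<Longrightarrow> rdec (f a)) \<Longrightarrow> hcoeff i k (\<lambda>x. \<Sum>a\<in>I. f a x) x = (\<Sum>a\<in>I. hcoeff i k (f a) x)"
proof (induction I rule: infinite_finite_induct)
  case (insert a I)
  then show ?case by (simp add: hcoeff_add rdec_sum)
qed (simp_all add: hcoeff_def)

lemma hcoeff_upd: "hcoeff i k f (upd x i t) = hcoeff i k f x"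
proof -
  have "upd (upd x i t) i s = upd x i s" for s by (simp add: vec_eq_iff upd_nth)
  then show ?thesis by (simp add: hcoeff_def)
qed

lemma hcoeff_hproj1: "hcoeff i l (hproj1 i k f) x = (if l = k then hcoeff i k f x else 0)"
proof -
  have "hcoeff i l (hproj1 i k f) x = (LINT t|lborel. of_real (hermite l t * hermite k t)
      * (of_real (1 / hermite_sqnorm k) * hcoeff i k f x))"
    unfolding hcoeff_def[of i l] hproj1_def by (simp add: hcoeff_upd hfun_def upd_nth mult_ac)
  also have "\<dots> = (LINT t|lborel. complex_of_real (hermite l t * hermite k t)) * (of_real (1 / hermite_sqnorm k) * hcoeff i k f x)"
    by (rule integral_mult_left_zero)
  also have "(LINT t|lborel. complex_of_real (hermite l t * hermite k t)) = of_real (ip (hermite l) (hermite k))"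
    by (simp only: integral_complex_of_real ip_def)
  finally show ?thesis using hermite_sqnorm_pos[of k] by (simp add: ip_hermite)
qed

text \<open>By orthogonality f and its projection have the same coefficients below n, so the
  projection annihilates the residual.\<close>

lemma hproj_diff_self:
  assumes "rdec f"
  shows "hproj i n (\<lambda>x. f x - hproj i n f x) = (\<lambda>x. 0)"
proof -
  have "hcoeff i l (\<lambda>x. f x + (-1) * hproj i n f x) x = 0" if "l < n" for l x
  proof -
    have "hcoeff i l (hproj i n f) x = hcoeff i l f x"
      unfolding hproj_def using assms that by (simp add: hcoeff_sum rdec_hproj1 hcoeff_hproj1)
    then show ?thesis
      by (subst hcoeff_add[OF assms rdec_cmult[OF rdec_hproj[OF assms]]]) (simp only: hcoeff_cmult, simp)
  qed
  then show ?thesis by (simp add: hproj_def hproj1_def)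
qed

text \<open>Since \<open>hproj i n\<close> is a projection, the residual can be taken repeatedly, which improves the rate.\<close>

lemma hproj_residual_iterate:
  assumes f: "rdec f" and w: "ladder_bdd f \<omega>" and n: "n \<ge> 1"
  shows "ladder_bdd (\<lambda>x. f x - hproj i n f x) (\<lambda>k. (res_weight ^^ Suc M) \<omega> k / real n powr (real (Suc M) / 4))"
proof (induction M)
  case 0
  show ?case using hproj_residual_ladder_bdd[OF f w n] by simp
next
  case (Suc M)
  let ?r = "\<lambda>x. f x - hproj i n f x"
  have r: "rdec ?r" by (intro rdec_diff f rdec_hproj)
  have h: "res_weight (\<lambda>k. \<omega> k / c) = (\<lambda>k. res_weight \<omega> k / c)" for \<omega> and c :: real
    by (rule ext) (simp only: res_weight_def add_divide_distrib[symmetric] times_divide_eq_right)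
  have p: "real n powr (real (Suc (Suc M)) / 4) = real n powr (real (Suc M) / 4) * real n powr (1/4)"
    by (simp add: powr_add[symmetric] add_divide_distrib)
  show ?case
    using hproj_residual_ladder_bdd[OF r Suc n, of i]
    unfolding hproj_diff_self[OF f] h p by simp
qed

text \<open>Each closure property answers one demand: \<open>shift\<close> that of a ladder
  operator, \<open>add\<close>, \<open>scale\<close> and \<open>index_mult\<close> the formula of
  \<open>res_weight\<close>, \<open>split\<close> the separation of the two variables of a kernel,
  and \<open>gauss\<close> the weights of Hermite functions, so that projections land in every
  class.\<close>

locale weight_class =
  fixes W :: "(nat \<Rightarrow> real) set"
  assumes nonneg: "\<omega> \<in> W \<Longrightarrow> 0 \<le> \<omega> k"
    and add: "\<omega> \<in> W \<Longrightarrow> \<omega>' \<in> W \<Longrightarrow> (\<lambda>k. \<omega> k + \<omega>' k) \<in> W"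
    and scale: "\<omega> \<in> W \<Longrightarrow> 0 \<le> c \<Longrightarrow> (\<lambda>k. c * \<omega> k) \<in> W"
    and shift: "\<omega> \<in> W \<Longrightarrow> (\<lambda>k. \<omega> (Suc k)) \<in> W"
    and index_mult: "\<omega> \<in> W \<Longrightarrow> (\<lambda>k. real (Suc k) * \<omega> k) \<in> W"
    and split: "\<omega> \<in> W \<Longrightarrow> \<exists>\<omega>'\<in>W. \<forall>j k. \<omega> (j + k) \<le> \<omega>' j * \<omega>' k"
    and gauss: "0 < R \<Longrightarrow> (\<lambda>k. R ^ k * sqrt (fact k)) \<in> W"

definition wspace :: "(nat \<Rightarrow> real) set \<Rightarrow> (real^'n::finite \<Rightarrow> complex) set" where
  "wspace W = {f. smooth f \<and> (\<exists>\<omega>\<in>W. ladder_bdd f \<omega>)}"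

lemma wspace_rdec: "f \<in> wspace W \<Longrightarrow> rdec f"
  unfolding wspace_def rdec_def by blast

lemma wspace_smooth: "f \<in> wspace W \<Longrightarrow> smooth f"
  unfolding wspace_def by blast

lemma wspaceI: "smooth f \<Longrightarrow> \<omega> \<in> W \<Longrightarrow> ladder_bdd f \<omega> \<Longrightarrow> f \<in> wspace W"
  unfolding wspace_def by blast

context weight_class
begin

lemma shift_add: "\<omega> \<in> W \<Longrightarrow> (\<lambda>k. \<omega> (k + j)) \<in> W"
proof (induction j)
  case (Suc j)
  then show ?case using shift[of "\<lambda>k. \<omega> (k + j)"] by simp
qed simp

lemma res_weight_closed: "\<omega> \<in> W \<Longrightarrow> res_weight \<omega> \<in> W"
proof -
  assume w: "\<omega> \<in> W"
  have "(\<lambda>k. 6 * (real (Suc k) * (\<omega> k + \<omega> (k + 1) + \<omega> (k + 3)))) \<in> W"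
    by (rule scale[OF index_mult[OF add[OF add[OF w shift_add[OF w]] shift_add[OF w]]]]) simp
  then show ?thesis by (simp only: res_weight_def[abs_def] mult.assoc Suc_eq_plus1)
qed

lemma res_weight_iterate_closed: "\<omega> \<in> W \<Longrightarrow> (res_weight ^^ M) \<omega> \<in> W"
  by (induction M) (auto intro: res_weight_closed)

lemma wspace_add: "f \<in> wspace W \<Longrightarrow> g \<in> wspace W \<Longrightarrow> (\<lambda>x. f x + g x) \<in> wspace W"
  unfolding wspace_def by (blast intro: smooth_add ladder_bdd_add add)

lemma wspace_cmult: "f \<in> wspace W \<Longrightarrow> (\<lambda>x. c * f x) \<in> wspace W"
  unfolding wspace_def using scale norm_ge_zero by (blast intro: smooth_cmult ladder_bdd_cmult)

lemma wspace_diff: "f \<in> wspace W \<Longrightarrow> g \<in> wspace W \<Longrightarrow> (\<lambda>x. f x - g x) \<in> wspace W"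
  using wspace_add[OF _ wspace_cmult[of g "-1"], of f] by simp

lemma wspace_zero: "(\<lambda>x. 0) \<in> wspace W"
  using gauss[of 1] by (intro wspaceI[of _ "\<lambda>k. 1 ^ k * sqrt (fact k)"] smooth_const ladder_bdd_zero) auto

lemma wspace_sum: "(\<And>i. i \<in> I \<Longrightarrow> f i \<in> wspace W) \<Longrightarrow> (\<lambda>x. \<Sum>i\<in>I. f i x) \<in> wspace W"
  by (induction I rule: infinite_finite_induct) (auto intro: wspace_zero wspace_add)

lemma wspace_partial: "f \<in> wspace W \<Longrightarrow> partial i f \<in> wspace W"
  and wspace_xmult: "f \<in> wspace W \<Longrightarrow> xmult i f \<in> wspace W"
  and wspace_ladder: "f \<in> wspace W \<Longrightarrow> ladder l f \<in> wspace W"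
  unfolding wspace_def
  using shift by (blast intro: smooth_partial smooth_xmult smooth_ladder ladder_bdd_partial
      ladder_bdd_xmult ladder_bdd_ladder)+

lemma wspace_word: "f \<in> wspace W \<Longrightarrow> word w f \<in> wspace W"
  by (induction w) (auto simp: word_Cons wspace_ladder)

end

section \<open>Projections in several coordinates and their finite rank\<close>

definition hprojs :: "nat \<Rightarrow> 'n list \<Rightarrow> (real^'n::finite \<Rightarrow> complex) \<Rightarrow> real^'n \<Rightarrow> complex" where
  "hprojs n L f = foldr (\<lambda>i. hproj i n) L f"

lemma hprojs_Nil: "hprojs n [] f = f"
  and hprojs_Cons: "hprojs n (i # L) f = hproj i n (hprojs n L f)"
  by (simp_all add: hprojs_def)

lemma rdec_hprojs: "rdec f \<Longrightarrow> rdec (hprojs n L f)"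
  by (induction L) (auto simp: hprojs_def rdec_hproj)

text \<open>One coordinate at a time, through f - P g = (f - g) + (g - P g) with g the projection in
  the coordinates already treated. The new weight depends on \<omega>, M and the coordinates but not
  on f or n, which makes this an operator estimate.\<close>

lemma (in weight_class) hprojs_residual:
  fixes L :: "'n::finite list"
  assumes w: "\<omega> \<in> W" and M: "M \<ge> 1"
  shows "\<exists>\<omega>'\<in>W. \<forall>n\<ge>1. \<forall>f. smooth f \<longrightarrow> ladder_bdd f \<omega> \<longrightarrow>
    ladder_bdd (\<lambda>x. f x - hprojs n L f x) (\<lambda>k. \<omega>' k / real n ^ M)"
proof (induction L)
  case Nil
  then show ?case using w nonneg by (auto simp: hprojs_Nil intro!: ladder_bdd_zero bexI[of _ \<omega>])
next
  case (Cons i L)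
  then obtain \<omega>1 where w1: "\<omega>1 \<in> W" and IH: "\<And>n f. n \<ge> 1 \<Longrightarrow> smooth f \<Longrightarrow> ladder_bdd f \<omega> \<Longrightarrow>
    ladder_bdd (\<lambda>x. f x - hprojs n L f x) (\<lambda>k. \<omega>1 k / real n ^ M)" by blast
  \<comment> \<open>Each residual gains n^(-1/4), so 4 M rounds gain n^(-M). The initial weight
    bounds \<open>hprojs n L f\<close>, written as f minus its residual, for every n \<ge>
    1.\<close>
  define \<omega>2 where "\<omega>2 = (res_weight ^^ (4 * M)) (\<lambda>k. \<omega> k + \<omega>1 k)"
  have w2: "\<omega>2 \<in> W" unfolding \<omega>2_def by (intro res_weight_iterate_closed add w w1)
  show ?case
  proof (intro bexI[OF _ add[OF w1 w2]] allI impI)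
    fix n :: nat and f :: "real^'n \<Rightarrow> complex"
    assume n: "n \<ge> 1" and s: "smooth f" and b: "ladder_bdd f \<omega>"
    have f: "rdec f" using s b by (auto simp: rdec_def)
    let ?g = "hprojs n L f"
    have g: "rdec ?g" by (rule rdec_hprojs[OF f])
    have n1: "1 \<le> real n ^ M" using n by (intro one_le_power) auto
    have "ladder_bdd (\<lambda>x. f x - (f x - ?g x)) (\<lambda>k. \<omega> k + \<omega>1 k / real n ^ M)"
      by (intro ladder_bdd_diff s smooth_diff b IH n rdec_smooth g)
    then have "ladder_bdd (\<lambda>x. f x - (f x - ?g x)) (\<lambda>k. \<omega> k + \<omega>1 k)"
    proof (rule ladder_bdd_mono)
      fix k
      have "\<omega>1 k / real n ^ M \<le> \<omega>1 k / 1" using n n1 nonneg[OF w1, of k] by (intro divide_left_mono) auto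
      then show "\<omega> k + \<omega>1 k / real n ^ M \<le> \<omega> k + \<omega>1 k" by simp
    qed
    then have gb: "ladder_bdd ?g (\<lambda>k. \<omega> k + \<omega>1 k)" by simp
    obtain M' where M': "4 * M = Suc M'" using M by (cases "4 * M") auto
    have "real n powr (real (4 * M) / 4) = real n ^ M" using n by (simp add: powr_realpow)
    then have "ladder_bdd (\<lambda>x. ?g x - hproj i n ?g x) (\<lambda>k. \<omega>2 k / real n ^ M)"
      using hproj_residual_iterate[OF g gb n, of i M'] unfolding \<omega>2_def M' by simp
    then have "ladder_bdd (\<lambda>x. (f x - ?g x) + (?g x - hproj i n ?g x)) (\<lambda>k. \<omega>1 k / real n ^ M + \<omega>2 k / real n ^ M)"
      by (intro ladder_bdd_add smooth_diff s rdec_smooth[OF g] rdec_smooth[OF rdec_hproj[OF g]] IH n b)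
    then show "ladder_bdd (\<lambda>x. f x - hprojs n (i # L) f x) (\<lambda>k. (\<omega>1 k + \<omega>2 k) / real n ^ M)"
      by (simp add: hprojs_Cons add_divide_distrib)
  qed
qed

lemma hproj1_sum:
  "(\<And>a. a \<in> I \<Longrightarrow> rdec (f a)) \<Longrightarrow> hproj1 i k (\<lambda>x. \<Sum>a\<in>I. f a x) x = (\<Sum>a\<in>I. hproj1 i k (f a) x)"
  by (simp add: hproj1_def hcoeff_sum sum_distrib_left)

definition hprods :: "('n \<Rightarrow> nat) \<Rightarrow> 'n list \<Rightarrow> (real^'n::finite \<Rightarrow> complex) \<Rightarrow> real^'n \<Rightarrow> complex" where
  "hprods \<alpha> L f = foldr (\<lambda>i. hproj1 i (\<alpha> i)) L f"

lemma rdec_hprods: "rdec f \<Longrightarrow> rdec (hprods \<alpha> L f)"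
  by (induction L) (auto simp: hprods_def rdec_hproj1)

lemma hprods_cong: "(\<And>i. i \<in> set L \<Longrightarrow> \<alpha> i = \<beta> i) \<Longrightarrow> hprods \<alpha> L f = hprods \<beta> L f"
  unfolding hprods_def by (induction L) auto

lemma hprojs_expand:
  assumes "rdec f" "distinct L"
  shows "hprojs n L f = (\<lambda>x. \<Sum>\<alpha>\<in>PiE (set L) (\<lambda>_. {..<n}). hprods \<alpha> L f x)"
  using assms(2)
proof (induction L)
  case Nil
  then show ?case by (simp add: hprojs_def hprods_def PiE_empty_domain)
next
  case (Cons i L)
  let ?A = "PiE (set L) (\<lambda>_. {..<n})"
  have i: "i \<notin> set L" using Cons.prems by simp
  show ?case
  proof
    fix x
    have "hprojs n (i # L) f x = (\<Sum>k<n. \<Sum>\<alpha>\<in>?A. hproj1 i k (hprods \<alpha> L f) x)"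
      using Cons by (simp add: hprojs_Cons hproj_def hproj1_sum rdec_hprods assms(1))
    also have "\<dots> = (\<Sum>(k, \<alpha>)\<in>{..<n} \<times> ?A. hprods (\<alpha>(i := k)) (i # L) f x)"
    proof -
      have "hprods (\<alpha>(i := k)) L f = hprods \<alpha> L f" for k \<alpha> using i by (intro hprods_cong) auto
      then have "hprods (\<alpha>(i := k)) (i # L) f = hproj1 i k (hprods \<alpha> L f)" for k \<alpha>
        by (simp add: hprods_def)
      then show ?thesis by (simp add: sum.cartesian_product)
    qed
    also have "\<dots> = (\<Sum>\<beta>\<in>(\<lambda>(y, g). g(i := y)) ` ({..<n} \<times> ?A). hprods \<beta> (i # L) f x)"
    proof (subst sum.reindex)
      show "inj_on (\<lambda>(y, g). g(i := y)) ({..<n} \<times> ?A)" using inj_combinator[OF i, of "\<lambda>_. {..<n}"] .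
    qed (auto intro!: sum.cong)
    finally show "hprojs n (i # L) f x = (\<Sum>\<alpha>\<in>PiE (set (i # L)) (\<lambda>_. {..<n}). hprods \<alpha> (i # L) f x)"
      by (simp add: PiE_insert_eq)
  qed
qed

text \<open>\<open>hproj1 i\<close> replaces all dependence on x_i by a Hermite factor, so the
  remaining factor \<open>v\<close> ignores the coordinates already treated. Once \<open>L\<close>
  contains every coordinate, \<open>v\<close> is constant.\<close>

lemma hprods_product:
  assumes "distinct L"
  shows "\<exists>v. (\<forall>x. hprods \<alpha> L f x = (\<Prod>i\<in>set L. hfun i (\<alpha> i) x) * v x) \<and> (\<forall>i\<in>set L. \<forall>x t. v (upd x i t) = v x)"
  using assms
proof (induction L)
  case Nil
  then show ?case by (intro exI[of _ f]) (simp add: hprods_def)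
next
  case (Cons i L)
  then have "distinct L" by simp
  from Cons.IH[OF this] obtain v where v: "\<And>x. hprods \<alpha> L f x = (\<Prod>i\<in>set L. hfun i (\<alpha> i) x) * v x"
    and inv: "\<And>j x t. j \<in> set L \<Longrightarrow> v (upd x j t) = v x" by blast
  have i: "i \<notin> set L" using Cons.prems by simp
  define v' where "v' x = of_real (1 / hermite_sqnorm (\<alpha> i)) * hcoeff i (\<alpha> i) v x" for x
  have "hprods \<alpha> (i # L) f x = (\<Prod>i\<in>set (i # L). hfun i (\<alpha> i) x) * v' x" for x
  proof -
    have "hfun j (\<alpha> j) (upd x i t) = hfun j (\<alpha> j) x" if "j \<in> set L" for j t
      using that i by (auto simp: hfun_def upd_nth)
    then have "(\<Prod>j\<in>set L. hfun j (\<alpha> j) (upd x i t)) = (\<Prod>j\<in>set L. hfun j (\<alpha> j) x)" for t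
      by (intro prod.cong) auto
    then have "hcoeff i (\<alpha> i) (hprods \<alpha> L f) x = (LINT t|lborel. (\<Prod>i\<in>set L. hfun i (\<alpha> i) x) *
        (complex_of_real (hermite (\<alpha> i) t) * v (upd x i t)))"
      unfolding hcoeff_def by (simp only: v mult.left_commute)
    then have "hcoeff i (\<alpha> i) (hprods \<alpha> L f) x = (\<Prod>i\<in>set L. hfun i (\<alpha> i) x) * hcoeff i (\<alpha> i) v x"
      by (simp only: integral_mult_right_zero hcoeff_def)
    then show ?thesis using i by (simp add: hprods_def hproj1_def v'_def mult_ac)
  qed
  moreover have "v' (upd x j t) = v' x" if "j \<in> set (i # L)" for j x t
  proof (cases "j = i")
    case True
    then show ?thesis by (simp add: v'_def hcoeff_upd)
  next
    case False
    have "upd (upd x j t) i s = upd (upd x i s) j t" for s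
      using False by (auto simp: vec_eq_iff upd_nth)
    then have "v (upd (upd x j t) i s) = v (upd x i s)" for s
      using inv[of j "upd x i s" t] that False by simp
    then show ?thesis by (simp add: v'_def hcoeff_def)
  qed
  ultimately show ?case by blast
qed

definition hermite_fun :: "('n::finite \<Rightarrow> nat) \<Rightarrow> real^'n \<Rightarrow> complex" where
  "hermite_fun \<alpha> x = (\<Prod>i\<in>UNIV. hfun i (\<alpha> i) x)"

lemma upd_invariant_const:
  fixes v :: "real^'n::finite \<Rightarrow> 'b"
  assumes "\<And>i x t. v (upd x i t) = v x"
  shows "v x = v y"
proof -
  have "v (\<chi> j. if j \<in> S then y $ j else x $ j) = v x" if "finite S" for S
    using that
  proof induction
    case (insert i S)
    have "(\<chi> j. if j \<in> insert i S then y $ j else x $ j) = upd (\<chi> j. if j \<in> S then y $ j else x $ j) i (y $ i)"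
      by (auto simp: vec_eq_iff upd_nth)
    then show ?case using insert.IH by (simp only: assms)
  qed simp
  from this[of UNIV] show ?thesis by simp
qed

text \<open>Only the coefficients depend on f; the n^d functions that span the range, d being the
  number of coordinates, do not.\<close>

lemma hprojs_finite_rank:
  fixes f :: "real^'n::finite \<Rightarrow> complex"
  assumes "rdec f"
  shows "\<exists>c. hprojs n coords f = (\<lambda>x. \<Sum>\<alpha>\<in>PiE UNIV (\<lambda>_. {..<n}). c \<alpha> * hermite_fun \<alpha> x)"
proof -
  have "\<exists>c. hprods \<alpha> coords f = (\<lambda>x. c * hermite_fun \<alpha> x)" for \<alpha>
  proof -
    obtain v where v: "\<And>x. hprods \<alpha> coords f x = (\<Prod>i\<in>UNIV. hfun i (\<alpha> i) x) * v x"
      and inv: "\<And>i x t. v (upd x i t) = v x"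
      using hprods_product[of coords \<alpha> f] by (auto simp: coords)
    have v0: "v x = v 0" for x by (rule upd_invariant_const[of v, OF inv])
    have "hprods \<alpha> coords f x = v 0 * hermite_fun \<alpha> x" for x
      using v[of x] unfolding v0[of x] by (simp only: hermite_fun_def mult.commute)
    then show ?thesis by blast
  qed
  then obtain c where "\<forall>\<alpha>. hprods \<alpha> coords f = (\<lambda>x. c \<alpha> * hermite_fun \<alpha> x)"
    using choice[of "\<lambda>\<alpha> c. hprods \<alpha> coords f = (\<lambda>x. c * hermite_fun \<alpha> x)"] by blast
  then show ?thesis using hprojs_expand[OF assms, of coords n] by (auto simp: coords)
qed

lemma hproj_add:
  "rdec f \<Longrightarrow> rdec g \<Longrightarrow> hproj i n (\<lambda>x. f x + g x) = (\<lambda>x. hproj i n f x + hproj i n g x)"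
  by (simp add: hproj_def hproj1_def hcoeff_add algebra_simps sum.distrib)

lemma hprojs_add:
  "rdec f \<Longrightarrow> rdec g \<Longrightarrow> hprojs n L (\<lambda>x. f x + g x) = (\<lambda>x. hprojs n L f x + hprojs n L g x)"
  by (induction L) (simp_all add: hprojs_Nil hprojs_Cons hproj_add rdec_hprojs)

lemma hprojs_cmult: "hprojs n L (\<lambda>x. c * f x) = (\<lambda>x. c * hprojs n L f x)"
  by (induction L) (simp_all add: hprojs_Nil hprojs_Cons hproj_cmult)

text \<open>\<open>sup_le_ip\<close> with e = 1: the squared norm of
  \<open>lower (hermite k)\<close> is 2 k times that of \<open>hermite k\<close>, and
  \<open>deriv_sq_le\<close> adds one more copy, so the total factor is 1 + 2 k + 1.\<close>

lemma hermite_sup: "(hermite k t)\<^sup>2 \<le> 2 * real (Suc k) * hermite_sqnorm k"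
proof -
  have l: "ip (lower (hermite k)) (lower (hermite k)) = 2 * real k * hermite_sqnorm k"
  proof (cases k)
    case 0
    then show ?thesis by (simp add: lower_hermite_0 del: hermite.simps)
  next
    case (Suc j)
    have "ip (\<lambda>x. c * hermite j x) (\<lambda>x. c * hermite j x) = c * (c * hermite_sqnorm j)" for c
      by (subst ip_cmult_left, subst ip_commute, subst ip_cmult_left) (simp add: hermite_sqnorm_def)
    then show ?thesis by (simp only: Suc lower_hermite_Suc hermite_sqnorm_Suc)
  qed
  have "(hermite k t)\<^sup>2 \<le> 1 * ip (hermite k) (hermite k) + ip (deriv (hermite k)) (deriv (hermite k)) / 1"
    by (intro sup_le_ip schwartz1_hermite) simp
  also have "\<dots> \<le> 2 * real (Suc k) * hermite_sqnorm k"
    using deriv_sq_le[OF schwartz1_hermite[of k]] l by (simp add: hermite_sqnorm_def algebra_simps)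
  finally show ?thesis .
qed

section \<open>Hermite functions of several variables and their place in every weight class\<close>

lemma smooth_hermite_fun: "smooth (hermite_fun \<alpha>)"
proof -
  have "smooth (\<lambda>x. \<Prod>i\<in>I. hfun i (\<alpha> i) x)" if "finite I" for I
    using that by induction (auto intro: smooth_const smooth_mult smooth_hfun)
  then show ?thesis by (simp add: hermite_fun_def[abs_def])
qed

lemma hermite_fun_split: "hermite_fun \<alpha> x = hfun i (\<alpha> i) x * (\<Prod>j\<in>UNIV - {i}. hfun j (\<alpha> j) x)"
  unfolding hermite_fun_def by (simp add: prod.remove[of UNIV i])

lemma partial_hermite_fun:
  "partial i (hermite_fun \<alpha>) x = of_real (deriv (hermite (\<alpha> i)) (x $ i)) * (\<Prod>j\<in>UNIV - {i}. hfun j (\<alpha> j) x)"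
proof -
  let ?r = "\<lambda>x. \<Prod>j\<in>UNIV - {i}. hfun j (\<alpha> j) x"
  have r: "smooth (\<lambda>x. \<Prod>j\<in>I. hfun j (\<alpha> j) x)" if "finite I" for I
    using that by induction (auto intro: smooth_const smooth_mult smooth_hfun)
  have p: "partial i (\<lambda>x. \<Prod>j\<in>I. hfun j (\<alpha> j) x) x = 0" if "finite I" "i \<notin> I" for I
    using that by induction (simp_all add: partial_const smooth_partial_mult smooth_hfun r hfun_derivative)
  have "hermite_fun \<alpha> = (\<lambda>x. hfun i (\<alpha> i) x * ?r x)" by (rule ext) (rule hermite_fun_split)
  then show ?thesis
    using p[of "UNIV - {i}"] by (simp add: smooth_partial_mult smooth_hfun r hfun_derivative)
qed

lemma ladder_hermite_fun_raise: "ladder (i, False) (hermite_fun \<alpha>) = hermite_fun (\<alpha>(i := Suc (\<alpha> i)))"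
proof
  fix x
  have "(\<Prod>j\<in>UNIV - {i}. hfun j ((\<alpha>(i := Suc (\<alpha> i))) j) x) = (\<Prod>j\<in>UNIV - {i}. hfun j (\<alpha> j) x)"
    by (rule prod.cong) auto
  then show "ladder (i, False) (hermite_fun \<alpha>) x = hermite_fun (\<alpha>(i := Suc (\<alpha> i))) x"
    unfolding hermite_fun_split[of "\<alpha>(i := Suc (\<alpha> i))" x i]
    by (simp add: ladder_False xmult_def partial_hermite_fun hermite_fun_split[of \<alpha> x i])
      (simp add: hfun_def raise_def algebra_simps)
qed

lemma ladder_hermite_fun_lower:
  "ladder (i, True) (hermite_fun \<alpha>) = (\<lambda>x. of_real (2 * real (\<alpha> i)) * hermite_fun (\<alpha>(i := \<alpha> i - 1)) x)"
proof
  fix x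
  have r: "(\<Prod>j\<in>UNIV - {i}. hfun j ((\<alpha>(i := \<alpha> i - 1)) j) x) = (\<Prod>j\<in>UNIV - {i}. hfun j (\<alpha> j) x)"
    by (rule prod.cong) auto
  have "x $ i * hermite (\<alpha> i) (x $ i) + deriv (hermite (\<alpha> i)) (x $ i) = 2 * real (\<alpha> i) * hermite (\<alpha> i - 1) (x $ i)"
  proof (cases "\<alpha> i")
    case 0
    then show ?thesis using fun_cong[OF lower_hermite_0, of "x $ i"] unfolding lower_def by (simp del: hermite.simps)
  next
    case (Suc k)
    then show ?thesis using fun_cong[OF lower_hermite_Suc[of k], of "x $ i"] unfolding lower_def by (simp del: hermite.simps)
  qed
  then have "complex_of_real (x $ i) * of_real (hermite (\<alpha> i) (x $ i)) + of_real (deriv (hermite (\<alpha> i)) (x $ i))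
     = of_real (2 * real (\<alpha> i) * hermite (\<alpha> i - 1) (x $ i))"
    by (metis of_real_add of_real_mult)
  then show "ladder (i, True) (hermite_fun \<alpha>) x = of_real (2 * real (\<alpha> i)) * hermite_fun (\<alpha>(i := \<alpha> i - 1)) x"
    unfolding hermite_fun_split[of "\<alpha>(i := \<alpha> i - 1)" x i] r
    by (simp add: ladder_True xmult_def partial_hermite_fun hermite_fun_split[of \<alpha> x i] hfun_def
        mult.assoc[symmetric] distrib_right[symmetric])
qed

text \<open>The L2 norm of \<open>hermite_fun \<alpha>\<close>. Measured against it, raising costs a
  factor sqrt (2 (\<alpha> i + 1)) and lowering sqrt (2 \<alpha> i); the square root of the
  factorial in \<open>gauss\<close> has its origin here.\<close>

definition hermite_fun_norm :: "('n::finite \<Rightarrow> nat) \<Rightarrow> real" where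
  "hermite_fun_norm \<alpha> = sqrt (\<Prod>i\<in>UNIV. hermite_sqnorm (\<alpha> i))"

lemma hermite_fun_norm_nonneg: "0 \<le> hermite_fun_norm \<alpha>"
  by (simp add: hermite_fun_norm_def prod_nonneg less_imp_le[OF hermite_sqnorm_pos])

lemma hermite_fun_norm_Suc:
  "hermite_fun_norm (\<alpha>(i := Suc (\<alpha> i))) = sqrt (2 * real (Suc (\<alpha> i))) * hermite_fun_norm \<alpha>"
proof -
  have "(\<Prod>j\<in>UNIV - {i}. hermite_sqnorm ((\<alpha>(i := Suc (\<alpha> i))) j)) = (\<Prod>j\<in>UNIV - {i}. hermite_sqnorm (\<alpha> j))"
    by (rule prod.cong) auto
  then show ?thesis
    unfolding hermite_fun_norm_def
    by (simp add: prod.remove[of UNIV i] hermite_sqnorm_Suc real_sqrt_mult[symmetric] mult.assoc)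
qed

text \<open>Deliberately crude: replacing 2 (\<alpha> i + 1) by \<open>2 ^ Suc k\<close> in each
  coordinate keeps the loss geometric in k, so that it fits into the constant R of
  \<open>gauss\<close>.\<close>

lemma hermite_fun_sup:
  fixes \<alpha> :: "'n::finite \<Rightarrow> nat"
  assumes "multi_size \<alpha> \<le> k"
  shows "cmod (hermite_fun \<alpha> x) \<le> sqrt ((2 ^ Suc k) ^ CARD('n)) * hermite_fun_norm \<alpha>"
proof -
  have "(cmod (hermite_fun \<alpha> x))\<^sup>2 = (\<Prod>i\<in>UNIV. (hermite (\<alpha> i) (x $ i))\<^sup>2)"
    by (simp add: hermite_fun_def prod_norm[symmetric] hfun_def prod_power_distrib)
  also have "\<dots> \<le> (\<Prod>i\<in>UNIV. 2 ^ Suc k * hermite_sqnorm (\<alpha> i))"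
  proof (rule prod_mono)
    fix i
    have "\<alpha> i \<le> multi_size \<alpha>" unfolding multi_size_def by (rule member_le_sum) auto
    then have "Suc (\<alpha> i) \<le> 2 ^ k" using assms by (metis Suc_leI le_trans less_exp linorder_not_le)
    then have "2 * real (Suc (\<alpha> i)) \<le> 2 ^ Suc k"
      by (metis mult_le_cancel_left_pos of_nat_le_iff of_nat_numeral of_nat_power power_Suc zero_less_numeral)
    then have "2 * real (Suc (\<alpha> i)) * hermite_sqnorm (\<alpha> i) \<le> 2 ^ Suc k * hermite_sqnorm (\<alpha> i)"
      using hermite_sqnorm_pos[of "\<alpha> i"] by (intro mult_right_mono) auto
    then show "0 \<le> (hermite (\<alpha> i) (x $ i))\<^sup>2 \<and> (hermite (\<alpha> i) (x $ i))\<^sup>2 \<le> 2 ^ Suc k * hermite_sqnorm (\<alpha> i)"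
      using hermite_sup[of "\<alpha> i" "x $ i"] by (auto intro: order_trans)
  qed
  also have "\<dots> = (2 ^ Suc k) ^ CARD('n) * (\<Prod>i\<in>UNIV. hermite_sqnorm (\<alpha> i))"
    by (simp add: prod.distrib)
  finally have "cmod (hermite_fun \<alpha> x) \<le> sqrt ((2 ^ Suc k) ^ CARD('n) * (\<Prod>i\<in>UNIV. hermite_sqnorm (\<alpha> i)))"
    by (rule real_le_rsqrt)
  then show ?thesis by (simp only: real_sqrt_mult hermite_fun_norm_def)
qed

text \<open>A ladder operator maps a multiple of one Hermite function to a multiple of another,
  possibly 0. As \<alpha> i \<le> length w, each letter enlarges the coefficient times the norm by
  at most sqrt (2 (length w + 1)), and these factors multiply to sqrt (2^k k!).\<close>

lemma word_hermite_fun_0: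
  fixes w :: "('n::finite \<times> bool) list"
  shows "\<exists>c \<alpha>. word w (hermite_fun (\<lambda>_. 0)) = (\<lambda>x. c * hermite_fun \<alpha> x) \<and> multi_size \<alpha> \<le> length w \<and>
    cmod c * hermite_fun_norm \<alpha> \<le> hermite_fun_norm (\<lambda>_::'n. 0) * sqrt (2 ^ length w * fact (length w))"
proof (induction w)
  case Nil
  show ?case by (intro exI[of _ 1] exI[of _ "\<lambda>_. 0"]) (simp add: multi_size_def)
next
  case (Cons l w)
  then obtain c \<alpha> where c: "word w (hermite_fun (\<lambda>_. 0)) = (\<lambda>x. c * hermite_fun \<alpha> x)"
    and m: "multi_size \<alpha> \<le> length w"
    and b: "cmod c * hermite_fun_norm \<alpha> \<le> hermite_fun_norm (\<lambda>_::'n. 0) * sqrt (2 ^ length w * fact (length w))"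
    by blast
  obtain i s where l: "l = (i, s)" by (cases l) auto
  have ai: "\<alpha> i \<le> length w"
    using m member_le_sum[of i UNIV \<alpha>] unfolding multi_size_def by simp
  have key: "cmod c * (sqrt (2 * real k) * hermite_fun_norm \<alpha>)
      \<le> hermite_fun_norm (\<lambda>_::'n. 0) * sqrt (2 ^ length (l # w) * fact (length (l # w)))"
    if "k \<le> Suc (length w)" for k
  proof -
    have "cmod c * (sqrt (2 * real k) * hermite_fun_norm \<alpha>) = sqrt (2 * real k) * (cmod c * hermite_fun_norm \<alpha>)"
      by simp
    also have "\<dots> \<le> sqrt (2 * real (Suc (length w))) * (hermite_fun_norm (\<lambda>_::'n. 0) * sqrt (2 ^ length w * fact (length w)))"
      using that hermite_fun_norm_nonneg[of \<alpha>] by (intro mult_mono b) auto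
    also have "\<dots> = hermite_fun_norm (\<lambda>_::'n. 0) * sqrt ((2 * real (Suc (length w))) * (2 ^ length w * fact (length w)))"
      by (simp only: real_sqrt_mult mult_ac)
    also have "(2 * real (Suc (length w))) * (2 ^ length w * fact (length w)) = 2 ^ length (l # w) * fact (length (l # w))"
      by (simp add: algebra_simps)
    finally show ?thesis .
  qed
  show ?case
  proof (cases s)
    case False
    show ?thesis
    proof (intro exI conjI)
      show "word (l # w) (hermite_fun (\<lambda>_. 0)) = (\<lambda>x. c * hermite_fun (\<alpha>(i := Suc (\<alpha> i))) x)"
        using False by (simp add: word_Cons c l ladder_cmult smooth_hermite_fun ladder_hermite_fun_raise)
      show "multi_size (\<alpha>(i := Suc (\<alpha> i))) \<le> length (l # w)"
        using multi_size_upd[of \<alpha> i "Suc (\<alpha> i)"] m by simp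
      show "cmod c * hermite_fun_norm (\<alpha>(i := Suc (\<alpha> i)))
        \<le> hermite_fun_norm (\<lambda>_::'n. 0) * sqrt (2 ^ length (l # w) * fact (length (l # w)))"
        unfolding hermite_fun_norm_Suc using ai by (intro key) simp
    qed
  next
    case True
    let ?\<beta> = "\<alpha>(i := \<alpha> i - 1)"
    \<comment> \<open>Both sides vanish if \<alpha> i = 0, so the truncated index \<alpha> i - 1
      does no harm.\<close>
    have nb: "2 * real (\<alpha> i) * hermite_fun_norm ?\<beta> = sqrt (2 * real (\<alpha> i)) * hermite_fun_norm \<alpha>"
    proof (cases "\<alpha> i")
      case (Suc k)
      then have "\<alpha> = ?\<beta>(i := Suc (?\<beta> i))" by auto
      then have "hermite_fun_norm \<alpha> = sqrt (2 * real (Suc (?\<beta> i))) * hermite_fun_norm ?\<beta>"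
        using hermite_fun_norm_Suc[of ?\<beta> i] by metis
      then show ?thesis using Suc by (simp add: mult.assoc[symmetric] del: of_nat_Suc)
    qed simp
    show ?thesis
    proof (intro exI conjI)
      show "word (l # w) (hermite_fun (\<lambda>_. 0)) = (\<lambda>x. (c * of_real (2 * real (\<alpha> i))) * hermite_fun ?\<beta> x)"
        using True by (simp add: word_Cons c l ladder_cmult smooth_hermite_fun ladder_hermite_fun_lower mult.assoc)
      show "multi_size ?\<beta> \<le> length (l # w)"
        using multi_size_upd[of \<alpha> i "\<alpha> i - 1"] m by simp
      have "cmod (c * of_real (2 * real (\<alpha> i))) * hermite_fun_norm ?\<beta> = cmod c * (2 * real (\<alpha> i) * hermite_fun_norm ?\<beta>)"
        by (simp add: norm_mult mult.assoc)
      also have "\<dots> \<le> hermite_fun_norm (\<lambda>_::'n. 0) * sqrt (2 ^ length (l # w) * fact (length (l # w)))"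
        unfolding nb using ai by (intro key) simp
      finally show "cmod (c * of_real (2 * real (\<alpha> i))) * hermite_fun_norm ?\<beta>
        \<le> hermite_fun_norm (\<lambda>_::'n. 0) * sqrt (2 ^ length (l # w) * fact (length (l # w)))" .
    qed
  qed
qed

text \<open>The geometric sup bound and the growth sqrt (2^k k!) combine to R^k sqrt (k!) with R^2 =
  2 * 2^d, up to a constant; the axiom \<open>gauss\<close> is modelled on this.\<close>

lemma (in weight_class) hermite_fun_0_wspace: "hermite_fun (\<lambda>_::'n::finite. 0) \<in> wspace W"
proof -
  let ?E = "hermite_fun_norm (\<lambda>_::'n. 0)" and ?d = "CARD('n)"
  define R where "R = sqrt (2 * 2 ^ ?d)"
  have R: "R > 0" by (simp add: R_def)
  define \<omega> where "\<omega> k = (sqrt (2 ^ ?d) * ?E) * (R ^ k * sqrt (fact k))" for k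
  have "\<omega> \<in> W"
    unfolding \<omega>_def[abs_def] by (intro scale gauss R) (auto simp: hermite_fun_norm_nonneg)
  moreover have "ladder_bdd (hermite_fun (\<lambda>_::'n. 0)) \<omega>"
    unfolding ladder_bdd_def
  proof (intro allI)
    fix w :: "('n \<times> bool) list" and x
    let ?k = "length w"
    obtain c \<alpha> where c: "word w (hermite_fun (\<lambda>_. 0)) = (\<lambda>x. c * hermite_fun \<alpha> x)" "multi_size \<alpha> \<le> ?k"
      "cmod c * hermite_fun_norm \<alpha> \<le> ?E * sqrt (2 ^ ?k * fact ?k)"
      using word_hermite_fun_0[of w] by blast
    have "cmod (word w (hermite_fun (\<lambda>_. 0)) x) \<le> cmod c * (sqrt ((2 ^ Suc ?k) ^ ?d) * hermite_fun_norm \<alpha>)"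
      unfolding c(1) norm_mult by (intro mult_left_mono hermite_fun_sup c) auto
    also have "\<dots> = sqrt ((2 ^ Suc ?k) ^ ?d) * (cmod c * hermite_fun_norm \<alpha>)" by simp
    also have "\<dots> \<le> sqrt ((2 ^ Suc ?k) ^ ?d) * (?E * sqrt (2 ^ ?k * fact ?k))"
      by (intro mult_left_mono c) auto
    also have "\<dots> = ?E * sqrt ((2 ^ Suc ?k) ^ ?d * (2 ^ ?k * fact ?k))"
      by (simp only: real_sqrt_mult mult_ac)
    also have "(2 ^ Suc ?k) ^ ?d * (2 ^ ?k * fact ?k) = 2 ^ ?d * ((2 * 2 ^ ?d) ^ ?k * fact ?k :: real)"
      by (simp add: power_mult_distrib power_mult[symmetric] mult_ac)
    also have "?E * sqrt (2 ^ ?d * ((2 * 2 ^ ?d) ^ ?k * fact ?k)) = \<omega> ?k"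
      by (simp only: real_sqrt_mult real_sqrt_power \<omega>_def R_def mult_ac)
    finally show "cmod (word w (hermite_fun (\<lambda>_. 0)) x) \<le> \<omega> ?k" .
  qed
  ultimately show ?thesis by (intro wspaceI smooth_hermite_fun)
qed

lemma (in weight_class) hermite_fun_wspace: "hermite_fun \<alpha> \<in> wspace W"
proof (induction "multi_size \<alpha>" arbitrary: \<alpha>)
  case 0
  then have "\<alpha> = (\<lambda>_. 0)" by (auto simp: multi_size_def)
  then show ?case using hermite_fun_0_wspace by simp
next
  case (Suc m)
  have "\<exists>i. \<alpha> i \<noteq> 0"
  proof (rule ccontr)
    assume "\<not> ?thesis"
    then have "multi_size \<alpha> = 0" by (simp add: multi_size_def)
    then show False using Suc.hyps(2) by simp
  qed
  then obtain i k where i: "\<alpha> i = Suc k" by (meson not0_implies_Suc)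
  have "m = multi_size (\<alpha>(i := k))" using multi_size_upd[of \<alpha> i k] Suc.hyps(2) i by simp
  then have "ladder (i, False) (hermite_fun (\<alpha>(i := k))) \<in> wspace W" by (intro wspace_ladder Suc.hyps(1))
  moreover have "\<alpha>(i := Suc k) = \<alpha>" using i by auto
  ultimately show ?case by (simp add: ladder_hermite_fun_raise)
qed

text \<open>A projection of any Schwartz function is a finite combination of Hermite functions. For
  the class \<open>roumieu (1/2)\<close> this puts it into \<open>GS_S (1/2)\<close>, where
  functionals on different test spaces can be compared.\<close>

lemma (in weight_class) hprojs_wspace:
  fixes f :: "real^'n::finite \<Rightarrow> complex"
  assumes "rdec f"
  shows "hprojs n coords f \<in> wspace W"
proof -
  obtain c where "hprojs n coords f = (\<lambda>x. \<Sum>\<alpha>\<in>PiE UNIV (\<lambda>_. {..<n}). c \<alpha> * hermite_fun \<alpha> x)"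
    using hprojs_finite_rank[OF assms] by blast
  then show ?thesis by (auto intro!: wspace_sum wspace_cmult hermite_fun_wspace)
qed

section \<open>Kernels and functionals\<close>

hide_const (open) Giry_Monad.join

text \<open>\<open>lborel\<close> on vectors is the image of a product measure under the coordinate
  map, so a product of integrable functions of single coordinates is integrable by Fubini.\<close>

lemma integrable_prod_coords:
  fixes g :: "real \<Rightarrow> real"
  assumes "integrable lborel g"
  shows "integrable lborel (\<lambda>x::real^'n::finite. \<Prod>i\<in>UNIV. g (x $ i))"
proof -
  interpret product_sigma_finite "\<lambda>_::real^'n. lborel :: real measure"
    by (intro product_sigma_finite.intro) (rule sigma_finite_lborel)
  have [measurable]: "g \<in> borel_measurable borel" using borel_measurable_integrable[OF assms] by simp
  have i: "integrable (Pi\<^sub>M (Basis :: (real^'n) set) (\<lambda>_. lborel)) (\<lambda>x. \<Prod>b\<in>Basis. g (x b))"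
    by (intro product_integrable_prod assms) auto
  have m: "(\<lambda>f. \<Sum>b\<in>(Basis :: (real^'n) set). f b *\<^sub>R b) \<in> measurable (Pi\<^sub>M Basis (\<lambda>_. lborel)) borel"
    by measurable
  have e: "(\<Prod>i\<in>UNIV. g ((\<Sum>b\<in>Basis. f b *\<^sub>R b) $ i)) = (\<Prod>b\<in>Basis. g (f b))"
    if "f \<in> space (Pi\<^sub>M (Basis :: (real^'n) set) (\<lambda>_. lborel))" for f
  proof -
    have B: "Basis = (\<lambda>i::'n. axis i (1::real)) ` UNIV" by (auto simp: Basis_vec_def)
    have inj: "inj (\<lambda>i::'n. axis i (1::real))" by (auto simp: inj_on_def axis_eq_axis)
    have "(\<Sum>b\<in>Basis. f b *\<^sub>R b) $ i = f (axis i 1)" for i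
      unfolding B by (subst sum.reindex[OF inj]) (simp add: sum_component axis_def if_distrib[of "\<lambda>c. _ * c"] cong: if_cong)
    then show ?thesis unfolding B by (subst prod.reindex[OF inj]) simp
  qed
  have "lborel = distr (Pi\<^sub>M Basis (\<lambda>_. lborel)) borel (\<lambda>f. \<Sum>b\<in>(Basis :: (real^'n) set). f b *\<^sub>R b)"
    unfolding lborel_def[where 'a="real^'n"] lborel_eq_real ..
  moreover have "integrable (distr (Pi\<^sub>M Basis (\<lambda>_. lborel)) borel (\<lambda>f. \<Sum>b\<in>(Basis :: (real^'n) set). f b *\<^sub>R b))
      (\<lambda>x. \<Prod>i\<in>UNIV. g (x $ i))"
    by (subst integrable_distr_eq[OF m], measurable)
      (rule Bochner_Integration.integrable_cong[THEN iffD2, OF refl _ i], erule e)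
  ultimately show ?thesis by simp
qed

text \<open>Adding x_i^2 f to f, successively in all coordinates, leads to a Schwartz function
  again, and such a function is bounded.\<close>

lemma rdec_polynomial_decay:
  assumes "rdec f"
  shows "\<exists>C. \<forall>x. (\<Prod>i\<in>UNIV. 1 + (x $ i)\<^sup>2) * cmod (f x) \<le> C"
proof -
  define m where "m = foldr (\<lambda>i g x. g x + xmult i (xmult i g) x) coords f"
  have "rdec (foldr (\<lambda>i g x. g x + xmult i (xmult i g) x) L f)" for L
    by (induction L) (auto intro: rdec_add rdec_xmult assms)
  then obtain C where C: "\<And>x. cmod (m x) \<le> C" using rdec_bounded unfolding m_def by blast
  have e: "foldr (\<lambda>i g x. g x + xmult i (xmult i g) x) L f x = of_real (\<Prod>i\<leftarrow>L. 1 + (x $ i)\<^sup>2) * f x" for L x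
    by (induction L) (auto simp: xmult_def power2_eq_square algebra_simps)
  have "(\<Prod>i\<leftarrow>coords. 1 + (x $ i)\<^sup>2) = (\<Prod>i\<in>UNIV. 1 + (x $ i)\<^sup>2)" for x :: "real^'a"
    using prod.distinct_set_conv_list[OF coords(1), of "\<lambda>i. 1 + (x $ i)\<^sup>2"] by (simp add: coords)
  then have mx: "m x = of_real (\<Prod>i\<in>UNIV. 1 + (x $ i)\<^sup>2) * f x" for x
    by (simp only: m_def e)
  have "(\<Prod>i\<in>UNIV. 1 + (x $ i)\<^sup>2) * cmod (f x) \<le> C" for x
  proof -
    have "0 \<le> (\<Prod>i\<in>UNIV. 1 + (x $ i)\<^sup>2)" by (intro prod_nonneg) auto
    moreover have "cmod (m x) = \<bar>\<Prod>i\<in>UNIV. 1 + (x $ i)\<^sup>2\<bar> * cmod (f x)"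
      by (simp only: mx norm_mult norm_of_real)
    ultimately show ?thesis using C[of x] by simp
  qed
  then show ?thesis by blast
qed

lemma rdec_integrable:
  fixes f :: "real^'n::finite \<Rightarrow> complex"
  assumes "rdec f"
  shows "integrable lborel f"
proof -
  obtain C where C: "\<And>x. (\<Prod>i\<in>UNIV. 1 + (x $ i)\<^sup>2) * cmod (f x) \<le> C"
    using rdec_polynomial_decay[OF assms] by blast
  show ?thesis
  proof (rule Bochner_Integration.integrable_bound)
    show "integrable lborel (\<lambda>x::real^'n. C * (\<Prod>i\<in>UNIV. inverse (1 + (x $ i)\<^sup>2)))"
      by (intro integrable_mult_right integrable_prod_coords integrable_inverse_one_plus_square)
    show "f \<in> borel_measurable lborel"
      using smooth_cont[OF rdec_smooth[OF assms]] by (simp add: borel_measurable_continuous_onI)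
    show "AE x in lborel. norm (f x) \<le> norm (C * (\<Prod>i\<in>UNIV. inverse (1 + (x $ i)\<^sup>2)))"
    proof (rule AE_I2)
      fix x :: "real^'n"
      have p: "(\<Prod>i\<in>UNIV. 1 + (x $ i)\<^sup>2) > 0" by (intro prod_pos) (auto simp: add_pos_nonneg)
      have "norm (f x) \<le> C / (\<Prod>i\<in>UNIV. 1 + (x $ i)\<^sup>2)"
        using C[of x] p by (simp add: pos_le_divide_eq mult.commute)
      also have "\<dots> = C * (\<Prod>i\<in>UNIV. inverse (1 + (x $ i)\<^sup>2))"
        by (simp add: divide_inverse prod_inversef[symmetric] o_def)
      finally show "norm (f x) \<le> norm (C * (\<Prod>i\<in>UNIV. inverse (1 + (x $ i)\<^sup>2)))"
        by (simp only: real_norm_def)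
    qed
  qed
qed

lemma rdec_mult_integrable:
  assumes "rdec f" "rdec g"
  shows "integrable lborel (\<lambda>x. f x * g x)"
proof -
  obtain B where B: "\<And>x. cmod (f x) \<le> B" using rdec_bounded[OF assms(1)] by blast
  show ?thesis
  proof (rule Bochner_Integration.integrable_bound)
    show "integrable lborel (\<lambda>x. of_real B * g x)" using rdec_integrable[OF assms(2)] by simp
    show "(\<lambda>x. f x * g x) \<in> borel_measurable lborel"
      by (simp, intro borel_measurable_continuous_onI continuous_on_mult smooth_cont rdec_smooth assms)
    show "AE x in lborel. norm (f x * g x) \<le> norm (of_real B * g x)"
    proof (rule AE_I2)
      fix x
      have "cmod (f x) \<le> \<bar>B\<bar>" using B[of x] by linarith
      then show "norm (f x * g x) \<le> norm (of_real B * g x)"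
        by (simp add: norm_mult mult_right_mono)
    qed
  qed
qed

section \<open>Kernels as functions of one group of variables with the other frozen\<close>

lemma join_nth [simp]: "join x y $ Inl i = x $ i" "join x y $ Inr j = y $ j"
  by (simp_all add: Defs.join_def)

lemma join_add: "join (x + v) y = join x y + join v 0" "join x (y + w) = join x y + join 0 w"
  by (auto simp: vec_eq_iff Defs.join_def split: sum.split)

lemma join_axis: "join (axis i 1) 0 = axis (Inl i) 1" "join 0 (axis j 1) = axis (Inr j) 1"
  by (auto simp: vec_eq_iff Defs.join_def axis_def split: sum.split)

lemma join_linear: "bounded_linear (\<lambda>x. join x 0)" "bounded_linear (\<lambda>y. join 0 y)"
  by (auto intro!: linear_conv_bounded_linear[THEN iffD1] linearI
      simp: vec_eq_iff Defs.join_def split: sum.split)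

lemma partial_chain:
  assumes "smooth K" "(h has_derivative D) (at x)" "D (axis i 1) = axis k 1"
  shows "(\<lambda>x. K (h x)) differentiable (at x)" "partial i (\<lambda>x. K (h x)) x = partial k K (h x)"
proof -
  note d = has_derivative_compose[OF assms(2) smooth_has_derivative[OF assms(1)]]
  show "(\<lambda>x. K (h x)) differentiable (at x)" using d by (rule differentiableI)
  have "(\<Sum>j\<in>UNIV. complex_of_real (axis k 1 $ j) * partial j K (h x)) = (\<Sum>j\<in>UNIV. if j = k then partial k K (h x) else 0)"
    by (rule sum.cong) (auto simp: axis_def)
  then show "partial i (\<lambda>x. K (h x)) x = partial k K (h x)"
    using partial_eq[OF d, of i] assms(3) by simp
qed

lemma join_right_derivative: "((\<lambda>y. join x y) has_derivative (\<lambda>w. join 0 w)) (at y)"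
proof -
  have d: "((\<lambda>y. join x 0 + join 0 y) has_derivative (\<lambda>w. join 0 w)) (at y)"
    using has_derivative_add[OF has_derivative_const bounded_linear_imp_has_derivative[OF join_linear(2)]]
    by simp
  have e: "(\<lambda>y. join x y) = (\<lambda>y. join x 0 + join 0 y)"
    by (rule ext) (metis join_add(2) add_0_left)
  show ?thesis by (subst e) (rule d)
qed

lemma join_left_derivative: "((\<lambda>x. join x y) has_derivative (\<lambda>v. join v 0)) (at x)"
proof -
  have d: "((\<lambda>x. join 0 y + join x 0) has_derivative (\<lambda>w. join w 0)) (at x)"
    using has_derivative_add[OF has_derivative_const bounded_linear_imp_has_derivative[OF join_linear(1)]]
    by simp
  have e: "(\<lambda>x. join x y) = (\<lambda>x. join 0 y + join x 0)"
    by (rule ext) (metis join_add(1) add_0_left)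
  show ?thesis by (subst e) (rule d)
qed

lemmas partial_join_right = partial_chain[OF _ join_right_derivative join_axis(2)]
lemmas partial_join_left = partial_chain[OF _ join_left_derivative join_axis(1)]

lemma smooth_join_right:
  fixes K :: "real^('m::finite + 'n::finite) \<Rightarrow> complex"
  assumes "smooth K"
  shows "smooth (\<lambda>y. K (join x y))"
proof -
  have "Ck m (\<lambda>y. K (join x y))" for m
    using assms
  proof (induction m arbitrary: K)
    case 0
    then show ?case using partial_join_right(1)[OF 0]
      by (auto simp: continuous_on_eq_continuous_within intro!: differentiable_imp_continuous_within)
  next
    case (Suc m)
    have "partial j (\<lambda>y. K (join x y)) = (\<lambda>y. partial (Inr j) K (join x y))" for j
      by (rule ext) (rule partial_join_right(2)[OF Suc.prems])
    then show ?case using Suc.IH[OF smooth_partial[OF Suc.prems]] partial_join_right(1)[OF Suc.prems] by simp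
  qed
  then show ?thesis by (simp add: smooth_def)
qed

lemma smooth_join_left:
  fixes K :: "real^('m::finite + 'n::finite) \<Rightarrow> complex"
  assumes "smooth K"
  shows "smooth (\<lambda>x. K (join x y))"
proof -
  have "Ck m (\<lambda>x. K (join x y))" for m
    using assms
  proof (induction m arbitrary: K)
    case 0
    then show ?case using partial_join_left(1)[OF 0]
      by (auto simp: continuous_on_eq_continuous_within intro!: differentiable_imp_continuous_within)
  next
    case (Suc m)
    have "partial j (\<lambda>x. K (join x y)) = (\<lambda>x. partial (Inl j) K (join x y))" for j
      by (rule ext) (rule partial_join_left(2)[OF Suc.prems])
    then show ?case using Suc.IH[OF smooth_partial[OF Suc.prems]] partial_join_left(1)[OF Suc.prems] by simp
  qed
  then show ?thesis by (simp add: smooth_def)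
qed

definition rword :: "('n \<times> bool) list \<Rightarrow> (('m + 'n) \<times> bool) list" where
  "rword w = map (\<lambda>(j, b). (Inr j, b)) w"

lemma length_rword [simp]: "length (rword w) = length w"
  by (simp add: rword_def)

lemma word_join_right:
  assumes "smooth K"
  shows "word w (\<lambda>y. K (join x y)) = (\<lambda>y. word (rword w) K (join x y))"
proof (induction w)
  case (Cons l w)
  obtain j b where l: "l = (j, b)" by (cases l) auto
  have "word (l # w) (\<lambda>y. K (join x y)) = ladder (j, b) (\<lambda>y. word (rword w) K (join x y))"
    by (simp add: word_Cons Cons l)
  also have "\<dots> = (\<lambda>y. ladder (Inr j, b) (word (rword w) K) (join x y))"
    by (simp add: ladder_def fun_eq_iff partial_join_right(2) smooth_word assms)
  also have "\<dots> = (\<lambda>y. word (rword (l # w)) K (join x y))"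
    by (simp add: rword_def word_Cons l)
  finally show ?case .
qed (simp add: rword_def)

lemma ladder_bdd_join_right:
  assumes "smooth K" "ladder_bdd K \<omega>"
  shows "ladder_bdd (\<lambda>y. K (join x y)) \<omega>"
  unfolding ladder_bdd_def
proof (intro allI)
  fix w y
  show "cmod (word w (\<lambda>y. K (join x y)) y) \<le> \<omega> (length w)"
    using ladder_bddD[OF assms(2), of "rword w" "join x y"] by (simp add: word_join_right assms(1))
qed

lemma wspace_join_right: "K \<in> wspace W \<Longrightarrow> (\<lambda>y. K (join x y)) \<in> wspace W"
  unfolding wspace_def by (blast intro: smooth_join_right ladder_bdd_join_right)

text \<open>Operators in the y variables commute with derivatives in the x variables; hence a word
  in y maps a Taylor remainder in x to a Taylor remainder.\<close>

lemma partial_word_right: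
  fixes K :: "real^('m::finite + 'n::finite) \<Rightarrow> complex"
  assumes "smooth K"
  shows "word (rword w) (partial (Inl i) K) = partial (Inl i) (word (rword w) K)"
proof (induction w)
  case (Cons l w)
  obtain j b where l: "l = (j, b)" by (cases l) auto
  let ?J = "word (rword w) K"
  have J: "smooth ?J" by (rule smooth_word[OF assms])
  define c :: complex where "c = (if b then 1 else -1)"
  have e: "ladder (Inr j, b) g = (\<lambda>x. xmult (Inr j) g x + c * partial (Inr j) g x)" for g :: "real^('m + 'n) \<Rightarrow> complex"
    by (simp add: ladder_def xmult_def c_def)
  have "partial (Inl i) (ladder (Inr j, b) ?J) = ladder (Inr j, b) (partial (Inl i) ?J)"
    unfolding e
    by (simp add: smooth_partial_add smooth_partial_cmult smooth_xmult smooth_cmult smooth_partial J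
        partial_xmult partial_commute[OF J, of "Inl i"])
  then show ?case using Cons by (simp add: rword_def word_Cons l)
qed (simp add: rword_def)

text \<open>Boundedness on each set of functions sharing one weight stands in for continuity;
  \<open>top_dual_wfunctional\<close> derives it for any test space topology that is
  \<open>absorbing\<close>.\<close>

definition wfunctional :: "(nat \<Rightarrow> real) set \<Rightarrow> ((real^'n::finite \<Rightarrow> complex) \<Rightarrow> complex) \<Rightarrow> bool" where
  "wfunctional W U \<longleftrightarrow>
     (\<forall>f\<in>wspace W. \<forall>g\<in>wspace W. U (\<lambda>x. f x + g x) = U f + U g) \<and>
     (\<forall>c. \<forall>f\<in>wspace W. U (\<lambda>x. c * f x) = c * U f) \<and>
     (\<forall>\<omega>\<in>W. \<exists>C. \<forall>f\<in>wspace W. ladder_bdd f \<omega> \<longrightarrow> cmod (U f) \<le> C)"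

context weight_class
begin

lemma wfunctional_add: "wfunctional W U \<Longrightarrow> f \<in> wspace W \<Longrightarrow> g \<in> wspace W \<Longrightarrow> U (\<lambda>x. f x + g x) = U f + U g"
  and wfunctional_cmult: "wfunctional W U \<Longrightarrow> f \<in> wspace W \<Longrightarrow> U (\<lambda>x. c * f x) = c * U f"
  and wfunctional_bdd: "wfunctional W U \<Longrightarrow> \<omega> \<in> W \<Longrightarrow> \<exists>C. \<forall>f\<in>wspace W. ladder_bdd f \<omega> \<longrightarrow> cmod (U f) \<le> C"
  unfolding wfunctional_def by blast+

lemma wfunctional_diff:
  "wfunctional W U \<Longrightarrow> f \<in> wspace W \<Longrightarrow> g \<in> wspace W \<Longrightarrow> U (\<lambda>x. f x - g x) = U f - U g"
  using wfunctional_add[of U f "\<lambda>x. -1 * g x"] wfunctional_cmult[of U g "-1"] wspace_cmult[of g "-1"] by simp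

lemma wfunctional_zero: "wfunctional W U \<Longrightarrow> U (\<lambda>x. 0) = 0"
  using wfunctional_cmult[OF _ wspace_zero, of U 0] by simp

lemma wfunctional_sum:
  assumes "wfunctional W U" "\<And>i. i \<in> I \<Longrightarrow> f i \<in> wspace W"
  shows "U (\<lambda>x. \<Sum>i\<in>I. f i x) = (\<Sum>i\<in>I. U (f i))"
  using assms(2)
  by (induction I rule: infinite_finite_induct)
    (simp_all add: wfunctional_zero[OF assms(1)] wfunctional_add[OF assms(1)] wspace_sum)

text \<open>Homogeneity, with a = 0 apart: a vanishing weight forces f = 0.\<close>

lemma wfunctional_scaled_bound:
  assumes U: "wfunctional W U" and f: "f \<in> wspace W" and a: "0 \<le> a"
    and bd: "ladder_bdd f (\<lambda>k. a * \<omega> k)"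
    and C: "\<And>f. f \<in> wspace W \<Longrightarrow> ladder_bdd f \<omega> \<Longrightarrow> cmod (U f) \<le> C"
  shows "cmod (U f) \<le> a * C"
proof (cases "a = 0")
  case True
  then have "f = (\<lambda>x. 0)" using ladder_bdd_0[OF bd] by (auto simp: fun_eq_iff)
  then show ?thesis using True wfunctional_zero[OF U] by simp
next
  case False
  have "ladder_bdd (\<lambda>x. of_real (1 / a) * f x) (\<lambda>k. cmod (of_real (1 / a)) * (a * \<omega> k))"
    by (rule ladder_bdd_cmult[OF wspace_smooth[OF f] bd])
  then have "ladder_bdd (\<lambda>x. of_real (1 / a) * f x) \<omega>" using a False by (simp add: norm_divide)
  then have "cmod (U (\<lambda>x. of_real (1 / a) * f x)) \<le> C" by (intro C wspace_cmult f)
  then have "cmod (of_real (1 / a) * U f) \<le> C" by (simp only: wfunctional_cmult[OF U f])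
  then have "cmod (U f) / a \<le> C" using a by (simp add: norm_mult norm_divide)
  then show ?thesis using a False by (simp add: divide_le_eq mult.commute)
qed

lemma wfunctional_combination:
  assumes "wfunctional W U" "wfunctional W V"
  shows "wfunctional W (\<lambda>f. a * U f + b * V f)"
  unfolding wfunctional_def
proof (intro conjI ballI allI)
  fix \<omega> assume w: "\<omega> \<in> W"
  obtain C D where C: "\<forall>f\<in>wspace W. ladder_bdd f \<omega> \<longrightarrow> cmod (U f) \<le> C"
    and D: "\<forall>f\<in>wspace W. ladder_bdd f \<omega> \<longrightarrow> cmod (V f) \<le> D"
    using wfunctional_bdd[OF assms(1) w] wfunctional_bdd[OF assms(2) w] by blast
  have "cmod (a * U f + b * V f) \<le> cmod a * C + cmod b * D" if "f \<in> wspace W" "ladder_bdd f \<omega>" for f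
  proof -
    have "cmod (a * U f + b * V f) \<le> cmod a * cmod (U f) + cmod b * cmod (V f)"
      by (metis norm_triangle_ineq norm_mult)
    also have "\<dots> \<le> cmod a * C + cmod b * D"
      using C D that by (intro add_mono mult_left_mono) auto
    finally show ?thesis .
  qed
  then show "\<exists>C. \<forall>f\<in>wspace W. ladder_bdd f \<omega> \<longrightarrow> cmod (a * U f + b * V f) \<le> C" by blast
qed (simp_all add: wfunctional_add[OF assms(1)] wfunctional_add[OF assms(2)]
    wfunctional_cmult[OF assms(1)] wfunctional_cmult[OF assms(2)] algebra_simps)

text \<open>\<open>f\<close> minus its Hermite projections satisfies ladder bounds in \<open>W\<close> with a constant tending to 0.\<close>

lemma wfunctional_vanish:
  fixes U :: "'n::finite functional"
  assumes U: "wfunctional W U" and f: "f \<in> wspace W"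
    and 0: "\<And>n. U (hprojs n coords f) = 0"
  shows "U f = 0"
proof -
  obtain \<omega> where w: "\<omega> \<in> W" "ladder_bdd f \<omega>" using f unfolding wspace_def by blast
  obtain \<omega>' where w': "\<omega>' \<in> W" and res: "\<And>n. n \<ge> 1 \<Longrightarrow>
    ladder_bdd (\<lambda>x. f x - hprojs n coords f x) (\<lambda>k. \<omega>' k / real n ^ 1)"
    using hprojs_residual[OF w(1), of 1 "coords :: 'n list"] w(2) wspace_smooth[OF f] by blast
  obtain C where C: "\<And>f. f \<in> wspace W \<Longrightarrow> ladder_bdd f \<omega>' \<Longrightarrow> cmod (U f) \<le> C"
    using wfunctional_bdd[OF U w'] by blast
  have b: "cmod (U f) \<le> (1 / real (Suc n)) * C" for n
  proof -
    have h: "hprojs (Suc n) coords f \<in> wspace W" by (rule hprojs_wspace[OF wspace_rdec[OF f]])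
    have "cmod (U (\<lambda>x. f x - hprojs (Suc n) coords f x)) \<le> (1 / real (Suc n)) * C"
      using res[of "Suc n"] by (intro wfunctional_scaled_bound[OF U wspace_diff[OF f h] _ _ C]) simp_all
    then show ?thesis using wfunctional_diff[OF U f h] 0 by simp
  qed
  have "(\<lambda>n. (1 / real (Suc n)) * C) \<longlonglongrightarrow> 0 * C"
    by (intro tendsto_mult tendsto_const LIMSEQ_inverse_real_of_nat[unfolded inverse_eq_divide])
  from LIMSEQ_le_const[OF this] b have "cmod (U f) \<le> 0 * C" by blast
  then show ?thesis by simp
qed

text \<open>The Taylor remainder of K in x is, as a function of y, ladder bounded by the square of
  the increment times the weight shifted by 2, because two x-derivatives cost two letters. A
  functional bounded on that weight turns this into a quadratic remainder, and
  \<open>second_order_partial\<close> applies.\<close>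

lemma wfunctional_slice_derivative:
  fixes K :: "real^('m::finite + 'n::finite) \<Rightarrow> complex"
  assumes U: "wfunctional W U" and K: "K \<in> wspace W"
  shows "(\<lambda>x. U (\<lambda>y. K (join x y))) differentiable (at x)"
    and "partial i (\<lambda>x. U (\<lambda>y. K (join x y))) x = U (\<lambda>y. partial (Inl i) K (join x y))"
proof -
  obtain \<omega> where w: "\<omega> \<in> W" "ladder_bdd K \<omega>" using K unfolding wspace_def by blast
  note sK = wspace_smooth[OF K]
  define \<omega>' where "\<omega>' k = \<omega> (k + 2)" for k
  have w': "\<omega>' \<in> W" unfolding \<omega>'_def[abs_def] by (rule shift_add[OF w(1)])
  obtain C where C: "\<And>f. f \<in> wspace W \<Longrightarrow> ladder_bdd f \<omega>' \<Longrightarrow> cmod (U f) \<le> C"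
    using wfunctional_bdd[OF U w'] by blast
  let ?d = "\<lambda>j y. partial (Inl j) K (join x y)"
  have d: "?d j \<in> wspace W" for j by (intro wspace_join_right wspace_partial K)
  have est: "cmod (U (\<lambda>y. K (join (x + v) y)) - U (\<lambda>y. K (join x y)) - (\<Sum>j\<in>UNIV. of_real (v $ j) * U (?d j)))
      \<le> C * (\<Sum>j\<in>UNIV. \<bar>v $ j\<bar>)\<^sup>2" for v :: "real^'m"
  proof -
    define r where "r y = (K (join (x + v) y) - K (join x y)) - (\<Sum>j\<in>UNIV. of_real (v $ j) * ?d j y)" for y
    have s: "(\<lambda>y. K (join (x + v) y) - K (join x y)) \<in> wspace W"
      "(\<lambda>y. \<Sum>j\<in>UNIV. of_real (v $ j) * ?d j y) \<in> wspace W"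
      by (intro wspace_diff wspace_join_right K wspace_sum wspace_cmult d)+
    have "U r = U (\<lambda>y. K (join (x + v) y)) - U (\<lambda>y. K (join x y)) - (\<Sum>j\<in>UNIV. of_real (v $ j) * U (?d j))"
      unfolding r_def[abs_def]
      by (simp add: wfunctional_diff[OF U] s wspace_join_right K wfunctional_sum[OF U] wspace_cmult d
          wfunctional_cmult[OF U])
    moreover have "cmod (U r) \<le> (\<Sum>j\<in>UNIV. \<bar>v $ j\<bar>)\<^sup>2 * C"
    proof (rule wfunctional_scaled_bound[OF U _ _ _ C])
      show "r \<in> wspace W" unfolding r_def[abs_def] by (intro wspace_diff s)
      show "ladder_bdd r (\<lambda>k. (\<Sum>j\<in>UNIV. \<bar>v $ j\<bar>)\<^sup>2 * \<omega>' k)"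
        unfolding ladder_bdd_def
      proof (intro allI)
        fix u :: "('n \<times> bool) list" and y
        define J where "J = word (rword u :: (('m + 'n) \<times> bool) list) K"
        have J: "smooth J" unfolding J_def by (rule smooth_word[OF sK])
        have Jb: "ladder_bdd J (\<lambda>k. \<omega> (k + length u))"
          unfolding J_def using ladder_bdd_word[OF w(2), of "rword u"] by simp
        have sm: "smooth (\<lambda>y. K (join z y))" "smooth (\<lambda>y. of_real (v $ j) * ?d j y)" for z j
          by (intro smooth_join_right sK smooth_cmult smooth_partial)+
        \<comment> \<open>The word in y passes through increments and derivatives in x, so it maps
          the remainder of \<open>K\<close> to the remainder of \<open>J\<close>.\<close>
        have "word u r y = (J (join (x + v) y) - J (join x y)) - (\<Sum>j\<in>UNIV. of_real (v $ j) * partial (Inl j) J (join x y))"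
          unfolding r_def[abs_def] J_def
          by (simp add: word_diff word_sum word_cmult smooth_diff smooth_sum sm smooth_join_right smooth_partial sK
              word_join_right partial_word_right)
        also have "\<dots> = J (join (x + v) y) - J (join x y) - (\<Sum>j\<in>UNIV. of_real (v $ j) * partial j (\<lambda>x. J (join x y)) x)"
          by (simp add: partial_join_left(2)[OF J])
        also have "cmod \<dots> \<le> \<omega> (length u + 2) * (\<Sum>j\<in>UNIV. \<bar>v $ j\<bar>)\<^sup>2"
        proof (rule second_order_bound[OF smooth_join_left[OF J]])
          fix a b z
          have "partial b (\<lambda>x. J (join x y)) = (\<lambda>x. partial (Inl b) J (join x y))"
            by (rule ext) (rule partial_join_left(2)[OF J])
          then have "partial a (partial b (\<lambda>x. J (join x y))) z = partial (Inl a) (partial (Inl b) J) (join z y)"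
            by (simp add: partial_join_left(2) smooth_partial J)
          then show "cmod (partial a (partial b (\<lambda>x. J (join x y))) z) \<le> \<omega> (length u + 2)"
            using ladder_bdd_0[OF ladder_bdd_partial[OF smooth_partial[OF J] ladder_bdd_partial[OF J Jb]]]
            by simp
        qed
        finally show "cmod (word u r y) \<le> (\<Sum>j\<in>UNIV. \<bar>v $ j\<bar>)\<^sup>2 * \<omega>' (length u)"
          by (simp add: \<omega>'_def mult.commute)
      qed
    qed simp
    ultimately show ?thesis by (simp add: mult.commute)
  qed
  show "(\<lambda>x. U (\<lambda>y. K (join x y))) differentiable (at x)"
    and "partial i (\<lambda>x. U (\<lambda>y. K (join x y))) x = U (?d i)"
    using second_order_partial[OF est] by auto
qed

lemma smooth_wfunctional_slice:
  fixes K :: "real^('m::finite + 'n::finite) \<Rightarrow> complex"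
  assumes U: "wfunctional W U" and K: "K \<in> wspace W"
  shows "smooth (\<lambda>x. U (\<lambda>y. K (join x y)))"
proof -
  have "Ck m (\<lambda>x. U (\<lambda>y. K (join x y)))" for m
    using K
  proof (induction m arbitrary: K)
    case 0
    then show ?case using wfunctional_slice_derivative(1)[OF U 0]
      by (auto simp: continuous_on_eq_continuous_within intro!: differentiable_imp_continuous_within)
  next
    case (Suc m)
    have "partial j (\<lambda>x. U (\<lambda>y. K (join x y))) = (\<lambda>x. U (\<lambda>y. partial (Inl j) K (join x y)))" for j
      by (rule ext) (rule wfunctional_slice_derivative(2)[OF U Suc.prems])
    then show ?case
      using wfunctional_slice_derivative(1)[OF U Suc.prems] Suc.IH[OF wspace_partial[OF Suc.prems]] by simp
  qed
  then show ?thesis by (simp add: smooth_def)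
qed

definition lword :: "('m \<times> bool) list \<Rightarrow> (('m + 'n) \<times> bool) list" where
  "lword w = map (\<lambda>(j, b). (Inl j, b)) w"

lemma word_wfunctional_slice:
  fixes K :: "real^('m::finite + 'n::finite) \<Rightarrow> complex"
  assumes U: "wfunctional W U" and K: "K \<in> wspace W"
  shows "word w (\<lambda>x. U (\<lambda>y. K (join x y))) = (\<lambda>x. U (\<lambda>y. word (lword w) K (join x y)))"
proof (induction w)
  case (Cons l w)
  obtain i b where l: "l = (i, b)" by (cases l) auto
  define J where "J = word (lword w :: (('m + 'n) \<times> bool) list) K"
  have J: "J \<in> wspace W" unfolding J_def by (rule wspace_word[OF K])
  have "ladder (i, b) (\<lambda>x. U (\<lambda>y. J (join x y))) x = U (\<lambda>y. ladder (Inl i, b) J (join x y))" for x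
  proof -
    let ?c = "if b then 1 else -1 :: complex"
    have "U (\<lambda>y. ladder (Inl i, b) J (join x y))
      = U (\<lambda>y. of_real (x $ i) * J (join x y) + ?c * partial (Inl i) J (join x y))"
      by (simp add: ladder_def)
    also have "\<dots> = of_real (x $ i) * U (\<lambda>y. J (join x y)) + ?c * U (\<lambda>y. partial (Inl i) J (join x y))"
      by (simp only: wfunctional_add[OF U] wfunctional_cmult[OF U] wspace_cmult wspace_join_right J wspace_partial)
    also have "\<dots> = ladder (i, b) (\<lambda>x. U (\<lambda>y. J (join x y))) x"
      by (simp add: ladder_def wfunctional_slice_derivative(2)[OF U J])
    finally show ?thesis by simp
  qed
  then show ?case using Cons by (simp add: word_Cons l J_def lword_def)
qed (simp add: lword_def)

text \<open>Letters in x act on K under the functional, letters in y are those against which U is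
  bounded. Of j + k letters in all, the split weight assigns \<omega>' k to the former and \<omega>'
  j to the latter, so U enters the bound through the constant C only.\<close>

lemma ladder_bdd_wfunctional_slice:
  fixes K :: "real^('m::finite + 'n::finite) \<Rightarrow> complex"
  assumes U: "wfunctional W U" and K: "K \<in> wspace W" "ladder_bdd K \<omega>"
    and split: "\<And>j k. \<omega> (j + k) \<le> \<omega>' j * \<omega>' k" "\<And>k. 0 \<le> \<omega>' k"
    and C: "\<And>f. f \<in> wspace W \<Longrightarrow> ladder_bdd f \<omega>' \<Longrightarrow> cmod (U f) \<le> C"
  shows "ladder_bdd (\<lambda>x. U (\<lambda>y. K (join x y))) (\<lambda>k. C * \<omega>' k)"
  unfolding ladder_bdd_def
proof (intro allI)
  fix w x
  let ?J = "word (lword w) K"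
  have J: "?J \<in> wspace W" by (rule wspace_word[OF K(1)])
  have "ladder_bdd ?J (\<lambda>j. \<omega> (j + length w))"
    using ladder_bdd_word[OF K(2), of "lword w"] by (simp add: lword_def)
  then have "ladder_bdd ?J (\<lambda>j. \<omega>' (length w) * \<omega>' j)"
    by (rule ladder_bdd_mono) (metis split(1) mult.commute)
  then have "ladder_bdd (\<lambda>y. ?J (join x y)) (\<lambda>j. \<omega>' (length w) * \<omega>' j)"
    by (rule ladder_bdd_join_right[OF wspace_smooth[OF J]])
  then have "cmod (U (\<lambda>y. ?J (join x y))) \<le> \<omega>' (length w) * C"
    by (intro wfunctional_scaled_bound[OF U _ _ _ C] wspace_join_right J split)
  then show "cmod (word w (\<lambda>x. U (\<lambda>y. K (join x y))) x) \<le> C * \<omega>' (length w)"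
    by (simp add: word_wfunctional_slice[OF U K(1)] mult.commute)
qed

end

section \<open>Singular values of kernel operators\<close>

text \<open>A base set of \<open>nbhd_topology\<close> need not by itself contain an open set around
  0. A sequence with V (Suc k) + V (Suc k) inside V k provides one: the points f for which f + V k
  stays in V 0 for some k form an open set, since a step by V (Suc k) leaves another V (Suc k) as
  room.\<close>

lemma nbhd_interior:
  fixes E :: "'v::ab_group_add set"
  assumes op: "\<And>U. openin X U \<longleftrightarrow> U \<subseteq> E \<and> (\<forall>f\<in>U. \<exists>V\<in>\<V>. \<forall>g\<in>V. f + g \<in> E \<longrightarrow> f + g \<in> U)"
    and E: "0 \<in> E" "\<And>f g. f \<in> E \<Longrightarrow> g \<in> E \<Longrightarrow> f - g \<in> E"
    and V: "\<And>k. V k \<in> \<V>" "\<And>k. 0 \<in> V k"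
    and half: "\<And>k g g'. g \<in> V (Suc k) \<Longrightarrow> g' \<in> V (Suc k) \<Longrightarrow> g \<in> E \<Longrightarrow> g' \<in> E \<Longrightarrow> g + g' \<in> V k"
  shows "\<exists>Q. openin X Q \<and> 0 \<in> Q \<and> Q \<subseteq> V (0::nat)"
proof -
  define Q where "Q = {f \<in> E. \<exists>k. \<forall>g\<in>V k. f + g \<in> E \<longrightarrow> f + g \<in> V 0}"
  have "openin X Q"
    unfolding op
  proof (intro conjI ballI)
    show "Q \<subseteq> E" by (auto simp: Q_def)
    fix f assume "f \<in> Q"
    then obtain k where f: "f \<in> E" and k: "\<And>g. g \<in> V k \<Longrightarrow> f + g \<in> E \<Longrightarrow> f + g \<in> V 0"
      by (auto simp: Q_def)
    have "f + g \<in> Q" if g: "g \<in> V (Suc k)" "f + g \<in> E" for g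
    proof -
      have gE: "g \<in> E" using E(2)[OF g(2) f] by simp
      have "f + g + g' \<in> V 0" if g': "g' \<in> V (Suc k)" "f + g + g' \<in> E" for g'
      proof -
        have "g' \<in> E" using E(2)[OF g'(2) g(2)] by simp
        then have "g + g' \<in> V k" using half g(1) g'(1) gE by blast
        then show ?thesis using k[of "g + g'"] g'(2) by (simp add: add.assoc)
      qed
      then show ?thesis using g(2) by (auto simp: Q_def)
    qed
    then show "\<exists>V\<in>\<V>. \<forall>g\<in>V. f + g \<in> E \<longrightarrow> f + g \<in> Q" using V(1) by blast
  qed
  moreover have "0 \<in> Q" using E(1) by (auto simp: Q_def intro: exI[of _ 0])
  moreover have "Q \<subseteq> V 0"
  proof
    fix f assume "f \<in> Q"
    then obtain k where f: "f \<in> E" and k: "\<And>g. g \<in> V k \<Longrightarrow> f + g \<in> E \<Longrightarrow> f + g \<in> V 0"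
      by (auto simp: Q_def)
    show "f \<in> V 0" using k[of 0] f V(2)[of k] by simp
  qed
  ultimately show ?thesis by blast
qed

lemma seminorm_interior:
  fixes E :: "'v::ab_group_add set"
  assumes E: "0 \<in> E" "\<And>f g. f \<in> E \<Longrightarrow> g \<in> E \<Longrightarrow> f - g \<in> E"
    and i: "i \<in> I" and N0: "N i 0 = 0" and D: "D \<ge> 1"
    and tri: "\<And>f g. f \<in> E \<Longrightarrow> g \<in> E \<Longrightarrow> N i (f + g) \<le> ennreal D * (N i f + N i g)"
    and e: "0 < \<epsilon>"
  shows "\<exists>Q. openin (seminorm_topology E I N) Q \<and> 0 \<in> Q \<and> (\<forall>f\<in>Q. N i f < ennreal \<epsilon>)"
proof -
  \<comment> \<open>The ratio 4 D makes D (c + c) at level k + 1 equal to half of c at level k, so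
    the balls form such a sequence even for a quasi-norm with constant D.\<close>
  define c where "c k = \<epsilon> / (4 * D) ^ k" for k :: nat
  have c: "c k > 0" for k using e D by (simp add: c_def)
  define V where "V k = {g. N i g < ennreal (c k)}" for k
  have "\<exists>Q. openin (seminorm_topology E I N) Q \<and> 0 \<in> Q \<and> Q \<subseteq> V 0"
  proof (rule nbhd_interior[OF openin_seminorm_topology E])
    show "V k \<in> seminorm_nbhds I N" for k
      unfolding seminorm_nbhds_def V_def using i c[of k]
      by (intro CollectI exI[of _ "{i}"] exI[of _ "c k"]) auto
    show "0 \<in> V k" for k using c[of k] by (simp add: V_def N0)
    fix k g g' assume g: "g \<in> V (Suc k)" "g' \<in> V (Suc k)" "g \<in> E" "g' \<in> E"
    have "N i (g + g') \<le> ennreal D * (N i g + N i g')" by (rule tri[OF g(3,4)])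
    also have "\<dots> \<le> ennreal D * (ennreal (c (Suc k)) + ennreal (c (Suc k)))"
      using g by (intro mult_left_mono add_mono) (auto simp: V_def)
    also have "\<dots> = ennreal (D * (c (Suc k) + c (Suc k)))"
      using D c[of "Suc k"] by (simp add: ennreal_mult' flip: ennreal_plus)
    also have "D * (c (Suc k) + c (Suc k)) = c k / 2"
      using D by (simp add: c_def field_simps)
    also have "ennreal (c k / 2) < ennreal (c k)"
      using c[of k] by (intro ennreal_lessI) auto
    finally show "g + g' \<in> V k" by (simp add: V_def)
  qed
  then show ?thesis by (auto simp: V_def c_def)
qed

lemma quasi_norm_onD:
  assumes "quasi_norm_on B q"
  shows "u \<in> B \<Longrightarrow> 0 \<le> q u" "u \<in> B \<Longrightarrow> q u = 0 \<longleftrightarrow> u = 0"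
    "u \<in> B \<Longrightarrow> q (cscale c u) = cmod c * q u"
    "\<exists>D\<ge>1. \<forall>u\<in>B. \<forall>v\<in>B. q (u + v) \<le> D * (q u + q v)"
  using assms by (simp_all add: quasi_norm_on_def)

lemma quasi_norm_unit_nbhd:
  assumes B: "cfun.subspace B" and q: "quasi_norm_on B q"
  shows "\<exists>Q. openin (quasi_norm_top B q) Q \<and> 0 \<in> Q \<and> (\<forall>u\<in>Q. q u < 1)"
proof -
  obtain D where D: "D \<ge> 1" "\<And>u v. u \<in> B \<Longrightarrow> v \<in> B \<Longrightarrow> q (u + v) \<le> D * (q u + q v)"
    using quasi_norm_onD(4)[OF q] by blast
  have 0: "0 \<in> B" by (rule cfun.subspace_0[OF B])
  have "\<exists>Q. openin (seminorm_topology B {()} (\<lambda>_ u. ennreal (q u))) Q \<and> 0 \<in> Q \<and>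
      (\<forall>f\<in>Q. ennreal (q f) < ennreal 1)"
  proof (rule seminorm_interior[where D=D])
    show "f - g \<in> B" if "f \<in> B" "g \<in> B" for f g using cfun.subspace_diff[OF B that] .
    show "ennreal (q 0) = 0" using quasi_norm_onD(2)[OF q 0] by simp
    fix f g assume f: "f \<in> B" "g \<in> B"
    have "ennreal (q (f + g)) \<le> ennreal (D * (q f + q g))" by (intro ennreal_leI D(2) f)
    also have "\<dots> = ennreal D * (ennreal (q f) + ennreal (q g))"
      using D(1) quasi_norm_onD(1)[OF q] f by (simp add: ennreal_mult' flip: ennreal_plus)
    finally show "ennreal (q (f + g)) \<le> ennreal D * (ennreal (q f) + ennreal (q g))" .
  qed (use 0 D in auto)
  then obtain Q where Q: "openin (quasi_norm_top B q) Q" "0 \<in> Q" "\<forall>f\<in>Q. ennreal (q f) < ennreal 1"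
    unfolding quasi_norm_top_def by (elim exE conjE)
  have *: "q u < 1" if "ennreal (q u) < ennreal 1" for u
  proof (rule ccontr)
    assume "\<not> q u < 1"
    then have "ennreal 1 \<le> ennreal (q u)" by (intro ennreal_leI) simp
    from leD[OF this] that show False by blast
  qed
  show ?thesis
  proof (intro exI conjI ballI)
    show "openin (quasi_norm_top B q) Q" "0 \<in> Q" by (rule Q)+
    show "q u < 1" if "u \<in> Q" for u by (rule *[OF bspec[OF Q(3) that]])
  qed
qed

lemma quasi_norm_top_nbhd:
  assumes "cfun.subspace B" "openin (quasi_norm_top B q) Q" "0 \<in> Q"
  shows "\<exists>\<epsilon>>0. \<forall>u\<in>B. q u < \<epsilon> \<longrightarrow> u \<in> Q"
proof -
  have "\<forall>f\<in>Q. \<exists>V\<in>seminorm_nbhds {()} (\<lambda>_ u. ennreal (q u)). \<forall>g\<in>V. f + g \<in> B \<longrightarrow> f + g \<in> Q"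
    using assms(2) by (simp add: quasi_norm_top_def openin_seminorm_topology)
  from bspec[OF this assms(3)] obtain V where V: "V \<in> seminorm_nbhds {()} (\<lambda>_ u. ennreal (q u))"
    "\<forall>g\<in>V. 0 + g \<in> B \<longrightarrow> 0 + g \<in> Q" by (rule bexE)
  from V(1)[unfolded seminorm_nbhds_def mem_Collect_eq] obtain F :: "unit set" and \<epsilon>
    where F: "V = {g. \<forall>i\<in>F. ennreal (q g) < ennreal \<epsilon>}" and e: "0 < \<epsilon>" by blast
  have "u \<in> V" if "q u < \<epsilon>" for u using that e by (simp add: F ennreal_lessI)
  then have "u \<in> Q" if "u \<in> B" "q u < \<epsilon>" for u using V(2) that by auto
  then show ?thesis using e by blast
qed

lemma topspace_quasi_norm_top [simp]: "topspace (quasi_norm_top B q) = B"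
  by (simp add: quasi_norm_top_def)

text \<open>Expresses that the functions sharing a weight in \<open>W\<close> form a bounded set in
  X: a single dilation brings them all into a given open set around 0.\<close>

definition absorbing :: "(nat \<Rightarrow> real) set \<Rightarrow> (real^'n::finite \<Rightarrow> complex) topology \<Rightarrow> bool" where
  "absorbing W X \<longleftrightarrow> topspace X = wspace W \<and>
     (\<forall>Q. openin X Q \<longrightarrow> 0 \<in> Q \<longrightarrow>
       (\<forall>\<omega>\<in>W. \<exists>\<delta>>0. \<forall>f\<in>wspace W. ladder_bdd f \<omega> \<longrightarrow> cscale (of_real \<delta>) f \<in> Q))"

text \<open>This turns continuity of an embedding into \<open>D\<close> into a bound that is uniform
  over all test functions with a given weight.\<close>

definition polar_nbhds :: "(nat \<Rightarrow> real) set \<Rightarrow> (real^'n::finite \<Rightarrow> complex) topology \<Rightarrow> 'n functional topology \<Rightarrow> bool" where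
  "polar_nbhds W X D \<longleftrightarrow> topspace D = top_dual X \<and>
     (\<forall>\<omega>\<in>W. \<exists>Q. openin D Q \<and> 0 \<in> Q \<and> (\<forall>v\<in>Q. \<forall>f\<in>wspace W. ladder_bdd f \<omega> \<longrightarrow> cmod (v f) \<le> 1))"

lemma linear_functional_zero: "linear_functional_on E u \<Longrightarrow> 0 \<in> E \<Longrightarrow> u 0 = 0"
proof -
  assume "linear_functional_on E u" "0 \<in> E"
  then have "u (cscale 0 0) = 0 * u 0" unfolding linear_functional_on_def by blast
  then show "u 0 = 0" by (simp add: cscale_def zero_fun_def)
qed

context weight_class
begin

lemma top_dual_wfunctional:
  assumes X: "absorbing W X" and u: "u \<in> top_dual X"
  shows "wfunctional W u"
proof -
  have tX: "topspace X = wspace W" using X by (simp add: absorbing_def)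
  have lin: "linear_functional_on (wspace W) u" and cont: "continuous_map X euclidean u"
    using u by (auto simp: top_dual_def tX)
  have z: "0 \<in> wspace W" using wspace_zero by (simp add: zero_fun_def)
  let ?Q = "{f \<in> topspace X. u f \<in> ball 0 1}"
  have "openin X ?Q" by (rule openin_continuous_map_preimage[OF cont]) simp
  moreover have "0 \<in> ?Q" using linear_functional_zero[OF lin z] z by (simp add: tX)
  ultimately have Q: "\<exists>\<delta>>0. \<forall>f\<in>wspace W. ladder_bdd f \<omega> \<longrightarrow> cscale (of_real \<delta>) f \<in> ?Q" if "\<omega> \<in> W" for \<omega>
    using X that unfolding absorbing_def by blast
  show ?thesis
    unfolding wfunctional_def
  proof (intro conjI ballI allI)
    show "u (\<lambda>x. f x + g x) = u f + u g" if "f \<in> wspace W" "g \<in> wspace W" for f g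
      using lin that unfolding linear_functional_on_def plus_fun_def by blast
    show "u (\<lambda>x. c * f x) = c * u f" if "f \<in> wspace W" for c f
      using lin that unfolding linear_functional_on_def cscale_def by blast
    fix \<omega> assume "\<omega> \<in> W"
    then obtain \<delta> where d: "\<delta> > 0" "\<forall>f\<in>wspace W. ladder_bdd f \<omega> \<longrightarrow> cscale (of_real \<delta>) f \<in> ?Q"
      using Q by blast
    have "cmod (u f) \<le> 1 / \<delta>" if f: "f \<in> wspace W" "ladder_bdd f \<omega>" for f
    proof -
      have "u (cscale (of_real \<delta>) f) = of_real \<delta> * u f"
        using lin f(1) unfolding linear_functional_on_def by blast
      moreover have "cmod (u (cscale (of_real \<delta>) f)) < 1" using d(2) f by auto
      ultimately show ?thesis using d(1) by (simp add: norm_mult pos_le_divide_eq mult.commute)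
    qed
    then show "\<exists>C. \<forall>f\<in>wspace W. ladder_bdd f \<omega> \<longrightarrow> cmod (u f) \<le> C" by blast
  qed
qed

text \<open>Takes the place of density of \<open>GS_S (1/2)\<close>: the difference of two
  functionals with equal restrictions is bounded on each weight and vanishes on all Hermite
  projections, hence everywhere by \<open>wfunctional_vanish\<close>.\<close>

lemma of_functional_inj:
  fixes X :: "(real^'n::finite \<Rightarrow> complex) topology"
  assumes X: "absorbing W X" and u: "u \<in> top_dual X" and v: "v \<in> top_dual X"
    and half: "\<forall>n (f :: real^'n \<Rightarrow> complex). rdec f \<longrightarrow> hprojs n coords f \<in> GS_S (1/2)"
    and eq: "of_functional u = of_functional v"
  shows "u = v"
proof
  fix f
  have tX: "topspace X = wspace W" using X by (simp add: absorbing_def)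
  show "u f = v f"
  proof (cases "f \<in> wspace W")
    case True
    have "1 * u f + (-1) * v f = 0"
    proof (rule wfunctional_vanish[OF wfunctional_combination[OF top_dual_wfunctional[OF X u]
            top_dual_wfunctional[OF X v]] True])
      fix n
      have "hprojs n coords f \<in> GS_S (1/2)" using half wspace_rdec[OF True] by blast
      then show "1 * u (hprojs n coords f) + (-1) * v (hprojs n coords f) = 0"
        using fun_cong[OF eq, of "hprojs n coords f"] by (simp add: of_functional_def restr_def)
    qed
    then show ?thesis by simp
  next
    case False
    then show ?thesis using u v by (auto simp: top_dual_def tX linear_functional_on_def)
  qed
qed

text \<open>\<open>E\<close> is a choice of extension from \<open>GS_S (1/2)\<close> to \<open>wspace W\<close>. It is well behaved because extensions are
  unique: the Hermite projections lie in \<open>GS_S (1/2)\<close> and determine a bounded functional.\<close>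

lemma domain_extension:
  fixes X :: "(real^'n::finite \<Rightarrow> complex) topology" and B :: "'n functional set"
  assumes X: "absorbing W X" and D: "polar_nbhds W X D"
    and half: "\<forall>n (f :: real^'n \<Rightarrow> complex). rdec f \<longrightarrow> hprojs n coords f \<in> GS_S (1/2)"
    and B: "cfun.subspace B" "quasi_norm_on B q"
    and emb: "embeds id (quasi_norm_top B q) of_functional D"
  defines "E \<equiv> inv_into (topspace D) of_functional"
  shows "u \<in> B \<Longrightarrow> wfunctional W (E u)"
    and "u \<in> B \<Longrightarrow> v \<in> B \<Longrightarrow> f \<in> wspace W \<Longrightarrow> E (u + v) f = E u f + E v f"
    and "u \<in> B \<Longrightarrow> f \<in> wspace W \<Longrightarrow> E (cscale c u) f = c * E u f"
    and "\<omega> \<in> W \<Longrightarrow> \<exists>C. \<forall>u\<in>B. \<forall>f\<in>wspace W. ladder_bdd f \<omega> \<longrightarrow> cmod (E u f) \<le> C * q u"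
proof -
  obtain e where cont: "continuous_map (quasi_norm_top B q) D e" and e: "\<And>u. u \<in> B \<Longrightarrow> of_functional (e u) = u"
    using emb by (auto simp: embeds_def)
  have tD: "topspace D = top_dual X" using D by (simp add: polar_nbhds_def)
  have eD: "e u \<in> top_dual X" if "u \<in> B" for u
    using continuous_map_image_subset_topspace[OF cont] that tD by auto
  have Ee: "E u = e u" if "u \<in> B" for u
    unfolding E_def
  proof (rule inv_into_f_eq)
    show "inj_on of_functional (topspace D)"
      unfolding tD by (rule inj_onI) (rule of_functional_inj[OF X _ _ half])
  qed (use e eD tD that in auto)
  have w: "wfunctional W (E u)" if "u \<in> B" for u
    using top_dual_wfunctional[OF X eD[OF that]] Ee[OF that] by simp
  then show "u \<in> B \<Longrightarrow> wfunctional W (E u)" by blast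
  have Eh: "E u g = u g" if "u \<in> B" "g \<in> GS_S (1/2)" for u g
    using fun_cong[OF e[OF that(1)], of g] that Ee by (simp add: of_functional_def restr_def)
  have h: "hprojs n coords f \<in> GS_S (1/2)" if "f \<in> wspace W" for n and f :: "real^'n \<Rightarrow> complex"
    using half wspace_rdec[OF that] by blast
  have add: "E (u + v) f = E u f + E v f" if "u \<in> B" "v \<in> B" "f \<in> wspace W" for u v f
  proof -
    have uv: "u + v \<in> B" by (rule cfun.subspace_add[OF B(1) that(1,2)])
    \<comment> \<open>The additivity defect is again a bounded functional, and it vanishes on
      projections because \<open>E u\<close> agrees with \<open>u\<close> on
      \<open>GS_S (1/2)\<close>.\<close>
    have "1 * E (u + v) f + (-1) * (1 * E u f + 1 * E v f) = 0"
    proof (rule wfunctional_vanish[OF wfunctional_combination[OF w[OF uv] wfunctional_combination[OF w w]] that(3)])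
      show "1 * E (u + v) (hprojs n coords f) + (-1) * (1 * E u (hprojs n coords f) + 1 * E v (hprojs n coords f)) = 0" for n
        using that uv h by (simp add: Eh)
    qed (use that in auto)
    then show ?thesis by algebra
  qed
  then show "u \<in> B \<Longrightarrow> v \<in> B \<Longrightarrow> f \<in> wspace W \<Longrightarrow> E (u + v) f = E u f + E v f" .
  have scale: "E (cscale c u) f = c * E u f" if "u \<in> B" "f \<in> wspace W" for c u f
  proof -
    have cu: "cscale c u \<in> B" by (rule cfun.subspace_scale[OF B(1) that(1)])
    have "1 * E (cscale c u) f + (- c) * E u f = 0"
    proof (rule wfunctional_vanish[OF wfunctional_combination[OF w[OF cu] w] that(2)])
      show "1 * E (cscale c u) (hprojs n coords f) + (- c) * E u (hprojs n coords f) = 0" for n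
        using that cu h by (simp add: Eh) (simp add: cscale_def)
    qed (use that in auto)
    then show ?thesis by simp
  qed
  then show "u \<in> B \<Longrightarrow> f \<in> wspace W \<Longrightarrow> E (cscale c u) f = c * E u f" .
  show "\<exists>C. \<forall>u\<in>B. \<forall>f\<in>wspace W. ladder_bdd f \<omega> \<longrightarrow> cmod (E u f) \<le> C * q u" if om: "\<omega> \<in> W"
  proof -
    have zB: "0 \<in> B" by (rule cfun.subspace_0[OF B(1)])
    from bspec[OF conjunct2[OF D[unfolded polar_nbhds_def]] om] obtain Q
      where Q: "openin D Q" "0 \<in> Q" "\<forall>v\<in>Q. \<forall>f\<in>wspace W. ladder_bdd f \<omega> \<longrightarrow> cmod (v f) \<le> 1"
      by (elim exE conjE) (rule that)
    \<comment> \<open>Continuity at 0 is useful only with this value. Since \<open>embeds\<close>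
      asserts no linearity of \<open>e\<close>, it comes from the homogeneity of the unique
      extension.\<close>
    have e0: "e 0 = 0"
    proof
      fix f
      show "e 0 f = 0 f"
      proof (cases "f \<in> wspace W")
        case True
        have "E (cscale 0 0) f = 0" using scale[OF zB True, of 0] by simp
        then show ?thesis using Ee[OF zB] by (simp add: cscale_def zero_fun_def)
      next
        case False
        then show ?thesis using eD[OF zB] X by (auto simp: top_dual_def absorbing_def linear_functional_on_def)
      qed
    qed
    have "openin (quasi_norm_top B q) {u \<in> B. e u \<in> Q}"
      using openin_continuous_map_preimage[OF cont Q(1)] by simp
    then obtain \<epsilon> where eps: "\<epsilon> > 0" "\<And>u. u \<in> B \<Longrightarrow> q u < \<epsilon> \<Longrightarrow> e u \<in> Q"
      using quasi_norm_top_nbhd[OF B(1), of q "{u \<in> B. e u \<in> Q}"] zB Q(2) e0 by auto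
    have "cmod (E u f) \<le> (2 / \<epsilon>) * q u" if u: "u \<in> B" and f: "f \<in> wspace W" "ladder_bdd f \<omega>" for u f
    proof (cases "u = 0")
      case True
      then show ?thesis using Ee[OF zB] e0 quasi_norm_onD(2)[OF B(2) zB] by simp
    next
      case False
      then have qu: "q u > 0" using quasi_norm_onD(1,2)[OF B(2) u] by simp
      \<comment> \<open>Rescales u to quasi-norm \<epsilon> / 2, strictly inside the ball that
        \<open>e\<close> maps into \<open>Q\<close>; undoing the dilation gives the constant 2 /
        \<epsilon>.\<close>
      define t where "t = \<epsilon> / (2 * q u)"
      have t: "t > 0" using qu eps(1) by (simp add: t_def)
      have tu: "cscale (of_real t) u \<in> B" by (rule cfun.subspace_scale[OF B(1) u])
      have "t * q u = \<epsilon> / 2" using qu by (simp add: t_def)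
      then have "q (cscale (of_real t) u) = \<epsilon> / 2"
        using quasi_norm_onD(3)[OF B(2) u, of "of_real t"] t by simp
      then have "cmod (E (cscale (of_real t) u) f) \<le> 1"
        using eps tu Ee[OF tu] Q(3) f by auto
      then have "t * cmod (E u f) \<le> 1" using scale[OF u f(1)] t by (simp add: norm_mult)
      then have "cmod (E u f) \<le> 1 / t" using t by (simp add: pos_le_divide_eq mult.commute)
      then show ?thesis by (simp add: t_def)
    qed
    then show ?thesis by blast
  qed
qed

lemma of_function_add:
  assumes "rdec f" "rdec g" and half: "\<forall>h \<in> (GS_S (1/2) :: (real^'n::finite \<Rightarrow> complex) set). rdec h"
  shows "of_function (\<lambda>x::real^'n. f x + g x) = of_function f + of_function g"
proof
  fix h
  show "of_function (\<lambda>x. f x + g x) h = (of_function f + of_function g) h"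
    unfolding of_function_def restr_def plus_fun_def
    using rdec_mult_integrable[OF assms(1), of h] rdec_mult_integrable[OF assms(2), of h] half
    by (simp add: distrib_right)
qed

lemma of_function_cmult: "of_function (\<lambda>x. c * f x) = cscale c (of_function f)"
  unfolding of_function_def restr_def cscale_def by (auto simp: mult.assoc fun_eq_iff)

text \<open>Continuity of the embedding at 0 yields an open set of test functions whose images have
  quasi-norm below 1. By \<open>absorbing\<close> it contains \<delta> f for every f of weight
  \<omega>, so C = 1 / \<delta> works, and homogeneity brings in the factor a.\<close>

lemma range_bound:
  fixes X :: "(real^'m::finite \<Rightarrow> complex) topology" and B :: "'m functional set"
  assumes X: "absorbing W X" and B: "cfun.subspace B" "quasi_norm_on B q"
    and emb: "embeds of_function X id (quasi_norm_top B q)"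
  shows "f \<in> wspace W \<Longrightarrow> of_function f \<in> B"
    and "\<omega> \<in> W \<Longrightarrow> \<exists>C\<ge>0. \<forall>a\<ge>0. \<forall>f\<in>wspace W. ladder_bdd f (\<lambda>k. a * \<omega> k) \<longrightarrow> q (of_function f) \<le> C * a"
proof -
  have tX: "topspace X = wspace W" using X by (simp add: absorbing_def)
  obtain e where cont: "continuous_map X (quasi_norm_top B q) e" and e: "\<And>f. f \<in> wspace W \<Longrightarrow> e f = of_function f"
    using emb by (auto simp: embeds_def tX)
  show inB: "of_function f \<in> B" if "f \<in> wspace W" for f
    using continuous_map_image_subset_topspace[OF cont] e[OF that] that tX by force
  assume om: "\<omega> \<in> W"
  have z: "0 \<in> wspace W" using wspace_zero by (simp add: zero_fun_def)
  have of0: "of_function (0 :: real^'m \<Rightarrow> complex) = 0"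
    by (auto simp: of_function_def restr_def fun_eq_iff)
  obtain Q where Q: "openin (quasi_norm_top B q) Q" "0 \<in> Q" "\<And>u. u \<in> Q \<Longrightarrow> q u < 1"
    using quasi_norm_unit_nbhd[OF B] by blast
  have op: "openin X {f \<in> topspace X. e f \<in> Q}" by (rule openin_continuous_map_preimage[OF cont Q(1)])
  have zQ: "0 \<in> {f \<in> topspace X. e f \<in> Q}" using z e[OF z] of0 Q(2) by (simp add: tX)
  have "\<exists>\<delta>>0. \<forall>f\<in>wspace W. ladder_bdd f \<omega> \<longrightarrow> cscale (of_real \<delta>) f \<in> Q'"
    if "openin X Q'" "0 \<in> Q'" for Q'
    using X om that unfolding absorbing_def by simp
  from this[OF op zQ] obtain \<delta> where d: "\<delta> > 0"
    "\<And>f. f \<in> wspace W \<Longrightarrow> ladder_bdd f \<omega> \<Longrightarrow> cscale (of_real \<delta>) f \<in> {f \<in> topspace X. e f \<in> Q}"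
    by blast
  have sc: "cscale c f \<in> wspace W" "of_function (cscale c f) = cscale c (of_function f)" if "f \<in> wspace W" for c f
    using wspace_cmult[OF that, of c] of_function_cmult[of c f] by (auto simp: cscale_def)
  have one: "q (of_function f) \<le> 1 / \<delta>" if f: "f \<in> wspace W" "ladder_bdd f \<omega>" for f
  proof -
    have "q (cscale (of_real \<delta>) (of_function f)) < 1"
      using d(2)[OF f] Q(3) e sc[OF f(1)] by auto
    then have "\<delta> * q (of_function f) < 1"
      using quasi_norm_onD(3)[OF B(2) inB[OF f(1)], of "of_real \<delta>"] d(1) by simp
    then show ?thesis using d(1) by (simp add: pos_le_divide_eq mult.commute)
  qed
  have "q (of_function f) \<le> 1 / \<delta> * a" if a: "a \<ge> 0" and f: "f \<in> wspace W" "ladder_bdd f (\<lambda>k. a * \<omega> k)" for a f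
  proof (cases "a = 0")
    case True
    then have "f = 0" using ladder_bdd_0[OF f(2)] by (auto simp: fun_eq_iff)
    then show ?thesis using True of0 quasi_norm_onD(2)[OF B(2) cfun.subspace_0[OF B(1)]] by simp
  next
    case False
    have "ladder_bdd (\<lambda>x. of_real (1 / a) * f x) (\<lambda>k. cmod (of_real (1 / a)) * (a * \<omega> k))"
      by (rule ladder_bdd_cmult[OF wspace_smooth[OF f(1)] f(2)])
    then have "ladder_bdd (cscale (of_real (1 / a)) f) \<omega>" using a False by (simp add: norm_divide cscale_def)
    then have "q (of_function (cscale (of_real (1 / a)) f)) \<le> 1 / \<delta>" by (intro one sc f)
    then have "q (of_function f) / a \<le> 1 / \<delta>"
      using quasi_norm_onD(3)[OF B(2) inB[OF f(1)], of "of_real (1 / a)"] a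
      by (simp only: sc(2)[OF f(1)]) (simp add: norm_divide)
    then show ?thesis using a False by (simp add: divide_le_eq)
  qed
  then show "\<exists>C\<ge>0. \<forall>a\<ge>0. \<forall>f\<in>wspace W. ladder_bdd f (\<lambda>k. a * \<omega> k) \<longrightarrow> q (of_function f) \<le> C * a"
    using d(1) by (intro exI[of _ "1 / \<delta>"]) auto
qed

end

section \<open>From finite rank approximation to Schatten classes\<close>

lemma singular_value_le:
  assumes "linear_map_on B1 T0" "T0 ` B1 \<subseteq> B2" "rank_le k B1 T0"
    and "\<And>u. u \<in> B1 \<Longrightarrow> q1 u \<le> 1 \<Longrightarrow> q2 (T u - T0 u) \<le> c"
  shows "singular_value (Suc k) B1 q1 B2 q2 T \<le> ennreal c"
proof -
  have "singular_value (Suc k) B1 q1 B2 q2 T \<le> op_norm B1 q1 q2 (\<lambda>u. T u - T0 u)"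
    unfolding singular_value_def using assms by (intro INF_lower) auto
  also have "\<dots> \<le> ennreal c"
    unfolding op_norm_def using assms(4) by (intro SUP_least ennreal_leI) auto
  finally show ?thesis .
qed

lemma epow_le:
  assumes "x \<le> ennreal c" "0 \<le> c" "0 \<le> r"
  shows "epow x r \<le> ennreal (c powr r)"
proof -
  have x: "x \<noteq> \<infinity>" using assms(1) by (metis ennreal_neq_top top.extremum_uniqueI infinity_ennreal_def)
  have "enn2real x \<le> c" using enn2real_mono[OF assms(1)] assms(2) by simp
  then have "enn2real x powr r \<le> c powr r" using assms by (intro powr_mono2) auto
  then show ?thesis using x by (simp add: epow_def ennreal_leI)
qed

text \<open>Comparison with the series of 1 / k^2, after choosing r with r s \<ge> 2 for the
  exponent s. The term k = 0 lies outside the decay hypothesis and is controlled by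
  \<open>a0\<close>.\<close>

lemma lp_norm_finite:
  assumes p: "0 < p" and a0: "a 0 < \<infinity>"
    and dec: "\<And>r. \<exists>C\<ge>0. \<forall>k\<ge>1. a k \<le> ennreal (C / real k ^ r)"
  shows "lp_norm p a < \<infinity>"
proof (cases "p = \<infinity>")
  case True
  obtain C where C: "\<And>k. k \<ge> 1 \<Longrightarrow> a k \<le> ennreal (C / real k ^ 0)" using dec[of 0] by blast
  have "a k \<le> max (a 0) (ennreal C)" for k
    using C[of k] by (cases "k = 0") (auto simp: max.coboundedI2)
  then have "(SUP k. a k) \<le> max (a 0) (ennreal C)" by (intro SUP_least)
  also have "\<dots> < \<infinity>" using a0 by simp
  finally show ?thesis using True by (simp add: lp_norm_def)
next
  case False
  define s where "s = enn2real p"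
  have s: "s > 0" using p False by (simp add: s_def enn2real_positive_iff less_top)
  define r where "r = nat \<lceil>2 / s\<rceil>"
  have r: "real r * s \<ge> 2"
  proof -
    have "2 / s \<le> real r" unfolding r_def using real_nat_ceiling_ge by blast
    then show ?thesis using s by (simp add: pos_divide_le_eq)
  qed
  obtain C where C0: "C \<ge> 0" and C: "\<And>k. k \<ge> 1 \<Longrightarrow> a k \<le> ennreal (C / real k ^ r)" using dec[of r] by blast
  define b where "b k = (if k = 0 then enn2real (a 0) powr s else C powr s * inverse (real k ^ 2))" for k
  have "epow (a k) s \<le> ennreal (b k)" for k
  proof (cases "k = 0")
    case True
    then show ?thesis using a0 by (simp add: epow_def b_def less_top)
  next
    case False
    then have k: "real k \<ge> 1" by simp
    have "epow (a k) s \<le> ennreal ((C / real k ^ r) powr s)"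
      using C[of k] C0 False s by (intro epow_le) auto
    also have "(C / real k ^ r) powr s = C powr s * inverse (real k powr (real r * s))"
    proof -
      have "(C / real k ^ r) powr s = C powr s / (real k ^ r) powr s"
        by (rule powr_divide)
      also have "(real k ^ r) powr s = real k powr (real r * s)"
        using k by (simp add: powr_realpow[symmetric] powr_powr)
      finally show ?thesis by (simp add: divide_inverse)
    qed
    also have "\<dots> \<le> C powr s * inverse (real k powr 2)"
      using k r by (intro mult_left_mono le_imp_inverse_le powr_mono) auto
    also have "real k powr 2 = real k ^ 2" using k by (simp add: powr_numeral)
    finally show ?thesis using False by (simp add: b_def ennreal_leI)
  qed
  then have "(\<Sum>k. epow (a k) s) \<le> (\<Sum>k. ennreal (b k))" by (intro suminf_le) auto
  also have "\<dots> = ennreal (\<Sum>k. b k)"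
  proof (rule suminf_ennreal2)
    show "summable b"
    proof (subst summable_Suc_iff[symmetric])
      have "summable (\<lambda>k. C powr s * inverse (real (Suc k) ^ 2))"
        using summable_ignore_initial_segment[OF inverse_power_summable[of 2, where 'a=real], of 1]
        by (intro summable_mult) simp
      then show "summable (\<lambda>k. b (Suc k))" by (simp add: b_def)
    qed
  qed (auto simp: b_def)
  finally have "(\<Sum>k. epow (a k) s) \<noteq> \<infinity>" by (metis ennreal_neq_top top.extremum_uniqueI infinity_ennreal_def)
  moreover have "lp_norm p a = epow (\<Sum>k. epow (a k) s) (1 / s)"
    using False by (simp add: lp_norm_def s_def)
  ultimately show ?thesis by (simp add: epow_def less_top)
qed

text \<open>n is the largest cutoff whose rank n^d fits into the budget k; its maximality gives the
  upper bound.\<close>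

lemma floor_root_exists:
  assumes "d \<ge> 1" "k \<ge> (1::nat)"
  shows "\<exists>n\<ge>1. n ^ d \<le> k \<and> k \<le> (Suc n) ^ d"
proof -
  let ?S = "{n. n ^ d \<le> k}"
  have "n \<le> k" if "n ^ d \<le> k" for n
  proof (cases "n = 0")
    case False
    then have "n \<le> n ^ d" using assms(1) by (intro self_le_power) auto
    then show ?thesis using that by simp
  qed simp
  then have fin: "finite ?S" by (intro finite_subset[of ?S "{..k}"]) auto
  have 1: "1 \<in> ?S" using assms(2) by simp
  define n where "n = Max ?S"
  have "n \<in> ?S" unfolding n_def using Max_in[OF fin] 1 by blast
  moreover have "1 \<le> n" unfolding n_def using fin 1 by (intro Max_ge)
  moreover have "Suc n \<notin> ?S" using Max_ge[OF fin, of "Suc n"] unfolding n_def by auto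
  ultimately show ?thesis by auto
qed

lemma rank_le_mono: "rank_le k B T \<Longrightarrow> k \<le> l \<Longrightarrow> rank_le l B T"
  unfolding rank_le_def by (meson le_trans)

text \<open>The singular value of order k + 1 permits rank k, so the largest n with n^d \<le> k is
  used. An error n^(-d r) becomes k^(-r) because k \<le> (n + 1)^d \<le> (2 n)^d, which accounts for
  the factor \<open>2 ^ (d * r)\<close>.\<close>

lemma schatten_classI:
  assumes T: "linear_map_on B1 T" "T ` B1 \<subseteq> B2" and p: "0 < p" and d: "d \<ge> 1" and z: "0 \<in> B2"
    and bd: "\<And>u. u \<in> B1 \<Longrightarrow> q1 u \<le> 1 \<Longrightarrow> q2 (T u) \<le> c"
    and approx: "\<And>M. M \<ge> 1 \<Longrightarrow> \<exists>C\<ge>0. \<forall>n\<ge>1. \<exists>T0. linear_map_on B1 T0 \<and> T0 ` B1 \<subseteq> B2 \<and> rank_le (n ^ d) B1 T0 \<and>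
      (\<forall>u\<in>B1. q1 u \<le> 1 \<longrightarrow> q2 (T u - T0 u) \<le> C / real n ^ M)"
  shows "T \<in> schatten_class p B1 q1 B2 q2"
proof -
  let ?a = "\<lambda>k. singular_value (Suc k) B1 q1 B2 q2 T"
  \<comment> \<open>Order 1 allows rank 0 only, so the comparison is with the zero operator.\<close>
  have "?a 0 \<le> ennreal c"
  proof (rule singular_value_le)
    show "linear_map_on B1 (\<lambda>_. 0)" by (simp add: linear_map_on_def)
    show "rank_le 0 B1 (\<lambda>_. 0)" unfolding rank_le_def by (intro exI[of _ "{}"]) auto
  qed (use z bd in auto)
  then have a0: "?a 0 < \<infinity>" by (metis ennreal_less_top infinity_ennreal_def le_less_trans)
  have pos: "\<exists>C\<ge>0. \<forall>k\<ge>1. ?a k \<le> ennreal (C / real k ^ r)" if r: "r \<ge> 1" for r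
  proof -
    have M: "d * r \<ge> 1" using d r by simp
    obtain C where C: "C \<ge> 0" and T0: "\<And>n. n \<ge> 1 \<Longrightarrow> \<exists>T0. linear_map_on B1 T0 \<and> T0 ` B1 \<subseteq> B2 \<and> rank_le (n ^ d) B1 T0 \<and>
      (\<forall>u\<in>B1. q1 u \<le> 1 \<longrightarrow> q2 (T u - T0 u) \<le> C / real n ^ (d * r))"
      using approx[OF M] by blast
    have "?a k \<le> ennreal (C * 2 ^ (d * r) / real k ^ r)" if k: "k \<ge> 1" for k
    proof -
      obtain n where n: "n \<ge> 1" "n ^ d \<le> k" "k \<le> Suc n ^ d" using floor_root_exists[OF d k] by blast
      obtain T' where T': "linear_map_on B1 T'" "T' ` B1 \<subseteq> B2" "rank_le (n ^ d) B1 T'"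
        "\<And>u. u \<in> B1 \<Longrightarrow> q1 u \<le> 1 \<Longrightarrow> q2 (T u - T' u) \<le> C / real n ^ (d * r)"
        using T0[OF n(1)] by blast
      have "?a k \<le> ennreal (C / real n ^ (d * r))"
        by (rule singular_value_le[OF T'(1,2) rank_le_mono[OF T'(3) n(2)]]) (rule T'(4))
      also have "\<dots> \<le> ennreal (C * 2 ^ (d * r) / real k ^ r)"
      proof (rule ennreal_leI)
        have "real k ^ r \<le> (real (Suc n) ^ d) ^ r"
          using n(3) by (intro power_mono) (metis of_nat_le_iff of_nat_power, simp)
        also have "\<dots> = real (Suc n) ^ (d * r)" by (simp add: power_mult)
        also have "\<dots> \<le> (2 * real n) ^ (d * r)" using n(1) by (intro power_mono) auto
        finally have "real k ^ r \<le> 2 ^ (d * r) * real n ^ (d * r)" by (simp add: power_mult_distrib)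
        then have "C * real k ^ r \<le> C * (2 ^ (d * r) * real n ^ (d * r))" using C by (rule mult_left_mono)
        then show "C / real n ^ (d * r) \<le> C * 2 ^ (d * r) / real k ^ r"
          using n(1) k by (simp add: divide_simps mult_ac)
      qed
      finally show ?thesis .
    qed
    then show ?thesis using C by (intro exI[of _ "C * 2 ^ (d * r)"]) auto
  qed
  \<comment> \<open>\<open>approx\<close> starts at M = 1, so the merely bounded case r = 0 is
    borrowed from r = 1.\<close>
  have "\<exists>C\<ge>0. \<forall>k\<ge>1. ?a k \<le> ennreal (C / real k ^ r)" for r
  proof (cases "r = 0")
    case True
    obtain C where C: "C \<ge> 0" "\<And>k. k \<ge> 1 \<Longrightarrow> ?a k \<le> ennreal (C / real k ^ 1)" using pos[of 1] by blast
    have "?a k \<le> ennreal (C / real k ^ r)" if "k \<ge> 1" for k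
    proof -
      have "C / real k ^ 1 \<le> C / real k ^ r" using True that C(1) divide_left_mono[of 1 "real k" C] by simp
      then show ?thesis using C(2)[OF that] ennreal_leI order_trans by blast
    qed
    then show ?thesis using C(1) by blast
  qed (use pos in auto)
  then have "lp_norm p ?a < \<infinity>" by (intro lp_norm_finite p a0)
  then show ?thesis using T by (simp add: schatten_class_def schatten_norm_def)
qed

theorem (in weight_class) kernel_op_schatten:
  fixes X1 :: "(real^'n::finite \<Rightarrow> complex) topology" and X2 :: "(real^'m::finite \<Rightarrow> complex) topology"
    and B1 :: "'n functional set" and B2 :: "'m functional set"
  assumes X1: "absorbing W X1" and X2: "absorbing W X2" and D: "polar_nbhds W X1 D"
    and half1: "\<forall>n (f :: real^'n \<Rightarrow> complex). rdec f \<longrightarrow> hprojs n coords f \<in> GS_S (1/2)"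
    and half2: "\<forall>h \<in> (GS_S (1/2) :: (real^'m \<Rightarrow> complex) set). rdec h"
    and B1: "cfun.subspace B1" "quasi_norm_on B1 q1" and B2: "cfun.subspace B2" "quasi_norm_on B2 q2"
    and emb1: "embeds id (quasi_norm_top B1 q1) of_functional D"
    and emb2: "embeds of_function X2 id (quasi_norm_top B2 q2)"
    and K: "(K :: real^('m + 'n) \<Rightarrow> complex) \<in> wspace W" and p: "0 < p"
  shows "kernel_op D K \<in> schatten_class p B1 q1 B2 q2"
proof -
  define E where "E = inv_into (topspace D) of_functional"
  \<comment> \<open>The image of u before it is identified with a functional. Smoothness and ladder
    bounds are proved for this function, and projections act on it.\<close>
  define G where "G u x = E u (\<lambda>y. K (join x y))" for u and x :: "real^'m"
  note ext = domain_extension[OF X1 D half1 B1 emb1, folded E_def]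
  note ran = range_bound[OF X2 B2 emb2]
  have T: "kernel_op D K u = of_function (G u)" for u
    by (simp add: kernel_op_def G_def[abs_def] E_def)
  obtain \<omega> where om: "\<omega> \<in> W" "ladder_bdd K \<omega>" using K unfolding wspace_def by blast
  obtain \<omega>1 where om1: "\<omega>1 \<in> W" "\<And>j k. \<omega> (j + k) \<le> \<omega>1 j * \<omega>1 k" using split[OF om(1)] by blast
  obtain C0 where C0: "\<And>u f. u \<in> B1 \<Longrightarrow> f \<in> wspace W \<Longrightarrow> ladder_bdd f \<omega>1 \<Longrightarrow> cmod (E u f) \<le> C0 * q1 u"
    using ext(4)[OF om1(1)] by blast
  \<comment> \<open>The maximum with 0 secures a nonnegative constant, as \<open>scale\<close>
    demands in \<open>CW\<close>.\<close>
  define C1 where "C1 = max 0 C0"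
  have C1: "cmod (E u f) \<le> C1" if "u \<in> B1" "q1 u \<le> 1" "f \<in> wspace W" "ladder_bdd f \<omega>1" for u f
  proof -
    have "C0 * q1 u \<le> C1 * 1"
      using that(2) quasi_norm_onD(1)[OF B1(2) that(1)] by (intro mult_mono) (auto simp: C1_def)
    then show ?thesis using C0[OF that(1,3,4)] by simp
  qed
  have sl: "(\<lambda>y. K (join x y)) \<in> wspace W" for x by (rule wspace_join_right[OF K])
  have Gs: "smooth (G u)" if "u \<in> B1" for u
    unfolding G_def[abs_def] by (rule smooth_wfunctional_slice[OF ext(1)[OF that] K])
  have Gb: "ladder_bdd (G u) (\<lambda>k. C1 * \<omega>1 k)" if "u \<in> B1" "q1 u \<le> 1" for u
    unfolding G_def[abs_def]
    by (rule ladder_bdd_wfunctional_slice[OF ext(1)[OF that(1)] K om(2) om1(2) nonneg[OF om1(1)]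
          C1[OF that]])
  have CW: "(\<lambda>k. C1 * \<omega>1 k) \<in> W" by (rule scale[OF om1(1)]) (simp add: C1_def)
  have Gadd: "G (u + v) = (\<lambda>x. G u x + G v x)" if "u \<in> B1" "v \<in> B1" for u v
    unfolding G_def[abs_def] using ext(2)[OF that sl] by simp
  have Gscale: "G (cscale c u) = (\<lambda>x. c * G u x)" if "u \<in> B1" for c u
    unfolding G_def[abs_def] using ext(3)[OF that sl] by simp
  \<comment> \<open>The fixed weight is available on the unit ball; any other u is first scaled into
    it, with 1 + q1 u in the denominator to avoid division by 0.\<close>
  have G: "G u \<in> wspace W" if u: "u \<in> B1" for u
  proof -
    define t where "t = 1 / (1 + q1 u)"
    have q: "q1 u \<ge> 0" by (rule quasi_norm_onD(1)[OF B1(2) u])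
    then have t: "t > 0" by (simp add: t_def)
    have "t * q1 u \<le> 1" using q by (simp add: t_def divide_le_eq)
    then have "q1 (cscale (of_real t) u) \<le> 1"
      using quasi_norm_onD(3)[OF B1(2) u, of "of_real t"] t by simp
    then have "G (cscale (of_real t) u) \<in> wspace W"
      using Gs Gb cfun.subspace_scale[OF B1(1) u] by (intro wspaceI[OF _ CW]) auto
    then have "(\<lambda>x. inverse (of_real t) * (of_real t * G u x)) \<in> wspace W"
      unfolding Gscale[OF u] by (rule wspace_cmult)
    then show ?thesis using t by (simp add: mult.assoc[symmetric])
  qed
  note of_add = of_function_add[OF _ _ half2]
  let ?P = "\<lambda>n u. of_function (hprojs n coords (G u))"
  from ran(2)[OF om1(1)] obtain C2 where
    C2: "\<forall>a\<ge>0. \<forall>f\<in>wspace W. ladder_bdd f (\<lambda>k. a * \<omega>1 k) \<longrightarrow> q2 (of_function f) \<le> C2 * a"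
    by (elim exE conjE) (rule that)
  show ?thesis
  proof (rule schatten_classI[where d = "CARD('m)" and c = "C2 * C1"])
    show "linear_map_on B1 (kernel_op D K)"
      unfolding linear_map_on_def T
    proof (intro conjI ballI allI)
      show "of_function (G (u + v)) = of_function (G u) + of_function (G v)" if "u \<in> B1" "v \<in> B1" for u v
        unfolding Gadd[OF that] by (rule of_add[OF wspace_rdec[OF G[OF that(1)]] wspace_rdec[OF G[OF that(2)]]])
      show "of_function (G (cscale c u)) = cscale c (of_function (G u))" if "u \<in> B1" for c u
        unfolding Gscale[OF that] by (rule of_function_cmult)
    qed
    show "kernel_op D K ` B1 \<subseteq> B2" unfolding T using ran(1) G by auto
    show "0 < p" by (rule p)
    show "1 \<le> CARD('m)" by (simp add: Suc_leI)
    show "0 \<in> B2" by (rule cfun.subspace_0[OF B2(1)])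
    show "q2 (kernel_op D K u) \<le> C2 * C1" if "u \<in> B1" "q1 u \<le> 1" for u
      unfolding T using that by (intro C2[rule_format] G Gb) (auto simp: C1_def)
    fix M :: nat assume M: "M \<ge> 1"
    from hprojs_residual[OF CW M, of "coords :: 'm list"] obtain \<omega>2 where om2: "\<omega>2 \<in> W"
      and res: "\<forall>n\<ge>1. \<forall>f. smooth f \<longrightarrow> ladder_bdd f (\<lambda>k. C1 * \<omega>1 k) \<longrightarrow>
      ladder_bdd (\<lambda>x. f x - hprojs n (coords :: 'm list) f x) (\<lambda>k. \<omega>2 k / real n ^ M)"
      by (elim bexE)
    from ran(2)[OF om2] obtain C3 where C3: "C3 \<ge> 0"
      "\<forall>a\<ge>0. \<forall>f\<in>wspace W. ladder_bdd f (\<lambda>k. a * \<omega>2 k) \<longrightarrow> q2 (of_function f) \<le> C3 * a"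
      by (elim exE conjE) (rule that)
    have "linear_map_on B1 (?P n) \<and> ?P n ` B1 \<subseteq> B2 \<and> rank_le (n ^ CARD('m)) B1 (?P n) \<and>
      (\<forall>u\<in>B1. q1 u \<le> 1 \<longrightarrow> q2 (kernel_op D K u - ?P n u) \<le> C3 / real n ^ M)" if n: "n \<ge> 1" for n
    proof (intro conjI ballI impI)
      note Gr = wspace_rdec[OF G]
      have Pw: "hprojs n coords (G u) \<in> wspace W" if "u \<in> B1" for u by (rule hprojs_wspace[OF Gr[OF that]])
      show "linear_map_on B1 (?P n)"
        unfolding linear_map_on_def
      proof (intro conjI ballI allI)
        show "?P n (u + v) = ?P n u + ?P n v" if "u \<in> B1" "v \<in> B1" for u v
          unfolding Gadd[OF that] hprojs_add[OF Gr[OF that(1)] Gr[OF that(2)]]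
          by (rule of_add[OF rdec_hprojs[OF Gr[OF that(1)]] rdec_hprojs[OF Gr[OF that(2)]]])
        show "?P n (cscale c u) = cscale c (?P n u)" if "u \<in> B1" for c u
          unfolding Gscale[OF that] hprojs_cmult by (rule of_function_cmult)
      qed
      show "?P n ` B1 \<subseteq> B2" using ran(1) Pw by auto
      show "rank_le (n ^ CARD('m)) B1 (?P n)"
        unfolding rank_le_def
      proof (intro exI conjI)
        let ?A = "PiE UNIV (\<lambda>_::'m. {..<n})"
        let ?S = "(\<lambda>\<alpha>. of_function (hermite_fun \<alpha>)) ` ?A"
        have fin: "finite ?A" by (intro finite_PiE) auto
        show "finite ?S" using fin by simp
        have "card ?S \<le> card ?A" using fin by (rule card_image_le)
        also have "card ?A = n ^ CARD('m)" by (simp add: card_PiE)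
        finally show "card ?S \<le> n ^ CARD('m)" .
        have sp: "of_function (\<lambda>x. \<Sum>\<alpha>\<in>I. c \<alpha> * hermite_fun \<alpha> x) \<in> cfun.span ?S" if "I \<subseteq> ?A" for I c
        proof -
          have "finite I" using that fin by (rule finite_subset)
          then show ?thesis using that
          proof induction
            case empty
            have "of_function (\<lambda>x. 0) = (0 :: 'm functional)" by (auto simp: of_function_def restr_def fun_eq_iff)
            then show ?case unfolding sum.empty by (simp only: cfun.span_zero)
          next
            case (insert \<alpha> I)
            have "of_function (\<lambda>x. \<Sum>\<alpha>\<in>insert \<alpha> I. c \<alpha> * hermite_fun \<alpha> x)
                = of_function (\<lambda>x. c \<alpha> * hermite_fun \<alpha> x + (\<Sum>\<alpha>\<in>I. c \<alpha> * hermite_fun \<alpha> x))"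
              using insert.hyps by simp
            also have "\<dots> = cscale (c \<alpha>) (of_function (hermite_fun \<alpha>)) + of_function (\<lambda>x. \<Sum>\<alpha>\<in>I. c \<alpha> * hermite_fun \<alpha> x)"
              by (subst of_add) (auto intro!: rdec_cmult rdec_sum wspace_rdec[OF hermite_fun_wspace] simp: of_function_cmult)
            finally have eq: "of_function (\<lambda>x. \<Sum>\<alpha>\<in>insert \<alpha> I. c \<alpha> * hermite_fun \<alpha> x)
                = cscale (c \<alpha>) (of_function (hermite_fun \<alpha>)) + of_function (\<lambda>x. \<Sum>\<alpha>\<in>I. c \<alpha> * hermite_fun \<alpha> x)" .
            have a: "of_function (hermite_fun \<alpha>) \<in> ?S" using insert.prems by blast
            have b: "of_function (\<lambda>x. \<Sum>\<alpha>\<in>I. c \<alpha> * hermite_fun \<alpha> x) \<in> cfun.span ?S"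
              using insert.IH insert.prems by blast
            show ?case unfolding eq by (rule cfun.span_add[OF cfun.span_scale[OF cfun.span_base[OF a]] b])
          qed
        qed
        show "?P n ` B1 \<subseteq> cfun.span ?S"
        proof
          fix w assume "w \<in> ?P n ` B1"
          then obtain u where u: "u \<in> B1" "w = ?P n u" by blast
          obtain c where "hprojs n coords (G u) = (\<lambda>x. \<Sum>\<alpha>\<in>?A. c \<alpha> * hermite_fun \<alpha> x)"
            using hprojs_finite_rank[OF Gr[OF u(1)]] by blast
          then show "w \<in> cfun.span ?S" using sp[of ?A c] u(2) by simp
        qed
      qed
      fix u assume u: "u \<in> B1" "q1 u \<le> 1"
      let ?r = "\<lambda>x. G u x - hprojs n coords (G u) x"
      \<comment> \<open>Additivity of \<open>of_function\<close> is stated for sums, so G u is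
        written as residual plus projection.\<close>
      have "of_function (\<lambda>x. ?r x + hprojs n coords (G u) x) = of_function ?r + ?P n u"
        by (intro of_add rdec_diff rdec_hprojs Gr u)
      then have "kernel_op D K u - ?P n u = of_function ?r" by (simp add: T)
      moreover have "q2 (of_function ?r) \<le> C3 * (1 / real n ^ M)"
        using res[rule_format, OF n Gs[OF u(1)] Gb[OF u]]
        by (intro C3(2)[rule_format] wspace_diff G Pw u) simp_all
      ultimately show "q2 (kernel_op D K u - ?P n u) \<le> C3 / real n ^ M" by simp
    qed
    then have "\<forall>n\<ge>1. \<exists>T0. linear_map_on B1 T0 \<and> T0 ` B1 \<subseteq> B2 \<and> rank_le (n ^ CARD('m)) B1 T0 \<and>
      (\<forall>u\<in>B1. q1 u \<le> 1 \<longrightarrow> q2 (kernel_op D K u - T0 u) \<le> C3 / real n ^ M)"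
      by (intro allI impI exI)
    with C3(1) show "\<exists>C\<ge>0. \<forall>n\<ge>1. \<exists>T0. linear_map_on B1 T0 \<and> T0 ` B1 \<subseteq> B2 \<and> rank_le (n ^ CARD('m)) B1 T0 \<and>
      (\<forall>u\<in>B1. q1 u \<le> 1 \<longrightarrow> q2 (kernel_op D K u - T0 u) \<le> C / real n ^ M)"
      by (intro exI conjI)
  qed
qed

section \<open>Weights of the Gelfand-Shilov and Schwartz spaces\<close>

definition gevrey :: "real \<Rightarrow> real \<Rightarrow> nat \<Rightarrow> real" where
  "gevrey s h k = h ^ k * fact k powr s"

lemma gevrey_pos: "0 < h \<Longrightarrow> 0 < gevrey s h k"
  by (simp add: gevrey_def)

lemma gevrey_mono: "0 \<le> h \<Longrightarrow> h \<le> h' \<Longrightarrow> gevrey s h k \<le> gevrey s h' k"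
  unfolding gevrey_def by (intro mult_right_mono power_mono) auto

lemma power_powr: "0 < x \<Longrightarrow> (x ^ k) powr s = (x powr s) ^ k" for x :: real
  by (induction k) (simp_all add: powr_mult)

text \<open>A geometric factor under the power s amounts to a change of h; this is how binomial
  constants are absorbed.\<close>

lemma gevrey_scale: "0 < a \<Longrightarrow> gevrey s (h * a powr s) k = h ^ k * (a ^ k * fact k) powr s"
  by (simp add: gevrey_def power_mult_distrib power_powr powr_mult)

lemma Suc_le_two_power: "real (Suc k) \<le> 2 ^ k"
  by (metis Suc_leI less_exp of_nat_le_iff of_nat_numeral of_nat_power)

lemma gevrey_Suc: "0 < h \<Longrightarrow> 0 \<le> s \<Longrightarrow> gevrey s h (Suc k) \<le> h * gevrey s (h * 2 powr s) k"
proof -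
  assume h: "0 < h" and s: "0 \<le> s"
  have "fact (Suc k) \<le> (2 ^ k * fact k :: real)"
    using Suc_le_two_power[of k] by (simp add: mult_right_mono)
  then have "fact (Suc k) powr s \<le> (2 ^ k * fact k :: real) powr s" using s by (intro powr_mono2) auto
  then have "h ^ k * fact (Suc k) powr s \<le> h ^ k * (2 ^ k * fact k) powr s" using h by (intro mult_left_mono) auto
  then show ?thesis using h by (simp add: gevrey_scale del: fact_Suc) (simp add: gevrey_def del: fact_Suc)
qed

lemma fact_mult_le: "fact a * fact b \<le> (fact (a + b) :: real)"
proof (induction a)
  case (Suc a)
  have "real (Suc a) * (fact a * fact b) \<le> real (Suc (a + b)) * fact (a + b)"
    using Suc by (intro mult_mono) auto
  then show ?case by (simp add: mult.assoc)
qed simp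

lemma fact_add_le: "(fact (a + b) :: real) \<le> 2 ^ (a + b) * (fact a * fact b)"
proof -
  have "fact a * fact b * (a + b choose a) = (fact (a + b) :: nat)"
    using binomial_fact_lemma[of a "a + b"] by simp
  then have "(fact (a + b) :: real) = fact a * fact b * real (a + b choose a)"
    by (metis of_nat_fact of_nat_mult)
  also have "\<dots> \<le> fact a * fact b * 2 ^ (a + b)"
    using binomial_le_pow2[of "a + b" a]
    by (intro mult_left_mono) (metis of_nat_le_iff of_nat_numeral of_nat_power, simp)
  finally show ?thesis by (simp add: mult.commute)
qed

lemma prod_fact_le: "finite I \<Longrightarrow> (\<Prod>i\<in>I. fact (a i)) \<le> (fact (\<Sum>i\<in>I. a i) :: real)"
proof (induction I rule: finite_induct)
  case (insert i I)
  have "fact (a i) * (\<Prod>i\<in>I. fact (a i)) \<le> fact (a i) * (fact (\<Sum>i\<in>I. a i) :: real)"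
    by (intro mult_left_mono insert.IH) auto
  also have "\<dots> \<le> fact (a i + (\<Sum>i\<in>I. a i))" by (rule fact_mult_le)
  finally show ?case using insert.hyps by simp
qed simp

text \<open>A crude bound for multinomial coefficients, splitting off one summand at a time with
  \<open>fact_add_le\<close>; what matters is that the factor is geometric in the sum.\<close>

lemma fact_sum_le: "finite I \<Longrightarrow> (fact (\<Sum>i\<in>I. a i) :: real) \<le> (2 ^ card I) ^ (\<Sum>i\<in>I. a i) * (\<Prod>i\<in>I. fact (a i))"
proof (induction I rule: finite_induct)
  case (insert i I)
  let ?S = "\<Sum>i\<in>I. a i" and ?P = "\<Prod>i\<in>I. fact (a i) :: real" and ?c = "2 ^ card I :: real"
  have P: "?P \<ge> 0" by (intro prod_nonneg) auto
  have "(fact (a i + ?S) :: real) \<le> 2 ^ (a i + ?S) * (fact (a i) * fact ?S)" by (rule fact_add_le)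
  also have "\<dots> \<le> 2 ^ (a i + ?S) * (fact (a i) * (?c ^ (a i + ?S) * ?P))"
  proof (intro mult_left_mono)
    have "?c ^ ?S \<le> ?c ^ (a i + ?S)" by (intro power_increasing) auto
    then have "?c ^ ?S * ?P \<le> ?c ^ (a i + ?S) * ?P" using P by (rule mult_right_mono)
    with insert.IH show "fact ?S \<le> ?c ^ (a i + ?S) * ?P" by (rule order_trans)
  qed auto
  also have "\<dots> = (2 * ?c) ^ (a i + ?S) * (fact (a i) * ?P)" by (simp only: power_mult_distrib mult_ac)
  finally show ?case using insert.hyps by simp
qed simp

lemma gevrey_split:
  assumes "0 < h" "0 \<le> s"
  shows "gevrey s h (j + k) \<le> gevrey s (h * 2 powr s) j * gevrey s (h * 2 powr s) k"
proof -
  have "fact (j + k) powr s \<le> (2 ^ (j + k) * (fact j * fact k) :: real) powr s"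
    using assms fact_add_le[of j k] by (intro powr_mono2) auto
  also have "\<dots> = (2 ^ j * fact j) powr s * (2 ^ k * fact k) powr s"
    by (simp add: powr_mult[symmetric] power_add mult_ac)
  finally have "h ^ (j + k) * fact (j + k) powr s \<le> h ^ (j + k) * ((2 ^ j * fact j) powr s * (2 ^ k * fact k) powr s)"
    using assms by (intro mult_left_mono) auto
  then show ?thesis by (simp add: gevrey_scale) (simp add: gevrey_def power_add mult_ac)
qed

lemma gevrey_index_mult: "0 < h \<Longrightarrow> real (Suc k) * gevrey s h k \<le> gevrey s (2 * h) k"
  using mult_right_mono[OF Suc_le_two_power, of "gevrey s h k" k] gevrey_pos[of h s k]
  by (simp add: gevrey_def power_mult_distrib mult.assoc)

lemma sqrt_fact_powr: "sqrt (fact k) = fact k powr (1/2)"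
  by (simp add: powr_half_sqrt)

text \<open>The three weight classes: Roumieu and Beurling type for the two kinds of Gelfand-Shilov spaces,
  and no growth restriction for the Schwartz space.\<close>

definition roumieu :: "real \<Rightarrow> (nat \<Rightarrow> real) set" where
  "roumieu s = {\<omega>. (\<forall>k. 0 \<le> \<omega> k) \<and> (\<exists>h>0. \<exists>C\<ge>0. \<forall>k. \<omega> k \<le> C * gevrey s h k)}"

definition beurling :: "real \<Rightarrow> (nat \<Rightarrow> real) set" where
  "beurling s = {\<omega>. (\<forall>k. 0 \<le> \<omega> k) \<and> (\<forall>h>0. \<exists>C\<ge>0. \<forall>k. \<omega> k \<le> C * gevrey s h k)}"

definition all_weights :: "(nat \<Rightarrow> real) set" where
  "all_weights = {\<omega>. \<forall>k. 0 \<le> \<omega> k}"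

lemma gevrey_bound_add:
  assumes "0 < h" "h \<le> H" "0 < h'" "h' \<le> H" "0 \<le> C" "0 \<le> C'"
    "\<And>k. \<omega> k \<le> C * gevrey s h k" "\<And>k. \<omega>' k \<le> C' * gevrey s h' k"
  shows "\<omega> k + \<omega>' k \<le> (C + C') * gevrey s H k"
proof -
  have "C * gevrey s h k \<le> C * gevrey s H k" "C' * gevrey s h' k \<le> C' * gevrey s H k"
    using assms by (auto intro!: mult_left_mono gevrey_mono)
  then show ?thesis using assms(7,8)[of k] by (simp add: distrib_right)
qed

lemma gevrey_bound_shift:
  assumes "0 < h" "0 \<le> s" "0 \<le> C" "\<And>k. \<omega> k \<le> C * gevrey s h k"
  shows "\<omega> (Suc k) \<le> (C * h) * gevrey s (h * 2 powr s) k"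
  using order_trans[OF assms(4) mult_left_mono[OF gevrey_Suc[OF assms(1,2)] assms(3)]] by (simp add: mult.assoc)

lemma gevrey_bound_index_mult:
  assumes "0 < h" "0 \<le> C" "\<And>k. \<omega> k \<le> C * gevrey s h k"
  shows "real (Suc k) * \<omega> k \<le> C * gevrey s (2 * h) k"
proof -
  have "real (Suc k) * \<omega> k \<le> real (Suc k) * (C * gevrey s h k)" by (intro mult_left_mono assms) auto
  also have "\<dots> = C * (real (Suc k) * gevrey s h k)" by simp
  also have "\<dots> \<le> C * gevrey s (2 * h) k" by (intro mult_left_mono gevrey_index_mult assms)
  finally show ?thesis .
qed

lemma roumieuI:
  assumes "\<And>k. 0 \<le> \<omega> k" "0 < h" "0 \<le> C" "\<And>k. \<omega> k \<le> C * gevrey s h k"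
  shows "\<omega> \<in> roumieu s"
  using assms unfolding roumieu_def by blast

text \<open>Enlarging h absorbs every geometric factor, so each closure property has an explicit
  majorant; s \<ge> 1/2 places sqrt (k!) below k!^s.\<close>

lemma weight_class_roumieu:
  assumes s: "s \<ge> 1/2"
  shows "weight_class (roumieu s)"
proof
  fix \<omega> \<omega>' :: "nat \<Rightarrow> real" and c R :: real and k
  show "0 \<le> \<omega> k" if "\<omega> \<in> roumieu s" using that by (simp add: roumieu_def)
  show "(\<lambda>k. R ^ k * sqrt (fact k)) \<in> roumieu s" if R: "0 < R"
  proof -
    have "R ^ k * sqrt (fact k) \<le> 1 * gevrey s R k" for k
      unfolding gevrey_def sqrt_fact_powr using R s by (auto intro!: mult_left_mono powr_mono)
    then show ?thesis using R by (intro roumieuI[of _ R 1]) auto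
  qed
  assume w: "\<omega> \<in> roumieu s"
  then obtain h C where h: "h > 0" "C \<ge> 0" and C: "\<And>k. \<omega> k \<le> C * gevrey s h k" and nn: "\<And>k. 0 \<le> \<omega> k"
    unfolding roumieu_def by auto
  show "(\<lambda>k. \<omega> k + \<omega>' k) \<in> roumieu s" if "\<omega>' \<in> roumieu s"
  proof -
    obtain h' C' where h': "h' > 0" "C' \<ge> 0" and C': "\<And>k. \<omega>' k \<le> C' * gevrey s h' k" and nn': "\<And>k. 0 \<le> \<omega>' k"
      using \<open>\<omega>' \<in> roumieu s\<close> unfolding roumieu_def by auto
    have "\<omega> k + \<omega>' k \<le> (C + C') * gevrey s (max h h') k" for k
      by (rule gevrey_bound_add[OF h(1) _ h'(1) _ h(2) h'(2) C C']) auto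
    then show ?thesis using h h' nn nn' by (intro roumieuI[of _ "max h h'" "C + C'"]) auto
  qed
  show "(\<lambda>k. c * \<omega> k) \<in> roumieu s" if c: "0 \<le> c"
  proof -
    have "c * \<omega> k \<le> (c * C) * gevrey s h k" for k using mult_left_mono[OF C c] by (simp add: mult.assoc)
    then show ?thesis using h nn c by (intro roumieuI[of _ h "c * C"]) auto
  qed
  show "(\<lambda>k. \<omega> (Suc k)) \<in> roumieu s"
    using h nn gevrey_bound_shift[OF h(1) _ h(2) C] s by (intro roumieuI[of _ "h * 2 powr s" "C * h"]) auto
  show "(\<lambda>k. real (Suc k) * \<omega> k) \<in> roumieu s"
    using h nn gevrey_bound_index_mult[OF h C] by (intro roumieuI[of _ "2 * h" C]) (auto simp del: of_nat_Suc)
  let ?H = "h * 2 powr s"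
  \<comment> \<open>The constant is \<open>max 1 C\<close> because C has to lie below its
    square.\<close>
  define \<omega>'' where "\<omega>'' k = max 1 C * gevrey s ?H k" for k
  have H: "?H > 0" using h by simp
  have "\<omega>'' \<in> roumieu s"
    unfolding \<omega>''_def using H gevrey_pos[OF H] by (intro roumieuI[of _ ?H "max 1 C"]) (auto intro!: less_imp_le mult_pos_pos)
  moreover have "\<omega> (j + k) \<le> \<omega>'' j * \<omega>'' k" for j k
  proof -
    have "\<omega> (j + k) \<le> C * (gevrey s ?H j * gevrey s ?H k)"
      using order_trans[OF C mult_left_mono[OF gevrey_split h(2)]] h s by simp
    also have "\<dots> \<le> (max 1 C * max 1 C) * (gevrey s ?H j * gevrey s ?H k)"
    proof (rule mult_right_mono)
      have "1 * C \<le> max 1 C * max 1 C" using h(2) by (intro mult_mono) auto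
      then show "C \<le> max 1 C * max 1 C" by simp
    qed (use gevrey_pos[OF H] in \<open>auto intro: less_imp_le mult_nonneg_nonneg\<close>)
    finally show ?thesis by (simp add: \<omega>''_def mult_ac)
  qed
  ultimately show "\<exists>\<omega>'\<in>roumieu s. \<forall>j k. \<omega> (j + k) \<le> \<omega>' j * \<omega>' k" by blast
qed

text \<open>With y = x^(1/d), a single term of the exponential series gives y^k \<le> exp y k!;
  raise this to the power d.\<close>

lemma power_le_fact_powr:
  fixes x d :: real
  assumes "x > 0" "d > 0"
  shows "\<exists>C\<ge>0. \<forall>k. x ^ k \<le> C * fact k powr d"
proof -
  define y where "y = x powr (1 / d)"
  have y: "y > 0" using assms by (simp add: y_def)
  have "x ^ k \<le> exp y powr d * fact k powr d" for k
  proof -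
    have "(\<lambda>n. y ^ n /\<^sub>R fact n) sums exp y" by (rule exp_converges)
    then have "(\<Sum>n\<in>{k}. y ^ n /\<^sub>R fact n) \<le> exp y"
      using sum_le_suminf[of "\<lambda>n. y ^ n /\<^sub>R fact n" "{k}"] y by (simp add: sums_iff)
    then have "y ^ k \<le> exp y * fact k" by (simp add: divide_simps mult_ac)
    then have "(y ^ k) powr d \<le> (exp y * fact k) powr d" using assms y by (intro powr_mono2) auto
    moreover have "(y ^ k) powr d = x ^ k"
      using assms y by (simp add: power_powr) (simp add: y_def powr_powr)
    ultimately show ?thesis by (simp add: powr_mult)
  qed
  then show ?thesis by (intro exI[of _ "exp y powr d"]) auto
qed

text \<open>One new weight has to serve every h, so a single Gevrey majorant as in the Roumieu case
  is not enough. Division by k!^s gives \<theta>, whose decreasing envelope \<Theta> satisfies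
  \<theta> (j + k) \<le> sqrt (\<Theta> j) sqrt (\<Theta> k), since it lies below both \<Theta> j
  and \<Theta> k. The square root still decays faster than every geometric sequence, because h^k
  becomes (sqrt h)^k with h arbitrary.\<close>

lemma beurling_split:
  assumes s: "0 \<le> s" and w: "\<omega> \<in> beurling s"
  shows "\<exists>\<omega>'\<in>beurling s. \<forall>j k. \<omega> (j + k) \<le> \<omega>' j * \<omega>' k"
proof -
  have nn: "0 \<le> \<omega> k" for k using w by (simp add: beurling_def)
  have bd: "\<exists>C\<ge>0. \<forall>k. \<omega> k \<le> C * gevrey s h k" if "h > 0" for h
    using w that by (simp add: beurling_def)
  define \<theta> where "\<theta> k = \<omega> k / fact k powr s" for k
  have th0: "0 \<le> \<theta> k" for k using nn by (simp add: \<theta>_def)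
  have thb: "\<exists>C\<ge>0. \<forall>k. \<theta> k \<le> C * h ^ k" if h: "h > 0" for h
  proof -
    obtain C where C: "C \<ge> 0" "\<And>k. \<omega> k \<le> C * gevrey s h k" using bd[OF h] by blast
    have "\<theta> k \<le> C * h ^ k" for k
      using C(2)[of k] by (simp add: \<theta>_def gevrey_def pos_divide_le_eq mult.assoc)
    then show ?thesis using C(1) by blast
  qed
  define \<Theta> where "\<Theta> k = (SUP i\<in>{k..}. \<theta> i)" for k
  have bdd: "bdd_above (\<theta> ` {k..})" for k
  proof -
    obtain C where "\<And>k. \<theta> k \<le> C * 1 ^ k" using thb[of 1] by auto
    then show ?thesis by (intro bdd_aboveI[of _ C]) auto
  qed
  have Th: "\<theta> i \<le> \<Theta> k" if "k \<le> i" for i k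
    unfolding \<Theta>_def using that by (intro cSUP_upper bdd) auto
  have Th0: "0 \<le> \<Theta> k" for k using th0[of k] Th[of k k] by simp
  have Thanti: "\<Theta> l \<le> \<Theta> k" if "k \<le> l" for k l
    unfolding \<Theta>_def using that by (intro cSUP_subset_mono bdd) auto
  have Thb: "\<Theta> k \<le> C * h ^ k" if "0 \<le> h" "h \<le> 1" "C \<ge> 0" "\<And>k. \<theta> k \<le> C * h ^ k" for h C k
    unfolding \<Theta>_def
  proof (rule cSUP_least)
    fix i assume "i \<in> {k..}"
    then have "h ^ i \<le> h ^ k" using that by (intro power_decreasing) auto
    then show "\<theta> i \<le> C * h ^ k" using that(4)[of i] mult_left_mono[of "h ^ i" "h ^ k" C] that(3) by linarith
  qed simp
  define \<omega>' where "\<omega>' k = sqrt (\<Theta> k) * gevrey s (2 powr s) k" for k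
  have "\<omega>' \<in> beurling s"
    unfolding beurling_def
  proof (intro CollectI conjI allI impI)
    show "0 \<le> \<omega>' k" for k using Th0[of k] gevrey_pos[of "2 powr s" s k] by (simp add: \<omega>'_def)
    fix \<eta> :: real assume eta: "\<eta> > 0"
    \<comment> \<open>sqrt h times the 2^s lost in splitting the factorial must not exceed \<eta>,
      and h \<le> 1 makes powers decreasing, so that the supremum over the tail inherits the rate at
      k.\<close>
    define h where "h = min 1 ((\<eta> / 2 powr s)\<^sup>2)"
    have h: "h > 0" "h \<le> 1" using eta by (auto simp: h_def)
    obtain C where C: "C \<ge> 0" "\<And>k. \<theta> k \<le> C * h ^ k" using thb[OF h(1)] by blast
    have "h \<le> (\<eta> / 2 powr s)\<^sup>2" by (simp add: h_def)
    then have "sqrt h \<le> \<eta> / 2 powr s" using eta h by (intro real_le_lsqrt) auto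
    then have sh: "sqrt h * 2 powr s \<le> \<eta>" by (simp add: pos_le_divide_eq)
    have "\<omega>' k \<le> sqrt C * gevrey s \<eta> k" for k
    proof -
      have "sqrt (\<Theta> k) \<le> sqrt (C * h ^ k)" using Thb[OF _ h(2) C] h by simp
      then have "\<omega>' k \<le> sqrt (C * h ^ k) * gevrey s (2 powr s) k"
        unfolding \<omega>'_def using gevrey_pos[of "2 powr s" s k] by (intro mult_right_mono) auto
      also have "\<dots> = sqrt C * gevrey s (sqrt h * 2 powr s) k"
        by (simp add: real_sqrt_mult real_sqrt_power gevrey_def power_mult_distrib mult_ac)
      also have "\<dots> \<le> sqrt C * gevrey s \<eta> k"
        using sh h C by (intro mult_left_mono gevrey_mono) auto
      finally show ?thesis .
    qed
    then show "\<exists>C\<ge>0. \<forall>k. \<omega>' k \<le> C * gevrey s \<eta> k" using C(1) by (intro exI[of _ "sqrt C"]) auto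
  qed
  moreover have "\<omega> (j + k) \<le> \<omega>' j * \<omega>' k" for j k
  proof -
    have "\<theta> (j + k) \<le> sqrt (\<Theta> j) * sqrt (\<Theta> k)"
    proof -
      have "sqrt (\<theta> (j + k)) * sqrt (\<theta> (j + k)) \<le> sqrt (\<Theta> j) * sqrt (\<Theta> k)"
        using Th[of j "j + k"] Th[of k "j + k"] th0[of "j + k"] by (intro mult_mono) auto
      then show ?thesis using th0[of "j + k"] by simp
    qed
    moreover have "gevrey s 1 (j + k) \<le> gevrey s (2 powr s) j * gevrey s (2 powr s) k"
      using gevrey_split[of 1 s j k] s by simp
    ultimately have "\<theta> (j + k) * gevrey s 1 (j + k) \<le> (sqrt (\<Theta> j) * sqrt (\<Theta> k)) * (gevrey s (2 powr s) j * gevrey s (2 powr s) k)"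
      using th0 Th0 gevrey_pos[of 1 s "j + k"] by (intro mult_mono) auto
    moreover have "\<theta> (j + k) * gevrey s 1 (j + k) = \<omega> (j + k)" by (simp add: \<theta>_def gevrey_def)
    ultimately show ?thesis by (simp add: \<omega>'_def mult_ac)
  qed
  ultimately show ?thesis by blast
qed

text \<open>The target parameter h is prescribed, so factors are absorbed by starting from a smaller
  one. For \<open>gauss\<close> this means that (R / h)^k is dominated by k!^(s - 1/2), and there
  the strict inequality s > 1/2 enters.\<close>

lemma weight_class_beurling:
  assumes s: "s > 1/2"
  shows "weight_class (beurling s)"
proof
  fix \<omega> \<omega>' :: "nat \<Rightarrow> real" and c R :: real and k
  show "0 \<le> \<omega> k" if "\<omega> \<in> beurling s" using that by (simp add: beurling_def)
  show "(\<lambda>k. R ^ k * sqrt (fact k)) \<in> beurling s" if R: "0 < R"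
    unfolding beurling_def
  proof (intro CollectI conjI allI impI)
    show "0 \<le> R ^ k * sqrt (fact k)" for k using R by simp
    fix h :: real assume h: "h > 0"
    obtain C where C: "C \<ge> 0" "\<And>k. (R / h) ^ k \<le> C * fact k powr (s - 1/2)"
      using power_le_fact_powr[of "R / h" "s - 1/2"] R h s by auto
    have "R ^ k * sqrt (fact k) \<le> C * gevrey s h k" for k
    proof -
      have "R ^ k * sqrt (fact k) = (R / h) ^ k * (h ^ k * fact k powr (1/2))"
        using h by (simp add: sqrt_fact_powr power_divide)
      also have "\<dots> \<le> (C * fact k powr (s - 1/2)) * (h ^ k * fact k powr (1/2))"
        using h by (intro mult_right_mono C) auto
      also have "\<dots> = C * h ^ k * (fact k powr (s - 1/2) * fact k powr (1/2))" by simp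
      also have "fact k powr (s - 1/2) * fact k powr (1/2) = (fact k :: real) powr s"
        by (simp add: powr_add[symmetric])
      finally show ?thesis by (simp add: gevrey_def mult.assoc)
    qed
    then show "\<exists>C\<ge>0. \<forall>k. R ^ k * sqrt (fact k) \<le> C * gevrey s h k" using C(1) by blast
  qed
  assume w: "\<omega> \<in> beurling s"
  have nn: "0 \<le> \<omega> k" for k using w by (simp add: beurling_def)
  have bd: "\<exists>C\<ge>0. \<forall>k. \<omega> k \<le> C * gevrey s h k" if "h > 0" for h
    using w that by (simp add: beurling_def)
  show "(\<lambda>k. \<omega> k + \<omega>' k) \<in> beurling s" if w': "\<omega>' \<in> beurling s"
    unfolding beurling_def
  proof (intro CollectI conjI allI impI)
    show "0 \<le> \<omega> k + \<omega>' k" for k using nn w' by (simp add: beurling_def)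
    fix h :: real assume h: "h > 0"
    obtain C C' where "C \<ge> 0" "\<And>k. \<omega> k \<le> C * gevrey s h k" "C' \<ge> 0" "\<And>k. \<omega>' k \<le> C' * gevrey s h k"
      using bd[OF h] w' h unfolding beurling_def by auto
    then show "\<exists>C\<ge>0. \<forall>k. \<omega> k + \<omega>' k \<le> C * gevrey s h k"
      using gevrey_bound_add[of h h h C C' \<omega> s \<omega>'] h by (intro exI[of _ "C + C'"]) auto
  qed
  show "(\<lambda>k. c * \<omega> k) \<in> beurling s" if c: "0 \<le> c"
    unfolding beurling_def
  proof (intro CollectI conjI allI impI)
    show "0 \<le> c * \<omega> k" for k using nn c by simp
    fix h :: real assume h: "h > 0"
    obtain C where C: "C \<ge> 0" "\<And>k. \<omega> k \<le> C * gevrey s h k" using bd[OF h] by blast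
    have "c * \<omega> k \<le> (c * C) * gevrey s h k" for k using mult_left_mono[OF C(2) c] by (simp add: mult.assoc)
    then show "\<exists>C\<ge>0. \<forall>k. c * \<omega> k \<le> C * gevrey s h k" using c C(1) by (intro exI[of _ "c * C"]) auto
  qed
  show "(\<lambda>k. \<omega> (Suc k)) \<in> beurling s"
    unfolding beurling_def
  proof (intro CollectI conjI allI impI)
    fix h :: real assume h: "h > 0"
    let ?h = "h / 2 powr s"
    have h': "?h > 0" "?h * 2 powr s = h" using h by auto
    obtain C where C: "C \<ge> 0" "\<And>k. \<omega> k \<le> C * gevrey s ?h k" using bd[OF h'(1)] by blast
    have "\<omega> (Suc k) \<le> (C * ?h) * gevrey s h k" for k
      using gevrey_bound_shift[OF h'(1) _ C, of k] s unfolding h'(2) by simp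
    then show "\<exists>C\<ge>0. \<forall>k. \<omega> (Suc k) \<le> C * gevrey s h k" using C(1) h by (intro exI[of _ "C * ?h"]) auto
  qed (use nn in auto)
  show "(\<lambda>k. real (Suc k) * \<omega> k) \<in> beurling s"
    unfolding beurling_def
  proof (intro CollectI conjI allI impI)
    fix h :: real assume h: "h > 0"
    obtain C where C: "C \<ge> 0" "\<And>k. \<omega> k \<le> C * gevrey s (h / 2) k" using bd[of "h / 2"] h by auto
    have "real (Suc k) * \<omega> k \<le> C * gevrey s h k" for k
      using gevrey_bound_index_mult[OF _ C, of k] h by simp
    then show "\<exists>C\<ge>0. \<forall>k. real (Suc k) * \<omega> k \<le> C * gevrey s h k" using C(1) by blast
  qed (use nn in auto)
  show "\<exists>\<omega>'\<in>beurling s. \<forall>j k. \<omega> (j + k) \<le> \<omega>' j * \<omega>' k"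
    using s by (intro beurling_split w) simp
qed

lemma weight_class_all: "weight_class all_weights"
proof
  fix \<omega> \<omega>' :: "nat \<Rightarrow> real" and c R :: real and k
  assume w: "\<omega> \<in> all_weights"
  \<comment> \<open>The larger of j and k, say l, satisfies j + k \<le> 2 l, so \<omega> (j + k)
    occurs in the sum for l; the summand 1 keeps the other factor at least 1.\<close>
  define \<omega>'' where "\<omega>'' j = 1 + (\<Sum>i\<le>2 * j. \<omega> i)" for j
  have nn: "0 \<le> \<omega> k" for k using w by (simp add: all_weights_def)
  have 1: "1 \<le> \<omega>'' j" for j unfolding \<omega>''_def using nn by (simp add: sum_nonneg)
  have "\<omega> (j + k) \<le> \<omega>'' j * \<omega>'' k" for j k
  proof -
    have le: "\<omega> (j + k) \<le> \<omega>'' l" if "j + k \<le> 2 * l" for l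
    proof -
      have "\<omega> (j + k) \<le> (\<Sum>i\<le>2 * l. \<omega> i)" using that nn by (intro member_le_sum) auto
      then show ?thesis by (simp add: \<omega>''_def)
    qed
    show ?thesis
    proof (cases "j \<le> k")
      case True
      have "1 * \<omega> (j + k) \<le> \<omega>'' j * \<omega>'' k" using True nn 1[of j] by (intro mult_mono le) auto
      then show ?thesis by simp
    next
      case False
      have "\<omega> (j + k) * 1 \<le> \<omega>'' j * \<omega>'' k" using False nn 1[of k] 1[of j] by (intro mult_mono le) auto
      then show ?thesis by simp
    qed
  qed
  moreover have "\<omega>'' \<in> all_weights" using 1 by (auto simp: all_weights_def intro: order_trans[of 0 1])
  ultimately show "\<exists>\<omega>'\<in>all_weights. \<forall>j k. \<omega> (j + k) \<le> \<omega>' j * \<omega>' k" by blast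
qed (auto simp: all_weights_def)

text \<open>For \<open>h < 1\<close> the factor \<open>L ^ min k K\<close> enforces the growth needed for normal ordering, at the cost
  of a constant; this is where \<open>s > 1/2\<close> is used.\<close>

lemma gevrey_ladder_bdd:
  fixes f :: "real^'n::finite \<Rightarrow> complex"
  assumes f: "smooth f" and A: "0 \<le> A" and h: "0 < h" and s: "s \<ge> 1/2" and sh: "s > 1/2 \<or> h \<ge> 1"
    and bd: "\<And>\<alpha> \<beta> x. cmod (of_real (mono_pow x \<beta>) * multi_deriv \<alpha> f x) \<le> A * gevrey s h (multi_size \<alpha> + multi_size \<beta>)"
  shows "\<exists>C\<ge>0. ladder_bdd f (\<lambda>k. C * gevrey s (3 * h) k)"
proof -
  \<comment> \<open>L h^2 \<ge> 1, so below the threshold K one extra factor L makes up for a small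
    h^2.\<close>
  define L where "L = max 1 (1 / h\<^sup>2)"
  have L: "L \<ge> 1" "L * h\<^sup>2 \<ge> 1"
    using h by (auto simp: L_def max_def field_simps)
  have pw: "real (k + 1) \<le> (real (k + 1) * real (k + 2)) powr s" for k
  proof -
    have "real (k + 1) = (real (k + 1) * real (k + 1)) powr (1/2)"
      by (simp add: powr_half_sqrt)
    also have "\<dots> \<le> (real (k + 1) * real (k + 1)) powr s"
      using s by (intro powr_mono) (auto simp: algebra_simps)
    also have "\<dots> \<le> (real (k + 1) * real (k + 2)) powr s"
      using s by (intro powr_mono2 mult_left_mono) auto
    finally show ?thesis .
  qed
  have "\<exists>K. \<forall>k\<ge>K. real (k + 1) \<le> h\<^sup>2 * (real (k + 1) * real (k + 2)) powr s"
  proof (cases "h \<ge> 1")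
    case True
    have "real (k + 1) \<le> h\<^sup>2 * (real (k + 1) * real (k + 2)) powr s" for k
      using mult_mono[of 1 "h\<^sup>2", OF _ pw[of k]] True by (simp add: one_le_power)
    then show ?thesis by blast
  next
    case False
    then have s': "s > 1/2" using sh by simp
    \<comment> \<open>Chosen so that (k + 1)^(2 s - 1) \<ge> 1 / h^2 as soon as k \<ge> x.\<close>
    define x where "x = (1 / h\<^sup>2) powr (1 / (2 * s - 1))"
    have "real (k + 1) \<le> h\<^sup>2 * (real (k + 1) * real (k + 2)) powr s" if k: "k \<ge> nat \<lceil>x\<rceil>" for k
    proof -
      let ?m = "real (k + 1)"
      have "x \<le> ?m" using k real_nat_ceiling_ge[of x] by linarith
      then have "x powr (2 * s - 1) \<le> ?m powr (2 * s - 1)" using s' by (intro powr_mono2) (auto simp: x_def)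
      moreover have "x powr (2 * s - 1) = 1 / h\<^sup>2" using s' h by (simp add: x_def powr_powr)
      ultimately have "1 / h\<^sup>2 \<le> ?m powr (2 * s - 1)" by simp
      moreover have "0 < h\<^sup>2" using h by simp
      ultimately have "1 \<le> h\<^sup>2 * ?m powr (2 * s - 1)" by (simp only: pos_divide_le_eq mult.commute)
      then have "?m * 1 \<le> ?m * (h\<^sup>2 * ?m powr (2 * s - 1))" by (intro mult_left_mono) auto
      also have "\<dots> = h\<^sup>2 * (?m * ?m) powr s"
      proof -
        have "?m * ?m powr (2 * s - 1) = ?m powr 1 * ?m powr (2 * s - 1)" by simp
        also have "\<dots> = ?m powr (2 * s)" by (simp only: powr_add[symmetric]) simp
        also have "\<dots> = ?m powr s * ?m powr s" by (simp add: powr_add[symmetric])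
        finally show ?thesis by (simp add: powr_mult mult.left_commute)
      qed
      also have "\<dots> \<le> h\<^sup>2 * (?m * real (k + 2)) powr s"
        using s by (intro mult_left_mono powr_mono2) auto
      finally show ?thesis by simp
    qed
    then show ?thesis by blast
  qed
  then obtain K where K: "\<And>k. k \<ge> K \<Longrightarrow> real (k + 1) \<le> h\<^sup>2 * (real (k + 1) * real (k + 2)) powr s" by blast
  define \<omega> where "\<omega> k = A * (L ^ min k K * gevrey s h k)" for k
  have g2: "gevrey s h (Suc (Suc k)) = h\<^sup>2 * (real (k + 1) * real (k + 2)) powr s * gevrey s h k" for k
  proof -
    have "(fact (Suc (Suc k)) :: real) = (real (k + 1) * real (k + 2)) * fact k" by (simp add: algebra_simps)
    then have "fact (Suc (Suc k)) powr s = (real (k + 1) * real (k + 2)) powr s * fact k powr s"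
      by (simp only: powr_mult)
    then show ?thesis by (simp only: gevrey_def power_Suc power2_eq_square mult_ac)
  qed
  have "ladder_bdd f (\<lambda>k. 3 ^ k * \<omega> k)"
  proof (rule normal_ordered_ladder_bdd[OF f])
    show "0 \<le> \<omega> k" for k unfolding \<omega>_def using A L gevrey_pos[OF h, of s k] by simp
    show "real (Suc k) * \<omega> k \<le> \<omega> (Suc (Suc k))" for k
    proof -
      let ?q = "(real (k + 1) * real (k + 2)) powr s"
      have "real (k + 1) * L ^ min k K \<le> L ^ min (Suc (Suc k)) K * (h\<^sup>2 * ?q)"
      proof (cases "K \<le> k")
        case True
        then have m: "min k K = K" "min (Suc (Suc k)) K = K" by auto
        have "L ^ K * real (k + 1) \<le> L ^ K * (h\<^sup>2 * ?q)"
          using K[OF True] L by (intro mult_left_mono) auto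
        then show ?thesis by (simp only: m mult.commute)
      next
        case False
        have "real (k + 1) * L ^ min k K \<le> (L * h\<^sup>2 * ?q) * L ^ min k K"
        proof (rule mult_right_mono)
          have "1 * real (k + 1) \<le> (L * h\<^sup>2) * ?q" using L by (intro mult_mono pw) auto
          then show "real (k + 1) \<le> L * h\<^sup>2 * ?q" by simp
        qed (use L in auto)
        also have "\<dots> = L ^ Suc (min k K) * (h\<^sup>2 * ?q)" by simp
        also have "\<dots> \<le> L ^ min (Suc (Suc k)) K * (h\<^sup>2 * ?q)"
          using False L by (intro mult_right_mono power_increasing) auto
        finally show ?thesis .
      qed
      then have "A * gevrey s h k * (real (k + 1) * L ^ min k K) \<le> A * gevrey s h k * (L ^ min (Suc (Suc k)) K * (h\<^sup>2 * ?q))"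
        using A gevrey_pos[OF h, of s k] by (intro mult_left_mono) auto
      then show ?thesis unfolding \<omega>_def g2 by (simp only: Suc_eq_plus1 mult_ac)
    qed
    fix \<alpha> \<beta> :: "'n \<Rightarrow> nat" and x
    let ?N = "multi_size \<alpha> + multi_size \<beta>"
    have "A * (1 * gevrey s h ?N) \<le> \<omega> ?N"
      unfolding \<omega>_def using A L gevrey_pos[OF h, of s ?N]
      by (intro mult_left_mono mult_right_mono) (auto intro: one_le_power)
    then show "cmod (of_real (mono_pow x \<beta>) * multi_deriv \<alpha> f x) \<le> \<omega> ?N"
      using bd[of x \<beta> \<alpha>] by simp
  qed
  moreover have "3 ^ k * \<omega> k \<le> (A * L ^ K) * gevrey s (3 * h) k" for k
  proof -
    have "3 ^ k * \<omega> k = (A * L ^ min k K) * gevrey s (3 * h) k"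
      by (simp add: \<omega>_def gevrey_def power_mult_distrib)
    also have "\<dots> \<le> (A * L ^ K) * gevrey s (3 * h) k"
      using A L gevrey_pos[of "3 * h" s k] h by (intro mult_right_mono mult_left_mono power_increasing) auto
    finally show ?thesis .
  qed
  ultimately have "ladder_bdd f (\<lambda>k. (A * L ^ K) * gevrey s (3 * h) k)" by (rule ladder_bdd_mono)
  then show ?thesis using A L by (intro exI[of _ "A * L ^ K"]) auto
qed

section \<open>Gelfand-Shilov norms and Schwartz seminorms against ladder bounds\<close>

lemma multi_fact_pos: "0 < multi_fact \<alpha>"
  unfolding multi_fact_def by (intro prod_pos) auto

lemma multi_fact_le: "multi_fact \<alpha> * multi_fact \<beta> \<le> fact (multi_size \<alpha> + multi_size \<beta>)"
proof -
  have "multi_fact \<alpha> * multi_fact \<beta> \<le> fact (multi_size \<alpha>) * fact (multi_size \<beta>)"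
    using multi_fact_pos[of \<beta>] unfolding multi_fact_def multi_size_def
    by (intro mult_mono prod_fact_le) (auto intro: prod_nonneg)
  also have "\<dots> \<le> fact (multi_size \<alpha> + multi_size \<beta>)" by (rule fact_mult_le)
  finally show ?thesis .
qed

lemma fact_multi_size_le:
  fixes \<alpha> \<beta> :: "'n::finite \<Rightarrow> nat"
  shows "fact (multi_size \<alpha> + multi_size \<beta>) \<le> (2 * 2 ^ CARD('n)) ^ (multi_size \<alpha> + multi_size \<beta>) * (multi_fact \<alpha> * multi_fact \<beta>)"
proof -
  let ?c = "2 ^ CARD('n) :: real"
  have 1: "fact (multi_size \<gamma>) \<le> ?c ^ multi_size \<gamma> * multi_fact \<gamma>" for \<gamma> :: "'n \<Rightarrow> nat"
    unfolding multi_size_def multi_fact_def by (rule fact_sum_le) simp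
  have "(fact (multi_size \<alpha> + multi_size \<beta>) :: real) \<le> 2 ^ (multi_size \<alpha> + multi_size \<beta>) * (fact (multi_size \<alpha>) * fact (multi_size \<beta>))"
    by (rule fact_add_le)
  also have "\<dots> \<le> 2 ^ (multi_size \<alpha> + multi_size \<beta>) * ((?c ^ multi_size \<alpha> * multi_fact \<alpha>) * (?c ^ multi_size \<beta> * multi_fact \<beta>))"
    using multi_fact_pos[of \<alpha>] by (intro mult_left_mono mult_mono 1) auto
  also have "\<dots> = (2 * ?c) ^ (multi_size \<alpha> + multi_size \<beta>) * (multi_fact \<alpha> * multi_fact \<beta>)"
    by (simp only: power_mult_distrib power_add mult_ac)
  finally show ?thesis .
qed

lemma GS_norm_le:
  fixes f :: "real^'n::finite \<Rightarrow> complex"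
  assumes f: "smooth f" "ladder_bdd f \<omega>" and bd: "\<And>k. \<omega> k \<le> C * gevrey s h k" and h: "0 < h" and s: "0 \<le> s" and C: "0 \<le> C"
  shows "GS_norm s (h * (2 * 2 ^ CARD('n)) powr s) f \<le> ennreal C"
  unfolding GS_norm_def
proof (intro SUP_least ennreal_leI)
  fix \<alpha> \<beta> :: "'n \<Rightarrow> nat" and x
  let ?N = "multi_size \<alpha> + multi_size \<beta>" and ?c = "2 * 2 ^ CARD('n) :: real" and ?m = "multi_fact \<alpha> * multi_fact \<beta>"
  have m: "?m > 0" using multi_fact_pos[of \<alpha>] multi_fact_pos[of \<beta>] by simp
  have "cmod (of_real (mono_pow x \<beta>) * multi_deriv \<alpha> f x) \<le> C * gevrey s h ?N"
    using ladder_bdd_normal_ordered[OF f, of x \<beta> \<alpha>] bd[of ?N] by simp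
  also have "\<dots> \<le> C * (h ^ ?N * (?c ^ ?N * ?m) powr s)"
    unfolding gevrey_def using h s C fact_multi_size_le[of \<alpha> \<beta>]
    by (intro mult_left_mono powr_mono2) auto
  also have "\<dots> = C * ((h * ?c powr s) ^ ?N * ?m powr s)"
    using m by (simp add: powr_mult power_powr power_mult_distrib)
  finally have "cmod (of_real (mono_pow x \<beta>) * multi_deriv \<alpha> f x) \<le> C * ((h * ?c powr s) ^ ?N * ?m powr s)" .
  moreover have "(h * ?c powr s) ^ ?N * ?m powr s > 0"
    using h m by (intro mult_pos_pos zero_less_power powr_gt_zero[THEN iffD2]) auto
  ultimately show "cmod (of_real (mono_pow x \<beta>) * multi_deriv \<alpha> f x) / ((h * ?c powr s) ^ ?N * ?m powr s) \<le> C"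
    by (simp only: pos_divide_le_eq)
qed

text \<open>This direction keeps h, as \<alpha>! \<beta>! \<le> (|\<alpha>| + |\<beta>|)!; the
  opposite one, \<open>GS_norm_le\<close>, pays a factor in h for the reverse comparison of
  factorials.\<close>

lemma GS_norm_normal_ordered:
  assumes fin: "GS_norm s h f < \<infinity>" and h: "0 < h" and s: "0 \<le> s"
  shows "cmod (of_real (mono_pow x \<beta>) * multi_deriv \<alpha> f x) \<le> enn2real (GS_norm s h f) * gevrey s h (multi_size \<alpha> + multi_size \<beta>)"
proof -
  let ?N = "multi_size \<alpha> + multi_size \<beta>" and ?m = "multi_fact \<alpha> * multi_fact \<beta>"
  let ?d = "h ^ ?N * ?m powr s" and ?A = "enn2real (GS_norm s h f)"
  have m: "?m > 0" using multi_fact_pos[of \<alpha>] multi_fact_pos[of \<beta>] by simp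
  then have d: "?d > 0" using h by (intro mult_pos_pos zero_less_power powr_gt_zero[THEN iffD2]) auto
  have "ennreal (cmod (of_real (mono_pow x \<beta>) * multi_deriv \<alpha> f x) / ?d) \<le> GS_norm s h f"
    unfolding GS_norm_def
    by (rule SUP_upper2[of \<alpha>], simp, rule SUP_upper2[of \<beta>], simp, rule SUP_upper2[of x], simp_all)
  also have "GS_norm s h f = ennreal ?A" using fin by (simp add: less_top)
  finally have "cmod (of_real (mono_pow x \<beta>) * multi_deriv \<alpha> f x) / ?d \<le> ?A" by simp
  then have "cmod (of_real (mono_pow x \<beta>) * multi_deriv \<alpha> f x) \<le> ?A * ?d"
    using d by (simp only: pos_divide_le_eq)
  also have "\<dots> \<le> ?A * (h ^ ?N * fact ?N powr s)"
    using h s m multi_fact_le[of \<alpha> \<beta>] by (intro mult_left_mono powr_mono2) auto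
  finally show ?thesis by (simp add: gevrey_def)
qed

lemma GS_stepI: "smooth f \<Longrightarrow> GS_norm s h f \<le> ennreal C \<Longrightarrow> f \<in> GS_step s h"
  unfolding GS_step_def by (auto intro: le_less_trans)

lemma GS_step_ladder_bdd:
  fixes f :: "real^'n::finite \<Rightarrow> complex"
  assumes f: "f \<in> GS_step s h" and h: "0 < h" and s: "s \<ge> 1/2" and sh: "s > 1/2 \<or> h \<ge> 1"
  shows "\<exists>C\<ge>0. ladder_bdd f (\<lambda>k. C * gevrey s (3 * h) k)"
proof (rule gevrey_ladder_bdd[OF _ _ h s sh])
  show "smooth f" using f by (simp add: GS_step_def)
  show "0 \<le> enn2real (GS_norm s h f)" by simp
  show "cmod (of_real (mono_pow x \<beta>) * multi_deriv \<alpha> f x) \<le> enn2real (GS_norm s h f) * gevrey s h (multi_size \<alpha> + multi_size \<beta>)" for \<alpha> \<beta> :: "'n \<Rightarrow> nat" and x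
    using f h s by (intro GS_norm_normal_ordered) (auto simp: GS_step_def)
qed

text \<open>The factor comes from \<open>(|\<alpha>| + |\<beta>|)! \<le> 2^(|\<alpha>| + |\<beta>|) |\<alpha>|! |\<beta>|!\<close> and \<open>|\<alpha>|! \<le> (2^d)^|\<alpha>| \<alpha>!\<close>.\<close>

definition gs_factor :: "'n::finite itself \<Rightarrow> real \<Rightarrow> real" where
  "gs_factor _ s = (2 * 2 ^ CARD('n)) powr s"

lemma gs_factor_pos: "0 < gs_factor TYPE('n::finite) s"
  by (simp add: gs_factor_def)

lemma GS_norm_wspace:
  fixes f :: "real^'n::finite \<Rightarrow> complex"
  assumes "smooth f" "ladder_bdd f (\<lambda>k. a * \<omega> k)" "\<And>k. \<omega> k \<le> C * gevrey s h k" "0 < h" "0 \<le> s" "0 \<le> C" "0 \<le> a"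
  shows "GS_norm s (h * gs_factor TYPE('n) s) f \<le> ennreal (a * C)"
  unfolding gs_factor_def
proof (rule GS_norm_le[OF assms(1,2) _ assms(4,5)])
  show "a * \<omega> k \<le> a * C * gevrey s h k" for k
    using mult_left_mono[OF assms(3,7)] by (simp add: mult.assoc)
qed (use assms in auto)

lemma GS_S_eq_wspace:
  assumes s: "s \<ge> 1/2"
  shows "(GS_S s :: (real^'n::finite \<Rightarrow> complex) set) = wspace (roumieu s)"
proof (intro equalityI subsetI)
  fix f :: "real^'n \<Rightarrow> complex" assume "f \<in> GS_S s"
  then obtain h where h: "h > 0" "f \<in> GS_step s h" by (auto simp: GS_S_def)
  \<comment> \<open>The parameter is enlarged to at least 1, so that
    \<open>gevrey_ladder_bdd\<close> covers s = 1/2 as well.\<close>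
  let ?H = "max h 1"
  have sm: "smooth f" using h(2) by (simp add: GS_step_def)
  have "\<exists>C\<ge>0. ladder_bdd f (\<lambda>k. C * gevrey s (3 * ?H) k)"
  proof (rule gevrey_ladder_bdd[OF sm _ _ s])
    fix \<alpha> \<beta> :: "'n \<Rightarrow> nat" and x
    have "cmod (of_real (mono_pow x \<beta>) * multi_deriv \<alpha> f x) \<le> enn2real (GS_norm s h f) * gevrey s h (multi_size \<alpha> + multi_size \<beta>)"
      using h s by (intro GS_norm_normal_ordered) (auto simp: GS_step_def)
    also have "\<dots> \<le> enn2real (GS_norm s h f) * gevrey s ?H (multi_size \<alpha> + multi_size \<beta>)"
      using h by (intro mult_left_mono gevrey_mono) auto
    finally show "cmod (of_real (mono_pow x \<beta>) * multi_deriv \<alpha> f x) \<le> enn2real (GS_norm s h f) * gevrey s ?H (multi_size \<alpha> + multi_size \<beta>)" .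
  qed auto
  then obtain C where C: "C \<ge> 0" "ladder_bdd f (\<lambda>k. C * gevrey s (3 * ?H) k)" by blast
  have "(\<lambda>k. C * gevrey s (3 * ?H) k) \<in> roumieu s"
    using C(1) by (intro roumieuI[of _ "3 * ?H" C]) (auto intro!: mult_nonneg_nonneg less_imp_le[OF gevrey_pos])
  then show "f \<in> wspace (roumieu s)" by (rule wspaceI[OF sm _ C(2)])
next
  fix f :: "real^'n \<Rightarrow> complex" assume "f \<in> wspace (roumieu s)"
  then obtain \<omega> h C where f: "smooth f" "ladder_bdd f \<omega>" and "h > 0" "C \<ge> 0" "\<And>k. \<omega> k \<le> C * gevrey s h k"
    by (auto simp: wspace_def roumieu_def)
  then have "GS_norm s (h * gs_factor TYPE('n) s) f \<le> ennreal (1 * C)"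
    using s by (intro GS_norm_wspace[of f 1 \<omega> C s h]) auto
  then have "f \<in> GS_step s (h * gs_factor TYPE('n) s)" by (rule GS_stepI[OF f(1)])
  then show "f \<in> GS_S s" using \<open>h > 0\<close> gs_factor_pos[where 'n='n] by (auto simp: GS_S_def)
qed

text \<open>The least weight of f. A Beurling weight must obey the bounds for all h at once, while
  each h comes with its own majorant; the supremum over words of a given length lies below all of
  them.\<close>

lemma ladder_sup_weight:
  assumes bd: "\<And>k. \<exists>B. \<forall>w x. length w = k \<longrightarrow> cmod (word w f x) \<le> B"
  obtains \<omega> where "ladder_bdd f \<omega>" "\<And>k. 0 \<le> \<omega> k"
    "\<And>k B. (\<And>w x. length w = k \<Longrightarrow> cmod (word w f x) \<le> B) \<Longrightarrow> \<omega> k \<le> B"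
proof
  define S where "S k = (\<lambda>(w, x). cmod (word w f x)) ` ({w. length w = k} \<times> UNIV)" for k
  have S: "S k \<noteq> {}" for k
    unfolding S_def using length_replicate[of k undefined] by blast
  have up: "bdd_above (S k)" for k
    using bd[of k] unfolding S_def bdd_above_def by (auto simp del: split_paired_All)
  show L: "ladder_bdd f (\<lambda>k. Sup (S k))"
    unfolding ladder_bdd_def by (intro allI cSup_upper up) (auto simp: S_def)
  show "0 \<le> Sup (S k)" for k by (rule ladder_bdd_nonneg[OF L])
  show "Sup (S k) \<le> B" if "\<And>w x. length w = k \<Longrightarrow> cmod (word w f x) \<le> B" for k B
    using S that by (intro cSup_least) (auto simp: S_def)
qed

lemma GS_Sigma_eq_wspace:
  assumes s: "s > 1/2"
  shows "(GS_Sigma s :: (real^'n::finite \<Rightarrow> complex) set) = wspace (beurling s)"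
proof (intro equalityI subsetI)
  fix f :: "real^'n \<Rightarrow> complex" assume f: "f \<in> GS_Sigma s"
  have sm: "smooth f" using f by (auto simp: GS_Sigma_def GS_step_def dest: bspec[of _ _ 1])
  have L: "\<exists>C\<ge>0. ladder_bdd f (\<lambda>k. C * gevrey s h k)" if h: "h > 0" for h
  proof -
    \<comment> \<open>Normal ordering multiplies the parameter by 3.\<close>
    have "f \<in> GS_step s (h / 3)" using f h by (auto simp: GS_Sigma_def)
    from GS_step_ladder_bdd[OF this] show ?thesis using h s by simp
  qed
  have "\<exists>B. \<forall>w x. length w = k \<longrightarrow> cmod (word w f x) \<le> B" for k
  proof -
    obtain C where "ladder_bdd f (\<lambda>k. C * gevrey s 1 k)" using L[of 1] by auto
    then show ?thesis unfolding ladder_bdd_def by (intro exI[of _ "C * gevrey s 1 k"]) metis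
  qed
  from ladder_sup_weight[OF this] obtain \<omega> where w: "ladder_bdd f \<omega>" "\<And>k. 0 \<le> \<omega> k"
    "\<And>k B. (\<And>w x. length w = k \<Longrightarrow> cmod (word w f x) \<le> B) \<Longrightarrow> \<omega> k \<le> B" by blast
  have "\<omega> \<in> beurling s"
    unfolding beurling_def
  proof (intro CollectI conjI allI impI)
    fix h :: real assume "h > 0"
    then obtain C where C: "C \<ge> 0" "ladder_bdd f (\<lambda>k. C * gevrey s h k)" using L by blast
    have "\<omega> k \<le> C * gevrey s h k" for k
      by (rule w(3)) (use ladder_bddD[OF C(2)] in auto)
    then show "\<exists>C\<ge>0. \<forall>k. \<omega> k \<le> C * gevrey s h k" using C(1) by blast
  qed (rule w(2))
  then show "f \<in> wspace (beurling s)" by (rule wspaceI[OF sm _ w(1)])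
next
  fix f :: "real^'n \<Rightarrow> complex" assume "f \<in> wspace (beurling s)"
  then obtain \<omega> where f: "smooth f" "ladder_bdd f \<omega>" and w: "\<omega> \<in> beurling s" by (auto simp: wspace_def)
  have "f \<in> GS_step s h" if h: "h > 0" for h
  proof -
    let ?h = "h / gs_factor TYPE('n) s"
    have h': "?h > 0" "?h * gs_factor TYPE('n) s = h" using h gs_factor_pos[where 'n='n, of s] by auto
    obtain C where "C \<ge> 0" "\<And>k. \<omega> k \<le> C * gevrey s ?h k" using w h' unfolding beurling_def by auto
    then have "GS_norm s (?h * gs_factor TYPE('n) s) f \<le> ennreal (1 * C)"
      using s f h' by (intro GS_norm_wspace[of f 1 \<omega> C s ?h]) auto
    then show ?thesis unfolding h'(2) by (rule GS_stepI[OF f(1)])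
  qed
  then show "f \<in> GS_Sigma s" by (auto simp: GS_Sigma_def)
qed

lemma schwartz_seminorm_wspace:
  assumes "smooth f" "ladder_bdd f \<omega>"
  shows "schwartz_seminorm (\<alpha>, \<beta>) f \<le> ennreal (\<omega> (multi_size \<alpha> + multi_size \<beta>))"
  unfolding schwartz_seminorm_def prod.case
  by (intro SUP_least ennreal_leI ladder_bdd_normal_ordered assms)

lemma schwartz_eq_wspace: "(schwartz :: (real^'n::finite \<Rightarrow> complex) set) = wspace all_weights"
proof (intro equalityI subsetI)
  fix f :: "real^'n \<Rightarrow> complex" assume f: "f \<in> schwartz"
  have sm: "smooth f" using f by (simp add: schwartz_def)
  define P where "P j = {ab :: ('n \<Rightarrow> nat) \<times> ('n \<Rightarrow> nat). multi_size (fst ab) + multi_size (snd ab) = j}" for j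
  have "\<alpha> i \<le> multi_size \<alpha>" for \<alpha> :: "'n \<Rightarrow> nat" and i
    unfolding multi_size_def by (rule member_le_sum) auto
  then have "P j \<subseteq> (PiE UNIV (\<lambda>_. {..j})) \<times> (PiE UNIV (\<lambda>_. {..j}))" for j
    by (auto simp: P_def PiE_iff intro: le_trans trans_le_add1 trans_le_add2)
  then have fin: "finite (P j)" for j by (rule finite_subset) (auto intro!: finite_PiE)
  define D where "D j = (\<Sum>ab\<in>P j. enn2real (schwartz_seminorm ab f))" for j
  \<comment> \<open>Summation over all orders up to k makes the sum monotone, and k! provides the
    growth demanded by normal ordering. \<open>D j\<close> is a finite sum, since finitely many
    pairs of multi-indices have total size j.\<close>
  define \<omega> where "\<omega> k = fact k * (\<Sum>j\<le>k. D j)" for k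
  have D0: "0 \<le> D j" for j unfolding D_def by (intro sum_nonneg) auto
  have S0: "0 \<le> (\<Sum>j\<le>k. D j)" for k using D0 by (intro sum_nonneg) auto
  have w0: "0 \<le> \<omega> k" for k using S0 by (simp add: \<omega>_def)
  have Dw: "D k \<le> \<omega> k" for k
  proof -
    have "D k \<le> (\<Sum>j\<le>k. D j)" using D0 by (intro member_le_sum) auto
    also have "\<dots> \<le> fact k * (\<Sum>j\<le>k. D j)" using S0[of k] mult_right_mono[of 1 "fact k" "\<Sum>j\<le>k. D j"] by simp
    finally show ?thesis by (simp add: \<omega>_def)
  qed
  have "ladder_bdd f (\<lambda>k. 3 ^ k * \<omega> k)"
  proof (rule normal_ordered_ladder_bdd[OF sm w0])
    fix k
    have "real (Suc k) * fact k \<le> real (Suc (Suc k)) * (real (Suc k) * fact k)"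
      using mult_right_mono[of 1 "real (Suc (Suc k))" "real (Suc k) * fact k"] by simp
    also have "\<dots> = fact (Suc (Suc k))" by simp
    finally have "real (Suc k) * fact k \<le> fact (Suc (Suc k))" .
    moreover have "(\<Sum>j\<le>k. D j) \<le> (\<Sum>j\<le>Suc (Suc k). D j)" using D0 by (intro sum_mono2) auto
    ultimately have "(real (Suc k) * fact k) * (\<Sum>j\<le>k. D j) \<le> fact (Suc (Suc k)) * (\<Sum>j\<le>Suc (Suc k). D j)"
      using S0 by (intro mult_mono) auto
    then show "real (Suc k) * \<omega> k \<le> \<omega> (Suc (Suc k))" by (simp only: \<omega>_def mult.assoc)
  next
    fix \<alpha> \<beta> :: "'n \<Rightarrow> nat" and x
    let ?N = "multi_size \<alpha> + multi_size \<beta>" and ?t = "cmod (of_real (mono_pow x \<beta>) * multi_deriv \<alpha> f x)"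
    have fin': "schwartz_seminorm (\<alpha>, \<beta>) f < \<infinity>" using f by (simp add: schwartz_def)
    have "ennreal ?t \<le> schwartz_seminorm (\<alpha>, \<beta>) f"
      unfolding schwartz_seminorm_def prod.case by (rule SUP_upper) simp
    then have "?t \<le> enn2real (schwartz_seminorm (\<alpha>, \<beta>) f)"
      using fin' enn2real_mono[of "ennreal ?t"] by simp
    also have "\<dots> \<le> D ?N" unfolding D_def by (intro member_le_sum fin) (auto simp: P_def)
    also have "\<dots> \<le> \<omega> ?N" by (rule Dw)
    finally show "?t \<le> \<omega> ?N" .
  qed
  moreover have "(\<lambda>k. 3 ^ k * \<omega> k) \<in> all_weights" using w0 by (simp add: all_weights_def)
  ultimately show "f \<in> wspace all_weights" using sm by (intro wspaceI)
next
  fix f :: "real^'n \<Rightarrow> complex" assume "f \<in> wspace all_weights"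
  then obtain \<omega> where "smooth f" "ladder_bdd f \<omega>" by (auto simp: wspace_def)
  then show "f \<in> schwartz"
    using le_less_trans[OF schwartz_seminorm_wspace[of f \<omega>] ennreal_less_top] by (auto simp: schwartz_def)
qed

section \<open>Bounded sets of the test spaces and neighbourhoods in their duals\<close>

lemma cscale_wspace:
  assumes "weight_class W" "f \<in> wspace W" "ladder_bdd f \<omega>" "0 \<le> \<delta>"
  shows "cscale (of_real \<delta>) f \<in> wspace W" "ladder_bdd (cscale (of_real \<delta>) f) (\<lambda>k. \<delta> * \<omega> k)"
  using weight_class.wspace_cmult[OF assms(1,2), of "of_real \<delta>"]
    ladder_bdd_cmult[OF wspace_smooth[OF assms(2)] assms(3), of "of_real \<delta>"] assms(4)
  by (simp_all add: cscale_def)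

lemma absorbing_seminorm_topology:
  fixes N :: "'i \<Rightarrow> (real^'n::finite \<Rightarrow> complex) \<Rightarrow> ennreal"
  assumes W: "weight_class W"
    and N: "\<And>i \<omega>. i \<in> I \<Longrightarrow> \<omega> \<in> W \<Longrightarrow> \<exists>C\<ge>0. \<forall>a\<ge>0. \<forall>f\<in>wspace W. ladder_bdd f (\<lambda>k. a * \<omega> k) \<longrightarrow> N i f \<le> ennreal (a * C)"
  shows "absorbing W (seminorm_topology (wspace W) I N)"
  unfolding absorbing_def
proof (intro conjI allI impI ballI)
  fix Q and \<omega> :: "nat \<Rightarrow> real"
  assume Q: "openin (seminorm_topology (wspace W) I N) Q" "0 \<in> Q" and w: "\<omega> \<in> W"
  have "\<forall>f\<in>Q. \<exists>V\<in>seminorm_nbhds I N. \<forall>g\<in>V. f + g \<in> wspace W \<longrightarrow> f + g \<in> Q"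
    using Q(1) by (simp add: openin_seminorm_topology)
  from bspec[OF this Q(2)] obtain V where V: "V \<in> seminorm_nbhds I N" "\<forall>g\<in>V. 0 + g \<in> wspace W \<longrightarrow> 0 + g \<in> Q"
    by (rule bexE)
  from V(1)[unfolded seminorm_nbhds_def mem_Collect_eq] obtain F \<epsilon>
    where F: "V = {g. \<forall>i\<in>F. N i g < ennreal \<epsilon>}" "finite F" "F \<subseteq> I" and e: "0 < \<epsilon>" by blast
  have "\<forall>i\<in>F. \<exists>C\<ge>0. \<forall>a\<ge>0. \<forall>f\<in>wspace W. ladder_bdd f (\<lambda>k. a * \<omega> k) \<longrightarrow> N i f \<le> ennreal (a * C)"
    using N[OF _ w] F(3) by (simp add: subset_iff)
  from bchoice[OF this] obtain C where C: "\<And>i. i \<in> F \<Longrightarrow> C i \<ge> 0"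
    and NC: "\<forall>i\<in>F. \<forall>a\<ge>0. \<forall>f\<in>wspace W. ladder_bdd f (\<lambda>k. a * \<omega> k) \<longrightarrow> N i f \<le> ennreal (a * C i)"
    by auto
  \<comment> \<open>A basic neighbourhood involves finitely many seminorms, and A dominates all
    their constants; the summand 1 keeps \<delta> meaningful if \<open>F\<close> is empty.\<close>
  define A where "A = 1 + (\<Sum>i\<in>F. C i)"
  have A: "A \<ge> 1" using C by (simp add: A_def sum_nonneg)
  have CA: "C i \<le> A" if "i \<in> F" for i
    using member_le_sum[of i F C] that C F(2) by (simp add: A_def)
  define \<delta> where "\<delta> = \<epsilon> / (2 * A)"
  have d: "\<delta> > 0" using e A by (simp add: \<delta>_def)
  have "cscale (of_real \<delta>) f \<in> Q" if f: "f \<in> wspace W" "ladder_bdd f \<omega>" for f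
  proof -
    note cf = cscale_wspace[OF W f, of \<delta>]
    have "N i (cscale (of_real \<delta>) f) < ennreal \<epsilon>" if i: "i \<in> F" for i
    proof -
      have "N i (cscale (of_real \<delta>) f) \<le> ennreal (\<delta> * C i)"
        using NC i cf d by auto
      also have "\<delta> * C i \<le> \<delta> * A" using CA[OF i] d by (intro mult_left_mono) auto
      then have "ennreal (\<delta> * C i) \<le> ennreal (\<epsilon> / 2)" using A by (intro ennreal_leI) (simp add: \<delta>_def)
      also have "ennreal (\<epsilon> / 2) < ennreal \<epsilon>" using e by (intro ennreal_lessI) auto
      finally show ?thesis .
    qed
    then show ?thesis using V(2) cf(1) d by (simp add: F(1))
  qed
  then show "\<exists>\<delta>>0. \<forall>f\<in>wspace W. ladder_bdd f \<omega> \<longrightarrow> cscale (of_real \<delta>) f \<in> Q" using d by blast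
qed simp

lemma absorbing_GS_Sigma:
  assumes s: "s > 1/2"
  shows "absorbing (beurling s) (GS_Sigma_top s :: (real^'n::finite \<Rightarrow> complex) topology)"
  unfolding GS_Sigma_top_def GS_Sigma_eq_wspace[OF s]
proof (rule absorbing_seminorm_topology[OF weight_class_beurling[OF s]])
  fix h :: real and \<omega> assume h: "h \<in> {0<..}" and w: "\<omega> \<in> beurling s"
  let ?h = "h / gs_factor TYPE('n) s"
  have h': "?h > 0" "?h * gs_factor TYPE('n) s = h" using h gs_factor_pos[where 'n='n, of s] by auto
  obtain C where C: "C \<ge> 0" "\<And>k. \<omega> k \<le> C * gevrey s ?h k" using w h' unfolding beurling_def by auto
  have "GS_norm s h f \<le> ennreal (a * C)" if "a \<ge> 0" "f \<in> wspace (beurling s)" "ladder_bdd f (\<lambda>k. a * \<omega> k)"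
    for a and f :: "real^'n \<Rightarrow> complex"
    using GS_norm_wspace[OF wspace_smooth[OF that(2)] that(3) C(2) h'(1) _ C(1) that(1)] s unfolding h'(2) by simp
  then show "\<exists>C\<ge>0. \<forall>a\<ge>0. \<forall>f\<in>wspace (beurling s). ladder_bdd f (\<lambda>k. a * \<omega> k) \<longrightarrow> GS_norm s h (f :: real^'n \<Rightarrow> complex) \<le> ennreal (a * C)"
    using C(1) by blast
qed

lemma absorbing_schwartz: "absorbing all_weights (schwartz_top :: (real^'n::finite \<Rightarrow> complex) topology)"
  unfolding schwartz_top_def schwartz_eq_wspace
proof (rule absorbing_seminorm_topology[OF weight_class_all])
  fix ab :: "('n \<Rightarrow> nat) \<times> ('n \<Rightarrow> nat)" and \<omega> assume w: "\<omega> \<in> all_weights"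
  obtain \<alpha> \<beta> where ab: "ab = (\<alpha>, \<beta>)" by (cases ab) auto
  have "schwartz_seminorm ab f \<le> ennreal (a * \<omega> (multi_size \<alpha> + multi_size \<beta>))"
    if "f \<in> wspace all_weights" "ladder_bdd f (\<lambda>k. a * \<omega> k)" for a and f :: "real^'n \<Rightarrow> complex"
    using schwartz_seminorm_wspace[OF wspace_smooth[OF that(1)] that(2), of \<alpha> \<beta>] by (simp add: ab)
  then show "\<exists>C\<ge>0. \<forall>a\<ge>0. \<forall>f\<in>wspace all_weights. ladder_bdd f (\<lambda>k. a * \<omega> k) \<longrightarrow> schwartz_seminorm ab (f :: real^'n \<Rightarrow> complex) \<le> ennreal (a * C)"
    using w by (intro exI[of _ "\<omega> (multi_size \<alpha> + multi_size \<beta>)"]) (auto simp: all_weights_def)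
qed

text \<open>All functions of weight \<omega> lie in one step of the inductive limit, with bounded
  norm there, so the radius that a neighbourhood has in that step decides.\<close>

lemma absorbing_GS_S:
  assumes s: "s \<ge> 1/2"
  shows "absorbing (roumieu s) (GS_S_top s :: (real^'n::finite \<Rightarrow> complex) topology)"
  unfolding absorbing_def
proof (intro conjI allI impI ballI)
  show "topspace (GS_S_top s) = (wspace (roumieu s) :: (real^'n \<Rightarrow> complex) set)"
    by (simp add: GS_S_top_def GS_S_eq_wspace[OF s])
  fix Q :: "(real^'n \<Rightarrow> complex) set" and \<omega>
  assume Q: "openin (GS_S_top s) Q" "0 \<in> Q" and w: "\<omega> \<in> roumieu s"
  have "\<forall>f\<in>Q. \<exists>V\<in>ind_limit_nbhds {0<..} (GS_step s) (GS_norm s) (\<lambda>h f. f). \<forall>g\<in>V. f + g \<in> GS_S s \<longrightarrow> f + g \<in> Q"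
    using Q(1) by (simp add: GS_S_top_def openin_ind_limit_topology)
  from bspec[OF this Q(2)] obtain V where V: "V \<in> ind_limit_nbhds {0<..} (GS_step s) (GS_norm s) (\<lambda>h f. f)"
    "\<forall>g\<in>V. 0 + g \<in> GS_S s \<longrightarrow> 0 + g \<in> Q" by (rule bexE)
  obtain h C where h: "h > 0" and C: "C \<ge> 0" "\<And>k. \<omega> k \<le> C * gevrey s h k"
    using w unfolding roumieu_def by auto
  let ?h = "h * gs_factor TYPE('n) s"
  have h': "?h \<in> {0<..}" using h gs_factor_pos[where 'n='n, of s] by simp
  obtain \<epsilon> where e: "\<epsilon> > 0" "\<forall>g\<in>GS_step s ?h. GS_norm s ?h g < ennreal \<epsilon> \<longrightarrow> g \<in> V"
    using V(1) h' unfolding ind_limit_nbhds_def by blast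
  define \<delta> where "\<delta> = \<epsilon> / (2 * (C + 1))"
  have d: "\<delta> > 0" using e(1) C(1) by (simp add: \<delta>_def)
  have dC: "\<delta> * C < \<epsilon>"
  proof -
    have "\<delta> * C \<le> \<delta> * (C + 1)" using d by (intro mult_left_mono) auto
    also have "\<dots> = \<epsilon> / 2" using C(1) by (simp add: \<delta>_def field_simps)
    finally show ?thesis using e(1) by simp
  qed
  have "cscale (of_real \<delta>) f \<in> Q" if f: "f \<in> wspace (roumieu s)" "ladder_bdd f \<omega>" for f :: "real^'n \<Rightarrow> complex"
  proof -
    note cf = cscale_wspace[OF weight_class_roumieu[OF s] f, of \<delta>]
    let ?g = "cscale (of_real \<delta>) f"
    have sm: "smooth ?g" using cf(1) d by (auto intro: wspace_smooth)
    have n: "GS_norm s ?h ?g \<le> ennreal (\<delta> * C)"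
      using cf(2) d s h C by (intro GS_norm_wspace[OF sm _ C(2)]) auto
    have "?g \<in> GS_step s ?h" by (rule GS_stepI[OF sm n])
    moreover have "GS_norm s ?h ?g < ennreal \<epsilon>"
      using n by (rule le_less_trans) (use dC d C e in \<open>auto intro: ennreal_lessI\<close>)
    ultimately have "?g \<in> V" using e(2) by blast
    then show ?thesis using V(2) cf(1) d by (simp add: GS_S_eq_wspace[OF s])
  qed
  then show "\<exists>\<delta>>0. \<forall>f\<in>wspace (roumieu s). ladder_bdd f \<omega> \<longrightarrow> cscale (of_real \<delta>) f \<in> Q" using d by blast
qed

lemma top_dual_zero: "0 \<in> top_dual X"
  by (auto simp: top_dual_def linear_functional_on_def zero_fun_def)

lemma top_dual_diff:
  assumes "u \<in> top_dual X" "v \<in> top_dual X"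
  shows "u - v \<in> top_dual X"
proof -
  have "continuous_map X euclidean (\<lambda>f. u f - v f)"
    using assms by (intro continuous_map_diff) (auto simp: top_dual_def)
  then show ?thesis
    using assms by (auto simp: top_dual_def linear_functional_on_def fun_diff_def algebra_simps)
qed

lemma sup_on_le: "(\<And>f. f \<in> C \<Longrightarrow> cmod (u f) \<le> c) \<Longrightarrow> sup_on C u \<le> ennreal c"
  unfolding sup_on_def by (intro SUP_least ennreal_leI)

lemma sup_on_upper: "f \<in> C \<Longrightarrow> ennreal (cmod (u f)) \<le> sup_on C u"
  unfolding sup_on_def by (rule SUP_upper)

lemma sup_on_triangle: "sup_on C (u + v) \<le> ennreal 1 * (sup_on C u + sup_on C v)"
proof -
  have "ennreal (cmod ((u + v) f)) \<le> sup_on C u + sup_on C v" if f: "f \<in> C" for f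
  proof -
    have "ennreal (cmod ((u + v) f)) \<le> ennreal (cmod (u f) + cmod (v f))"
      by (intro ennreal_leI) (simp add: norm_triangle_ineq)
    also have "\<dots> = ennreal (cmod (u f)) + ennreal (cmod (v f))" by simp
    also have "\<dots> \<le> sup_on C u + sup_on C v" using f by (intro add_mono sup_on_upper)
    finally show ?thesis .
  qed
  then show ?thesis unfolding sup_on_def[of C "u + v"] by (auto intro: SUP_least)
qed

lemma sup_on_nbhd:
  assumes "C \<in> I'" "0 < \<epsilon>"
  shows "\<exists>Q. openin (seminorm_topology (top_dual X) I' (\<lambda>i. sup_on (c i))) Q \<and> 0 \<in> Q \<and> (\<forall>u\<in>Q. sup_on (c C) u < ennreal \<epsilon>)"
proof (rule seminorm_interior[where D=1])
  have "sup_on (c C) 0 \<le> ennreal 0" by (rule sup_on_le) simp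
  then show "sup_on (c C) 0 = 0" by simp
qed (use assms top_dual_zero top_dual_diff sup_on_triangle in auto)

text \<open>The functions of weight \<omega> form a bounded set and so index one of the seminorms of
  the strong dual; an open set inside its unit ball is what is sought.\<close>

lemma polar_nbhds_schwartz: "polar_nbhds all_weights schwartz_top (schwartz_dual_top :: 'n::finite functional topology)"
  unfolding polar_nbhds_def
proof (intro conjI ballI)
  show "topspace (schwartz_dual_top :: 'n functional topology) = top_dual schwartz_top"
    by (simp add: schwartz_dual_top_def)
  fix \<omega> assume "\<omega> \<in> all_weights"
  define C where "C = {f :: real^'n \<Rightarrow> complex. f \<in> wspace all_weights \<and> ladder_bdd f \<omega>}"
  have "(SUP f\<in>C. schwartz_seminorm (\<alpha>, \<beta>) f) < \<infinity>" for \<alpha> \<beta>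
  proof -
    have "(SUP f\<in>C. schwartz_seminorm (\<alpha>, \<beta>) f) \<le> ennreal (\<omega> (multi_size \<alpha> + multi_size \<beta>))"
      by (intro SUP_least schwartz_seminorm_wspace) (auto simp: C_def wspace_smooth)
    then show ?thesis by (rule le_less_trans) simp
  qed
  then have "C \<in> {C. schwartz_bounded C}" by (auto simp: schwartz_bounded_def C_def schwartz_eq_wspace)
  from sup_on_nbhd[OF this, of 1 schwartz_top "\<lambda>C. C"] obtain Q
    where Q: "openin schwartz_dual_top Q" "0 \<in> Q" "\<forall>u\<in>Q. sup_on C u < ennreal 1"
    unfolding schwartz_dual_top_def by auto
  have "\<forall>v\<in>Q. \<forall>f\<in>(wspace all_weights :: (real^'n \<Rightarrow> complex) set). ladder_bdd f \<omega> \<longrightarrow> cmod (v f) \<le> 1"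
  proof (intro ballI impI)
    fix v and f :: "real^'n \<Rightarrow> complex" assume v: "v \<in> Q" and "f \<in> wspace all_weights" "ladder_bdd f \<omega>"
    then have "f \<in> C" by (simp add: C_def)
    from le_less_trans[OF sup_on_upper[OF this] bspec[OF Q(3) v]]
    show "cmod (v f) \<le> 1" by (simp add: ennreal_less_iff)
  qed
  then show "\<exists>Q. openin (schwartz_dual_top :: 'n functional topology) Q \<and> 0 \<in> Q \<and> (\<forall>v\<in>Q. \<forall>f\<in>wspace all_weights. ladder_bdd f \<omega> \<longrightarrow> cmod (v f) \<le> 1)"
    by (intro exI[of _ Q] conjI Q(1,2))
qed

lemma GS_step_ball_scaled:
  fixes f :: "real^'n::finite \<Rightarrow> complex"
  assumes W: "weight_class W" and f: "f \<in> wspace W" "ladder_bdd f \<omega>" and C: "C > 0" "\<And>k. \<omega> k \<le> C * gevrey s h k"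
    and h: "h > 0" and s: "s \<ge> 0"
  shows "cscale (of_real (1 / C)) f \<in> GS_step_ball s (h * gs_factor TYPE('n) s)"
proof -
  note cf = cscale_wspace[OF W f, of "1 / C"]
  have sm: "smooth (cscale (of_real (1 / C)) f)" using cf(1) C(1) by (auto intro: wspace_smooth)
  have "GS_norm s (h * gs_factor TYPE('n) s) (cscale (of_real (1 / C)) f) \<le> ennreal (1 / C * C)"
    using cf(2) C h s by (intro GS_norm_wspace[OF sm]) auto
  then have n: "GS_norm s (h * gs_factor TYPE('n) s) (cscale (of_real (1 / C)) f) \<le> ennreal 1"
    using C(1) by simp
  show ?thesis using GS_stepI[OF sm n] n unfolding GS_step_ball_def by (simp del: of_real_divide)
qed

text \<open>A multiple of the functions of weight \<omega> lies in the unit ball of a single step,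
  so one of the dual norms of the projective limit controls them.\<close>

lemma polar_nbhds_GS_S:
  assumes s: "s \<ge> 1/2"
  shows "polar_nbhds (roumieu s) (GS_S_top s) (GS_S_dual_top s :: 'n::finite functional topology)"
  unfolding polar_nbhds_def
proof (intro conjI ballI)
  show "topspace (GS_S_dual_top s :: 'n functional topology) = top_dual (GS_S_top s)"
    by (simp add: GS_S_dual_top_def)
  fix \<omega> assume w: "\<omega> \<in> roumieu s"
  then obtain h C0 where h: "h > 0" and C0: "C0 \<ge> 0" "\<And>k. \<omega> k \<le> C0 * gevrey s h k"
    unfolding roumieu_def by auto
  define C where "C = C0 + 1"
  have C: "C > 0" "\<And>k. \<omega> k \<le> C * gevrey s h k"
    using C0(1) order_trans[OF C0(2) mult_right_mono[of C0 C]] gevrey_pos[OF h, of s] by (auto simp: C_def less_imp_le)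
  let ?h = "h * gs_factor TYPE('n) s"
  have "?h \<in> {0<..}" using h gs_factor_pos[where 'n='n, of s] by simp
  from sup_on_nbhd[OF this, of "1 / C" "GS_S_top s" "GS_step_ball s"] C(1) obtain Q :: "'n functional set"
    where Q: "openin (GS_S_dual_top s) Q" "0 \<in> Q" "\<forall>u\<in>Q. sup_on (GS_step_ball s ?h) u < ennreal (1 / C)"
    unfolding GS_S_dual_top_def by auto
  have "\<forall>v\<in>Q. \<forall>f\<in>(wspace (roumieu s) :: (real^'n \<Rightarrow> complex) set). ladder_bdd f \<omega> \<longrightarrow> cmod (v f) \<le> 1"
  proof (intro ballI impI)
    fix u and f :: "real^'n \<Rightarrow> complex" assume u: "u \<in> Q" and f: "f \<in> wspace (roumieu s)" "ladder_bdd f \<omega>"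
    have "cscale (of_real (1 / C)) f \<in> GS_step_ball s ?h"
      using s by (intro GS_step_ball_scaled[OF weight_class_roumieu[OF s] f C h]) auto
    from sup_on_upper[OF this, of u] have "ennreal (cmod (u (cscale (of_real (1 / C)) f))) < ennreal (1 / C)"
      using Q(3) u by (meson le_less_trans)
    then have lt: "cmod (u (cscale (of_real (1 / C)) f)) < 1 / C" by (simp add: ennreal_less_iff)
    have "u \<in> top_dual (GS_S_top s)"
      using openin_subset[OF Q(1)] u by (auto simp: GS_S_dual_top_def)
    then have "u (cscale (of_real (1 / C)) f) = of_real (1 / C) * u f"
      using f(1) by (auto simp: top_dual_def linear_functional_on_def GS_S_top_def GS_S_eq_wspace[OF s])
    then have "cmod (u f) / C < 1 / C" using lt C(1) by (simp add: norm_divide)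
    then show "cmod (u f) \<le> 1" using C(1) by (simp add: divide_less_cancel)
  qed
  then show "\<exists>Q. openin (GS_S_dual_top s :: 'n functional topology) Q \<and> 0 \<in> Q \<and> (\<forall>v\<in>Q. \<forall>f\<in>wspace (roumieu s). ladder_bdd f \<omega> \<longrightarrow> cmod (v f) \<le> 1)"
    by (intro exI[of _ Q] conjI Q(1,2))
qed

text \<open>The inductive limit topology is not defined by seminorms, so the scaled polars
  \<open>V k\<close> are shown to be absolutely convex and to contain the image of a ball of the
  dual of every step. The latter holds because a Beurling weight lies below a multiple of the Gevrey
  weight for each h. The factors 2^(-k) supply the halving sequence for
  \<open>nbhd_interior\<close>.\<close>

lemma polar_nbhds_GS_Sigma:
  assumes s: "s > 1/2"
  shows "polar_nbhds (beurling s) (GS_Sigma_top s) (GS_Sigma_dual_top s :: 'n::finite functional topology)"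
  unfolding polar_nbhds_def
proof (intro conjI ballI)
  show "topspace (GS_Sigma_dual_top s :: 'n functional topology) = top_dual (GS_Sigma_top s)"
    by (simp add: GS_Sigma_dual_top_def)
  fix \<omega> assume w: "\<omega> \<in> beurling s"
  define B where "B = {f :: real^'n \<Rightarrow> complex. f \<in> wspace (beurling s) \<and> ladder_bdd f \<omega>}"
  define V where "V k = {v :: 'n functional. \<forall>f\<in>B. cmod (v f) \<le> 1 / 2 ^ k}" for k :: nat
  have "\<exists>Q. openin (GS_Sigma_dual_top s) Q \<and> 0 \<in> Q \<and> Q \<subseteq> V 0"
    unfolding GS_Sigma_dual_top_def
  proof (rule nbhd_interior[OF openin_ind_limit_topology])
    show "0 \<in> V k" for k by (simp add: V_def)
    show "g + g' \<in> V k" if "g \<in> V (Suc k)" "g' \<in> V (Suc k)" for k g g'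
      unfolding V_def
    proof (intro CollectI ballI)
      fix f assume "f \<in> B"
      then have "cmod (g f) \<le> 1 / 2 ^ Suc k" "cmod (g' f) \<le> 1 / 2 ^ Suc k" using that by (auto simp: V_def)
      then have "cmod (g f + g' f) \<le> 1 / 2 ^ Suc k + 1 / 2 ^ Suc k" by (rule norm_triangle_mono)
      then show "cmod ((g + g') f) \<le> 1 / 2 ^ k" by simp
    qed
    fix k
    show "V k \<in> ind_limit_nbhds {0<..} (GS_step_dual s) (\<lambda>h. sup_on (GS_step_ball s h)) (\<lambda>h. restr (GS_Sigma s))"
      unfolding ind_limit_nbhds_def
    proof (intro CollectI conjI ballI)
      show "absolutely_convex (V k)"
        unfolding absolutely_convex_def
      proof (intro ballI allI impI)
        fix u v and a b :: complex assume uv: "u \<in> V k" "v \<in> V k" and ab: "cmod a + cmod b \<le> 1"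
        show "cscale a u + cscale b v \<in> V k"
          unfolding V_def
        proof (intro CollectI ballI)
          fix f assume "f \<in> B"
          then have uf: "cmod (u f) \<le> 1 / 2 ^ k" "cmod (v f) \<le> 1 / 2 ^ k" using uv by (auto simp: V_def)
          have "cmod ((cscale a u + cscale b v) f) \<le> cmod a * cmod (u f) + cmod b * cmod (v f)"
            using norm_triangle_ineq[of "a * u f" "b * v f"] by (simp add: cscale_def norm_mult)
          also have "\<dots> \<le> cmod a * (1 / 2 ^ k) + cmod b * (1 / 2 ^ k)"
            by (intro add_mono mult_left_mono uf) auto
          also have "\<dots> = (cmod a + cmod b) * (1 / 2 ^ k)" by (simp only: distrib_right)
          also have "\<dots> \<le> 1 * (1 / 2 ^ k)" by (intro mult_right_mono ab) auto
          finally show "cmod ((cscale a u + cscale b v) f) \<le> 1 / 2 ^ k" by simp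
        qed
      qed
      fix H :: real assume H: "H \<in> {0<..}"
      let ?h = "H / gs_factor TYPE('n) s"
      have h: "?h > 0" "?h * gs_factor TYPE('n) s = H" using H gs_factor_pos[where 'n='n, of s] by auto
      obtain C0 where C0: "C0 \<ge> 0" "\<And>k. \<omega> k \<le> C0 * gevrey s ?h k" using w h(1) unfolding beurling_def by auto
      define C where "C = C0 + 1"
      have C: "C > 0" "\<And>k. \<omega> k \<le> C * gevrey s ?h k"
        using C0(1) order_trans[OF C0(2) mult_right_mono[of C0 C]] gevrey_pos[OF h(1), of s] by (auto simp: C_def less_imp_le)
      have "restr (GS_Sigma s) g \<in> V k"
        if g: "g \<in> GS_step_dual s H" and b: "sup_on (GS_step_ball s H) g < ennreal (1 / 2 ^ k / C)" for g
        unfolding V_def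
      proof (intro CollectI ballI)
        fix f assume "f \<in> B"
        then have f: "f \<in> wspace (beurling s)" "ladder_bdd f \<omega>" by (auto simp: B_def)
        then have fS: "f \<in> GS_Sigma s" by (simp add: GS_Sigma_eq_wspace[OF s])
        then have fH: "f \<in> GS_step s H" using H by (auto simp: GS_Sigma_def)
        have "cscale (of_real (1 / C)) f \<in> GS_step_ball s (?h * gs_factor TYPE('n) s)"
          using s by (intro GS_step_ball_scaled[OF weight_class_beurling[OF s] f C h(1)]) auto
        from sup_on_upper[OF this[unfolded h(2)], of g]
        have "ennreal (cmod (g (cscale (of_real (1 / C)) f))) < ennreal (1 / 2 ^ k / C)"
          using b by (rule le_less_trans)
        then have "cmod (g (cscale (of_real (1 / C)) f)) < 1 / 2 ^ k / C" by (simp add: ennreal_less_iff)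
        moreover have "g (cscale (of_real (1 / C)) f) = of_real (1 / C) * g f"
          using g fH by (auto simp: GS_step_dual_def linear_functional_on_def)
        ultimately have "cmod (g f) / C < 1 / 2 ^ k / C" using C(1) by (simp add: norm_divide)
        then have "cmod (g f) < 1 / 2 ^ k" using C(1) by (simp add: field_simps)
        then show "cmod (restr (GS_Sigma s) g f) \<le> 1 / 2 ^ k" using fS by (simp add: restr_def)
      qed
      then show "\<exists>\<epsilon>>0. \<forall>g\<in>GS_step_dual s H. sup_on (GS_step_ball s H) g < ennreal \<epsilon> \<longrightarrow> restr (GS_Sigma s) g \<in> V k"
        using C(1) by (intro exI[of _ "1 / 2 ^ k / C"]) auto
    qed
  qed (auto intro: top_dual_zero top_dual_diff)
  then obtain Q where Q: "openin (GS_Sigma_dual_top s) Q" "0 \<in> Q" "Q \<subseteq> V 0" by (elim exE conjE)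
  have "\<forall>v\<in>Q. \<forall>f\<in>wspace (beurling s). ladder_bdd f \<omega> \<longrightarrow> cmod (v f) \<le> 1"
    using Q(3) by (auto simp: V_def B_def)
  then show "\<exists>Q. openin (GS_Sigma_dual_top s :: 'n functional topology) Q \<and> 0 \<in> Q \<and> (\<forall>v\<in>Q. \<forall>f\<in>wspace (beurling s). ladder_bdd f \<omega> \<longrightarrow> cmod (v f) \<le> 1)"
    by (intro exI[of _ Q] conjI Q(1,2))
qed

section \<open>Application to the three kinds of test spaces\<close>

lemma hprojs_GS_S_half: "\<forall>n (f :: real^'n::finite \<Rightarrow> complex). rdec f \<longrightarrow> hprojs n coords f \<in> GS_S (1/2)"
  using weight_class.hprojs_wspace[OF weight_class_roumieu[of "1/2"]] GS_S_eq_wspace[of "1/2"] by auto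

lemma GS_S_half_rdec: "\<forall>h \<in> (GS_S (1/2) :: (real^'n::finite \<Rightarrow> complex) set). rdec h"
  using GS_S_eq_wspace[of "1/2"] wspace_rdec by auto

theorem theorem4p1:
  fixes B1 :: "'n::finite functional set" and q1 :: "'n functional \<Rightarrow> real"
    and B2 :: "'m::finite functional set" and q2 :: "'m functional \<Rightarrow> real"
    and p :: ennreal
  assumes "quasi_banach B1 q1" and "quasi_banach B2 q2"
    and "embeds of_function (GS_S_top (1/2)) id (quasi_norm_top B1 q1)"
    and "embeds id (quasi_norm_top B1 q1) of_functional (GS_S_dual_top (1/2))"
    and "embeds of_function (GS_S_top (1/2)) id (quasi_norm_top B2 q2)"
    and "embeds id (quasi_norm_top B2 q2) of_functional (GS_S_dual_top (1/2))"
    and "0 < p"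
  shows
    "(\<forall>s\<ge>1/2. embeds id (quasi_norm_top B1 q1) of_functional (GS_S_dual_top s) \<longrightarrow>
        embeds of_function (GS_S_top s) id (quasi_norm_top B2 q2) \<longrightarrow>
        (\<forall>K \<in> (GS_S s :: (real^('m + 'n) \<Rightarrow> complex) set).
           kernel_op (GS_S_dual_top s) K \<in> schatten_class p B1 q1 B2 q2)) \<and>
     (\<forall>s>1/2. embeds id (quasi_norm_top B1 q1) of_functional (GS_Sigma_dual_top s) \<longrightarrow>
        embeds of_function (GS_Sigma_top s) id (quasi_norm_top B2 q2) \<longrightarrow>
        (\<forall>K \<in> (GS_Sigma s :: (real^('m + 'n) \<Rightarrow> complex) set).
           kernel_op (GS_Sigma_dual_top s) K \<in> schatten_class p B1 q1 B2 q2)) \<and>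
     (embeds id (quasi_norm_top B1 q1) of_functional schwartz_dual_top \<longrightarrow>
        embeds of_function schwartz_top id (quasi_norm_top B2 q2) \<longrightarrow>
        (\<forall>K \<in> (schwartz :: (real^('m + 'n) \<Rightarrow> complex) set).
           kernel_op schwartz_dual_top K \<in> schatten_class p B1 q1 B2 q2))"
proof -
  have B1: "cfun.subspace B1" "quasi_norm_on B1 q1" and B2: "cfun.subspace B2" "quasi_norm_on B2 q2"
    using assms(1,2) by (auto simp: quasi_banach_def)
  show ?thesis
  proof (intro conjI allI impI ballI)
    fix s :: real and K :: "real^('m + 'n) \<Rightarrow> complex"
    assume s: "1/2 \<le> s" and e1: "embeds id (quasi_norm_top B1 q1) of_functional (GS_S_dual_top s)"
      and e2: "embeds of_function (GS_S_top s) id (quasi_norm_top B2 q2)" and K: "K \<in> GS_S s"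
    show "kernel_op (GS_S_dual_top s) K \<in> schatten_class p B1 q1 B2 q2"
      by (rule weight_class.kernel_op_schatten[OF weight_class_roumieu[OF s] absorbing_GS_S[OF s] absorbing_GS_S[OF s]
            polar_nbhds_GS_S[OF s] hprojs_GS_S_half GS_S_half_rdec B1 B2 e1 e2 K[unfolded GS_S_eq_wspace[OF s]] assms(7)])
  next
    fix s :: real and K :: "real^('m + 'n) \<Rightarrow> complex"
    assume s: "1/2 < s" and e1: "embeds id (quasi_norm_top B1 q1) of_functional (GS_Sigma_dual_top s)"
      and e2: "embeds of_function (GS_Sigma_top s) id (quasi_norm_top B2 q2)" and K: "K \<in> GS_Sigma s"
    show "kernel_op (GS_Sigma_dual_top s) K \<in> schatten_class p B1 q1 B2 q2"
      by (rule weight_class.kernel_op_schatten[OF weight_class_beurling[OF s] absorbing_GS_Sigma[OF s] absorbing_GS_Sigma[OF s]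
            polar_nbhds_GS_Sigma[OF s] hprojs_GS_S_half GS_S_half_rdec B1 B2 e1 e2 K[unfolded GS_Sigma_eq_wspace[OF s]] assms(7)])
  next
    fix K :: "real^('m + 'n) \<Rightarrow> complex"
    assume e1: "embeds id (quasi_norm_top B1 q1) of_functional schwartz_dual_top"
      and e2: "embeds of_function schwartz_top id (quasi_norm_top B2 q2)" and K: "K \<in> schwartz"
    show "kernel_op schwartz_dual_top K \<in> schatten_class p B1 q1 B2 q2"
      by (rule weight_class.kernel_op_schatten[OF weight_class_all absorbing_schwartz absorbing_schwartz
            polar_nbhds_schwartz hprojs_GS_S_half GS_S_half_rdec B1 B2 e1 e2 K[unfolded schwartz_eq_wspace] assms(7)])
  qed
qed

end
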